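(* Let $\mathcal{C}_1,\mathcal{C}_2,\mathcal{C}_3,\mathcal{C}_4$ be the fusion categories defined in the context ($\mathcal{C}_1=\mathcal{C}^{\mathbb{Z}/3\mathbb{Z}}$, $\mathcal{C}_2=\mathcal{C}\rtimes\mathbb{Z}/3\mathbb{Z}$, where $\mathcal{C}$ is the even part of the $3^{\mathbb{Z}/2\mathbb{Z}\times\mathbb{Z}/2\mathbb{Z}}$ subfactor; $\mathcal{C}_3$ and $\mathcal{C}_4$ are the dual categories of $\mathcal{C}_2$ with respect to $1+\alpha_g$ and $1+\alpha_g\rho$, $g\neq0$). The fusion category $\mathcal{C}_4$ is not equivalent to $\mathcal{C}_1$, $\mathcal{C}_2$, or $\mathcal{C}_3$.
   Context: Fusion categories are over $\mathbb{C}$. A division algebra in a fusion category is an algebra whose category of modules is semisimple and indecomposable as a module category and which is simple as a left module over itself. The dual category of a fusion category with respect to a division algebra $A$ is the fusion category of $A$-$A$ bimodules. A Q-system in a unitary fusion category is an algebra whose multiplication map is a co-isometry. Let $G=\mathbb{Z}/2\mathbb{Z}\times\mathbb{Z}/2\mathbb{Z}$. $\mathcal{C}$ is the unitary fusion category with simple objects $\alpha_g,\ \alpha_g\rho$ ($g\in G$), where the $\alpha_g$ are the simple objects of a full tensor subcategory equivalent to $\mathrm{Vec}_G$, with $\alpha_g\rho\cong\rho\,\alpha_{g^{-1}}$ and $\rho\otimes\rho\cong 1\oplus\bigoplus_{g\in G}\alpha_g\rho$, and such that $1\oplus\rho$ admits a Q-system; the corresponding subfactor is the $3^G$ subfactor,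 known to be unique and self-dual, and each $1+\alpha_g\rho$ has a unique Q-system structure. $\mathcal{C}$ is realized inside the category $\mathrm{End}_0(M)$ of finite-index endomorphisms of a type III factor $M$, with $\alpha_g\alpha_h=\alpha_{gh}$ and $\alpha_g\rho=\rho\alpha_{g^{-1}}$ exactly. By a result of Izumi there is an order three automorphism $\gamma$ of $M$ commuting with $\rho$ and with $\gamma\alpha_g=\alpha_{\theta(g)}\gamma$, where $\theta$ cyclically permutes the nontrivial elements of $G$; conjugation by $\gamma$ gives an action of $\mathbb{Z}/3\mathbb{Z}$ on $\mathcal{C}$. $\mathcal{C}_1=\mathcal{C}^{\mathbb{Z}/3\mathbb{Z}}$ is the equivariantization of $\mathcal{C}$ by this action (the even part of the $4442$ subfactor). $\mathcal{C}_2=\mathcal{C}\rtimes\mathbb{Z}/3\mathbb{Z}$ is the crossed product, i.e. the category generated by $\mathcal{C}$ and $\gamma$, a $\mathbb{Z}/3\mathbb{Z}$-graded extension of $\mathcal{C}$. $\mathcal{C}_3$ is the dual category of $\mathcal{C}_2$ with respect to the $2$-dimensional simple algebra $1+\alpha_g$ for any $0\neq g\in G$. $\mathcal{C}_4$ is the dual category of $\mathcal{C}_2$ with respect to the algebra $1+\alpha_g\rho$ for any $0\neq g\in G$. (Conjugation by $\gamma$ shows these do not depend on the choice of $g\ne0$.) *)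

theory Defs
  imports "HOL-Analysis.Analysis" "HOL-Library.Numeral_Type"
begin

section \<open>Complex-linear and monoidal categories\<close>

text \<open>
  Composition is written in the usual order (\<open>g \<odot> f\<close> is \<open>f\<close> followed by \<open>g\<close>). \<open>Comp\<close>, \<open>Add\<close>, etc. are
  only meaningful on (composable, respectively parallel) arrows.
\<close>

record ('o, 'm) lincat =
  Obj :: "'o set"
  Arr :: "'m set"
  Src :: "'m \<Rightarrow> 'o"
  Tgt :: "'m \<Rightarrow> 'o"
  Ident :: "'o \<Rightarrow> 'm"
  Comp :: "'m \<Rightarrow> 'm \<Rightarrow> 'm" (infixr "\<odot>\<index>" 70)
  Add :: "'m \<Rightarrow> 'm \<Rightarrow> 'm" (infixl "\<oplus>\<index>" 65)
  Scal :: "complex \<Rightarrow> 'm \<Rightarrow> 'm"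
  Zero :: "'o \<Rightarrow> 'o \<Rightarrow> 'm"

record ('o, 'm) moncat = "('o, 'm) lincat" +
  TensO :: "'o \<Rightarrow> 'o \<Rightarrow> 'o" (infixr "\<boxtimes>\<index>" 75)
  TensM :: "'m \<Rightarrow> 'm \<Rightarrow> 'm" (infixr "\<otimes>\<index>" 75)
  Unit :: "'o" ("\<one>\<index>")
  Assoc :: "'o \<Rightarrow> 'o \<Rightarrow> 'o \<Rightarrow> 'm"  \<comment> \<open>\<open>(x \<boxtimes> y) \<boxtimes> z \<longrightarrow> x \<boxtimes> (y \<boxtimes> z)\<close>\<close>
  LUnit :: "'o \<Rightarrow> 'm"  \<comment> \<open>\<open>\<one> \<boxtimes> x \<longrightarrow> x\<close>\<close>
  RUnit :: "'o \<Rightarrow> 'm"  \<comment> \<open>\<open>x \<boxtimes> \<one> \<longrightarrow> x\<close>\<close>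

definition Hom :: "('o, 'm, 'z) lincat_scheme \<Rightarrow> 'o \<Rightarrow> 'o \<Rightarrow> 'm set" where
  "Hom C x y = {f \<in> Arr C. Src C f = x \<and> Tgt C f = y}"

locale linear_category =
  fixes C :: "('o, 'm, 'z) lincat_scheme" (structure)
  assumes Src_Obj: "f \<in> Arr C \<Longrightarrow> Src C f \<in> Obj C"
    and Tgt_Obj: "f \<in> Arr C \<Longrightarrow> Tgt C f \<in> Obj C"
    and Ident_Hom: "x \<in> Obj C \<Longrightarrow> Ident C x \<in> Hom C x x"
    and Comp_Hom: "\<lbrakk>f \<in> Hom C x y; g \<in> Hom C y z\<rbrakk> \<Longrightarrow> g \<odot> f \<in> Hom C x z"
    and Comp_Ident: "f \<in> Hom C x y \<Longrightarrow> f \<odot> Ident C x = f"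
    and Ident_Comp: "f \<in> Hom C x y \<Longrightarrow> Ident C y \<odot> f = f"
    and Comp_assoc: "\<lbrakk>f \<in> Hom C w x; g \<in> Hom C x y; h \<in> Hom C y z\<rbrakk> \<Longrightarrow> (h \<odot> g) \<odot> f = h \<odot> (g \<odot> f)"
    and Zero_Hom: "\<lbrakk>x \<in> Obj C; y \<in> Obj C\<rbrakk> \<Longrightarrow> Zero C x y \<in> Hom C x y"
    and Add_Hom: "\<lbrakk>f \<in> Hom C x y; g \<in> Hom C x y\<rbrakk> \<Longrightarrow> f \<oplus> g \<in> Hom C x y"
    and Scal_Hom: "f \<in> Hom C x y \<Longrightarrow> Scal C c f \<in> Hom C x y"
    and Add_assoc: "\<lbrakk>f \<in> Hom C x y; g \<in> Hom C x y; h \<in> Hom C x y\<rbrakk> \<Longrightarrow> (f \<oplus> g) \<oplus> h = f \<oplus> (g \<oplus> h)"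
    and Add_commute: "\<lbrakk>f \<in> Hom C x y; g \<in> Hom C x y\<rbrakk> \<Longrightarrow> f \<oplus> g = g \<oplus> f"
    and Zero_Add: "f \<in> Hom C x y \<Longrightarrow> Zero C x y \<oplus> f = f"
    and Add_inverse: "f \<in> Hom C x y \<Longrightarrow> f \<oplus> Scal C (-1) f = Zero C x y"
    and Scal_Add: "\<lbrakk>f \<in> Hom C x y; g \<in> Hom C x y\<rbrakk> \<Longrightarrow> Scal C c (f \<oplus> g) = Scal C c f \<oplus> Scal C c g"
    and Add_Scal: "f \<in> Hom C x y \<Longrightarrow> Scal C (c + d) f = Scal C c f \<oplus> Scal C d f"
    and Scal_Scal: "f \<in> Hom C x y \<Longrightarrow> Scal C c (Scal C d f) = Scal C (c * d) f"
    and Scal_one: "f \<in> Hom C x y \<Longrightarrow> Scal C 1 f = f"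
    and Comp_Add: "\<lbrakk>f \<in> Hom C x y; g \<in> Hom C x y; h \<in> Hom C y z\<rbrakk> \<Longrightarrow> h \<odot> (f \<oplus> g) = h \<odot> f \<oplus> h \<odot> g"
    and Add_Comp: "\<lbrakk>f \<in> Hom C x y; g \<in> Hom C y z; h \<in> Hom C y z\<rbrakk> \<Longrightarrow> (g \<oplus> h) \<odot> f = g \<odot> f \<oplus> h \<odot> f"
    and Comp_Scal: "\<lbrakk>f \<in> Hom C x y; g \<in> Hom C y z\<rbrakk> \<Longrightarrow> g \<odot> Scal C c f = Scal C c (g \<odot> f)"
    and Scal_Comp: "\<lbrakk>f \<in> Hom C x y; g \<in> Hom C y z\<rbrakk> \<Longrightarrow> Scal C c g \<odot> f = Scal C c (g \<odot> f)"

definition inverse_arrows :: "('o, 'm, 'z) lincat_scheme \<Rightarrow> 'm \<Rightarrow> 'm \<Rightarrow> bool" where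
  "inverse_arrows C f g \<longleftrightarrow> f \<in> Arr C \<and> g \<in> Hom C (Tgt C f) (Src C f) \<and>
     g \<odot>\<^bsub>C\<^esub> f = Ident C (Src C f) \<and> f \<odot>\<^bsub>C\<^esub> g = Ident C (Tgt C f)"

definition iso_arrow :: "('o, 'm, 'z) lincat_scheme \<Rightarrow> 'm \<Rightarrow> bool" where
  "iso_arrow C f \<longleftrightarrow> (\<exists>g. inverse_arrows C f g)"

definition inv_arrow :: "('o, 'm, 'z) lincat_scheme \<Rightarrow> 'm \<Rightarrow> 'm" where
  "inv_arrow C f = (THE g. inverse_arrows C f g)"

definition isomorphic :: "('o, 'm, 'z) lincat_scheme \<Rightarrow> 'o \<Rightarrow> 'o \<Rightarrow> bool" where
  "isomorphic C x y \<longleftrightarrow> (\<exists>f \<in> Hom C x y. iso_arrow C f)"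

definition mono_arrow :: "('o, 'm, 'z) lincat_scheme \<Rightarrow> 'm \<Rightarrow> bool" where
  "mono_arrow C f \<longleftrightarrow> f \<in> Arr C \<and>
     (\<forall>w. \<forall>g \<in> Hom C w (Src C f). \<forall>h \<in> Hom C w (Src C f). f \<odot>\<^bsub>C\<^esub> g = f \<odot>\<^bsub>C\<^esub> h \<longrightarrow> g = h)"

definition epi_arrow :: "('o, 'm, 'z) lincat_scheme \<Rightarrow> 'm \<Rightarrow> bool" where
  "epi_arrow C f \<longleftrightarrow> f \<in> Arr C \<and>
     (\<forall>z. \<forall>g \<in> Hom C (Tgt C f) z. \<forall>h \<in> Hom C (Tgt C f) z. g \<odot>\<^bsub>C\<^esub> f = h \<odot>\<^bsub>C\<^esub> f \<longrightarrow> g = h)"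

definition zero_obj :: "('o, 'm, 'z) lincat_scheme \<Rightarrow> 'o \<Rightarrow> bool" where
  "zero_obj C x \<longleftrightarrow> x \<in> Obj C \<and> Ident C x = Zero C x x"

definition simple_obj :: "('o, 'm, 'z) lincat_scheme \<Rightarrow> 'o \<Rightarrow> bool" where
  "simple_obj C x \<longleftrightarrow> x \<in> Obj C \<and> \<not> zero_obj C x \<and>
     (\<forall>y. \<forall>f \<in> Hom C y x. mono_arrow C f \<longrightarrow> zero_obj C y \<or> iso_arrow C f)"

definition arrow_sum :: "('o, 'm, 'z) lincat_scheme \<Rightarrow> 'o \<Rightarrow> 'o \<Rightarrow> 'm list \<Rightarrow> 'm" where
  "arrow_sum C x y fs = foldr (Add C) fs (Zero C x y)"

definition direct_sum :: "('o, 'm, 'z) lincat_scheme \<Rightarrow> 'o \<Rightarrow> 'o list \<Rightarrow> bool" where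
  "direct_sum C x xs \<longleftrightarrow> x \<in> Obj C \<and> set xs \<subseteq> Obj C \<and>
     (\<exists>i p. (\<forall>k < length xs. i k \<in> Hom C (xs ! k) x \<and> p k \<in> Hom C x (xs ! k)) \<and>
        (\<forall>k < length xs. \<forall>l < length xs.
           p k \<odot>\<^bsub>C\<^esub> i l = (if k = l then Ident C (xs ! k) else Zero C (xs ! l) (xs ! k))) \<and>
        arrow_sum C x x (map (\<lambda>k. i k \<odot>\<^bsub>C\<^esub> p k) [0..<length xs]) = Ident C x)"

definition kernel_of :: "('o, 'm, 'z) lincat_scheme \<Rightarrow> 'm \<Rightarrow> 'm \<Rightarrow> bool" where
  "kernel_of C f k \<longleftrightarrow> f \<in> Arr C \<and> k \<in> Arr C \<and> Tgt C k = Src C f \<and>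
     f \<odot>\<^bsub>C\<^esub> k = Zero C (Src C k) (Tgt C f) \<and>
     (\<forall>w. \<forall>h \<in> Hom C w (Src C f). f \<odot>\<^bsub>C\<^esub> h = Zero C w (Tgt C f) \<longrightarrow>
        (\<exists>!u. u \<in> Hom C w (Src C k) \<and> k \<odot>\<^bsub>C\<^esub> u = h))"

definition cokernel_of :: "('o, 'm, 'z) lincat_scheme \<Rightarrow> 'm \<Rightarrow> 'm \<Rightarrow> bool" where
  "cokernel_of C f k \<longleftrightarrow> f \<in> Arr C \<and> k \<in> Arr C \<and> Src C k = Tgt C f \<and>
     k \<odot>\<^bsub>C\<^esub> f = Zero C (Src C f) (Tgt C k) \<and>
     (\<forall>z. \<forall>h \<in> Hom C (Tgt C f) z. h \<odot>\<^bsub>C\<^esub> f = Zero C (Src C f) z \<longrightarrow>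
        (\<exists>!u. u \<in> Hom C (Tgt C k) z \<and> u \<odot>\<^bsub>C\<^esub> k = h))"

definition coequalizer :: "('o, 'm, 'z) lincat_scheme \<Rightarrow> 'm \<Rightarrow> 'm \<Rightarrow> 'm \<Rightarrow> bool" where
  "coequalizer C f g q \<longleftrightarrow> q \<in> Arr C \<and> f \<in> Arr C \<and> g \<in> Hom C (Src C f) (Tgt C f) \<and>
     Src C q = Tgt C f \<and> q \<odot>\<^bsub>C\<^esub> f = q \<odot>\<^bsub>C\<^esub> g \<and>
     (\<forall>z. \<forall>h \<in> Hom C (Tgt C f) z. h \<odot>\<^bsub>C\<^esub> f = h \<odot>\<^bsub>C\<^esub> g \<longrightarrow>
        (\<exists>!u. u \<in> Hom C (Tgt C q) z \<and> u \<odot>\<^bsub>C\<^esub> q = h))"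

locale semisimple_category = linear_category +
  assumes zero_ex: "\<exists>x. zero_obj C x"
    and direct_sum_ex: "\<lbrakk>x \<in> Obj C; y \<in> Obj C\<rbrakk> \<Longrightarrow> \<exists>z. direct_sum C z [x, y]"
    and kernel_ex: "f \<in> Arr C \<Longrightarrow> \<exists>k. kernel_of C f k"
    and cokernel_ex: "f \<in> Arr C \<Longrightarrow> \<exists>k. cokernel_of C f k"
    and mono_is_kernel: "mono_arrow C k \<Longrightarrow> \<exists>f. kernel_of C f k"
    and epi_is_cokernel: "epi_arrow C k \<Longrightarrow> \<exists>f. cokernel_of C f k"
    and semisimple: "x \<in> Obj C \<Longrightarrow> \<exists>xs. (\<forall>y \<in> set xs. simple_obj C y) \<and> direct_sum C x xs"

locale monoidal_linear_category = linear_category C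
  for C :: "('o, 'm, 'z) moncat_scheme" (structure) +
  assumes Unit_Obj: "\<one> \<in> Obj C"
    and TensO_Obj: "\<lbrakk>x \<in> Obj C; y \<in> Obj C\<rbrakk> \<Longrightarrow> x \<boxtimes> y \<in> Obj C"
    and TensM_Hom: "\<lbrakk>f \<in> Hom C x x'; g \<in> Hom C y y'\<rbrakk> \<Longrightarrow> f \<otimes> g \<in> Hom C (x \<boxtimes> y) (x' \<boxtimes> y')"
    and TensM_Ident: "\<lbrakk>x \<in> Obj C; y \<in> Obj C\<rbrakk> \<Longrightarrow> Ident C x \<otimes> Ident C y = Ident C (x \<boxtimes> y)"
    and TensM_Comp: "\<lbrakk>f \<in> Hom C x x'; f' \<in> Hom C x' x''; g \<in> Hom C y y'; g' \<in> Hom C y' y''\<rbrakk> \<Longrightarrow>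
          (f' \<odot> f) \<otimes> (g' \<odot> g) = (f' \<otimes> g') \<odot> (f \<otimes> g)"
    and TensM_Add: "\<lbrakk>f \<in> Hom C x x'; g \<in> Hom C y y'; h \<in> Hom C y y'\<rbrakk> \<Longrightarrow>
          f \<otimes> (g \<oplus> h) = f \<otimes> g \<oplus> f \<otimes> h"
    and Add_TensM: "\<lbrakk>f \<in> Hom C x x'; g \<in> Hom C x x'; h \<in> Hom C y y'\<rbrakk> \<Longrightarrow>
          (f \<oplus> g) \<otimes> h = f \<otimes> h \<oplus> g \<otimes> h"
    and TensM_Scal: "\<lbrakk>f \<in> Hom C x x'; g \<in> Hom C y y'\<rbrakk> \<Longrightarrow> f \<otimes> Scal C c g = Scal C c (f \<otimes> g)"
    and Scal_TensM: "\<lbrakk>f \<in> Hom C x x'; g \<in> Hom C y y'\<rbrakk> \<Longrightarrow> Scal C c f \<otimes> g = Scal C c (f \<otimes> g)"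
    and Assoc_Hom: "\<lbrakk>x \<in> Obj C; y \<in> Obj C; z \<in> Obj C\<rbrakk> \<Longrightarrow>
          Assoc C x y z \<in> Hom C ((x \<boxtimes> y) \<boxtimes> z) (x \<boxtimes> (y \<boxtimes> z))"
    and Assoc_iso: "\<lbrakk>x \<in> Obj C; y \<in> Obj C; z \<in> Obj C\<rbrakk> \<Longrightarrow> iso_arrow C (Assoc C x y z)"
    and Assoc_natural: "\<lbrakk>f \<in> Hom C x x'; g \<in> Hom C y y'; h \<in> Hom C z z'\<rbrakk> \<Longrightarrow>
          Assoc C x' y' z' \<odot> ((f \<otimes> g) \<otimes> h) = (f \<otimes> (g \<otimes> h)) \<odot> Assoc C x y z"
    and LUnit_Hom: "x \<in> Obj C \<Longrightarrow> LUnit C x \<in> Hom C (\<one> \<boxtimes> x) x"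
    and LUnit_iso: "x \<in> Obj C \<Longrightarrow> iso_arrow C (LUnit C x)"
    and LUnit_natural: "f \<in> Hom C x x' \<Longrightarrow> LUnit C x' \<odot> (Ident C \<one> \<otimes> f) = f \<odot> LUnit C x"
    and RUnit_Hom: "x \<in> Obj C \<Longrightarrow> RUnit C x \<in> Hom C (x \<boxtimes> \<one>) x"
    and RUnit_iso: "x \<in> Obj C \<Longrightarrow> iso_arrow C (RUnit C x)"
    and RUnit_natural: "f \<in> Hom C x x' \<Longrightarrow> RUnit C x' \<odot> (f \<otimes> Ident C \<one>) = f \<odot> RUnit C x"
    and pentagon: "\<lbrakk>w \<in> Obj C; x \<in> Obj C; y \<in> Obj C; z \<in> Obj C\<rbrakk> \<Longrightarrow>
          Assoc C w x (y \<boxtimes> z) \<odot> Assoc C (w \<boxtimes> x) y z =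
          (Ident C w \<otimes> Assoc C x y z) \<odot> Assoc C w (x \<boxtimes> y) z \<odot> (Assoc C w x y \<otimes> Ident C z)"
    and triangle: "\<lbrakk>x \<in> Obj C; y \<in> Obj C\<rbrakk> \<Longrightarrow>
          (Ident C x \<otimes> LUnit C y) \<odot> Assoc C x \<one> y = RUnit C x \<otimes> Ident C y"

definition left_dual :: "('o, 'm, 'z) moncat_scheme \<Rightarrow> 'o \<Rightarrow> 'o \<Rightarrow> bool" where
  "left_dual C y x \<longleftrightarrow> (\<exists>ev \<in> Hom C (y \<boxtimes>\<^bsub>C\<^esub> x) \<one>\<^bsub>C\<^esub>. \<exists>coev \<in> Hom C \<one>\<^bsub>C\<^esub> (x \<boxtimes>\<^bsub>C\<^esub> y).
     RUnit C x \<odot>\<^bsub>C\<^esub> (Ident C x \<otimes>\<^bsub>C\<^esub> ev) \<odot>\<^bsub>C\<^esub> Assoc C x y x \<odot>\<^bsub>C\<^esub> (coev \<otimes>\<^bsub>C\<^esub> Ident C x) = LUnit C x \<and>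
     LUnit C y \<odot>\<^bsub>C\<^esub> (ev \<otimes>\<^bsub>C\<^esub> Ident C y) \<odot>\<^bsub>C\<^esub> inv_arrow C (Assoc C y x y) \<odot>\<^bsub>C\<^esub> (Ident C y \<otimes>\<^bsub>C\<^esub> coev) = RUnit C y)"

locale fusion_category = monoidal_linear_category C + semisimple_category C
  for C :: "('o, 'm, 'z) moncat_scheme" (structure) +
  assumes finite_simples: "\<exists>S. finite S \<and> (\<forall>x. simple_obj C x \<longrightarrow> (\<exists>y \<in> S. isomorphic C x y))"
    and finite_dim_Hom: "\<lbrakk>x \<in> Obj C; y \<in> Obj C\<rbrakk> \<Longrightarrow> \<exists>fs. set fs \<subseteq> Hom C x y \<and>
          (\<forall>f \<in> Hom C x y. \<exists>c. f = arrow_sum C x y (map (\<lambda>k. Scal C (c k) (fs ! k)) [0..<length fs]))"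
    and Unit_simple: "simple_obj C \<one>"
    and left_dual_ex: "x \<in> Obj C \<Longrightarrow> \<exists>y \<in> Obj C. left_dual C y x"
    and right_dual_ex: "x \<in> Obj C \<Longrightarrow> \<exists>y \<in> Obj C. left_dual C x y"


subsection \<open>Equivalence of fusion categories\<close>

definition linear_functor ::
    "('o, 'm, 'y) lincat_scheme \<Rightarrow> ('p, 'n, 'z) lincat_scheme \<Rightarrow> ('o \<Rightarrow> 'p) \<Rightarrow> ('m \<Rightarrow> 'n) \<Rightarrow> bool" where
  "linear_functor C D F \<Phi> \<longleftrightarrow>
     (\<forall>x \<in> Obj C. F x \<in> Obj D \<and> \<Phi> (Ident C x) = Ident D (F x)) \<and>
     (\<forall>x y. \<forall>f \<in> Hom C x y. \<Phi> f \<in> Hom D (F x) (F y) \<and> (\<forall>c. \<Phi> (Scal C c f) = Scal D c (\<Phi> f))) \<and>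
     (\<forall>x y. \<forall>f \<in> Hom C x y. \<forall>g \<in> Hom C x y. \<Phi> (f \<oplus>\<^bsub>C\<^esub> g) = \<Phi> f \<oplus>\<^bsub>D\<^esub> \<Phi> g) \<and>
     (\<forall>x y z. \<forall>f \<in> Hom C x y. \<forall>g \<in> Hom C y z. \<Phi> (g \<odot>\<^bsub>C\<^esub> f) = \<Phi> g \<odot>\<^bsub>D\<^esub> \<Phi> f)"

definition category_equivalence ::
    "('o, 'm, 'y) lincat_scheme \<Rightarrow> ('p, 'n, 'z) lincat_scheme \<Rightarrow> ('o \<Rightarrow> 'p) \<Rightarrow> ('m \<Rightarrow> 'n) \<Rightarrow> bool" where
  "category_equivalence C D F \<Phi> \<longleftrightarrow> linear_functor C D F \<Phi> \<and>
     (\<forall>x \<in> Obj C. \<forall>y \<in> Obj C. bij_betw \<Phi> (Hom C x y) (Hom D (F x) (F y))) \<and>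
     (\<forall>z \<in> Obj D. \<exists>x \<in> Obj C. isomorphic D (F x) z)"

definition monoidal_structure ::
    "('o, 'm, 'y) moncat_scheme \<Rightarrow> ('p, 'n, 'z) moncat_scheme \<Rightarrow> ('o \<Rightarrow> 'p) \<Rightarrow> ('m \<Rightarrow> 'n) \<Rightarrow>
     ('o \<Rightarrow> 'o \<Rightarrow> 'n) \<Rightarrow> 'n \<Rightarrow> bool" where
  "monoidal_structure C D F \<Phi> J \<epsilon> \<longleftrightarrow>
     \<epsilon> \<in> Hom D \<one>\<^bsub>D\<^esub> (F \<one>\<^bsub>C\<^esub>) \<and> iso_arrow D \<epsilon> \<and>
     (\<forall>x \<in> Obj C. \<forall>y \<in> Obj C. J x y \<in> Hom D (F x \<boxtimes>\<^bsub>D\<^esub> F y) (F (x \<boxtimes>\<^bsub>C\<^esub> y)) \<and> iso_arrow D (J x y)) \<and>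
     (\<forall>x x' y y'. \<forall>f \<in> Hom C x x'. \<forall>g \<in> Hom C y y'.
        J x' y' \<odot>\<^bsub>D\<^esub> (\<Phi> f \<otimes>\<^bsub>D\<^esub> \<Phi> g) = \<Phi> (f \<otimes>\<^bsub>C\<^esub> g) \<odot>\<^bsub>D\<^esub> J x y) \<and>
     (\<forall>x \<in> Obj C. \<forall>y \<in> Obj C. \<forall>z \<in> Obj C.
        \<Phi> (Assoc C x y z) \<odot>\<^bsub>D\<^esub> J (x \<boxtimes>\<^bsub>C\<^esub> y) z \<odot>\<^bsub>D\<^esub> (J x y \<otimes>\<^bsub>D\<^esub> Ident D (F z)) =
        J x (y \<boxtimes>\<^bsub>C\<^esub> z) \<odot>\<^bsub>D\<^esub> (Ident D (F x) \<otimes>\<^bsub>D\<^esub> J y z) \<odot>\<^bsub>D\<^esub> Assoc D (F x) (F y) (F z)) \<and>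
     (\<forall>x \<in> Obj C.
        \<Phi> (LUnit C x) \<odot>\<^bsub>D\<^esub> J \<one>\<^bsub>C\<^esub> x \<odot>\<^bsub>D\<^esub> (\<epsilon> \<otimes>\<^bsub>D\<^esub> Ident D (F x)) = LUnit D (F x) \<and>
        \<Phi> (RUnit C x) \<odot>\<^bsub>D\<^esub> J x \<one>\<^bsub>C\<^esub> \<odot>\<^bsub>D\<^esub> (Ident D (F x) \<otimes>\<^bsub>D\<^esub> \<epsilon>) = RUnit D (F x))"

definition tensor_equivalent :: "('o, 'm, 'y) moncat_scheme \<Rightarrow> ('p, 'n, 'z) moncat_scheme \<Rightarrow> bool" where
  "tensor_equivalent C D \<longleftrightarrow>
     (\<exists>F \<Phi> J \<epsilon>. category_equivalence C D F \<Phi> \<and> monoidal_structure C D F \<Phi> J \<epsilon>)"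


subsection \<open>Full subcategories and categories of objects with extra structure\<close>

definition full_sub :: "('o, 'm, 'z) lincat_scheme \<Rightarrow> 'o set \<Rightarrow> ('o, 'm, 'z) lincat_scheme" where
  "full_sub C S = C\<lparr>Obj := Obj C \<inter> S, Arr := {f \<in> Arr C. Src C f \<in> S \<and> Tgt C f \<in> S}\<rparr>"

text \<open>The full replete tensor subcategory, closed under direct sums and subobjects (direct summands),
  generated by \<open>S\<close>.\<close>

inductive_set generated :: "('o, 'm, 'z) moncat_scheme \<Rightarrow> 'o set \<Rightarrow> 'o set"
  for C :: "('o, 'm, 'z) moncat_scheme" and S :: "'o set" where
  base: "\<lbrakk>x \<in> S; x \<in> Obj C\<rbrakk> \<Longrightarrow> x \<in> generated C S"
| unit: "\<one>\<^bsub>C\<^esub> \<in> generated C S"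
| tensor: "\<lbrakk>x \<in> generated C S; y \<in> generated C S\<rbrakk> \<Longrightarrow> x \<boxtimes>\<^bsub>C\<^esub> y \<in> generated C S"
| sum: "\<lbrakk>x \<in> generated C S; y \<in> generated C S; direct_sum C z [x, y]\<rbrakk> \<Longrightarrow> z \<in> generated C S"
| summand: "\<lbrakk>y \<in> generated C S; i \<in> Hom C x y; p \<in> Hom C y x; p \<odot>\<^bsub>C\<^esub> i = Ident C x; x \<in> Obj C\<rbrakk> \<Longrightarrow>
    x \<in> generated C S"

text \<open>Objects \<open>p \<in> Obs\<close> with underlying object \<open>U p\<close> of \<open>C\<close>; the arrows \<open>p \<longrightarrow> q\<close> are the arrows
  \<open>f : U p \<longrightarrow> U q\<close> of \<open>C\<close> with \<open>P p q f\<close>, tagged with \<open>p\<close> and \<open>q\<close>.\<close>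

definition structured ::
    "('o, 'm, 'z) lincat_scheme \<Rightarrow> 'p set \<Rightarrow> ('p \<Rightarrow> 'o) \<Rightarrow> ('p \<Rightarrow> 'p \<Rightarrow> 'm \<Rightarrow> bool) \<Rightarrow>
     ('p, 'p \<times> 'm \<times> 'p) lincat" where
  "structured C Obs U P = \<lparr>
     Obj = Obs,
     Arr = {(p, f, q). p \<in> Obs \<and> q \<in> Obs \<and> f \<in> Hom C (U p) (U q) \<and> P p q f},
     Src = (\<lambda>(p, f, q). p),
     Tgt = (\<lambda>(p, f, q). q),
     Ident = (\<lambda>p. (p, Ident C (U p), p)),
     Comp = (\<lambda>(q, g, r) (p, f, q'). (p, g \<odot>\<^bsub>C\<^esub> f, r)),
     Add = (\<lambda>(p, f, q) (p', g, q'). (p, f \<oplus>\<^bsub>C\<^esub> g, q)),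
     Scal = (\<lambda>c (p, f, q). (p, Scal C c f, q)),
     Zero = (\<lambda>p q. (p, Zero C (U p) (U q), q))\<rparr>"


subsection \<open>Algebras, modules and the dual category\<close>

text \<open>An algebra is a triple of an object, a multiplication and a unit arrow.\<close>

fun algebra_in :: "('o, 'm, 'z) moncat_scheme \<Rightarrow> 'o \<times> 'm \<times> 'm \<Rightarrow> bool" where
  "algebra_in C (A, m, e) \<longleftrightarrow> A \<in> Obj C \<and> m \<in> Hom C (A \<boxtimes>\<^bsub>C\<^esub> A) A \<and> e \<in> Hom C \<one>\<^bsub>C\<^esub> A \<and>
     m \<odot>\<^bsub>C\<^esub> (m \<otimes>\<^bsub>C\<^esub> Ident C A) = m \<odot>\<^bsub>C\<^esub> (Ident C A \<otimes>\<^bsub>C\<^esub> m) \<odot>\<^bsub>C\<^esub> Assoc C A A A \<and>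
     m \<odot>\<^bsub>C\<^esub> (e \<otimes>\<^bsub>C\<^esub> Ident C A) = LUnit C A \<and>
     m \<odot>\<^bsub>C\<^esub> (Ident C A \<otimes>\<^bsub>C\<^esub> e) = RUnit C A"

fun left_module :: "('o, 'm, 'z) moncat_scheme \<Rightarrow> 'o \<times> 'm \<times> 'm \<Rightarrow> 'o \<times> 'm \<Rightarrow> bool" where
  "left_module C (A, m, e) (X, l) \<longleftrightarrow> X \<in> Obj C \<and> l \<in> Hom C (A \<boxtimes>\<^bsub>C\<^esub> X) X \<and>
     l \<odot>\<^bsub>C\<^esub> (m \<otimes>\<^bsub>C\<^esub> Ident C X) = l \<odot>\<^bsub>C\<^esub> (Ident C A \<otimes>\<^bsub>C\<^esub> l) \<odot>\<^bsub>C\<^esub> Assoc C A A X \<and>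
     l \<odot>\<^bsub>C\<^esub> (e \<otimes>\<^bsub>C\<^esub> Ident C X) = LUnit C X"

fun right_module :: "('o, 'm, 'z) moncat_scheme \<Rightarrow> 'o \<times> 'm \<times> 'm \<Rightarrow> 'o \<times> 'm \<Rightarrow> bool" where
  "right_module C (A, m, e) (X, r) \<longleftrightarrow> X \<in> Obj C \<and> r \<in> Hom C (X \<boxtimes>\<^bsub>C\<^esub> A) X \<and>
     r \<odot>\<^bsub>C\<^esub> (r \<otimes>\<^bsub>C\<^esub> Ident C A) = r \<odot>\<^bsub>C\<^esub> (Ident C X \<otimes>\<^bsub>C\<^esub> m) \<odot>\<^bsub>C\<^esub> Assoc C X A A \<and>
     r \<odot>\<^bsub>C\<^esub> (Ident C X \<otimes>\<^bsub>C\<^esub> e) = RUnit C X"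

fun bimodule :: "('o, 'm, 'z) moncat_scheme \<Rightarrow> 'o \<times> 'm \<times> 'm \<Rightarrow> 'o \<times> 'm \<times> 'm \<Rightarrow> bool" where
  "bimodule C (A, m, e) (X, l, r) \<longleftrightarrow> left_module C (A, m, e) (X, l) \<and> right_module C (A, m, e) (X, r) \<and>
     r \<odot>\<^bsub>C\<^esub> (l \<otimes>\<^bsub>C\<^esub> Ident C A) = l \<odot>\<^bsub>C\<^esub> (Ident C A \<otimes>\<^bsub>C\<^esub> r) \<odot>\<^bsub>C\<^esub> Assoc C A X A"

fun left_module_map :: "('o, 'm, 'z) moncat_scheme \<Rightarrow> 'o \<times> 'm \<times> 'm \<Rightarrow> 'o \<times> 'm \<Rightarrow> 'o \<times> 'm \<Rightarrow> 'm \<Rightarrow> bool" where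
  "left_module_map C (A, m, e) (X, l) (Y, l') f \<longleftrightarrow> f \<odot>\<^bsub>C\<^esub> l = l' \<odot>\<^bsub>C\<^esub> (Ident C A \<otimes>\<^bsub>C\<^esub> f)"

fun bimodule_map :: "('o, 'm, 'z) moncat_scheme \<Rightarrow> 'o \<times> 'm \<times> 'm \<Rightarrow> 'o \<times> 'm \<times> 'm \<Rightarrow> 'o \<times> 'm \<times> 'm \<Rightarrow> 'm \<Rightarrow> bool" where
  "bimodule_map C (A, m, e) (X, l, r) (Y, l', r') f \<longleftrightarrow>
     f \<odot>\<^bsub>C\<^esub> l = l' \<odot>\<^bsub>C\<^esub> (Ident C A \<otimes>\<^bsub>C\<^esub> f) \<and> f \<odot>\<^bsub>C\<^esub> r = r' \<odot>\<^bsub>C\<^esub> (f \<otimes>\<^bsub>C\<^esub> Ident C A)"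

definition left_module_category ::
    "('o, 'm, 'z) moncat_scheme \<Rightarrow> 'o \<times> 'm \<times> 'm \<Rightarrow> ('o \<times> 'm, ('o \<times> 'm) \<times> 'm \<times> ('o \<times> 'm)) lincat" where
  "left_module_category C A = structured C {X. left_module C A X} fst (left_module_map C A)"

text \<open>Left \<open>A\<close>-modules form a right module category over \<open>C\<close>: \<open>Y\<close> sends \<open>(X, l)\<close> to \<open>X \<boxtimes> Y\<close> with the action
  \<open>A \<boxtimes> (X \<boxtimes> Y) \<cong> (A \<boxtimes> X) \<boxtimes> Y \<longrightarrow> X \<boxtimes> Y\<close>.\<close>

fun module_tensor :: "('o, 'm, 'z) moncat_scheme \<Rightarrow> 'o \<times> 'm \<times> 'm \<Rightarrow> 'o \<times> 'm \<Rightarrow> 'o \<Rightarrow> 'o \<times> 'm" where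
  "module_tensor C (A, m, e) (X, l) Y =
     (X \<boxtimes>\<^bsub>C\<^esub> Y, (l \<otimes>\<^bsub>C\<^esub> Ident C Y) \<odot>\<^bsub>C\<^esub> inv_arrow C (Assoc C A X Y))"

text \<open>Indecomposability as a module category: a splitting into a direct sum of two module
  subcategories \<open>S\<close> and \<open>T\<close> is trivial.\<close>

definition indecomposable_module_category :: "('o, 'm, 'z) moncat_scheme \<Rightarrow> 'o \<times> 'm \<times> 'm \<Rightarrow> bool" where
  "indecomposable_module_category C A \<longleftrightarrow>
     (\<exists>X. left_module C A X \<and> \<not> zero_obj (left_module_category C A) X) \<and>
     (\<forall>S T. S \<subseteq> Obj (left_module_category C A) \<and> T \<subseteq> Obj (left_module_category C A) \<and>
        (\<forall>Y \<in> Obj C. (\<forall>X \<in> S. module_tensor C A X Y \<in> S) \<and> (\<forall>X \<in> T. module_tensor C A X Y \<in> T)) \<and>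
        (\<forall>X \<in> S. \<forall>X' \<in> T.
           Hom (left_module_category C A) X X' = {Zero (left_module_category C A) X X'} \<and>
           Hom (left_module_category C A) X' X = {Zero (left_module_category C A) X' X}) \<and>
        (\<forall>Z \<in> Obj (left_module_category C A). \<exists>X \<in> S. \<exists>X' \<in> T.
           direct_sum (left_module_category C A) Z [X, X'])
        \<longrightarrow> (\<forall>X \<in> S. zero_obj (left_module_category C A) X) \<or>
            (\<forall>X \<in> T. zero_obj (left_module_category C A) X))"

definition division_algebra :: "('o, 'm, 'z) moncat_scheme \<Rightarrow> 'o \<times> 'm \<times> 'm \<Rightarrow> bool" where
  "division_algebra C A \<longleftrightarrow> algebra_in C A \<and>
     semisimple_category (left_module_category C A) \<and> indecomposable_module_category C A \<and>
     simple_obj (left_module_category C A) (fst A, fst (snd A))"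

text \<open>\<open>dag\<close> is the involution of the underlying unitary category.\<close>

fun q_system :: "('o, 'm, 'z) moncat_scheme \<Rightarrow> ('m \<Rightarrow> 'm) \<Rightarrow> 'o \<times> 'm \<times> 'm \<Rightarrow> bool" where
  "q_system C dag (A, m, e) \<longleftrightarrow> algebra_in C (A, m, e) \<and> m \<odot>\<^bsub>C\<^esub> dag m = Ident C A"

text \<open>\<open>q : X \<boxtimes> Y \<longrightarrow> Z\<close> exhibits \<open>Z\<close>, with the induced actions, as \<open>X \<otimes>\<^sub>A Y\<close>.\<close>

fun is_rel_tensor ::
    "('o, 'm, 'z) moncat_scheme \<Rightarrow> 'o \<times> 'm \<times> 'm \<Rightarrow> 'o \<times> 'm \<times> 'm \<Rightarrow> 'o \<times> 'm \<times> 'm \<Rightarrow>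
     ('o \<times> 'm \<times> 'm) \<times> 'm \<Rightarrow> bool" where
  "is_rel_tensor C (A, m, e) (X, l, r) (Y, l', r') ((Z, l'', r''), q) \<longleftrightarrow>
     bimodule C (A, m, e) (Z, l'', r'') \<and> q \<in> Hom C (X \<boxtimes>\<^bsub>C\<^esub> Y) Z \<and>
     coequalizer C (r \<otimes>\<^bsub>C\<^esub> Ident C Y) ((Ident C X \<otimes>\<^bsub>C\<^esub> l') \<odot>\<^bsub>C\<^esub> Assoc C X A Y) q \<and>
     l'' \<odot>\<^bsub>C\<^esub> (Ident C A \<otimes>\<^bsub>C\<^esub> q) \<odot>\<^bsub>C\<^esub> Assoc C A X Y = q \<odot>\<^bsub>C\<^esub> (l \<otimes>\<^bsub>C\<^esub> Ident C Y) \<and>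
     r'' \<odot>\<^bsub>C\<^esub> (q \<otimes>\<^bsub>C\<^esub> Ident C A) = q \<odot>\<^bsub>C\<^esub> (Ident C X \<otimes>\<^bsub>C\<^esub> r') \<odot>\<^bsub>C\<^esub> Assoc C X Y A"

definition rel_tensor ::
    "('o, 'm, 'z) moncat_scheme \<Rightarrow> 'o \<times> 'm \<times> 'm \<Rightarrow> 'o \<times> 'm \<times> 'm \<Rightarrow> 'o \<times> 'm \<times> 'm \<Rightarrow> 'o \<times> 'm \<times> 'm" where
  "rel_tensor C A B B' = fst (SOME Tq. is_rel_tensor C A B B' Tq)"

definition rel_proj ::
    "('o, 'm, 'z) moncat_scheme \<Rightarrow> 'o \<times> 'm \<times> 'm \<Rightarrow> 'o \<times> 'm \<times> 'm \<Rightarrow> 'o \<times> 'm \<times> 'm \<Rightarrow> 'm" where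
  "rel_proj C A B B' = snd (SOME Tq. is_rel_tensor C A B B' Tq)"

text \<open>The arrow out of a quotient determined by \<open>h\<close>.\<close>

definition descend :: "('o, 'm, 'z) lincat_scheme \<Rightarrow> 'm \<Rightarrow> 'm \<Rightarrow> 'm" where
  "descend C q h = (THE k. k \<in> Hom C (Tgt C q) (Tgt C h) \<and> k \<odot>\<^bsub>C\<^esub> q = h)"

definition dual_category ::
    "('o, 'm, 'z) moncat_scheme \<Rightarrow> 'o \<times> 'm \<times> 'm \<Rightarrow>
     ('o \<times> 'm \<times> 'm, ('o \<times> 'm \<times> 'm) \<times> 'm \<times> ('o \<times> 'm \<times> 'm)) moncat" where
  "dual_category C A = lincat.extend (structured C {B. bimodule C A B} fst (bimodule_map C A))
    (moncat.fields
      (rel_tensor C A)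
      (\<lambda>(B, f, B') (D, g, D'). (rel_tensor C A B D,
         descend C (rel_proj C A B D) (rel_proj C A B' D' \<odot>\<^bsub>C\<^esub> (f \<otimes>\<^bsub>C\<^esub> g)),
         rel_tensor C A B' D'))
      (fst A, fst (snd A), fst (snd A))
      (\<lambda>B D E. (rel_tensor C A (rel_tensor C A B D) E,
         descend C (rel_proj C A (rel_tensor C A B D) E \<odot>\<^bsub>C\<^esub> (rel_proj C A B D \<otimes>\<^bsub>C\<^esub> Ident C (fst E)))
           (rel_proj C A B (rel_tensor C A D E) \<odot>\<^bsub>C\<^esub> (Ident C (fst B) \<otimes>\<^bsub>C\<^esub> rel_proj C A D E) \<odot>\<^bsub>C\<^esub>
            Assoc C (fst B) (fst D) (fst E)),
         rel_tensor C A B (rel_tensor C A D E)))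
      (\<lambda>B. (rel_tensor C A (fst A, fst (snd A), fst (snd A)) B,
         descend C (rel_proj C A (fst A, fst (snd A), fst (snd A)) B) (fst (snd B)),
         B))
      (\<lambda>B. (rel_tensor C A B (fst A, fst (snd A), fst (snd A)),
         descend C (rel_proj C A B (fst A, fst (snd A), fst (snd A))) (snd (snd B)),
         B)))"


subsection \<open>Equivariantization\<close>

text \<open>For a strict action \<open>k \<mapsto> (T k, \<tau> k)\<close> of a group on \<open>C\<close> by strict monoidal functors (\<open>T k\<close> on objects,
  \<open>\<tau> k\<close> on arrows), so that \<open>T k (x \<boxtimes> y) = T k x \<boxtimes> T k y\<close> and \<open>T (k + l) x = T k (T l x)\<close> literally.\<close>

definition equivariant_object ::
    "('o, 'm, 'z) moncat_scheme \<Rightarrow> ('g::group_add \<Rightarrow> 'o \<Rightarrow> 'o) \<Rightarrow> ('g \<Rightarrow> 'm \<Rightarrow> 'm) \<Rightarrow> 'o \<times> ('g \<Rightarrow> 'm) \<Rightarrow> bool" where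
  "equivariant_object C T \<tau> = (\<lambda>(X, u). X \<in> Obj C \<and>
     (\<forall>k. u k \<in> Hom C (T k X) X \<and> iso_arrow C (u k)) \<and>
     (\<forall>k l. u (k + l) = u k \<odot>\<^bsub>C\<^esub> \<tau> k (u l)))"

definition equivariantization ::
    "('o, 'm, 'z) moncat_scheme \<Rightarrow> ('g::group_add \<Rightarrow> 'o \<Rightarrow> 'o) \<Rightarrow> ('g \<Rightarrow> 'm \<Rightarrow> 'm) \<Rightarrow>
     ('o \<times> ('g \<Rightarrow> 'm), ('o \<times> ('g \<Rightarrow> 'm)) \<times> 'm \<times> ('o \<times> ('g \<Rightarrow> 'm))) moncat" where
  "equivariantization C T \<tau> =
    (let tens = (\<lambda>(X, u) (Y, v). (X \<boxtimes>\<^bsub>C\<^esub> Y, \<lambda>k. u k \<otimes>\<^bsub>C\<^esub> v k));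
         one = (\<one>\<^bsub>C\<^esub>, \<lambda>k. Ident C \<one>\<^bsub>C\<^esub>)
     in lincat.extend
          (structured C {X. equivariant_object C T \<tau> X} fst
             (\<lambda>(X, u) (Y, v) f. \<forall>k. f \<odot>\<^bsub>C\<^esub> u k = v k \<odot>\<^bsub>C\<^esub> \<tau> k f))
          (moncat.fields tens
             (\<lambda>(p, f, p') (q, g, q'). (tens p q, f \<otimes>\<^bsub>C\<^esub> g, tens p' q'))
             one
             (\<lambda>p q r. (tens (tens p q) r, Assoc C (fst p) (fst q) (fst r), tens p (tens q r)))
             (\<lambda>p. (tens one p, LUnit C (fst p), p))
             (\<lambda>p. (tens p one, RUnit C (fst p), p))))"


section \<open>Type III factors and the category of finite index endomorphisms\<close>

class complex_hilbert_space = real_inner + complete_space +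
  fixes scaleC :: "complex \<Rightarrow> 'a \<Rightarrow> 'a"
    and cinner :: "'a \<Rightarrow> 'a \<Rightarrow> complex"
  assumes scaleC_add_right: "scaleC c (x + y) = scaleC c x + scaleC c y"
    and scaleC_add_left: "scaleC (c + d) x = scaleC c x + scaleC d x"
    and scaleC_scaleC: "scaleC c (scaleC d x) = scaleC (c * d) x"
    and scaleC_of_real: "scaleC (complex_of_real r) x = r *\<^sub>R x"
    and cinner_add_left: "cinner (x + y) z = cinner x z + cinner y z"
    and cinner_scaleC_left: "cinner (scaleC c x) y = c * cinner x y"
    and cinner_commute: "cinner x y = cnj (cinner y x)"
    and inner_eq_Re_cinner: "x \<bullet> y = Re (cinner x y)"

text \<open>\<open>'h \<Rightarrow>\<^sub>L 'h\<close> consists of the bounded real-linear maps.\<close>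

definition bounded_ops :: "('h::complex_hilbert_space \<Rightarrow>\<^sub>L 'h) set" where
  "bounded_ops = {t. \<forall>c v. blinfun_apply t (scaleC c v) = scaleC c (blinfun_apply t v)}"

definition op_scale :: "complex \<Rightarrow> ('h::complex_hilbert_space \<Rightarrow>\<^sub>L 'h) \<Rightarrow> 'h \<Rightarrow>\<^sub>L 'h" where
  "op_scale c t = Blinfun (\<lambda>v. scaleC c (blinfun_apply t v))"

definition op_adj :: "('h::complex_hilbert_space \<Rightarrow>\<^sub>L 'h) \<Rightarrow> 'h \<Rightarrow>\<^sub>L 'h" where
  "op_adj t = (THE s. \<forall>v w. cinner (blinfun_apply t v) w = cinner v (blinfun_apply s w))"

definition op_le :: "('h::complex_hilbert_space \<Rightarrow>\<^sub>L 'h) \<Rightarrow> ('h \<Rightarrow>\<^sub>L 'h) \<Rightarrow> bool" where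
  "op_le s t \<longleftrightarrow> (\<forall>v. cinner (blinfun_apply (t - s) v) v \<in> \<real> \<and>
     0 \<le> Re (cinner (blinfun_apply (t - s) v) v))"

definition commutant :: "('h::complex_hilbert_space \<Rightarrow>\<^sub>L 'h) set \<Rightarrow> ('h \<Rightarrow>\<^sub>L 'h) set" where
  "commutant S = {t \<in> bounded_ops. \<forall>s \<in> S. t o\<^sub>L s = s o\<^sub>L t}"

definition von_neumann_algebra :: "('h::complex_hilbert_space \<Rightarrow>\<^sub>L 'h) set \<Rightarrow> bool" where
  "von_neumann_algebra M \<longleftrightarrow> M \<subseteq> bounded_ops \<and> (\<forall>t \<in> M. op_adj t \<in> M) \<and> commutant (commutant M) = M"

definition factor :: "('h::complex_hilbert_space \<Rightarrow>\<^sub>L 'h) set \<Rightarrow> bool" where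
  "factor M \<longleftrightarrow> von_neumann_algebra M \<and> (id_blinfun :: 'h \<Rightarrow>\<^sub>L 'h) \<noteq> 0 \<and>
     M \<inter> commutant M = range (\<lambda>c. op_scale c id_blinfun)"

definition type_III_factor :: "('h::complex_hilbert_space \<Rightarrow>\<^sub>L 'h) set \<Rightarrow> bool" where
  "type_III_factor M \<longleftrightarrow> factor M \<and>
     (\<forall>p \<in> M. p o\<^sub>L p = p \<and> op_adj p = p \<and> p \<noteq> 0 \<longrightarrow>
        (\<exists>v \<in> M. op_adj v o\<^sub>L v = p \<and> op_le (v o\<^sub>L op_adj v) p \<and> v o\<^sub>L op_adj v \<noteq> p))"

definition is_lub_in :: "('h::complex_hilbert_space \<Rightarrow>\<^sub>L 'h) set \<Rightarrow> ('h \<Rightarrow>\<^sub>L 'h) set \<Rightarrow> ('h \<Rightarrow>\<^sub>L 'h) \<Rightarrow> bool" where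
  "is_lub_in N D s \<longleftrightarrow> s \<in> N \<and> (\<forall>t \<in> D. op_le t s) \<and> (\<forall>u \<in> N. (\<forall>t \<in> D. op_le t u) \<longrightarrow> op_le s u)"

definition normal_map ::
    "('h::complex_hilbert_space \<Rightarrow>\<^sub>L 'h) set \<Rightarrow> ('h \<Rightarrow>\<^sub>L 'h) set \<Rightarrow> (('h \<Rightarrow>\<^sub>L 'h) \<Rightarrow> ('h \<Rightarrow>\<^sub>L 'h)) \<Rightarrow> bool" where
  "normal_map M N \<phi> \<longleftrightarrow> (\<forall>D s. D \<noteq> {} \<and> D \<subseteq> M \<and> (\<forall>t \<in> D. op_adj t = t) \<and>
     (\<forall>t \<in> D. \<forall>t' \<in> D. \<exists>t'' \<in> D. op_le t t'' \<and> op_le t' t'') \<and> is_lub_in M D s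
     \<longrightarrow> is_lub_in N (\<phi> ` D) (\<phi> s))"

text \<open>Maps defined on \<open>M\<close> are extended by 0 outside \<open>M\<close>, so that equality of functions is equality on \<open>M\<close>
  and composition of endomorphisms is composition of functions.\<close>

definition id_on :: "('h::complex_hilbert_space \<Rightarrow>\<^sub>L 'h) set \<Rightarrow> ('h \<Rightarrow>\<^sub>L 'h) \<Rightarrow> ('h \<Rightarrow>\<^sub>L 'h)" where
  "id_on M x = (if x \<in> M then x else 0)"

definition endomorphism :: "('h::complex_hilbert_space \<Rightarrow>\<^sub>L 'h) set \<Rightarrow> (('h \<Rightarrow>\<^sub>L 'h) \<Rightarrow> ('h \<Rightarrow>\<^sub>L 'h)) \<Rightarrow> bool" where
  "endomorphism M \<phi> \<longleftrightarrow> (\<forall>x. x \<notin> M \<longrightarrow> \<phi> x = 0) \<and> \<phi> ` M \<subseteq> M \<and>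
     (\<forall>x \<in> M. \<forall>y \<in> M. \<phi> (x + y) = \<phi> x + \<phi> y \<and> \<phi> (x o\<^sub>L y) = \<phi> x o\<^sub>L \<phi> y) \<and>
     (\<forall>x \<in> M. \<forall>c. \<phi> (op_scale c x) = op_scale c (\<phi> x)) \<and>
     (\<forall>x \<in> M. \<phi> (op_adj x) = op_adj (\<phi> x)) \<and>
     \<phi> id_blinfun = id_blinfun \<and> normal_map M M \<phi>"

definition automorphism :: "('h::complex_hilbert_space \<Rightarrow>\<^sub>L 'h) set \<Rightarrow> (('h \<Rightarrow>\<^sub>L 'h) \<Rightarrow> ('h \<Rightarrow>\<^sub>L 'h)) \<Rightarrow> bool" where
  "automorphism M \<phi> \<longleftrightarrow> endomorphism M \<phi> \<and> bij_betw \<phi> M M"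

definition conditional_expectation ::
    "('h::complex_hilbert_space \<Rightarrow>\<^sub>L 'h) set \<Rightarrow> ('h \<Rightarrow>\<^sub>L 'h) set \<Rightarrow> (('h \<Rightarrow>\<^sub>L 'h) \<Rightarrow> ('h \<Rightarrow>\<^sub>L 'h)) \<Rightarrow> bool" where
  "conditional_expectation M N E \<longleftrightarrow> E ` M \<subseteq> N \<and> (\<forall>y \<in> N. E y = y) \<and>
     (\<forall>x \<in> M. \<forall>y \<in> M. E (x + y) = E x + E y) \<and>
     (\<forall>x \<in> M. \<forall>c. E (op_scale c x) = op_scale c (E x)) \<and>
     (\<forall>x \<in> M. \<forall>a \<in> N. \<forall>b \<in> N. E (a o\<^sub>L x o\<^sub>L b) = a o\<^sub>L E x o\<^sub>L b) \<and>
     (\<forall>x \<in> M. op_le 0 x \<longrightarrow> op_le 0 (E x)) \<and> normal_map M N E"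

text \<open>Finite index of \<open>\<phi>(M) \<subseteq> M\<close>: a normal conditional expectation satisfying a Pimsner-Popa inequality.\<close>

definition finite_index :: "('h::complex_hilbert_space \<Rightarrow>\<^sub>L 'h) set \<Rightarrow> (('h \<Rightarrow>\<^sub>L 'h) \<Rightarrow> ('h \<Rightarrow>\<^sub>L 'h)) \<Rightarrow> bool" where
  "finite_index M \<phi> \<longleftrightarrow> (\<exists>E c. 0 < c \<and> conditional_expectation M (\<phi> ` M) E \<and>
     (\<forall>x \<in> M. op_le 0 x \<longrightarrow> op_le (c *\<^sub>R x) (E x)))"

type_synonym 'h endo = "('h \<Rightarrow>\<^sub>L 'h) \<Rightarrow> ('h \<Rightarrow>\<^sub>L 'h)"
type_synonym 'h intertwiner = "'h endo \<times> ('h \<Rightarrow>\<^sub>L 'h) \<times> 'h endo"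

text \<open>The strict monoidal category of finite index endomorphisms of \<open>M\<close>. Unital endomorphisms have no
  zero object, so the zero map is added as one. The arrows \<open>\<lambda> \<longrightarrow> \<mu>\<close> are the \<open>t \<in> M\<close> with
  \<open>t \<lambda>(x) = \<mu>(x) t\<close>; the equation \<open>\<mu>(1) t \<lambda>(1) = t\<close> is automatic for unital \<open>\<lambda>, \<mu>\<close> and forces \<open>t = 0\<close> if
  \<open>\<lambda>\<close> or \<open>\<mu>\<close> is the zero map.\<close>

definition End0 :: "('h::complex_hilbert_space \<Rightarrow>\<^sub>L 'h) set \<Rightarrow> ('h endo, 'h intertwiner) moncat" where
  "End0 M =
    (let obs = insert (\<lambda>x. 0) {\<phi>. endomorphism M \<phi> \<and> finite_index M \<phi>};
         idn = (\<lambda>\<mu>. (\<mu>, \<mu> id_blinfun, \<mu>))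
     in \<lparr>
       Obj = obs,
       Arr = {(\<mu>, t, \<nu>). \<mu> \<in> obs \<and> \<nu> \<in> obs \<and> t \<in> M \<and> \<nu> id_blinfun o\<^sub>L t o\<^sub>L \<mu> id_blinfun = t \<and>
                (\<forall>x \<in> M. t o\<^sub>L \<mu> x = \<nu> x o\<^sub>L t)},
       Src = (\<lambda>(\<mu>, t, \<nu>). \<mu>),
       Tgt = (\<lambda>(\<mu>, t, \<nu>). \<nu>),
       Ident = idn,
       Comp = (\<lambda>(\<mu>', s, \<nu>) (\<mu>, t, \<nu>'). (\<mu>, s o\<^sub>L t, \<nu>)),
       Add = (\<lambda>(\<mu>, t, \<nu>) (\<mu>', s, \<nu>'). (\<mu>, t + s, \<nu>)),
       Scal = (\<lambda>c (\<mu>, t, \<nu>). (\<mu>, op_scale c t, \<nu>)),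
       Zero = (\<lambda>\<mu> \<nu>. (\<mu>, 0, \<nu>)),
       TensO = (\<lambda>\<mu> \<nu>. \<mu> \<circ> \<nu>),
       TensM = (\<lambda>(\<mu>, t, \<mu>') (\<nu>, s, \<nu>'). (\<mu> \<circ> \<nu>, t o\<^sub>L \<mu> s, \<mu>' \<circ> \<nu>')),
       Unit = id_on M,
       Assoc = (\<lambda>\<mu> \<nu> \<xi>. idn (\<mu> \<circ> \<nu> \<circ> \<xi>)),
       LUnit = idn,
       RUnit = idn\<rparr>)"

definition dagger :: "'h::complex_hilbert_space intertwiner \<Rightarrow> 'h intertwiner" where
  "dagger = (\<lambda>(\<mu>, t, \<nu>). (\<nu>, op_adj t, \<mu>))"


section \<open>The categories\<close>

text \<open>The group is the additive group \<open>2 \<times> 2\<close>, where \<open>2\<close> is the type of integers mod 2.\<close>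

definition cat_C ::
    "('h::complex_hilbert_space \<Rightarrow>\<^sub>L 'h) set \<Rightarrow> (2 \<times> 2 \<Rightarrow> 'h endo) \<Rightarrow> 'h endo \<Rightarrow> ('h endo, 'h intertwiner) moncat" where
  "cat_C M \<alpha> \<rho> = full_sub (End0 M)
     {x. \<exists>xs. set xs \<subseteq> range \<alpha> \<union> range (\<lambda>g. \<alpha> g \<circ> \<rho>) \<and> direct_sum (End0 M) x xs}"

text \<open>\<open>\<gamma>\<^sup>k\<close> for \<open>k\<close> in the integers mod 3\<close>

definition pow3 :: "('h::complex_hilbert_space \<Rightarrow>\<^sub>L 'h) set \<Rightarrow> 'h endo \<Rightarrow> 3 \<Rightarrow> 'h endo" where
  "pow3 M \<gamma> k = (\<gamma> ^^ (LEAST n. of_nat n = k)) \<circ> id_on M"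

definition conj_obj :: "('h::complex_hilbert_space \<Rightarrow>\<^sub>L 'h) set \<Rightarrow> 'h endo \<Rightarrow> 3 \<Rightarrow> 'h endo \<Rightarrow> 'h endo" where
  "conj_obj M \<gamma> k \<mu> = pow3 M \<gamma> k \<circ> \<mu> \<circ> pow3 M \<gamma> (- k)"

definition conj_arr ::
    "('h::complex_hilbert_space \<Rightarrow>\<^sub>L 'h) set \<Rightarrow> 'h endo \<Rightarrow> 3 \<Rightarrow> 'h intertwiner \<Rightarrow> 'h intertwiner" where
  "conj_arr M \<gamma> k = (\<lambda>(\<mu>, t, \<nu>). (conj_obj M \<gamma> k \<mu>, pow3 M \<gamma> k t, conj_obj M \<gamma> k \<nu>))"

definition cat_C1 where
  "cat_C1 M \<alpha> \<rho> \<gamma> = equivariantization (cat_C M \<alpha> \<rho>) (conj_obj M \<gamma>) (conj_arr M \<gamma>)"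

definition cat_C2 ::
    "('h::complex_hilbert_space \<Rightarrow>\<^sub>L 'h) set \<Rightarrow> (2 \<times> 2 \<Rightarrow> 'h endo) \<Rightarrow> 'h endo \<Rightarrow> 'h endo \<Rightarrow>
     ('h endo, 'h intertwiner) moncat" where
  "cat_C2 M \<alpha> \<rho> \<gamma> = full_sub (End0 M) (generated (End0 M) (insert \<gamma> (Obj (cat_C M \<alpha> \<rho>))))"

end

theory Submission
  imports Defs "HOL-Computational_Algebra.Fundamental_Theorem_Algebra"
begin

text \<open>
  Only the linear structure of an equivalence is needed: \<open>C\<^sub>4\<close> has between 14 and 20 simple objects (in fact 16),
  whereas \<open>C\<^sub>1\<close> and \<open>C\<^sub>3\<close> have at most 12 and \<open>C\<^sub>2\<close> has 24. In each of these categories the Hom spaces are spaces of operators, and every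
  arrow \<open>t\<close> is von Neumann regular (\<open>t g t = t\<close> for some \<open>g\<close>), so finite-dimensional endomorphism algebras
  split into simple idempotents. The dimensions of the Hom spaces between the members of a finite generating
  family therefore form a Gram matrix \<open>(\<Sum>s\<in>S. n i s * n j s)\<close>, where \<open>S\<close> is the set of simple classes, and such
  a matrix bounds \<open>card S\<close>. As generating families serve the simple objects \<open>\<alpha>\<^sub>k\<rho>\<^sup>e\<gamma>\<^sup>c\<close> of \<open>C\<^sub>2\<close>, the free
  bimodules \<open>A (\<alpha>\<^sub>k\<rho>\<^sup>e\<gamma>\<^sup>c) A\<close> in \<open>C\<^sub>3\<close> and \<open>C\<^sub>4\<close>, and the objects \<open>\<Oplus>\<^sub>j \<gamma>\<^sup>j x \<gamma>\<^sup>-\<^sup>j\<close> induced to \<open>C\<^sub>1\<close>. By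
  Frobenius reciprocity their Hom spaces are computed by the fusion rules alone. Since \<open>S\<close> is common to
  equivalent categories, regularity is needed on one side only and is never proved for \<open>C\<^sub>4\<close>.
\<close>

section \<open>Operators on a complex Hilbert space\<close>

text \<open>Only \<open>cat_C\<close> is assumed to be a fusion category, so \<open>cat_C2\<close>,
  its dual categories and the equivariantization may not be treated as semisimple at the outset, and
  an idempotent of a bimodule has no image at hand. Simple objects are therefore replaced by
  idempotents with scalar corners (\<open>brick\<close>), and semisimplicity by quasi-inverses. For
  underlying objects these come from Gaussian elimination in sums of words. They become compatible
  with extra structure by averaging: over the left and right actions of a group of order two for
  \<open>1 + \<alpha>\<^sub>g\<close>, over a group of order three for equivariant objects. For
  \<open>1 + \<alpha>\<^sub>h\<rho>\<close> no such group is at hand, so C4 only supplies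
  dimensions. The Gram matrices of C2, C3 and C4 split along the grading by powers of
  \<open>\<gamma>\<close>. What separates the categories is that \<open>\<gamma>\<close> moves every
  nonzero \<open>g\<close>: in degree \<open>c \<noteq> 0\<close> the left and right factors of a
  free bimodule shift by different group elements. C4 gets 8 classes in degree 0 and between 3 and 6
  in each of the two other degrees, hence 14 and 20. These bounds are crude, but already miss 12 and
  24.\<close>

lemma cinner_add_right: "cinner x (y + z) = cinner x y + cinner x (z::'h::complex_hilbert_space)"
  by (metis cinner_add_left cinner_commute complex_cnj_add)

lemma cinner_scaleC_right: "cinner x (scaleC c y) = cnj c * cinner x (y::'h::complex_hilbert_space)"
  by (metis cinner_scaleC_left cinner_commute complex_cnj_mult)

lemma cinner_self: "cinner x x = complex_of_real ((norm (x::'h::complex_hilbert_space))\<^sup>2)"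
proof -
  have "Im (cinner x x) = - Im (cinner x x)"
    using arg_cong[OF cinner_commute[of x x], of Im] by simp
  then show ?thesis
    by (simp add: complex_eq_iff inner_eq_Re_cinner[symmetric] power2_norm_eq_inner)
qed

lemma norm_scaleC: "norm (scaleC c x) = cmod c * norm (x::'h::complex_hilbert_space)"
proof -
  have "complex_of_real ((norm (scaleC c x))\<^sup>2) = c * cnj c * complex_of_real ((norm x)\<^sup>2)"
    by (metis cinner_self cinner_scaleC_left cinner_scaleC_right mult.assoc mult.left_commute)
  then have "complex_of_real ((norm (scaleC c x))\<^sup>2) = complex_of_real ((cmod c * norm x)\<^sup>2)"
    by (simp add: complex_norm_square[symmetric] power_mult_distrib del: of_real_power)
  then have "(norm (scaleC c x))\<^sup>2 = (cmod c * norm x)\<^sup>2"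
    using of_real_eq_iff by blast
  then show ?thesis
    by (simp add: power2_eq_iff_nonneg)
qed

lemma scaleC_one [simp]: "scaleC 1 x = (x::'h::complex_hilbert_space)"
  using scaleC_of_real[of 1 x] by simp

lemma bounded_linear_scaleC: "bounded_linear (scaleC c :: 'h::complex_hilbert_space \<Rightarrow> 'h)"
proof (rule bounded_linear_intro[where K = "cmod c"])
  show "scaleC c (r *\<^sub>R x) = r *\<^sub>R scaleC c x" for r and x :: 'h
    by (metis scaleC_of_real scaleC_scaleC mult.commute)
qed (auto simp: scaleC_add_right norm_scaleC)

lemma blinfun_apply_op_scale [simp]:
  "blinfun_apply (op_scale c t) v = scaleC c (blinfun_apply t (v::'h::complex_hilbert_space))"
  unfolding op_scale_def
  by (subst bounded_linear_Blinfun_apply)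
    (auto intro: bounded_linear_compose[OF bounded_linear_scaleC blinfun.bounded_linear_right])

abbreviation op_mult :: "('h::real_normed_vector \<Rightarrow>\<^sub>L 'h) \<Rightarrow> ('h \<Rightarrow>\<^sub>L 'h) \<Rightarrow> 'h \<Rightarrow>\<^sub>L 'h" (infixl "\<cdot>" 70) where
  "s \<cdot> t \<equiv> s o\<^sub>L t"

abbreviation op_one :: "'h::real_normed_vector \<Rightarrow>\<^sub>L 'h" ("\<I>") where
  "\<I> \<equiv> id_blinfun"

lemma op_assoc: "(a \<cdot> b) \<cdot> c = a \<cdot> (b \<cdot> c)"
  by (rule blinfun_eqI) simp

lemma op_one_simps [simp]: "\<I> \<cdot> t = t" "t \<cdot> \<I> = t"
  by (auto intro: blinfun_eqI)

interpretation blinfun_compose: bounded_bilinear "(o\<^sub>L)"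
  by (rule bounded_bilinear_blinfun_compose)

lemmas op_distribs = blinfun_compose.add_left blinfun_compose.add_right
  blinfun_compose.diff_left blinfun_compose.diff_right blinfun_compose.minus_left
  blinfun_compose.minus_right

declare blinfun_compose.zero_left [simp] blinfun_compose.zero_right [simp]

interpretation cvs: vector_space "op_scale :: complex \<Rightarrow> ('h::complex_hilbert_space \<Rightarrow>\<^sub>L 'h) \<Rightarrow> 'h \<Rightarrow>\<^sub>L 'h"
  by standard (auto intro!: blinfun_eqI simp: scaleC_add_left scaleC_add_right scaleC_scaleC blinfun.bilinear_simps)

lemma op_scale_left: "op_scale c s \<cdot> t = op_scale c (s \<cdot> t)"
  by (auto intro: blinfun_eqI)

text \<open>Complex linearity of \<open>s\<close> matters:
  \<open>'h \<Rightarrow>\<^sub>L 'h\<close> also contains operators that are only real-linear, and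
  these need not commute with complex scalars.\<close>

lemma op_scale_right: "s \<in> bounded_ops \<Longrightarrow> s \<cdot> op_scale c t = op_scale c (s \<cdot> t)"
  by (auto intro: blinfun_eqI simp: bounded_ops_def)

lemma bounded_ops_closed [simp, intro]:
  "0 \<in> bounded_ops" "\<I> \<in> bounded_ops"
  "s \<in> bounded_ops \<Longrightarrow> t \<in> bounded_ops \<Longrightarrow> s + t \<in> bounded_ops"
  "s \<in> bounded_ops \<Longrightarrow> t \<in> bounded_ops \<Longrightarrow> s - t \<in> bounded_ops"
  "s \<in> bounded_ops \<Longrightarrow> t \<in> bounded_ops \<Longrightarrow> s \<cdot> t \<in> bounded_ops"
  "s \<in> bounded_ops \<Longrightarrow> op_scale c s \<in> bounded_ops"
  by (auto simp: bounded_ops_def blinfun.bilinear_simps scaleC_add_right scaleC_scaleC mult.commute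
       linear_diff[OF bounded_linear.linear[OF bounded_linear_scaleC]]
       linear_0[OF bounded_linear.linear[OF bounded_linear_scaleC]])

subsection \<open>Adjoints\<close>

text \<open>The closed affine hyperplane \<open>f v = 1\<close> has a point \<open>w\<close> of
  least norm. It is orthogonal to the kernel of \<open>f\<close>, so a rescaling of it represents
  \<open>f\<close>.\<close>

lemma riesz_representation:
  fixes f :: "'h::{real_inner, complete_space} \<Rightarrow> real"
  assumes f: "bounded_linear f"
  shows "\<exists>w. \<forall>v. f v = v \<bullet> w"
proof (cases "\<forall>v. f v = 0")
  case True
  then show ?thesis by (intro exI[of _ 0]) simp
next
  case False
  interpret f: bounded_linear f by (fact f)
  from False obtain v0 where v0: "f v0 \<noteq> 0" by blast
  define S where "S = {v. f v = 1}"
  have "v0 /\<^sub>R f v0 \<in> S" using v0 by (simp add: S_def f.scaleR)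
  then have ne: "S \<noteq> {}" by blast
  define d where "d = (INF v\<in>S. norm v)"
  have bdd: "bdd_below (norm ` S)" by (intro bdd_belowI[of _ 0]) auto
  have d_le: "d \<le> norm v" if "v \<in> S" for v
    unfolding d_def using bdd that by (rule cINF_lower)
  have d0: "0 \<le> d" unfolding d_def using ne by (intro cINF_greatest) auto
  have ex: "\<exists>v\<in>S. norm v < d + 1 / real (Suc n)" for n
  proof -
    have "d < d + 1 / real (Suc n)" by simp
    then show ?thesis unfolding d_def using cINF_less_iff[OF ne bdd] by blast
  qed
  then obtain u where uS: "\<And>n. u n \<in> S" and ud: "\<And>n. norm (u n) < d + 1 / real (Suc n)" by metis
  have mid: "d\<^sup>2 * 4 \<le> (norm (a + b))\<^sup>2" if "a \<in> S" "b \<in> S" for a b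
  proof -
    have "(a + b) /\<^sub>R 2 \<in> S" using that by (simp add: S_def f.scaleR f.add)
    from d_le[OF this] have "2 * d \<le> norm (a + b)" by simp
    then have "(2 * d)\<^sup>2 \<le> (norm (a + b))\<^sup>2" using d0 by (intro power_mono) auto
    then show ?thesis by (simp add: power_mult_distrib)
  qed
  \<comment> \<open>Parallelogram law: the midpoint of two points of \<open>S\<close> is again in
    \<open>S\<close>, so two points of nearly minimal norm are close together. This makes the
    minimizing sequence Cauchy.\<close>
  have par: "(norm (a - b))\<^sup>2 \<le> 2 * (norm a)\<^sup>2 + 2 * (norm b)\<^sup>2 - 4 * d\<^sup>2" if "a \<in> S" "b \<in> S" for a b
  proof -
    have "(norm (a - b))\<^sup>2 + (norm (a + b))\<^sup>2 = 2 * (norm a)\<^sup>2 + 2 * (norm b)\<^sup>2"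
      by (simp add: power2_norm_eq_inner inner_diff_left inner_diff_right inner_add_left inner_add_right inner_commute)
    with mid[OF that] show ?thesis by linarith
  qed
  have bound: "(norm (u m - u n))\<^sup>2 \<le> (8 * d + 4) / real (Suc k)" if "m \<ge> k" "n \<ge> k" for m n k
  proof -
    have sq: "(norm (u j))\<^sup>2 \<le> d\<^sup>2 + (2 * d + 1) / real (Suc k)" if "j \<ge> k" for j
    proof -
      have le: "1 / real (Suc j) \<le> 1 / real (Suc k)" using that by (simp add: frac_le)
      have "norm (u j) \<le> d + 1 / real (Suc k)" using ud[of j] le by linarith
      then have "(norm (u j))\<^sup>2 \<le> (d + 1 / real (Suc k))\<^sup>2" by (intro power_mono) auto
      also have "\<dots> = d\<^sup>2 + 2 * d / real (Suc k) + (1 / real (Suc k)) * (1 / real (Suc k))"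
        by (simp add: power2_eq_square algebra_simps)
      also have "\<dots> \<le> d\<^sup>2 + 2 * d / real (Suc k) + 1 * (1 / real (Suc k))"
        by (intro add_left_mono mult_right_mono) auto
      finally show ?thesis by (simp add: add_divide_distrib)
    qed
    have "(norm (u m - u n))\<^sup>2 \<le> 4 * ((2 * d + 1) / real (Suc k))"
      using par[OF uS[of m] uS[of n]] sq[OF that(1)] sq[OF that(2)] by linarith
    then show ?thesis by (simp add: field_simps)
  qed
  have "Cauchy u"
  proof (rule metric_CauchyI)
    fix e :: real assume e: "0 < e"
    obtain k where k: "(8 * d + 4) / e\<^sup>2 < real k" using reals_Archimedean2 by blast
    have "dist (u m) (u n) < e" if "m \<ge> k" "n \<ge> k" for m n
    proof -
      have "(8 * d + 4) < real (Suc k) * e\<^sup>2" using k e by (simp add: field_simps) (smt (verit) zero_less_power)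
      then have "(8 * d + 4) / real (Suc k) < e\<^sup>2" by (simp add: field_simps)
      then have "(norm (u m - u n))\<^sup>2 < e\<^sup>2" using bound[OF that] by linarith
      then show ?thesis using e by (simp add: dist_norm power_less_imp_less_base)
    qed
    then show "\<exists>k. \<forall>m\<ge>k. \<forall>n\<ge>k. dist (u m) (u n) < e" by blast
  qed
  then obtain w where w: "u \<longlonglongrightarrow> w" using Cauchy_convergent convergent_def by blast
  have "(\<lambda>n. f (u n)) \<longlonglongrightarrow> f w" using w by (rule f.tendsto)
  moreover have "(\<lambda>n. f (u n)) = (\<lambda>n. 1)" using uS by (auto simp: S_def)
  ultimately have fw: "f w = 1" by (simp add: LIMSEQ_const_iff)
  have nw: "norm w \<le> d"
  proof (rule LIMSEQ_le)
    show "(\<lambda>n. norm (u n)) \<longlonglongrightarrow> norm w" using w by (rule tendsto_norm)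
    show "(\<lambda>n. d + 1 / real (Suc n)) \<longlonglongrightarrow> d" using LIMSEQ_inverse_real_of_nat_add[of d]
      by (simp add: inverse_eq_divide)
    show "\<exists>N. \<forall>n\<ge>N. norm (u n) \<le> d + 1 / real (Suc n)" using ud less_imp_le by blast
  qed
  have w0: "w \<noteq> 0" using fw f.zero by auto
  have orth: "v \<bullet> w = 0" if "f v = 0" for v
  proof (rule ccontr)
    assume nz: "v \<bullet> w \<noteq> 0"
    then have v: "v \<bullet> v \<noteq> 0" by auto
    then have vpos: "v \<bullet> v > 0" by (simp add: order_less_le)
    \<comment> \<open>Subtracting from \<open>w\<close> its projection to the line of
      \<open>v\<close> stays in \<open>S\<close> and would lower the norm below the minimum.\<close>
    define r where "r = (v \<bullet> w) / (v \<bullet> v)"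
    have "w - r *\<^sub>R v \<in> S" using fw that by (simp add: S_def f.diff f.scaleR)
    then have "norm w \<le> norm (w - r *\<^sub>R v)" using d_le nw by force
    then have "(norm w)\<^sup>2 \<le> (norm (w - r *\<^sub>R v))\<^sup>2" by (intro power_mono) auto
    also have "\<dots> = (norm w)\<^sup>2 - 2 * r * (v \<bullet> w) + r * r * (v \<bullet> v)"
      by (simp add: power2_norm_eq_inner inner_diff_left inner_diff_right inner_commute algebra_simps)
    also have "r * r * (v \<bullet> v) = r * (v \<bullet> w)" using v by (simp add: r_def)
    finally have "r * (v \<bullet> w) \<le> 0" by simp
    moreover have "r * (v \<bullet> w) = (v \<bullet> w)\<^sup>2 / (v \<bullet> v)" by (simp add: r_def power2_eq_square)
    moreover have "(v \<bullet> w)\<^sup>2 / (v \<bullet> v) > 0" using nz vpos by simp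
    ultimately show False by simp
  qed
  have "f v = v \<bullet> (w /\<^sub>R (w \<bullet> w))" for v
  proof -
    have "f (v - f v *\<^sub>R w) = 0" using fw by (simp add: f.diff f.scaleR)
    from orth[OF this] have "v \<bullet> w = f v * (w \<bullet> w)" by (simp add: inner_diff_left)
    then show ?thesis using w0 by (simp add: field_simps)
  qed
  then show ?thesis by blast
qed

text \<open>Recovers the complex inner product from the real one, so that representing real
  functionals suffices for complex adjoints.\<close>

lemma cinner_eq_Complex: "cinner x y = Complex (x \<bullet> y) (x \<bullet> scaleC \<i> (y::'h::complex_hilbert_space))"
  by (simp add: complex_eq_iff inner_eq_Re_cinner cinner_scaleC_right)

lemma inner_scaleC_ii: "x \<bullet> scaleC \<i> y = - (scaleC \<i> x \<bullet> (y::'h::complex_hilbert_space))"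
  by (simp add: inner_eq_Re_cinner cinner_scaleC_right cinner_scaleC_left)

text \<open>Representing \<open>v \<mapsto> t v \<bullet> w\<close> gives the adjoint for the real
  inner product. As \<open>t\<close> commutes with \<open>\<i>\<close>, so does this adjoint, which
  upgrades the identity to \<open>cinner\<close>; complex linearity of the adjoint follows from the
  upgraded identity.\<close>

lemma adjoint_exists:
  assumes t: "t \<in> bounded_ops"
  shows "\<exists>s \<in> bounded_ops. \<forall>v w. cinner (blinfun_apply t v) w = cinner v (blinfun_apply s (w::'h::complex_hilbert_space))"
proof -
  have "\<exists>z. \<forall>v. blinfun_apply t v \<bullet> w = v \<bullet> z" for w
    by (intro riesz_representation bounded_linear_compose[OF bounded_linear_inner_left blinfun.bounded_linear_right])
  then obtain s where s: "\<And>v w. blinfun_apply t v \<bullet> w = v \<bullet> s w" by metis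
  have eqI: "x = y" if "\<And>v. v \<bullet> x = v \<bullet> (y::'h)" for x y
    using that by (metis inner_commute vector_eq_ldot)
  have ic: "s (scaleC \<i> w) = scaleC \<i> (s w)" for w
  proof (rule eqI)
    fix v
    have "v \<bullet> s (scaleC \<i> w) = - (blinfun_apply t (scaleC \<i> v) \<bullet> w)"
      using t by (simp add: s[symmetric] inner_scaleC_ii bounded_ops_def)
    then show "v \<bullet> s (scaleC \<i> w) = v \<bullet> scaleC \<i> (s w)" by (simp add: s inner_scaleC_ii)
  qed
  have bl: "bounded_linear s"
  proof (rule bounded_linear_intro[where K = "norm t"])
    show "s (x + y) = s x + s y" for x y
      by (rule eqI) (simp add: inner_add_right s[symmetric])
    show "s (r *\<^sub>R x) = r *\<^sub>R s x" for r x
      by (rule eqI) (simp add: s[symmetric])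
    show "norm (s x) \<le> norm x * norm t" for x
    proof (cases "s x = 0")
      case False
      have "norm (s x) * norm (s x) = blinfun_apply t (s x) \<bullet> x"
        by (simp add: s power2_norm_eq_inner[symmetric] power2_eq_square[symmetric])
      also have "\<dots> \<le> norm (blinfun_apply t (s x)) * norm x" by (rule norm_cauchy_schwarz)
      also have "\<dots> \<le> (norm t * norm (s x)) * norm x" by (intro mult_right_mono norm_blinfun) auto
      finally show ?thesis using False by (simp add: mult.commute mult.left_commute)
    qed simp
  qed
  have cin: "cinner (blinfun_apply t v) w = cinner v (s w)" for v w
    using t by (simp add: cinner_eq_Complex s ic)
  have "s (scaleC c w) = scaleC c (s w)" for c w
  proof (rule eqI)
    fix v
    have "cinner v (s (scaleC c w)) = cnj c * cinner v (s w)"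
      by (simp add: cin[symmetric] cinner_scaleC_right)
    then have "cinner v (s (scaleC c w)) = cinner v (scaleC c (s w))" by (simp add: cinner_scaleC_right)
    then show "v \<bullet> s (scaleC c w) = v \<bullet> scaleC c (s w)" by (simp add: inner_eq_Re_cinner)
  qed
  then show ?thesis using bl cin
    by (intro bexI[of _ "Blinfun s"]) (auto simp: bounded_linear_Blinfun_apply bounded_ops_def)
qed

lemma cinner_ext: "(\<And>v. cinner v x = cinner v y) \<Longrightarrow> x = (y::'h::complex_hilbert_space)"
  by (metis inner_commute inner_eq_Re_cinner vector_eq_ldot)

lemma op_adj_unique:
  assumes "\<And>v w. cinner (blinfun_apply t v) w = cinner v (blinfun_apply s (w::'h::complex_hilbert_space))"
  shows "op_adj t = s"
  unfolding op_adj_def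
proof (rule the_equality)
  show "s' = s" if "\<forall>v w. cinner (blinfun_apply t v) w = cinner v (blinfun_apply s' w)" for s'
    using that assms by (intro blinfun_eqI cinner_ext) metis
qed (use assms in blast)

lemma op_adj:
  assumes "t \<in> bounded_ops"
  shows "cinner (blinfun_apply t v) w = cinner v (blinfun_apply (op_adj t) (w::'h::complex_hilbert_space))"
    and "op_adj t \<in> bounded_ops"
  using adjoint_exists[OF assms] op_adj_unique by metis+

lemma op_adj_mult: "s \<in> bounded_ops \<Longrightarrow> t \<in> bounded_ops \<Longrightarrow> op_adj (s \<cdot> t) = op_adj t \<cdot> op_adj s"
  by (rule op_adj_unique) (simp add: op_adj)

lemma op_adj_adj: "t \<in> bounded_ops \<Longrightarrow> op_adj (op_adj t) = t"
  by (rule op_adj_unique) (metis cinner_commute op_adj(1))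

lemma op_adj_mult_eq_0: "t \<in> bounded_ops \<Longrightarrow> op_adj t \<cdot> t = 0 \<Longrightarrow> t = (0 :: 'h::complex_hilbert_space \<Rightarrow>\<^sub>L 'h)"
proof (rule blinfun_eqI)
  fix v :: 'h
  assume t: "t \<in> bounded_ops" "op_adj t \<cdot> t = 0"
  have "cinner (blinfun_apply t v) (blinfun_apply t v) = cinner v (blinfun_apply (op_adj t \<cdot> t) v)"
    using t(1) by (simp add: op_adj)
  also have "\<dots> = 0" using t(2) by (metis cinner_add_right add_cancel_right_right blinfun.zero_left)
  finally show "blinfun_apply t v = blinfun_apply 0 v" by (simp add: cinner_self)
qed

section \<open>Dimensions\<close>

text \<open>A relation instead of a dimension function, so that \<open>cdim V n\<close> also asserts
  that \<open>V\<close> is a subspace of finite dimension.\<close>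

definition cdim :: "('h::complex_hilbert_space \<Rightarrow>\<^sub>L 'h) set \<Rightarrow> nat \<Rightarrow> bool" where
  "cdim V n \<longleftrightarrow> (\<exists>B. finite B \<and> cvs.independent B \<and> cvs.span B = V \<and> card B = n)"

lemma cdim_unique: "cdim V m \<Longrightarrow> cdim V n \<Longrightarrow> m = n"
  unfolding cdim_def by (metis cvs.dim_span_eq_card_independent)

lemma cdim_zero: "cdim {0} 0"
  unfolding cdim_def by (intro exI[of _ "{}"]) (auto simp: cvs.span_empty cvs.independent_empty)

lemma cdim_0D: "cdim V 0 \<Longrightarrow> V = {0}"
  unfolding cdim_def by (metis card_0_eq cvs.span_empty)

interpretation cvp: vector_space_pair
  "op_scale :: complex \<Rightarrow> ('h::complex_hilbert_space \<Rightarrow>\<^sub>L 'h) \<Rightarrow> 'h \<Rightarrow>\<^sub>L 'h"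
  "op_scale :: complex \<Rightarrow> ('h::complex_hilbert_space \<Rightarrow>\<^sub>L 'h) \<Rightarrow> 'h \<Rightarrow>\<^sub>L 'h"
  ..

lemma cdim_bij:
  fixes V W :: "('h::complex_hilbert_space \<Rightarrow>\<^sub>L 'h) set"
  assumes V: "cdim V n" and f: "bij_betw f V W"
    and add: "\<And>x y. x \<in> V \<Longrightarrow> y \<in> V \<Longrightarrow> f (x + y) = f x + f y"
    and scale: "\<And>c x. x \<in> V \<Longrightarrow> f (op_scale c x) = op_scale c (f x)"
  shows "cdim W n"
proof -
  obtain B where B: "finite B" "cvs.independent B" "cvs.span B = V" "card B = n"
    using V unfolding cdim_def by blast
  \<comment> \<open>\<open>f\<close> is only linear on \<open>V\<close>; \<open>g\<close> is a
    linear map on all operators with the same values on the basis, hence on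
    \<open>V\<close>.\<close>
  define g where "g = cvp.construct B f"
  have lin: "Vector_Spaces.linear op_scale op_scale g"
    unfolding g_def using B(2) by (rule cvp.linear_construct)
  have gB: "g b = f b" if "b \<in> B" for b
    unfolding g_def using cvp.construct_basis[OF B(2) that] .
  have "v \<in> V \<and> g v = f v" if "v \<in> cvs.span B" for v
    using that
  proof (induction rule: cvs.span_induct_alt)
    case base
    have "f 0 = 0" using scale[of 0 0] B(3) cvs.span_zero[of B] by simp
    then show ?case using cvp.linear_0[OF lin] B(3) cvs.span_zero[of B] by simp
  next
    case (step c x y)
    have "x \<in> V" "op_scale c x \<in> V"
      using cvs.span_base[OF step(1)] cvs.span_scale[OF cvs.span_base[OF step(1)]] B(3) by simp_all
    moreover have "op_scale c x + y \<in> V"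
      using cvs.span_add[OF cvs.span_scale[OF cvs.span_base[OF step(1)]]] step(2) B(3) by simp
    ultimately show ?case
      using add scale step gB by (simp add: cvp.linear_add[OF lin] cvp.linear_scale[OF lin])
  qed
  then have gV: "g v = f v" if "v \<in> V" for v using that B(3) by simp
  have bij: "bij_betw g V W" using bij_betw_cong[of V g f W] gV f by simp
  have "cvs.independent (g ` B)"
    using lin B(2,3) bij by (intro cvp.linear_independent_injective_image) (auto simp: bij_betw_def)
  moreover have "cvs.span (g ` B) = W"
    using cvp.linear_span_image[OF lin] B(3) bij by (simp add: bij_betw_def)
  moreover have "card (g ` B) = n"
    using B(3,4) bij cvs.span_superset[of B] by (metis bij_betw_def card_image inj_on_subset)
  ultimately show ?thesis unfolding cdim_def using B(1) by blast
qed

section \<open>Eigenvalues in finite dimensional algebras\<close>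

text \<open>The value of \<open>p\<close> at \<open>f\<close> with \<open>e\<close> as the unit: the
  zeroth power of \<open>f\<close> is \<open>e\<close>. The algebras at hand are corners cut out by
  an idempotent, whose unit need not be \<open>\<I>\<close>.\<close>

definition op_poly :: "('h::complex_hilbert_space \<Rightarrow>\<^sub>L 'h) \<Rightarrow> ('h \<Rightarrow>\<^sub>L 'h) \<Rightarrow> complex poly \<Rightarrow> 'h \<Rightarrow>\<^sub>L 'h" where
  "op_poly e f p = (\<Sum>i\<le>degree p. op_scale (coeff p i) (((\<cdot>) f ^^ i) e))"

lemma op_poly_le: "degree p \<le> n \<Longrightarrow> op_poly e f p = (\<Sum>i\<le>n. op_scale (coeff p i) (((\<cdot>) f ^^ i) e))"
  unfolding op_poly_def by (rule sum.mono_neutral_left) (auto simp: coeff_eq_0)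

lemma op_poly_add: "op_poly e f (p + q) = op_poly e f p + op_poly e f q"
  by (simp add: op_poly_le[of _ "max (degree p) (degree q)"] degree_add_le cvs.scale_left_distrib sum.distrib)

lemma op_poly_smult: "op_poly e f (smult c p) = op_scale c (op_poly e f p)"
  by (simp add: op_poly_le[of _ "degree p"] degree_smult_le cvs.scale_sum_right)

lemma op_poly_pCons_0:
  assumes "f \<in> bounded_ops"
  shows "op_poly e f (pCons 0 p) = f \<cdot> op_poly e f p"
proof -
  have "op_poly e f (pCons 0 p) = (\<Sum>i\<le>Suc (degree p). op_scale (coeff (pCons 0 p) i) (((\<cdot>) f ^^ i) e))"
    by (rule op_poly_le) (simp add: degree_pCons_le)
  also have "\<dots> = (\<Sum>i\<le>degree p. op_scale (coeff p i) (f \<cdot> ((\<cdot>) f ^^ i) e))"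
    unfolding sum.atMost_Suc_shift by simp
  also have "\<dots> = f \<cdot> op_poly e f p"
    by (simp add: op_poly_def blinfun_compose.sum_right op_scale_right[OF assms])
  finally show ?thesis .
qed

text \<open>Some nonzero polynomial in \<open>f\<close> kills \<open>e\<close>, since
  \<open>V\<close> is finite-dimensional. Its complex roots are split off one by one, and the last
  nonzero value reached is an eigenvector of left multiplication by \<open>f\<close>.\<close>

lemma eigenvector_exists:
  assumes V: "cvs.subspace V" "V \<subseteq> bounded_ops" "\<And>s t. s \<in> V \<Longrightarrow> t \<in> V \<Longrightarrow> s \<cdot> t \<in> V"
    and fin: "finite T" "V \<subseteq> cvs.span T"
    and e: "e \<in> V" "e \<noteq> 0" and f: "f \<in> V"
  shows "\<exists>c. \<exists>q \<in> V. q \<noteq> 0 \<and> f \<cdot> q = op_scale c q"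
proof -
  define pw where "pw i = ((\<cdot>) f ^^ i) e" for i
  have pwV: "pw i \<in> V" for i unfolding pw_def by (induction i) (auto simp: e f V(3))
  have fb: "f \<in> bounded_ops" using f V(2) by blast
  have evV: "op_poly e f p \<in> V" for p
    unfolding op_poly_def by (intro cvs.subspace_sum[OF V(1)] cvs.subspace_scale[OF V(1)])
      (simp add: pwV[unfolded pw_def])
  have key: "\<exists>c. \<exists>q \<in> V. q \<noteq> 0 \<and> f \<cdot> q = op_scale c q" if "p \<noteq> 0" "op_poly e f p = 0" for p
    using that
  proof (induction "degree p" arbitrary: p rule: less_induct)
    case less
    show ?case
    proof (cases "degree p = 0")
      case True
      then obtain c where c: "p = [:c:]" by (meson degree_eq_zeroE)
      then have "op_scale c e = 0" using less(3) by (simp add: op_poly_def)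
      then show ?thesis using c less(2) e(2) by auto
    next
      case False
      then have "\<not> constant (poly p)" by (simp add: constant_degree)
      then obtain z where "poly p z = 0" using fundamental_theorem_of_algebra by blast
      then obtain q where q: "p = [:- z, 1:] * q" by (meson dvdE poly_eq_0_iff_dvd)
      have q0: "q \<noteq> 0" using q less(2) by auto
      then have dq: "degree q < degree p" unfolding q by (subst degree_mult_eq) auto
      show ?thesis
      proof (cases "op_poly e f q = 0")
        case True
        then show ?thesis using less(1)[OF dq q0] by blast
      next
        case False
        have "p = smult (- z) q + pCons 0 q" unfolding q by simp
        then have "f \<cdot> op_poly e f q - op_scale z (op_poly e f q) = 0"
          using less(3) by (simp only: op_poly_add op_poly_smult op_poly_pCons_0[OF fb]) simp
        then show ?thesis using False evV[of q] by auto
      qed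
    qed
  qed
  define n where "n = card T"
  \<comment> \<open>The \<open>n + 1\<close> powers of \<open>f\<close> lie in the span of
    \<open>n\<close> operators. Equal powers form a separate case, because linear dependence is a
    property of the set of values.\<close>
  have "\<exists>p. p \<noteq> 0 \<and> op_poly e f p = 0"
  proof (cases "inj_on pw {..n}")
    case False
    then obtain i j where ij: "i \<noteq> j" "pw i = pw j" unfolding inj_on_def by blast
    have ev: "op_poly e f (monom 1 k) = pw k" for k
    proof -
      have "op_poly e f (monom 1 k) = (\<Sum>i\<le>k. if i = k then pw k else 0)"
        unfolding op_poly_def degree_monom_eq[OF one_neq_zero] pw_def by (rule sum.cong) auto
      then show ?thesis by simp
    qed
    have "op_poly e f (monom 1 i + smult (-1) (monom 1 j)) = 0"
      unfolding op_poly_add op_poly_smult ev using ij by simp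
    moreover have "coeff (monom 1 i + smult (-1) (monom (1::complex) j)) i = 1"
      using ij by simp
    then have "monom 1 i + smult (-1) (monom (1::complex) j) \<noteq> 0"
      using coeff_0[of i] by (metis zero_neq_one)
    ultimately show ?thesis by blast
  next
    case True
    have "cvs.dependent (pw ` {..n})"
    proof (rule ccontr)
      assume ind: "\<not> cvs.dependent (pw ` {..n})"
      have "pw ` {..n} \<subseteq> cvs.span T" using pwV fin(2) by blast
      with cvs.independent_span_bound[OF fin(1) ind] have "card (pw ` {..n}) \<le> card T" by simp
      then show False using True by (simp add: card_image n_def)
    qed
    then obtain u where u: "\<exists>v\<in>pw ` {..n}. u v \<noteq> 0" "(\<Sum>v\<in>pw ` {..n}. op_scale (u v) v) = 0"
      using cvs.dependent_finite[of "pw ` {..n}"] by auto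
    define p where "p = (\<Sum>i\<le>n. monom (u (pw i)) i)"
    have cp: "coeff p i = (if i \<le> n then u (pw i) else 0)" for i
      by (simp add: p_def coeff_sum sum.delta)
    have "degree p \<le> n" by (rule degree_le) (simp add: cp)
    then have "op_poly e f p = (\<Sum>i\<le>n. op_scale (coeff p i) (pw i))"
      unfolding pw_def by (rule op_poly_le)
    also have "\<dots> = (\<Sum>i\<le>n. op_scale (u (pw i)) (pw i))"
      by (rule sum.cong) (simp_all only: cp atMost_iff if_True)
    also have "\<dots> = (\<Sum>v\<in>pw ` {..n}. op_scale (u v) v)"
      by (subst sum.reindex[OF True]) simp
    finally have "op_poly e f p = 0" using u(2) by simp
    moreover have "p \<noteq> 0" using u(1) cp by (metis atMost_iff coeff_0 imageE)
    ultimately show ?thesis by blast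
  qed
  then show ?thesis using key by blast
qed

section \<open>Gram matrices of regular linear categories\<close>

text \<open>The common form of all categories compared: Hom spaces of operators, composed as
  operators. Neither direct sums nor images of idempotents are required. \<open>I p\<close> is left
  open because the zero object has identity 0.\<close>

locale opcat =
  fixes ob :: "'p set" and H :: "'p \<Rightarrow> 'p \<Rightarrow> ('h::complex_hilbert_space \<Rightarrow>\<^sub>L 'h) set"
    and I :: "'p \<Rightarrow> 'h \<Rightarrow>\<^sub>L 'h"
  assumes subspace_H: "\<lbrakk>p \<in> ob; q \<in> ob\<rbrakk> \<Longrightarrow> cvs.subspace (H p q)"
    and H_bounded_ops: "\<lbrakk>p \<in> ob; q \<in> ob; t \<in> H p q\<rbrakk> \<Longrightarrow> t \<in> bounded_ops"
    and I_H: "p \<in> ob \<Longrightarrow> I p \<in> H p p"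
    and I_left: "\<lbrakk>p \<in> ob; q \<in> ob; t \<in> H p q\<rbrakk> \<Longrightarrow> I q \<cdot> t = t"
    and I_right: "\<lbrakk>p \<in> ob; q \<in> ob; t \<in> H p q\<rbrakk> \<Longrightarrow> t \<cdot> I p = t"
    and H_mult: "\<lbrakk>p \<in> ob; q \<in> ob; r \<in> ob; s \<in> H q r; t \<in> H p q\<rbrakk> \<Longrightarrow> s \<cdot> t \<in> H p r"
begin

lemma H_0: "\<lbrakk>p \<in> ob; q \<in> ob\<rbrakk> \<Longrightarrow> 0 \<in> H p q"
  using subspace_H cvs.subspace_0 by blast

lemma H_add: "\<lbrakk>p \<in> ob; q \<in> ob; s \<in> H p q; t \<in> H p q\<rbrakk> \<Longrightarrow> s + t \<in> H p q"
  using subspace_H cvs.subspace_add by blast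

lemma H_diff: "\<lbrakk>p \<in> ob; q \<in> ob; s \<in> H p q; t \<in> H p q\<rbrakk> \<Longrightarrow> s - t \<in> H p q"
  using subspace_H cvs.subspace_diff by blast

lemma H_scale: "\<lbrakk>p \<in> ob; q \<in> ob; t \<in> H p q\<rbrakk> \<Longrightarrow> op_scale c t \<in> H p q"
  using subspace_H cvs.subspace_scale by blast

text \<open>An idempotent whose corner consists of scalars. It stands for a simple summand of
  \<open>p\<close>, without an object that realizes this summand.\<close>

definition brick :: "'p \<Rightarrow> ('h \<Rightarrow>\<^sub>L 'h) \<Rightarrow> bool" where
  "brick p e \<longleftrightarrow> e \<in> H p p \<and> e \<cdot> e = e \<and> e \<noteq> 0 \<and> (\<forall>t \<in> H p p. \<exists>c. e \<cdot> (t \<cdot> e) = op_scale c e)"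

definition resolution :: "'p \<Rightarrow> nat \<Rightarrow> (nat \<Rightarrow> 'h \<Rightarrow>\<^sub>L 'h) \<Rightarrow> bool" where
  "resolution p n e \<longleftrightarrow> (\<forall>j<n. e j \<in> H p p \<and> e j \<noteq> 0) \<and>
     (\<forall>j<n. \<forall>k<n. e j \<cdot> e k = (if j = k then e j else 0)) \<and> (\<Sum>j<n. e j) = I p"

lemma resolutionD:
  assumes "resolution p n e"
  shows "j < n \<Longrightarrow> e j \<in> H p p" "j < n \<Longrightarrow> e j \<noteq> 0"
    and "j < n \<Longrightarrow> k < n \<Longrightarrow> e j \<cdot> e k = (if j = k then e j else 0)" and "(\<Sum>j<n. e j) = I p"
  using assms unfolding resolution_def by simp_all

text \<open>Generators in the categorical sense: arrows out of the family separate arrows. In a Gram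
  decomposition this makes every simple class occur in some member.\<close>

definition generating :: "('i \<Rightarrow> 'p) \<Rightarrow> 'i set \<Rightarrow> bool" where
  "generating P J \<longleftrightarrow> (\<forall>y\<in>ob. \<forall>z\<in>ob. \<forall>f\<in>H y z. f \<noteq> 0 \<longrightarrow> (\<exists>j\<in>J. \<exists>t\<in>H (P j) y. f \<cdot> t \<noteq> 0))"

lemma mult_span_eq_0:
  assumes "x \<in> cvs.span S" "a \<in> bounded_ops" "\<And>s. s \<in> S \<Longrightarrow> a \<cdot> s = 0"
  shows "a \<cdot> x = 0"
  using assms(1)
proof (induction rule: cvs.span_induct_alt)
  case (step c x y)
  then show ?case using assms(2,3) by (simp add: op_distribs op_scale_right)
qed simp

text \<open>Orthogonal nonzero idempotents are linearly independent. The bound allows a resolution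
  of maximal length to be chosen.\<close>

lemma resolution_bound:
  assumes p: "p \<in> ob" and res: "resolution p n e" and fin: "finite T" "H p p \<subseteq> cvs.span T"
  shows "n \<le> card T"
proof -
  have orth: "e j \<cdot> e k = (if j = k then e j else 0)" if "j < n" "k < n" for j k
    using resolutionD[OF res] that by simp
  have eH: "e j \<in> H p p" "e j \<noteq> 0" if "j < n" for j
    using resolutionD[OF res] that by simp_all
  have inj: "inj_on e {..<n}"
  proof (rule inj_onI)
    fix j k assume jk: "j \<in> {..<n}" "k \<in> {..<n}" "e j = e k"
    show "j = k"
    proof (rule ccontr)
      assume "j \<noteq> k"
      then have "e j \<cdot> e j = 0" using orth[of j k] jk by simp
      then show False using orth[of j j] eH jk by simp
    qed
  qed
  have "cvs.independent (e ` {..<n})"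
    unfolding cvs.dependent_def
  proof clarsimp
    fix j assume j: "j < n" and sp: "e j \<in> cvs.span (e ` {..<n} - {e j})"
    have "e j \<cdot> e j = 0"
    proof (rule mult_span_eq_0[OF sp])
      show "e j \<in> bounded_ops" using H_bounded_ops[OF p p] eH j by blast
      show "e j \<cdot> s = 0" if "s \<in> e ` {..<n} - {e j}" for s
        using that orth[OF j] by auto
    qed
    then show False using orth[OF j j] eH[OF j] by simp
  qed
  moreover have "e ` {..<n} \<subseteq> cvs.span T" using eH(1) fin(2) by blast
  ultimately have "card (e ` {..<n}) \<le> card T"
    using cvs.independent_span_bound[OF fin(1)] by blast
  then show ?thesis using inj by (simp add: card_image)
qed

end

locale regular_opcat = opcat ob H I for ob :: "'p set" and H :: "'p \<Rightarrow> 'p \<Rightarrow> ('h::complex_hilbert_space \<Rightarrow>\<^sub>L 'h) set" and I +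
  assumes regular: "\<lbrakk>p \<in> ob; q \<in> ob; t \<in> H p q\<rbrakk> \<Longrightarrow> \<exists>g \<in> H q p. t \<cdot> (g \<cdot> t) = t"
begin

text \<open>For a non-scalar \<open>f\<close> in the corner of \<open>e\<close>, an eigenvalue
  \<open>c\<close> makes \<open>f' = f - c e\<close> a nonzero zero divisor. A quasi-inverse
  \<open>g\<close> of it gives the idempotent \<open>a = e g f'\<close>: nonzero because
  \<open>f' a = f'\<close>, and different from \<open>e\<close> because it kills the eigenvector
  \<open>q\<close>.\<close>

lemma idempotent_split:
  assumes p: "p \<in> ob" and fin: "finite T" "H p p \<subseteq> cvs.span T"
    and e: "e \<in> H p p" "e \<cdot> e = e" "e \<noteq> 0" and nb: "\<not> brick p e"
  shows "\<exists>a \<in> H p p. a \<cdot> a = a \<and> a \<noteq> 0 \<and> a \<noteq> e \<and> e \<cdot> a = a \<and> a \<cdot> e = a"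
proof -
  define V where "V = {t \<in> H p p. e \<cdot> t = t \<and> t \<cdot> e = t}"
  have eb: "e \<in> bounded_ops" using H_bounded_ops[OF p p e(1)] .
  have sub: "cvs.subspace V" unfolding V_def cvs.subspace_def
    using H_0 H_add H_scale p by (auto simp: op_distribs op_scale_left op_scale_right[OF eb])
  from nb e obtain t where t: "t \<in> H p p" "\<And>c. e \<cdot> (t \<cdot> e) \<noteq> op_scale c e"
    unfolding brick_def by blast
  define f where "f = e \<cdot> (t \<cdot> e)"
  have ee: "e \<cdot> (e \<cdot> x) = e \<cdot> x" for x using e(2) by (metis op_assoc)
  have fV: "f \<in> V" unfolding V_def f_def
    using H_mult[OF p p p] t(1) e by (simp add: op_assoc ee)
  have eV: "e \<in> V" unfolding V_def using e by simp
  have "\<exists>c. \<exists>q \<in> V. q \<noteq> 0 \<and> f \<cdot> q = op_scale c q"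
  proof (rule eigenvector_exists[OF sub _ _ fin(1) _ eV e(3) fV])
    show "V \<subseteq> bounded_ops" unfolding V_def using H_bounded_ops[OF p p] by blast
    show "s \<cdot> t \<in> V" if "s \<in> V" "t \<in> V" for s t
      using that H_mult[OF p p p] unfolding V_def by (auto simp: op_assoc) (metis op_assoc)
    show "V \<subseteq> cvs.span T" unfolding V_def using fin(2) by blast
  qed
  then obtain c q where q: "q \<in> V" "q \<noteq> 0" "f \<cdot> q = op_scale c q" by blast
  define f' where "f' = f - op_scale c e"
  have f': "f' \<in> H p p" "f' \<noteq> 0" "e \<cdot> f' = f'" "f' \<cdot> e = f'"
    using fV e H_diff H_scale p t(2)[of c] unfolding f'_def V_def f_def[symmetric]
    by (auto simp: op_distribs op_scale_left op_scale_right[OF eb])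
  have f'q: "f' \<cdot> q = 0" using q unfolding f'_def V_def by (simp add: op_distribs op_scale_left)
  obtain g where g: "g \<in> H p p" "f' \<cdot> (g \<cdot> f') = f'" using regular[OF p p f'(1)] by blast
  define a where "a = e \<cdot> (g \<cdot> f')"
  have f'e: "f' \<cdot> (e \<cdot> x) = f' \<cdot> x" for x using f'(4) by (metis op_assoc)
  have aa: "a \<cdot> a = a" unfolding a_def by (simp add: op_assoc f'e g(2))
  have "f' \<cdot> a = f'" unfolding a_def using f'e g(2) by simp
  then have a0: "a \<noteq> 0" using f'(2) by auto
  have "a \<cdot> q = 0" unfolding a_def by (simp add: op_assoc f'q)
  then have ae: "a \<noteq> e" using q unfolding V_def by auto
  have "a \<in> H p p" unfolding a_def using H_mult[OF p p p] e(1) g(1) f'(1) by blast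
  moreover have "e \<cdot> a = a" "a \<cdot> e = a" unfolding a_def by (simp_all add: ee op_assoc f'(4))
  ultimately show ?thesis using aa a0 ae by blast
qed

text \<open>In a resolution of maximal length every member is a brick, since any other member could
  be split into two.\<close>

lemma brick_resolution:
  assumes p: "p \<in> ob" and fin: "cdim (H p p) d"
  shows "\<exists>n e. resolution p n e \<and> (\<forall>j<n. brick p (e j))"
proof -
  obtain T where T: "finite T" "H p p \<subseteq> cvs.span T" using fin unfolding cdim_def by blast
  have "\<exists>n e. resolution p n e"
  \<comment> \<open>Members of a resolution are nonzero, so the zero object has only the empty
    one.\<close>
  proof (cases "I p = 0")
    case True
    then have "resolution p 0 (\<lambda>_. 0)" by (simp add: resolution_def)
    then show ?thesis by blast
  next
    case False
    then have "resolution p 1 (\<lambda>_. I p)" using I_H[OF p] I_left[OF p p] by (simp add: resolution_def)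
    then show ?thesis by blast
  qed
  then obtain n where n: "\<exists>e. resolution p n e" and mx: "\<And>m. \<exists>e. resolution p m e \<Longrightarrow> m \<le> n"
    using Greatest_le_nat[of "\<lambda>n. \<exists>e. resolution p n e" _ "card T"]
      GreatestI_ex_nat[of "\<lambda>n. \<exists>e. resolution p n e" "card T"] resolution_bound[OF p _ T] by metis
  then obtain e where e: "resolution p n e" by blast
  have orth: "e j \<cdot> e k = (if j = k then e j else 0)" if "j < n" "k < n" for j k
    using resolutionD[OF e] that by simp
  have eH: "e j \<in> H p p" "e j \<noteq> 0" if "j < n" for j
    using resolutionD[OF e] that by simp_all
  have "brick p (e j)" if j: "j < n" for j
  proof (rule ccontr)
    assume nb: "\<not> brick p (e j)"
    have "e j \<cdot> e j = e j" using orth[OF j j] by simp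
    from idempotent_split[OF p T eH(1)[OF j] this eH(2)[OF j] nb] obtain a where
      a: "a \<in> H p p" "a \<cdot> a = a" "a \<noteq> 0" "a \<noteq> e j" "e j \<cdot> a = a" "a \<cdot> e j = a" by blast
    \<comment> \<open>\<open>a\<close> takes the place of \<open>e j\<close>, and the complement
      \<open>e j - a\<close> is appended at the new position \<open>n\<close>.\<close>
    define e' where "e' = e(j := a, n := e j - a)"
    have e': "e' j = a" "e' n = e j - a" "\<And>k. k < n \<Longrightarrow> k \<noteq> j \<Longrightarrow> e' k = e k"
      using j unfolding e'_def by auto
    have a0: "a \<cdot> e k = 0" "e k \<cdot> a = 0" if "k < n" "k \<noteq> j" for k
    proof -
      have "a \<cdot> (e j \<cdot> e k) = 0" "(e k \<cdot> e j) \<cdot> a = 0" using orth that j by simp_all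
      then show "a \<cdot> e k = 0" "e k \<cdot> a = 0" using a(5,6) by (simp_all add: op_assoc) (metis op_assoc)
    qed
    have "resolution p (Suc n) e'" unfolding resolution_def
    proof (intro conjI allI impI)
      fix k assume "k < Suc n"
      then consider "k = n" | "k = j" | "k < n" "k \<noteq> j" by linarith
      then show "e' k \<in> H p p" "e' k \<noteq> 0" using e' a eH j H_diff p by (cases; auto)+
    next
      fix k l assume kl: "k < Suc n" "l < Suc n"
      have n: "e' n \<cdot> e' l = (if n = l then e' n else 0)" if "l < Suc n" for l
      proof -
        consider "l = n" | "l = j" | "l < n" "l \<noteq> j" using \<open>l < Suc n\<close> by linarith
        then show ?thesis using e' a orth[OF j] j a0(1)[of l] by cases (simp_all add: op_distribs)
      qed
      have a': "e' j \<cdot> e' l = (if j = l then e' j else 0)" if "l < Suc n" for l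
      proof -
        consider "l = n" | "l = j" | "l < n" "l \<noteq> j" using \<open>l < Suc n\<close> by linarith
        then show ?thesis using e' a j a0(1)[of l] by cases (simp_all add: op_distribs)
      qed
      have k': "e' k \<cdot> e' l = (if k = l then e' k else 0)" if "k < n" "k \<noteq> j" "l < Suc n"
      proof -
        consider "l = n" | "l = j" | "l < n" "l \<noteq> j" using \<open>l < Suc n\<close> by linarith
        then show ?thesis using e' a j a0(2)[of k] orth[of k] that by cases (simp_all add: op_distribs)
      qed
      show "e' k \<cdot> e' l = (if k = l then e' k else 0)"
        using n a' k' kl by (cases "k = n"; cases "k = j") auto
    next
      have "(\<Sum>k<n. e' k) = (\<Sum>k\<in>{..<n}-{j}. e k) + a"
        using j e' by (simp add: sum.remove[of _ j])
      moreover have "I p = (\<Sum>k\<in>{..<n}-{j}. e k) + e j"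
        using e j unfolding resolution_def by (simp add: sum.remove[of _ j] add.commute)
      ultimately show "(\<Sum>k<Suc n. e' k) = I p" using e' by simp
    qed
    then show False using mx[of "Suc n"] by auto
  qed
  then show ?thesis using e by blast
qed

text \<open>Schur's lemma. With \<open>u = b t a\<close> and a quasi-inverse \<open>g\<close> of
  \<open>u\<close>, the products \<open>a g u\<close> and \<open>u g b\<close> are scalars in the
  two corners, and \<open>u g u = u\<close> forces both scalars to be 1. Comparing another
  \<open>t'\<close> with \<open>t\<close> through \<open>g\<close> lands in the corner of
  \<open>a\<close> and so yields a multiple of \<open>u\<close>.\<close>

lemma brick_schur:
  assumes pq: "p \<in> ob" "q \<in> ob" and a: "brick p a" and b: "brick q b"
    and t: "t \<in> H p q" "b \<cdot> (t \<cdot> a) \<noteq> 0"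
  shows "\<exists>s \<in> H q p. a \<cdot> (s \<cdot> (b \<cdot> (t \<cdot> a))) = a \<and> b \<cdot> (t \<cdot> (a \<cdot> (s \<cdot> b))) = b"
    and "t' \<in> H p q \<Longrightarrow> \<exists>c. b \<cdot> (t' \<cdot> a) = op_scale c (b \<cdot> (t \<cdot> a))"
proof -
  have aH: "a \<in> H p p" and aa: "a \<cdot> (a \<cdot> x) = a \<cdot> x" and a2: "a \<cdot> a = a" for x
    using a unfolding brick_def by (metis op_assoc)+
  have bH: "b \<in> H q q" and bb: "b \<cdot> (b \<cdot> x) = b \<cdot> x" and b2: "b \<cdot> b = b" for x
    using b unfolding brick_def by (metis op_assoc)+
  define u where "u = b \<cdot> (t \<cdot> a)"
  have uH: "u \<in> H p q" unfolding u_def using H_mult pq aH bH t(1) by metis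
  obtain g where g: "g \<in> H q p" "u \<cdot> (g \<cdot> u) = u" using regular[OF pq uH] by blast
  have ub: "u \<in> bounded_ops" using H_bounded_ops[OF pq uH] .
  have ua: "u \<cdot> a = u" "u \<cdot> (a \<cdot> x) = u \<cdot> x" and bu: "b \<cdot> u = u" "b \<cdot> (u \<cdot> x) = u \<cdot> x" for x
    unfolding u_def by (simp_all add: op_assoc aa a2 bb b2)
  have "g \<cdot> u \<in> H p p" using H_mult pq g(1) uH by metis
  then obtain c where "a \<cdot> ((g \<cdot> u) \<cdot> a) = op_scale c a" using a unfolding brick_def by blast
  then have c: "a \<cdot> (g \<cdot> u) = op_scale c a" by (simp add: op_assoc ua)
  have "u \<cdot> (a \<cdot> (g \<cdot> u)) = u" using g(2) ua by simp
  then have "op_scale c u = op_scale 1 u" using c by (simp add: op_scale_right[OF ub] ua)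
  then have "c = 1" using t(2) u_def by (simp only: cvs.scale_cancel_right) simp
  then have agu: "a \<cdot> (g \<cdot> u) = a" using c by simp
  have "u \<cdot> g \<in> H q q" using H_mult pq g(1) uH by metis
  then obtain d where "b \<cdot> ((u \<cdot> g) \<cdot> b) = op_scale d b" using b unfolding brick_def by blast
  then have d: "u \<cdot> (g \<cdot> b) = op_scale d b" by (simp add: op_assoc bu)
  have "u \<cdot> (g \<cdot> (b \<cdot> u)) = op_scale d (b \<cdot> u)" using d by (metis op_assoc op_scale_left)
  then have "op_scale d u = op_scale 1 u" using g(2) bu by simp
  then have "d = 1" using t(2) u_def by (simp only: cvs.scale_cancel_right) simp
  then have ugb: "u \<cdot> (g \<cdot> b) = b" using d by simp
  show "\<exists>s \<in> H q p. a \<cdot> (s \<cdot> (b \<cdot> (t \<cdot> a))) = a \<and> b \<cdot> (t \<cdot> (a \<cdot> (s \<cdot> b))) = b"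
    using g(1) agu ugb by (intro bexI[of _ g]) (simp_all add: u_def op_assoc)
  show "\<exists>c. b \<cdot> (t' \<cdot> a) = op_scale c (b \<cdot> (t \<cdot> a))" if t': "t' \<in> H p q"
  proof -
    have "g \<cdot> (b \<cdot> t') \<in> H p p" using H_mult pq g(1) bH t' by metis
    then obtain k where k: "a \<cdot> ((g \<cdot> (b \<cdot> t')) \<cdot> a) = op_scale k a" using a unfolding brick_def by blast
    have "b \<cdot> (t' \<cdot> a) = (u \<cdot> (g \<cdot> b)) \<cdot> (b \<cdot> (t' \<cdot> a))" using ugb by (simp add: bb)
    also have "\<dots> = u \<cdot> (a \<cdot> ((g \<cdot> (b \<cdot> t')) \<cdot> a))" by (simp add: op_assoc ua bb)
    also have "\<dots> = op_scale k u" unfolding k by (simp add: op_scale_right[OF ub] ua)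
    finally show ?thesis unfolding u_def by blast
  qed
qed

text \<open>By \<open>brick_schur\<close> this means that the two bricks have isomorphic images. The
  equivalence classes of this relation stand for isomorphism classes of simple objects.\<close>

definition linked :: "'p \<times> ('h \<Rightarrow>\<^sub>L 'h) \<Rightarrow> 'p \<times> ('h \<Rightarrow>\<^sub>L 'h) \<Rightarrow> bool" where
  "linked = (\<lambda>(p, a) (q, b). \<exists>t \<in> H p q. b \<cdot> (t \<cdot> a) \<noteq> 0)"

lemma linked_refl: "brick p a \<Longrightarrow> linked (p, a) (p, a)"
  unfolding linked_def brick_def by force

lemma linked_sym:
  assumes "p \<in> ob" "q \<in> ob" "brick p a" "brick q b" "linked (p, a) (q, b)"
  shows "linked (q, b) (p, a)"
proof -
  obtain t where t: "t \<in> H p q" "b \<cdot> (t \<cdot> a) \<noteq> 0" using assms(5) unfolding linked_def by auto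
  from brick_schur(1)[OF assms(1-4) t] obtain s where s: "s \<in> H q p" "a \<cdot> (s \<cdot> (b \<cdot> (t \<cdot> a))) = a" by blast
  have "a \<cdot> (s \<cdot> b) \<noteq> 0"
  proof
    assume "a \<cdot> (s \<cdot> b) = 0"
    then have "(a \<cdot> (s \<cdot> b)) \<cdot> (t \<cdot> a) = 0" by simp
    then show False using s(2) assms(3) unfolding brick_def by (simp add: op_assoc)
  qed
  then show ?thesis using s(1) unfolding linked_def by auto
qed

text \<open>The arrow \<open>t' b t\<close> works: \<open>b t a\<close> is invertible between the
  corners, so composing with its inverse gives back \<open>t' b\<close>, which \<open>c\<close> does
  not annihilate.\<close>

lemma linked_trans:
  assumes "p \<in> ob" "q \<in> ob" "r \<in> ob" "brick p a" "brick q b" "brick r c"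
    and "linked (p, a) (q, b)" "linked (q, b) (r, c)"
  shows "linked (p, a) (r, c)"
proof -
  obtain t where t: "t \<in> H p q" "b \<cdot> (t \<cdot> a) \<noteq> 0" using assms(7) unfolding linked_def by auto
  obtain t' where t': "t' \<in> H q r" "c \<cdot> (t' \<cdot> b) \<noteq> 0" using assms(8) unfolding linked_def by auto
  from brick_schur(1)[OF assms(1,2,4,5) t] obtain s where
    s: "s \<in> H q p" "b \<cdot> (t \<cdot> (a \<cdot> (s \<cdot> b))) = b" by blast
  have "t' \<cdot> (b \<cdot> t) \<in> H p r" using assms(1-5) t t' H_mult unfolding brick_def by metis
  moreover have "c \<cdot> ((t' \<cdot> (b \<cdot> t)) \<cdot> a) \<noteq> 0"
  proof
    assume "c \<cdot> ((t' \<cdot> (b \<cdot> t)) \<cdot> a) = 0"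
    then have "(c \<cdot> ((t' \<cdot> (b \<cdot> t)) \<cdot> a)) \<cdot> (s \<cdot> b) = 0" by simp
    then have "c \<cdot> (t' \<cdot> (b \<cdot> (t \<cdot> (a \<cdot> (s \<cdot> b))))) = 0" by (simp add: op_assoc)
    then show False using s(2) t'(2) by simp
  qed
  ultimately show ?thesis unfolding linked_def by auto
qed

text \<open>The two resolutions cut an arrow into blocks \<open>b k (t a j)\<close>. A block is zero
  unless the bricks are linked, and is then a multiple of a fixed one, so the linked pairs index a
  basis.\<close>

lemma cdim_resolution:
  assumes pq: "p \<in> ob" "q \<in> ob"
    and m: "resolution p m a" "\<And>j. j < m \<Longrightarrow> brick p (a j)"
    and n: "resolution q n b" "\<And>j. j < n \<Longrightarrow> brick q (b j)"
  shows "cdim (H p q) (card {(j, k). j < m \<and> k < n \<and> linked (p, a j) (q, b k)})"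
proof -
  define L where "L = {(j, k). j < m \<and> k < n \<and> linked (p, a j) (q, b k)}"
  have L: "j < m" "k < n" "linked (p, a j) (q, b k)" if "(j, k) \<in> L" for j k
    using that unfolding L_def by auto
  have "L \<subseteq> {..<m} \<times> {..<n}" unfolding L_def by auto
  then have finL: "finite L" by (rule finite_subset) auto
  define t where "t = (\<lambda>(j, k). SOME t. t \<in> H p q \<and> b k \<cdot> (t \<cdot> a j) \<noteq> 0)"
  have "t (j, k) \<in> H p q \<and> b k \<cdot> (t (j, k) \<cdot> a j) \<noteq> 0" if "(j, k) \<in> L" for j k
    unfolding t_def prod.case using L(3)[OF that] unfolding linked_def prod.case
    by (intro someI_ex[of "\<lambda>t. t \<in> H p q \<and> b k \<cdot> (t \<cdot> a j) \<noteq> 0"]) blast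
  then have t: "\<And>j k. (j, k) \<in> L \<Longrightarrow> t (j, k) \<in> H p q"
      "\<And>j k. (j, k) \<in> L \<Longrightarrow> b k \<cdot> (t (j, k) \<cdot> a j) \<noteq> 0" by simp_all
  have ao: "a j \<cdot> a k = (if j = k then a j else 0)" "a j \<in> H p p" if "j < m" "k < m" for j k
    using resolutionD[OF m(1)] that by simp_all
  have bo: "b j \<cdot> b k = (if j = k then b j else 0)" "b j \<in> H q q" if "j < n" "k < n" for j k
    using resolutionD[OF n(1)] that by simp_all
  define u where "u = (\<lambda>(j, k). b k \<cdot> (t (j, k) \<cdot> a j))"
  have uH: "u (j, k) \<in> H p q" if "(j, k) \<in> L" for j k
    unfolding u_def prod.case
    by (rule H_mult[OF pq(1,2,2) bo(2) H_mult[OF pq(1,1,2) t(1)[OF that] ao(2)]]) (use L[OF that] in auto)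
  have u0: "u (j, k) \<noteq> 0" if "(j, k) \<in> L" for j k
    using t(2)[OF that] unfolding u_def by simp
  have ub: "b k' \<cdot> (u (j, k) \<cdot> a j') = (if (j', k') = (j, k) then u (j, k) else 0)"
    if "(j, k) \<in> L" "j' < m" "k' < n" for j k j' k'
  proof -
    have "b k' \<cdot> (u (j, k) \<cdot> a j') = (b k' \<cdot> b k) \<cdot> (t (j, k) \<cdot> (a j \<cdot> a j'))"
      unfolding u_def by (simp add: op_assoc)
    then show ?thesis using ao(1)[of j j'] bo(1)[of k' k] that L[OF that(1)] unfolding u_def by auto
  qed
  have inj: "inj_on u L"
  proof (rule inj_onI)
    fix x y assume x: "x \<in> L" and y: "y \<in> L" and xy: "u x = u y"
    obtain j k where x': "x = (j, k)" by (cases x)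
    obtain j' k' where y': "y = (j', k')" by (cases y)
    show "x = y"
      using ub[of j k j k] ub[of j' k' j k] u0[of j k] L[of j k] x y xy unfolding x' y'
      by (auto split: if_splits)
  qed
  have "cvs.independent (u ` L)" unfolding cvs.dependent_def
  proof clarify
    fix j k assume jk: "(j, k) \<in> L" and sp: "u (j, k) \<in> cvs.span (u ` L - {u (j, k)})"
    have "b k \<cdot> (x \<cdot> a j) = 0" if "x \<in> cvs.span (u ` L - {u (j, k)})" for x
      using that
    proof (induction rule: cvs.span_induct_alt)
      case (step c x y)
      from step(1) obtain j' k' where x: "x = u (j', k')" "(j', k') \<in> L" "(j', k') \<noteq> (j, k)" by auto
      have "b k \<in> bounded_ops" using H_bounded_ops[OF pq(2,2)] bo(2) L[OF jk] by blast
      moreover have "b k \<cdot> (x \<cdot> a j) = 0" using ub[OF x(2), of j k] L[OF jk] x by auto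
      ultimately show ?case using step(2) by (simp add: op_distribs op_scale_left op_scale_right)
    qed simp
    from this[OF sp] show False using ub[OF jk, of j k] L[OF jk] u0[OF jk] by simp
  qed
  moreover have "cvs.span (u ` L) = H p q"
  proof
    show "cvs.span (u ` L) \<subseteq> H p q"
      by (rule cvs.span_minimal[OF _ subspace_H[OF pq]]) (use uH in auto)
    show "H p q \<subseteq> cvs.span (u ` L)"
    proof
      fix x assume x: "x \<in> H p q"
      have bxa: "b k \<cdot> (x \<cdot> a j) \<in> cvs.span (u ` L)" if "j < m" "k < n" for j k
      proof (cases "(j, k) \<in> L")
        case True
        from brick_schur(2)[OF pq m(2)[OF that(1)] n(2)[OF that(2)] t[OF True] x] obtain c where
          "b k \<cdot> (x \<cdot> a j) = op_scale c (u (j, k))" unfolding u_def by auto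
        then show ?thesis using True by (simp add: cvs.span_scale cvs.span_base)
      next
        case False
        then have "b k \<cdot> (x \<cdot> a j) = 0" using x that unfolding L_def linked_def by auto
        then show ?thesis by (simp add: cvs.span_zero)
      qed
      have "x = (\<Sum>k<n. b k) \<cdot> (x \<cdot> (\<Sum>j<m. a j))"
        using m(1) n(1) I_left I_right pq x unfolding resolution_def by simp
      also have "\<dots> = (\<Sum>k<n. \<Sum>j<m. b k \<cdot> (x \<cdot> a j))"
        by (simp add: blinfun_compose.sum_left blinfun_compose.sum_right) (rule sum.swap)
      also have "\<dots> \<in> cvs.span (u ` L)"
        by (intro cvs.span_sum) (use bxa in auto)
      finally show "x \<in> cvs.span (u ` L)" .
    qed
  qed
  ultimately show ?thesis unfolding cdim_def L_def[symmetric]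
    using finL inj by (intro exI[of _ "u ` L"]) (simp add: card_image)
qed

text \<open>\<open>S\<close> consists of the classes of linked bricks, a brick being named by the
  index of its object and its position there, and \<open>n i s\<close> counts the bricks of
  \<open>P i\<close> in \<open>s\<close>. A Hom space has one dimension per linked pair, whence the
  sum of products. Coverage is stated for every generating subfamily \<open>J\<close>, so that one
  \<open>S\<close> can serve two families at once.\<close>

theorem gram_decomposition:
  fixes P :: "'i \<Rightarrow> 'p"
  assumes A: "finite A" "\<And>i. i \<in> A \<Longrightarrow> P i \<in> ob" "\<And>i. i \<in> A \<Longrightarrow> \<exists>d. cdim (H (P i) (P i)) d"
  shows "\<exists>(S :: ('i \<times> nat) set set) n. finite S \<and>
     (\<forall>i\<in>A. \<forall>j\<in>A. cdim (H (P i) (P j)) (\<Sum>s\<in>S. n i s * n j s)) \<and>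
     (\<forall>J. J \<subseteq> A \<and> generating P J \<longrightarrow> (\<forall>s\<in>S. \<exists>j\<in>J. 0 < n j s))"
proof -
  have "\<exists>N e. resolution (P i) N e \<and> (\<forall>j<N. brick (P i) (e j))" if "i \<in> A" for i
    using A(2,3)[OF that] brick_resolution by blast
  then obtain N E where res: "\<And>i. i \<in> A \<Longrightarrow> resolution (P i) (N i) (E i)"
    and br: "\<And>i j. i \<in> A \<Longrightarrow> j < N i \<Longrightarrow> brick (P i) (E i j)" by metis
  define X where "X = (SIGMA i:A. {..<N i})"
  define R where "R = {((i, j), (i', j')). (i, j) \<in> X \<and> (i', j') \<in> X \<and> linked (P i, E i j) (P i', E i' j')}"
  have finX: "finite X" unfolding X_def using A(1) by auto
  have eq: "equiv X R"
  proof (rule equivI)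
    show "R \<subseteq> X \<times> X" unfolding R_def by auto
    show "refl_on X R" unfolding R_def X_def using linked_refl br by (auto intro!: refl_onI)
    show "sym R" unfolding R_def X_def using linked_sym br A(2) by (auto intro!: symI)
    show "trans R" unfolding R_def X_def using linked_trans br A(2) by (auto intro!: transI) blast
  qed
  define S where "S = X // R"
  have finS: "finite S" unfolding S_def by (rule finite_quotient[OF finX]) (auto simp: R_def)
  define n where "n i s = card {j. (i, j) \<in> s}" for i and s :: "('i \<times> nat) set"
  have sX: "s \<subseteq> X" if "s \<in> S" for s
    using that unfolding S_def by (rule in_quotient_imp_subset[OF eq])
  have "cdim (H (P i) (P j)) (\<Sum>s\<in>S. n i s * n j s)" if ij: "i \<in> A" "j \<in> A" for i j
  proof -
    let ?B = "\<lambda>s. {k. (i, k) \<in> s} \<times> {l. (j, l) \<in> s}"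
    have "{(k, l). k < N i \<and> l < N j \<and> linked (P i, E i k) (P j, E j l)} = (\<Union>s\<in>S. ?B s)"
    proof safe
      fix k l assume kl: "k < N i" "l < N j" "linked (P i, E i k) (P j, E j l)"
      have "R `` {(i, k)} \<in> S" unfolding S_def using kl ij by (auto intro!: quotientI simp: X_def)
      moreover have "(i, k) \<in> R `` {(i, k)}" "(j, l) \<in> R `` {(i, k)}"
        using kl ij linked_refl br unfolding R_def X_def by auto
      ultimately show "(k, l) \<in> (\<Union>s\<in>S. ?B s)" by blast
    next
      fix s k l assume s: "s \<in> S" "(i, k) \<in> s" "(j, l) \<in> s"
      then show "k < N i" "l < N j" using sX[OF s(1)] unfolding X_def by auto
      have "((i, k), (j, l)) \<in> R" using quotient_eq_iff[OF eq] s unfolding S_def by blast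
      then show "linked (P i, E i k) (P j, E j l)" unfolding R_def by auto
    qed
    moreover have "card (\<Union>s\<in>S. ?B s) = (\<Sum>s\<in>S. card (?B s))"
    proof (rule card_UN_disjoint[OF finS])
      have "{k. (i, k) \<in> s} \<subseteq> {..<N i}" "{l. (j, l) \<in> s} \<subseteq> {..<N j}" if "s \<in> S" for s
        using sX[OF that] unfolding X_def by auto
      then show "\<forall>s\<in>S. finite (?B s)" by (meson finite_SigmaI finite_lessThan finite_subset)
      show "\<forall>s\<in>S. \<forall>s'\<in>S. s \<noteq> s' \<longrightarrow> ?B s \<inter> ?B s' = {}"
        using quotient_disj[OF eq] unfolding S_def by fast
    qed
    ultimately show ?thesis
      using cdim_resolution[OF A(2)[OF ij(1)] A(2)[OF ij(2)] res[OF ij(1)] br[OF ij(1)] res[OF ij(2)] br[OF ij(2)]]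
      by (simp add: n_def card_cartesian_product)
  qed
  moreover have "\<exists>j\<in>J. 0 < n j s" if J: "J \<subseteq> A" "generating P J" and s: "s \<in> S" for J s
  proof -
    obtain i k where ik: "(i, k) \<in> s" "(i, k) \<in> X"
      using s sX[OF s] in_quotient_imp_non_empty[OF eq] unfolding S_def by fast
    have i: "i \<in> A" "k < N i" using ik(2) unfolding X_def by auto
    have e: "E i k \<in> H (P i) (P i)" "E i k \<noteq> 0" using br[OF i] unfolding brick_def by auto
    then obtain j t where j: "j \<in> J" "t \<in> H (P j) (P i)" "E i k \<cdot> t \<noteq> 0"
      using J(2) A(2)[OF i(1)] unfolding generating_def by blast
    have jA: "j \<in> A" using j(1) J(1) by blast
    \<comment> \<open>Inserting the resolution of \<open>P j\<close> finds a brick of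
      \<open>P j\<close> linked to the given one.\<close>
    have "E i k \<cdot> t = E i k \<cdot> (t \<cdot> (\<Sum>l<N j. E j l))"
      using res[OF jA] I_right[OF A(2)[OF jA] A(2)[OF i(1)] j(2)] unfolding resolution_def by simp
    also have "\<dots> = (\<Sum>l<N j. E i k \<cdot> (t \<cdot> E j l))" by (simp add: blinfun_compose.sum_right)
    finally obtain l where l: "l < N j" "E i k \<cdot> (t \<cdot> E j l) \<noteq> 0"
      using j(3) by (metis (no_types, lifting) lessThan_iff sum.neutral)
    then have "((j, l), (i, k)) \<in> R" unfolding R_def X_def linked_def using jA j(2) i by auto
    then have "(j, l) \<in> s"
      using in_quotient_imp_closed[OF eq s[unfolded S_def] ik(1)] eq by (meson equiv_def symD)
    moreover have "finite {l. (j, l) \<in> s}"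
      using sX[OF s] unfolding X_def by (auto intro: finite_subset[of _ "{..<N j}"])
    ultimately have "0 < n j s" unfolding n_def by (auto simp: card_gt_0_iff)
    then show ?thesis using j(1) by blast
  qed
  ultimately show ?thesis using finS by blast
qed

end

section \<open>Intertwiners and direct sum decompositions\<close>

lemma op_reassoc: "a \<cdot> b = c \<Longrightarrow> a \<cdot> (b \<cdot> s) = c \<cdot> s"
  by (simp add: op_assoc[symmetric])

locale vN_algebra =
  fixes M :: "('h::complex_hilbert_space \<Rightarrow>\<^sub>L 'h) set"
  assumes vN: "von_neumann_algebra M"
begin

lemma M_bounded_ops: "t \<in> M \<Longrightarrow> t \<in> bounded_ops"
  using vN unfolding von_neumann_algebra_def by blast

lemma M_iff: "t \<in> M \<longleftrightarrow> t \<in> bounded_ops \<and> (\<forall>s \<in> commutant M. t \<cdot> s = s \<cdot> t)"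
  using vN unfolding von_neumann_algebra_def commutant_def by blast

lemma commutant_bounded_ops: "s \<in> commutant M \<Longrightarrow> s \<in> bounded_ops"
  unfolding commutant_def by blast

lemma M_closed [simp, intro]:
  "0 \<in> M" "\<I> \<in> M" "s \<in> M \<Longrightarrow> t \<in> M \<Longrightarrow> s + t \<in> M" "s \<in> M \<Longrightarrow> t \<in> M \<Longrightarrow> s - t \<in> M"
  "s \<in> M \<Longrightarrow> t \<in> M \<Longrightarrow> s \<cdot> t \<in> M" "s \<in> M \<Longrightarrow> op_scale c s \<in> M" "s \<in> M \<Longrightarrow> op_adj s \<in> M"
proof -
  show "s \<cdot> t \<in> M" if "s \<in> M" "t \<in> M"
  proof -
    have "s \<cdot> (t \<cdot> r) = r \<cdot> (s \<cdot> t)" if "r \<in> commutant M" for r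
      using that \<open>s \<in> M\<close> \<open>t \<in> M\<close> op_reassoc[of s r "r \<cdot> s" t] unfolding M_iff by (simp add: op_assoc)
    then show ?thesis using that unfolding M_iff by (simp add: op_assoc)
  qed
  show "op_adj s \<in> M" if "s \<in> M"
    using vN that unfolding von_neumann_algebra_def by blast
qed (auto simp: M_iff op_distribs op_scale_left op_scale_right commutant_bounded_ops)

text \<open>\<open>emap\<close> includes the zero map, which \<open>End0\<close> adds as a zero object; so \<open>x \<I>\<close> may differ from \<open>\<I>\<close>.\<close>

definition emap :: "'h endo \<Rightarrow> bool" where
  "emap x \<longleftrightarrow> (\<forall>z. z \<notin> M \<longrightarrow> x z = 0) \<and> (\<forall>z \<in> M. x z \<in> M) \<and>
     (\<forall>z \<in> M. \<forall>w \<in> M. x (z + w) = x z + x w \<and> x (z \<cdot> w) = x z \<cdot> x w) \<and>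
     (\<forall>z \<in> M. \<forall>c. x (op_scale c z) = op_scale c (x z))"

lemma emap_outside: "emap x \<Longrightarrow> z \<notin> M \<Longrightarrow> x z = 0"
  and emap_M [simp]: "emap x \<Longrightarrow> z \<in> M \<Longrightarrow> x z \<in> M"
  and emap_add: "emap x \<Longrightarrow> z \<in> M \<Longrightarrow> w \<in> M \<Longrightarrow> x (z + w) = x z + x w"
  and emap_mult: "emap x \<Longrightarrow> z \<in> M \<Longrightarrow> w \<in> M \<Longrightarrow> x (z \<cdot> w) = x z \<cdot> x w"
  and emap_scale: "emap x \<Longrightarrow> z \<in> M \<Longrightarrow> x (op_scale c z) = op_scale c (x z)"
  unfolding emap_def by blast+

lemma emap_0 [simp]: "emap x \<Longrightarrow> x 0 = 0"
  using emap_scale[of x 0 0] by simp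

lemma emap_diff: "emap x \<Longrightarrow> z \<in> M \<Longrightarrow> w \<in> M \<Longrightarrow> x (z - w) = x z - x w"
  using emap_add[of x "z - w" w] by simp

lemma emap_sum: "emap x \<Longrightarrow> (\<And>j. j \<in> J \<Longrightarrow> z j \<in> M) \<Longrightarrow> x (\<Sum>j\<in>J. z j) = (\<Sum>j\<in>J. x (z j)) \<and> (\<Sum>j\<in>J. z j) \<in> M"
  by (induction J rule: infinite_finite_induct) (auto simp: emap_add)

lemma emap_comp: "emap x \<Longrightarrow> emap y \<Longrightarrow> emap (x \<circ> y)"
  unfolding emap_def[of "x \<circ> y"] by (simp add: emap_add emap_mult emap_scale emap_outside)

lemma emap_id_on: "emap (id_on M)"
  unfolding emap_def id_on_def by auto

lemma emap_zero: "emap (\<lambda>_. 0)"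
  unfolding emap_def by auto

definition intw :: "'h endo \<Rightarrow> 'h endo \<Rightarrow> ('h \<Rightarrow>\<^sub>L 'h) set" where
  "intw x y = {t \<in> M. y \<I> \<cdot> (t \<cdot> x \<I>) = t \<and> (\<forall>z \<in> M. t \<cdot> x z = y z \<cdot> t)}"

lemma intw_M: "t \<in> intw x y \<Longrightarrow> t \<in> M"
  unfolding intw_def by blast

lemma intw_nat: "t \<in> intw x y \<Longrightarrow> z \<in> M \<Longrightarrow> t \<cdot> x z = y z \<cdot> t"
  unfolding intw_def by blast

lemma intw_nat2: "t \<in> intw x y \<Longrightarrow> z \<in> M \<Longrightarrow> t \<cdot> (x z \<cdot> s) = y z \<cdot> (t \<cdot> s)"
  by (simp add: op_reassoc[OF intw_nat] op_assoc)

lemma emap_one_mult: "emap x \<Longrightarrow> z \<in> M \<Longrightarrow> x \<I> \<cdot> x z = x z" "emap x \<Longrightarrow> z \<in> M \<Longrightarrow> x z \<cdot> x \<I> = x z"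
  by (simp_all add: emap_mult[symmetric])

lemma emap_one_mult2: "emap x \<Longrightarrow> z \<in> M \<Longrightarrow> x \<I> \<cdot> (x z \<cdot> s) = x z \<cdot> s"
    "emap x \<Longrightarrow> z \<in> M \<Longrightarrow> x z \<cdot> (x \<I> \<cdot> s) = x z \<cdot> s"
  by (simp_all add: emap_mult[symmetric] op_assoc[symmetric])

lemma intw_sandwich: "t \<in> intw x y \<Longrightarrow> y \<I> \<cdot> (t \<cdot> x \<I>) = t"
  unfolding intw_def by blast

lemma intw_right:
  assumes "emap x" "t \<in> intw x y"
  shows "t \<cdot> x \<I> = t"
proof -
  have "t \<cdot> x \<I> = (y \<I> \<cdot> (t \<cdot> x \<I>)) \<cdot> x \<I>" using intw_sandwich[OF assms(2)] by simp
  also have "\<dots> = y \<I> \<cdot> (t \<cdot> x \<I>)" by (simp only: op_assoc emap_one_mult(1)[OF assms(1) M_closed(2)])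
  also have "\<dots> = t" by (rule intw_sandwich[OF assms(2)])
  finally show ?thesis .
qed

lemma intw_left:
  assumes "emap y" "t \<in> intw x y"
  shows "y \<I> \<cdot> t = t"
proof -
  have "y \<I> \<cdot> t = y \<I> \<cdot> (y \<I> \<cdot> (t \<cdot> x \<I>))" using intw_sandwich[OF assms(2)] by simp
  also have "\<dots> = y \<I> \<cdot> (t \<cdot> x \<I>)" by (simp only: emap_one_mult2(1)[OF assms(1) M_closed(2)])
  also have "\<dots> = t" by (rule intw_sandwich[OF assms(2)])
  finally show ?thesis .
qed

lemma intw_left2: "emap y \<Longrightarrow> t \<in> intw x y \<Longrightarrow> y \<I> \<cdot> (t \<cdot> s) = t \<cdot> s"
  and intw_right2: "emap x \<Longrightarrow> t \<in> intw x y \<Longrightarrow> t \<cdot> (x \<I> \<cdot> s) = t \<cdot> s"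
  by (simp_all add: op_reassoc[OF intw_left] op_reassoc[OF intw_right])

lemma intwI:
  assumes "t \<in> M" "y \<I> \<cdot> t = t" "t \<cdot> x \<I> = t" "\<And>z. z \<in> M \<Longrightarrow> t \<cdot> x z = y z \<cdot> t"
  shows "t \<in> intw x y"
  using assms unfolding intw_def by simp

lemma intw_id: "emap x \<Longrightarrow> x \<I> \<in> intw x x"
  by (rule intwI) (auto simp: emap_one_mult)

lemma intw_mult: "emap x \<Longrightarrow> emap z \<Longrightarrow> s \<in> intw y z \<Longrightarrow> t \<in> intw x y \<Longrightarrow> s \<cdot> t \<in> intw x z"
proof (rule intwI)
  assume a: "emap x" "emap z" "s \<in> intw y z" "t \<in> intw x y"
  show "s \<cdot> t \<in> M" using a intw_M by blast
  show "z \<I> \<cdot> (s \<cdot> t) = s \<cdot> t" using a by (simp add: intw_left2)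
  show "(s \<cdot> t) \<cdot> x \<I> = s \<cdot> t" using a by (simp add: intw_right op_assoc)
  show "(s \<cdot> t) \<cdot> x w = z w \<cdot> (s \<cdot> t)" if "w \<in> M" for w
    using a that by (simp add: op_assoc intw_nat intw_nat2)
qed

lemma subspace_intw: "emap y \<Longrightarrow> cvs.subspace (intw x y)"
  unfolding cvs.subspace_def
proof (intro conjI ballI allI)
  assume y: "emap y"
  show "0 \<in> intw x y" unfolding intw_def by simp
  fix s t c assume s: "s \<in> intw x y"
  have "op_scale c (y \<I> \<cdot> (s \<cdot> x \<I>)) = y \<I> \<cdot> (op_scale c s \<cdot> x \<I>)"
    using y by (simp add: op_scale_left op_scale_right M_bounded_ops)
  then show "op_scale c s \<in> intw x y"
    using s y unfolding intw_def by (auto simp: op_scale_left op_scale_right M_bounded_ops)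
  show "s + t \<in> intw x y" if t: "t \<in> intw x y"
  proof -
    have "y \<I> \<cdot> ((s + t) \<cdot> x \<I>) = s + t"
      using intw_sandwich[OF s] intw_sandwich[OF t] by (simp add: op_distribs)
    then show ?thesis using s t unfolding intw_def by (simp add: op_distribs)
  qed
qed

lemma intw_add: "emap y \<Longrightarrow> s \<in> intw x y \<Longrightarrow> t \<in> intw x y \<Longrightarrow> s + t \<in> intw x y"
  and intw_diff: "emap y \<Longrightarrow> s \<in> intw x y \<Longrightarrow> t \<in> intw x y \<Longrightarrow> s - t \<in> intw x y"
  and intw_scale: "emap y \<Longrightarrow> t \<in> intw x y \<Longrightarrow> op_scale c t \<in> intw x y"
  and intw_0: "0 \<in> intw x y"
  using subspace_intw cvs.subspace_add cvs.subspace_diff cvs.subspace_scale by (blast, blast, blast) (simp add: intw_def)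

text \<open>The operator of \<open>t\<close> tensored with the identity of \<open>y\<close>. If
  \<open>y \<I> = \<I>\<close>, it is \<open>t\<close> itself; the extra factor is there for the
  zero object.\<close>

lemma intw_whisker_right:
  assumes "emap x" "emap x'" "emap y" "t \<in> intw x x'"
  shows "t \<cdot> x (y \<I>) \<in> intw (x \<circ> y) (x' \<circ> y)"
proof (rule intwI)
  have yM: "y \<I> \<in> M" using assms by simp
  have nat: "t \<cdot> x z = x' z \<cdot> t" if "z \<in> M" for z using intw_nat[OF assms(4) that] .
  show "t \<cdot> x (y \<I>) \<in> M" using assms intw_M[OF assms(4)] by simp
  show "(x' \<circ> y) \<I> \<cdot> (t \<cdot> x (y \<I>)) = t \<cdot> x (y \<I>)"
    using assms yM by (simp add: nat) (simp add: emap_mult[symmetric] op_assoc[symmetric] emap_one_mult)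
  show "t \<cdot> x (y \<I>) \<cdot> (x \<circ> y) \<I> = t \<cdot> x (y \<I>)"
    using assms yM by (simp add: op_assoc emap_mult[symmetric] emap_one_mult)
  show "t \<cdot> x (y \<I>) \<cdot> (x \<circ> y) z = (x' \<circ> y) z \<cdot> (t \<cdot> x (y \<I>))" if "z \<in> M" for z
  proof -
    have "t \<cdot> x (y \<I>) \<cdot> x (y z) = t \<cdot> x (y z)"
      using assms that by (simp add: op_assoc emap_mult[symmetric] emap_one_mult)
    also have "\<dots> = t \<cdot> (x (y z) \<cdot> x (y \<I>))"
      using assms that by (simp add: emap_mult[symmetric] emap_one_mult)
    also have "\<dots> = x' (y z) \<cdot> (t \<cdot> x (y \<I>))" using assms that by (simp add: intw_nat2)
    finally show ?thesis by simp
  qed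
qed

lemma intw_whisker_left:
  assumes "emap x" "emap y" "emap y'" "t \<in> intw y y'"
  shows "x t \<in> intw (x \<circ> y) (x \<circ> y')"
  by (rule intwI) (use assms intw_M[OF assms(4)] in
    \<open>simp_all add: emap_mult[symmetric] intw_left intw_right intw_nat\<close>)

text \<open>\<open>dsum f X xs\<close>: the image of the idempotent \<open>f\<close> on \<open>X\<close> is the direct sum of \<open>xs\<close>.\<close>

fun dsum :: "('h \<Rightarrow>\<^sub>L 'h) \<Rightarrow> 'h endo \<Rightarrow> 'h endo list \<Rightarrow> bool" where
  "dsum f X [] \<longleftrightarrow> f = 0"
| "dsum f X (x # xs) \<longleftrightarrow> (\<exists>i \<in> intw x X. \<exists>p \<in> intw X x.
     p \<cdot> i = x \<I> \<and> f \<cdot> i = i \<and> p \<cdot> f = p \<and> dsum (f - i \<cdot> p) X xs)"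

declare dsum.simps(2) [simp del]

lemma dsum_ConsI:
  assumes "i \<in> intw x X" "p \<in> intw X x" "p \<cdot> i = x \<I>" "f \<cdot> i = i" "p \<cdot> f = p" "dsum (f - i \<cdot> p) X xs"
  shows "dsum f X (x # xs)"
  using assms unfolding dsum.simps by blast

lemma dsum_ConsE:
  assumes "dsum f X (x # xs)"
  obtains i p where "i \<in> intw x X" "p \<in> intw X x" "p \<cdot> i = x \<I>" "f \<cdot> i = i" "p \<cdot> f = p" "dsum (f - i \<cdot> p) X xs"
  using assms unfolding dsum.simps by blast

definition idem :: "'h endo \<Rightarrow> ('h \<Rightarrow>\<^sub>L 'h) \<Rightarrow> bool" where
  "idem X f \<longleftrightarrow> f \<in> intw X X \<and> f \<cdot> f = f"

lemma idem_one: "emap X \<Longrightarrow> idem X (X \<I>)"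
  unfolding idem_def by (simp add: intw_id emap_one_mult)

lemma idem_mult2: "idem X f \<Longrightarrow> f \<cdot> (f \<cdot> s) = f \<cdot> s"
  unfolding idem_def by (simp add: op_reassoc)

lemma idem_diff:
  assumes "emap X" "emap x" "idem X f" "i \<in> intw x X" "p \<in> intw X x" "p \<cdot> i = x \<I>" "f \<cdot> i = i" "p \<cdot> f = p"
  shows "idem X (f - i \<cdot> p)"
proof -
  have "p \<cdot> (i \<cdot> p) = p" "f \<cdot> (i \<cdot> p) = i \<cdot> p" using assms by (simp_all add: op_reassoc intw_left)
  then show ?thesis using assms unfolding idem_def
    by (simp add: intw_diff intw_mult op_distribs op_assoc)
qed

lemma dsum_append:
  assumes "emap X" "\<forall>x\<in>set xs. emap x" "idem X f" "idem X g" "f \<cdot> g = 0" "g \<cdot> f = 0"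
    and "dsum f X xs" "dsum g X ys"
  shows "dsum (f + g) X (xs @ ys)"
  using assms
proof (induction xs arbitrary: f)
  case (Cons x xs)
  obtain i p where ip: "i \<in> intw x X" "p \<in> intw X x" "p \<cdot> i = x \<I>" "f \<cdot> i = i" "p \<cdot> f = p"
    "dsum (f - i \<cdot> p) X xs"
    by (rule dsum_ConsE[of f X x xs]) (use Cons.prems in blast)+
  have "g \<cdot> (f \<cdot> i) = 0" "(p \<cdot> f) \<cdot> g = 0"
    using Cons.prems(5,6) by (simp_all add: op_assoc op_reassoc[of g f])
  then have 0: "g \<cdot> i = 0" "p \<cdot> g = 0" using ip by simp_all
  then have 1: "g \<cdot> (i \<cdot> p) = 0" by (simp add: op_reassoc)
  have "idem X (f - i \<cdot> p)" by (rule idem_diff[OF _ _ _ ip(1-5)]) (use Cons.prems in auto)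
  then have "dsum ((f - i \<cdot> p) + g) X (xs @ ys)"
    using Cons.prems ip(6) 0 1 by (intro Cons.IH) (simp_all add: op_distribs op_assoc)
  then have "dsum ((f + g) - i \<cdot> p) X (xs @ ys)" by (simp add: algebra_simps)
  then show ?case unfolding append_Cons using ip 0 by (intro dsum_ConsI[of i x X p]) (simp_all add: op_distribs)
qed simp

text \<open>\<open>j\<close> and \<open>q\<close> identify the image of \<open>f\<close> on
  \<open>Y\<close> with the image of \<open>j \<cdot> q\<close> on \<open>X\<close>. Each step of
  the induction replaces them by their restrictions to what is left after one summand is
  removed.\<close>

lemma dsum_transport:
  assumes "emap X" "emap Y" "\<forall>x\<in>set xs. emap x" "idem Y f" "j \<in> intw Y X" "q \<in> intw X Y" "q \<cdot> j = f"
    "j \<cdot> f = j" "f \<cdot> q = q" "dsum f Y xs"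
  shows "dsum (j \<cdot> q) X xs"
  using assms
proof (induction xs arbitrary: f j q)
  case Nil
  then show ?case by auto
next
  case (Cons x xs)
  obtain i p where ip: "i \<in> intw x Y" "p \<in> intw Y x" "p \<cdot> i = x \<I>" "f \<cdot> i = i" "p \<cdot> f = p"
    "dsum (f - i \<cdot> p) Y xs"
    by (rule dsum_ConsE[of f Y x xs]) (use Cons.prems in blast)+
  let ?g = "f - i \<cdot> p"
  have g: "idem Y ?g" by (rule idem_diff[OF _ _ _ ip(1-5)]) (use Cons.prems in auto)
  have qj: "q \<cdot> (j \<cdot> s) = f \<cdot> s" and jf: "j \<cdot> (f \<cdot> s) = j \<cdot> s" and ff: "f \<cdot> (f \<cdot> s) = f \<cdot> s"
    and fi: "f \<cdot> (i \<cdot> s) = i \<cdot> s" and pf: "p \<cdot> (f \<cdot> s) = p \<cdot> s" for s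
    using op_reassoc[OF Cons.prems(7)] op_reassoc[OF Cons.prems(8)] idem_mult2[OF Cons.prems(4)]
      op_reassoc[OF ip(4)] op_reassoc[OF ip(5)] by simp_all
  have gg: "?g \<cdot> ?g = ?g" using g unfolding idem_def by blast
  have "dsum ((j \<cdot> ?g) \<cdot> (?g \<cdot> q)) X xs"
  proof (rule Cons.IH[OF Cons.prems(1,2) _ g])
    show "j \<cdot> ?g \<in> intw Y X" "?g \<cdot> q \<in> intw X Y"
      using Cons.prems g unfolding idem_def by (auto intro: intw_mult)
    have "(?g \<cdot> q) \<cdot> (j \<cdot> ?g) = ?g \<cdot> (f \<cdot> ?g)" by (simp add: op_assoc qj)
    also have "f \<cdot> ?g = ?g" using Cons.prems(4) by (simp add: op_distribs idem_def fi)
    finally show "(?g \<cdot> q) \<cdot> (j \<cdot> ?g) = ?g" using gg by simp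
    show "(j \<cdot> ?g) \<cdot> ?g = j \<cdot> ?g" "?g \<cdot> (?g \<cdot> q) = ?g \<cdot> q" using gg by (simp_all only: op_assoc[symmetric]) (simp only: op_assoc gg)
  qed (use Cons.prems ip in simp_all)
  also have "(j \<cdot> ?g) \<cdot> (?g \<cdot> q) = j \<cdot> ((?g \<cdot> ?g) \<cdot> q)" by (simp only: op_assoc)
  also have "\<dots> = j \<cdot> q - (j \<cdot> i) \<cdot> (p \<cdot> q)"
    unfolding gg using Cons.prems by (simp add: op_distribs op_assoc)
  finally have "dsum (j \<cdot> q - (j \<cdot> i) \<cdot> (p \<cdot> q)) X xs" .
  moreover have "j \<cdot> i \<in> intw x X" "p \<cdot> q \<in> intw X x" using Cons.prems ip by (auto intro: intw_mult)
  moreover have "(p \<cdot> q) \<cdot> (j \<cdot> i) = x \<I>" "(j \<cdot> q) \<cdot> (j \<cdot> i) = j \<cdot> i" "(p \<cdot> q) \<cdot> (j \<cdot> q) = p \<cdot> q"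
    using ip Cons.prems(9) by (simp_all add: op_assoc qj jf pf)
  ultimately show ?case by (intro dsum_ConsI)
qed

text \<open>Each summand carries its decomposition into \<open>X\<close> by
  \<open>dsum_transport\<close>; the idempotents of different summands are orthogonal, so the lists
  can be appended.\<close>

lemma dsum_refine:
  assumes "emap X" "idem X f" "dsum f X (map F js)"
    "\<And>j. j \<in> set js \<Longrightarrow> emap (F j) \<and> (\<forall>y \<in> set (zs j). emap y) \<and> dsum (F j \<I>) (F j) (zs j)"
  shows "dsum f X (concat (map zs js))"
  using assms
proof (induction js arbitrary: f)
  case (Cons j js)
  let ?x = "F j"
  obtain i p where ip: "i \<in> intw ?x X" "p \<in> intw X ?x" "p \<cdot> i = ?x \<I>" "f \<cdot> i = i" "p \<cdot> f = p"
    "dsum (f - i \<cdot> p) X (map F js)"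
    by (rule dsum_ConsE[of f X ?x "map F js"]) (use Cons.prems in auto)
  have x: "emap ?x" "\<forall>y \<in> set (zs j). emap y" "dsum (?x \<I>) ?x (zs j)" using Cons.prems(4)[of j] by auto
  have g: "idem X (f - i \<cdot> p)" by (rule idem_diff[OF _ _ _ ip(1-5)]) (use Cons.prems x in auto)
  have xp: "?x \<I> \<cdot> p = p" "i \<cdot> ?x \<I> = i" using ip x intw_left intw_right by blast+
  have "dsum (i \<cdot> p) X (zs j)"
    using dsum_transport[OF Cons.prems(1) x(1,2) idem_one[OF x(1)] ip(1,2,3) _ _ x(3)] xp by blast
  moreover have "dsum (f - i \<cdot> p) X (concat (map zs js))"
    by (rule Cons.IH[OF Cons.prems(1) g ip(6)]) (use Cons.prems(4) in auto)
  moreover have pip: "p \<cdot> (i \<cdot> p) = p" using op_reassoc[OF ip(3)] xp by simp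
  moreover have "idem X (i \<cdot> p)" unfolding idem_def using pip ip Cons.prems by (simp add: intw_mult op_assoc)
  ultimately have "dsum (i \<cdot> p + (f - i \<cdot> p)) X (zs j @ concat (map zs js))"
    using g x ip Cons.prems(1) by (intro dsum_append) (simp_all add: op_distribs op_assoc op_reassoc[OF ip(4)])
  then show ?case by simp
qed simp

lemma dsum_whisker_left:
  assumes "emap X" "emap Y" "\<forall>y\<in>set ys. emap y" "f \<in> M" "dsum f Y ys"
  shows "dsum (X f) (X \<circ> Y) (map (\<lambda>y. X \<circ> y) ys)"
  using assms
proof (induction ys arbitrary: f)
  case (Cons y ys)
  obtain i p where ip: "i \<in> intw y Y" "p \<in> intw Y y" "p \<cdot> i = y \<I>" "f \<cdot> i = i" "p \<cdot> f = p"
    "dsum (f - i \<cdot> p) Y ys"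
    by (rule dsum_ConsE[of f Y y ys]) (use Cons.prems in blast)+
  have iM: "i \<in> M" "p \<in> M" using ip intw_M by blast+
  have "dsum (X (f - i \<cdot> p)) (X \<circ> Y) (map (\<lambda>y. X \<circ> y) ys)"
    by (rule Cons.IH[OF _ _ _ _ ip(6)]) (use Cons.prems iM in auto)
  then have "dsum (X f - X i \<cdot> X p) (X \<circ> Y) (map (\<lambda>y. X \<circ> y) ys)"
    using Cons.prems iM by (simp add: emap_diff emap_mult)
  moreover have "X i \<in> intw (X \<circ> y) (X \<circ> Y)" "X p \<in> intw (X \<circ> Y) (X \<circ> y)"
    using intw_whisker_left Cons.prems ip by auto
  moreover have "X p \<cdot> X i = (X \<circ> y) \<I>" "X f \<cdot> X i = X i" "X p \<cdot> X f = X p"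
    using Cons.prems iM ip by (simp_all add: emap_mult[symmetric])
  ultimately show ?case unfolding list.map by (intro dsum_ConsI)
qed simp

lemma dsum_whisker_right:
  assumes "emap X" "emap Y" "\<forall>x\<in>set xs. emap x" "f \<in> intw X X" "dsum f X xs"
  shows "dsum (f \<cdot> X (Y \<I>)) (X \<circ> Y) (map (\<lambda>x. x \<circ> Y) xs)"
  using assms
proof (induction xs arbitrary: f)
  case (Cons x xs)
  obtain i p where ip: "i \<in> intw x X" "p \<in> intw X x" "p \<cdot> i = x \<I>" "f \<cdot> i = i" "p \<cdot> f = p"
    "dsum (f - i \<cdot> p) X xs"
    by (rule dsum_ConsE[of f X x xs]) (use Cons.prems in blast)+
  have x: "emap x" using Cons.prems by simp
  have YY: "Y \<I> \<cdot> Y \<I> = Y \<I>" "Y \<I> \<in> M" using Cons.prems by (simp_all add: emap_one_mult)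
  then have xx: "x (Y \<I>) \<cdot> x (Y \<I>) = x (Y \<I>)" "x (Y \<I>) \<cdot> (x (Y \<I>) \<cdot> s) = x (Y \<I>) \<cdot> s" for s
    using x by (simp_all add: emap_mult[symmetric] op_assoc[symmetric])
  let ?i = "i \<cdot> x (Y \<I>)" and ?p = "p \<cdot> X (Y \<I>)"
  have p': "?p = x (Y \<I>) \<cdot> p" using intw_nat[OF ip(2) YY(2)] .
  have "dsum ((f - i \<cdot> p) \<cdot> X (Y \<I>)) (X \<circ> Y) (map (\<lambda>x. x \<circ> Y) xs)"
    by (rule Cons.IH[OF _ _ _ _ ip(6)]) (use Cons.prems ip in \<open>auto simp: intw_diff intw_mult\<close>)
  also have "(f - i \<cdot> p) \<cdot> X (Y \<I>) = f \<cdot> X (Y \<I>) - ?i \<cdot> ?p"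
    by (simp add: p' op_distribs op_assoc xx)
  finally have "dsum (f \<cdot> X (Y \<I>) - ?i \<cdot> ?p) (X \<circ> Y) (map (\<lambda>x. x \<circ> Y) xs)" .
  moreover have "?i \<in> intw (x \<circ> Y) (X \<circ> Y)" "?p \<in> intw (X \<circ> Y) (x \<circ> Y)"
    using intw_whisker_right Cons.prems ip x by blast+
  moreover have pi: "p \<cdot> (i \<cdot> s) = x \<I> \<cdot> s" "f \<cdot> (i \<cdot> s) = i \<cdot> s" for s
    using op_reassoc[OF ip(3)] op_reassoc[OF ip(4)] by simp_all
  have "?p \<cdot> ?i = (x \<circ> Y) \<I>"
    unfolding p' using x YY by (simp add: op_assoc pi emap_one_mult xx)
  moreover have "(f \<cdot> X (Y \<I>)) \<cdot> ?i = ?i"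
    using intw_nat2[OF ip(1) YY(2), symmetric] by (simp add: op_assoc xx pi)
  moreover have "?p \<cdot> (f \<cdot> X (Y \<I>)) = ?p"
    using op_reassoc[OF ip(5)] p' by (simp add: op_assoc[symmetric]) (simp add: op_assoc xx)
  ultimately show ?case unfolding list.map by (intro dsum_ConsI)
qed simp

text \<open>Pairwise disjoint objects with scalar endomorphisms. In contrast to
  \<open>brick\<close>, these are actual objects; the instance in view is the set of words
  \<open>W\<close>.\<close>

definition orth_bricks :: "'h endo set \<Rightarrow> bool" where
  "orth_bricks S \<longleftrightarrow> (\<forall>x\<in>S. emap x \<and> x \<I> \<noteq> 0 \<and> (\<forall>t\<in>intw x x. \<exists>c. t = op_scale c (x \<I>)) \<and>
     (\<forall>y\<in>S. x \<noteq> y \<longrightarrow> intw x y = {0}))"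

lemma orth_bricksD:
  assumes "orth_bricks S" "x \<in> S"
  shows "emap x" "x \<I> \<noteq> 0" "t \<in> intw x x \<Longrightarrow> \<exists>c. t = op_scale c (x \<I>)"
    "y \<in> S \<Longrightarrow> x \<noteq> y \<Longrightarrow> t \<in> intw x y \<Longrightarrow> t = 0"
  using assms unfolding orth_bricks_def by auto

lemma orth_bricks_link:
  assumes S: "orth_bricks S" "x \<in> S" "y \<in> S" and t: "t \<in> intw x y" "t \<noteq> 0"
  obtains c where "y = x" "c \<noteq> 0" "t = op_scale c (x \<I>)"
proof -
  have yx: "y = x"
  proof (rule ccontr)
    assume "y \<noteq> x"
    then have "t = 0" by (intro orth_bricksD(4)[OF S(1,2,3) _ t(1)]) simp
    then show False using t(2) by simp
  qed
  with t(1) have "t \<in> intw x x" by simp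
  from orth_bricksD(3)[OF S(1,2) this] obtain c where "t = op_scale c (x \<I>)" ..
  moreover from this have "c \<noteq> 0" using t(2) by auto
  moreover note yx
  ultimately show ?thesis using that by blast
qed

lemma cdim_insert:
  assumes "cdim V n" "v \<notin> V" "W = {op_scale c v + u | c u. u \<in> V}"
  shows "cdim W (Suc n)"
proof -
  obtain B where B: "finite B" "cvs.independent B" "cvs.span B = V" "card B = n"
    using assms(1) unfolding cdim_def by blast
  have v: "v \<notin> cvs.span B" "v \<notin> B" using B assms(2) cvs.span_base by auto
  have "cvs.span (insert v B) = W"
    unfolding cvs.span_insert assms(3) B(3)
  proof safe
    fix x k assume "x - op_scale k v \<in> V"
    then show "\<exists>c u. x = op_scale c v + u \<and> u \<in> V" by (intro exI[of _ k] exI[of _ "x - op_scale k v"]) simp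
  next
    fix c u assume "u \<in> V"
    then show "\<exists>k. op_scale c v + u - op_scale k v \<in> V" by (intro exI[of _ c]) simp
  qed
  then show ?thesis unfolding cdim_def using B v cvs.independent_insert[of v B]
    by (intro exI[of _ "insert v B"]) simp
qed

text \<open>Removing a summand \<open>x\<close> from the image of \<open>f\<close> leaves the arrows
  killed by \<open>p\<close>. Nothing is lost if \<open>x \<noteq> w\<close>; if
  \<open>x = w\<close>, the coordinate \<open>p t\<close> is a scalar and the inclusion
  \<open>i\<close> spans a complement.\<close>

lemma cdim_hom_dsum:
  assumes S: "orth_bricks S" "w \<in> S" "set xs \<subseteq> S" and X: "emap X" "idem X f" "dsum f X xs"
  shows "cdim {t \<in> intw w X. f \<cdot> t = t} (count_list xs w)"
  using X S(3)
proof (induction xs arbitrary: f)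
  case Nil
  then have "{t \<in> intw w X. f \<cdot> t = t} = {0}" using intw_0 by auto
  then show ?case using cdim_zero by simp
next
  case (Cons x xs)
  obtain i p where ip: "i \<in> intw x X" "p \<in> intw X x" "p \<cdot> i = x \<I>" "f \<cdot> i = i" "p \<cdot> f = p"
    "dsum (f - i \<cdot> p) X xs"
    by (rule dsum_ConsE[of f X x xs]) (use Cons.prems in blast)+
  have x: "x \<in> S" "emap x" and w: "emap w" using Cons.prems S orth_bricksD(1)[OF S(1)] by auto
  have g: "idem X (f - i \<cdot> p)" by (rule idem_diff[OF _ _ _ ip(1-5)]) (use Cons.prems x in auto)
  let ?V = "{t \<in> intw w X. (f - i \<cdot> p) \<cdot> t = t}"
  have V: "cdim ?V (count_list xs w)" using Cons.IH[OF Cons.prems(1) g ip(6)] Cons.prems(4) by simp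
  have pV: "p \<cdot> t = 0" if "t \<in> ?V" for t
  proof -
    have "p \<cdot> t = p \<cdot> ((f - i \<cdot> p) \<cdot> t)" using that by simp
    also have "\<dots> = 0" using op_reassoc[OF ip(3)] op_reassoc[OF ip(5)] intw_left[OF x(2) ip(2)] op_reassoc[of "x \<I>" p p]
      by (simp add: op_distribs op_assoc)
    finally show ?thesis .
  qed
  have fV: "f \<cdot> t = t" if "t \<in> ?V" for t
  proof -
    have "f \<cdot> t = f \<cdot> ((f - i \<cdot> p) \<cdot> t)" using that by simp
    also have "\<dots> = (f - i \<cdot> p) \<cdot> t" using op_reassoc[OF ip(4)] idem_mult2[OF Cons.prems(2)]
      by (simp add: op_distribs op_assoc)
    finally show ?thesis using that by simp
  qed
  show ?case
  proof (cases "x = w")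
    case False
    have "p \<cdot> t = 0" if "t \<in> intw w X" for t
      using orth_bricksD(4)[OF S(1,2) x(1)] intw_mult[OF w x(2) ip(2) that] False by auto
    then have "(f - i \<cdot> p) \<cdot> t = f \<cdot> t" if "t \<in> intw w X" for t
      using that by (simp add: op_distribs op_assoc)
    then have "{t \<in> intw w X. f \<cdot> t = t} = ?V" by (intro Collect_cong conj_cong) simp_all
    then show ?thesis using V False by simp
  next
    case True
    have i: "i \<in> intw w X" "f \<cdot> i = i" "p \<cdot> i \<noteq> 0" using ip True orth_bricksD(2)[OF S(1,2)] by auto
    have "{t \<in> intw w X. f \<cdot> t = t} = {op_scale c i + u | c u. u \<in> ?V}" (is "?L = ?R")
    proof
      have fb: "f \<in> bounded_ops" using Cons.prems(2) intw_M M_bounded_ops unfolding idem_def by blast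
      show "?R \<subseteq> ?L"
      proof clarify
        fix c u assume "u \<in> intw w X" "(f - i \<cdot> p) \<cdot> u = u"
        then have "u \<in> intw w X" "f \<cdot> u = u" using fV by simp_all
        then show "op_scale c i + u \<in> intw w X \<and> f \<cdot> (op_scale c i + u) = op_scale c i + u"
          using i Cons.prems(1) by (simp add: op_distribs op_scale_right[OF fb] intw_add intw_scale)
      qed
      show "?L \<subseteq> ?R"
      proof
        fix t assume t: "t \<in> ?L"
        then have "p \<cdot> t \<in> intw w w" using intw_mult[OF w x(2) ip(2)] True by auto
        then obtain c where c: "p \<cdot> t = op_scale c (w \<I>)" using orth_bricksD(3)[OF S(1,2)] by blast
        have ipt: "i \<cdot> (p \<cdot> t) = op_scale c i"
          unfolding c using op_scale_right[OF M_bounded_ops[OF intw_M[OF ip(1)]]] intw_right[OF w i(1)] by simp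
        define u where "u = t - op_scale c i"
        have "(f - i \<cdot> p) \<cdot> t = u" unfolding u_def using t ipt by (simp add: op_distribs op_assoc)
        then have "(f - i \<cdot> p) \<cdot> u = u" using g idem_mult2 by metis
        then have "u \<in> ?V" unfolding u_def using t i Cons.prems(1) by (simp add: intw_diff intw_scale)
        then show "t \<in> ?R" unfolding u_def by (auto intro!: exI[of _ c] exI[of _ "t - op_scale c i"])
      qed
    qed
    moreover have "i \<notin> ?V" using pV i(3) by blast
    ultimately show ?thesis using cdim_insert[OF V] True by simp
  qed
qed

text \<open>Some coordinate of \<open>s\<close> is nonzero. By orthogonality it is a nonzero scalar,
  so the projection to that summand, rescaled, is a left inverse.\<close>

lemma dsum_detect_right:
  assumes S: "orth_bricks S" "x \<in> S" "set ys \<subseteq> S"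
    and Y: "emap Y" "idem Y g" "dsum g Y ys" and s: "s \<in> intw x Y" "g \<cdot> s = s" "s \<noteq> 0"
  shows "\<exists>b \<in> intw Y x. b \<cdot> s = x \<I>"
  using Y S(3) s(2)
proof (induction ys arbitrary: g)
  case Nil
  then show ?case using s(3) by simp
next
  case (Cons y ys)
  obtain i p where ip: "i \<in> intw y Y" "p \<in> intw Y y" "p \<cdot> i = y \<I>" "g \<cdot> i = i" "p \<cdot> g = p"
    "dsum (g - i \<cdot> p) Y ys"
    by (rule dsum_ConsE[of g Y y ys]) (use Cons.prems in blast)+
  have y: "y \<in> S" "emap y" and x: "emap x" using Cons.prems S orth_bricksD(1)[OF S(1)] by auto
  have g: "idem Y (g - i \<cdot> p)" by (rule idem_diff[OF _ _ _ ip(1-5)]) (use Cons.prems y in auto)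
  show ?case
  proof (cases "p \<cdot> s = 0")
    case True
    then have "(g - i \<cdot> p) \<cdot> s = s" using Cons.prems(5) by (simp add: op_distribs op_assoc)
    then show ?thesis using Cons.IH[OF Cons.prems(1) g ip(6)] Cons.prems(4) by simp
  next
    case False
    have "p \<cdot> s \<in> intw x y" using intw_mult[OF x y(2) ip(2) s(1)] .
    from orth_bricks_link[OF S(1,2) y(1) this False] obtain c where
      c: "y = x" "c \<noteq> 0" "p \<cdot> s = op_scale c (x \<I>)" .
    then show ?thesis using ip(2) x
      by (intro bexI[of _ "op_scale (inverse c) p"]) (simp_all add: op_scale_left intw_scale)
  qed
qed

lemma dsum_detect_left:
  assumes S: "orth_bricks S" "x \<in> S" "set ys \<subseteq> S"
    and Y: "emap Y" "idem Y g" "dsum g Y ys" and s: "s \<in> intw Y x" "s \<cdot> g = s" "s \<noteq> 0"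
  shows "\<exists>j \<in> intw x Y. s \<cdot> j = x \<I>"
  using Y S(3) s(2)
proof (induction ys arbitrary: g)
  case Nil
  then show ?case using s(3) by simp
next
  case (Cons y ys)
  obtain i p where ip: "i \<in> intw y Y" "p \<in> intw Y y" "p \<cdot> i = y \<I>" "g \<cdot> i = i" "p \<cdot> g = p"
    "dsum (g - i \<cdot> p) Y ys"
    by (rule dsum_ConsE[of g Y y ys]) (use Cons.prems in blast)+
  have y: "y \<in> S" "emap y" and x: "emap x" using Cons.prems S orth_bricksD(1)[OF S(1)] by auto
  have g: "idem Y (g - i \<cdot> p)" by (rule idem_diff[OF _ _ _ ip(1-5)]) (use Cons.prems y in auto)
  show ?case
  proof (cases "s \<cdot> i = 0")
    case True
    then have "s \<cdot> (g - i \<cdot> p) = s" using Cons.prems(5) by (simp add: op_distribs op_reassoc)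
    then show ?thesis using Cons.IH[OF Cons.prems(1) g ip(6)] Cons.prems(4) by simp
  next
    case False
    have "s \<cdot> i \<in> intw y x" using intw_mult[OF y(2) x s(1) ip(1)] .
    from orth_bricks_link[OF S(1) y(1) S(2) this False] obtain c where
      c: "x = y" "c \<noteq> 0" "s \<cdot> i = op_scale c (y \<I>)" .
    then show ?thesis using ip(1) Cons.prems(1) M_bounded_ops[OF intw_M[OF s(1)]]
      by (intro bexI[of _ "op_scale (inverse c) i"]) (simp_all add: op_scale_right intw_scale)
  qed
qed

text \<open>Gaussian elimination: McCoy's observation that \<open>t\<close> is von Neumann regular as soon as \<open>t - t h t\<close> is.\<close>

lemma dsum_regular:
  assumes S: "orth_bricks S" "set xs \<subseteq> S" "set ys \<subseteq> S"
    and X: "emap X" "idem X f" "dsum f X xs" and Y: "emap Y" "dsum (Y \<I>) Y ys"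
    and t: "t \<in> intw X Y" "t \<cdot> f = t"
  shows "\<exists>g \<in> intw Y X. t \<cdot> (g \<cdot> t) = t"
  using X S(2) t
proof (induction xs arbitrary: f t)
  case Nil
  then show ?case using intw_0 by auto
next
  case (Cons x xs)
  obtain i p where ip: "i \<in> intw x X" "p \<in> intw X x" "p \<cdot> i = x \<I>" "f \<cdot> i = i" "p \<cdot> f = p"
    "dsum (f - i \<cdot> p) X xs"
    by (rule dsum_ConsE[of f X x xs]) (use Cons.prems in blast)+
  have x: "x \<in> S" "emap x" using Cons.prems orth_bricksD(1)[OF S(1)] by auto
  have g: "idem X (f - i \<cdot> p)" by (rule idem_diff[OF _ _ _ ip(1-5)]) (use Cons.prems x in auto)
  have IH: "\<exists>g \<in> intw Y X. t \<cdot> (g \<cdot> t) = t" if "t \<in> intw X Y" "t \<cdot> f = t" "t \<cdot> i = 0" for t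
    using Cons.IH[OF Cons.prems(1) g ip(6) _ that(1)] Cons.prems(4) that(2,3)
    by (simp add: op_distribs op_reassoc)
  show ?case
  proof (cases "t \<cdot> i = 0")
    case True
    then show ?thesis using IH Cons.prems by blast
  next
    case False
    have ti: "t \<cdot> i \<in> intw x Y" using intw_mult[OF x(2) Y(1) Cons.prems(5) ip(1)] .
    obtain b where b: "b \<in> intw Y x" "b \<cdot> (t \<cdot> i) = x \<I>"
      using dsum_detect_right[OF S(1) x(1) S(3) Y(1) idem_one[OF Y(1)] Y(2) ti intw_left[OF Y(1) ti] False] by blast
    \<comment> \<open>\<open>h\<close> is a quasi-inverse for the part of \<open>t\<close> on the
      summand \<open>x\<close>. The corrected arrow \<open>t'\<close> vanishes on that summand, so
      the induction hypothesis applies to it.\<close>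
    define h where "h = i \<cdot> b"
    define t' where "t' = t - t \<cdot> (h \<cdot> t)"
    have h: "h \<in> intw Y X" unfolding h_def using intw_mult[OF Y(1) Cons.prems(1) ip(1) b(1)] .
    have t': "t' \<in> intw X Y" unfolding t'_def
      by (intro intw_diff[OF Y(1)] Cons.prems(5) intw_mult[OF Cons.prems(1) Y(1) Cons.prems(5)]
          intw_mult[OF Cons.prems(1,1) h])
    have "t' \<cdot> f = t'" unfolding t'_def using Cons.prems(6) by (simp add: op_distribs op_assoc)
    moreover have "t' \<cdot> i = 0" unfolding t'_def h_def using b(2) intw_right[OF x(2) ip(1)]
      by (simp add: op_distribs op_assoc)
    ultimately obtain g where g: "g \<in> intw Y X" "t' \<cdot> (g \<cdot> t') = t'" using IH[OF t'] by blast
    \<comment> \<open>This is \<open>(1 - h t) g (1 - t h) + h\<close> multiplied out. As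
      \<open>t' = t - t h t\<close>, it gives \<open>t k t = t' g t' + t h t = t\<close>.\<close>
    define k where "k = g - g \<cdot> (t \<cdot> h) - h \<cdot> (t \<cdot> g) + h \<cdot> (t \<cdot> (g \<cdot> (t \<cdot> h))) + h"
    have "k \<in> intw Y X" unfolding k_def
      by (intro intw_add[OF Cons.prems(1)] intw_diff[OF Cons.prems(1)] g(1) h
          intw_mult[OF Y(1) Cons.prems(1) g(1)] intw_mult[OF Y(1) Cons.prems(1) h]
          intw_mult[OF Y(1) Y(1) Cons.prems(5)])
    moreover have "t \<cdot> (k \<cdot> t) = t' \<cdot> (g \<cdot> t') + t \<cdot> (h \<cdot> t)"
      unfolding k_def t'_def by (simp add: op_distribs op_assoc)
    ultimately show ?thesis unfolding g(2) unfolding t'_def by (intro bexI[of _ k]) simp_all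
  qed
qed

text \<open>Makes sums of simple objects closed under direct summands. For each \<open>y\<close> on
  the way, either \<open>f\<close> does not meet it and factors through the rest, or
  \<open>y\<close> splits off from \<open>f\<close>.\<close>

lemma dsum_retract:
  assumes S: "orth_bricks S" "set ys \<subseteq> S" and Y: "emap Y" "idem Y g" "dsum g Y ys"
    and X: "emap X" "idem X f" and ab: "a \<in> intw Y X" "b \<in> intw X Y" "f = a \<cdot> (g \<cdot> b)"
  shows "\<exists>xs. set xs \<subseteq> S \<and> dsum f X xs"
  using Y S(2) X(2) ab
proof (induction ys arbitrary: f g a b)
  case Nil
  then show ?case by (intro exI[of _ "[]"]) simp
next
  case (Cons y ys)
  obtain i p where ip: "i \<in> intw y Y" "p \<in> intw Y y" "p \<cdot> i = y \<I>" "g \<cdot> i = i" "p \<cdot> g = p"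
    "dsum (g - i \<cdot> p) Y ys"
    by (rule dsum_ConsE[of g Y y ys]) (use Cons.prems in blast)+
  have y: "y \<in> S" "emap y" using Cons.prems orth_bricksD(1)[OF S(1)] by auto
  have g: "idem Y (g - i \<cdot> p)" by (rule idem_diff[OF _ _ _ ip(1-5)]) (use Cons.prems y in auto)
  have fH: "f \<in> intw X X" "f \<cdot> f = f" and ff: "f \<cdot> (f \<cdot> s) = f \<cdot> s" for s
    using Cons.prems(5) idem_mult2 unfolding idem_def by blast+
  show ?case
  proof (cases "p \<cdot> (b \<cdot> f) = 0")
    case True
    have "f = (f \<cdot> a) \<cdot> ((g - i \<cdot> p) \<cdot> (b \<cdot> f))"
    proof -
      have "f = f \<cdot> (f \<cdot> f)" using fH by simp
      also have "\<dots> = f \<cdot> ((a \<cdot> (g \<cdot> b)) \<cdot> f)" using Cons.prems(8) by simp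
      also have "\<dots> = (f \<cdot> a) \<cdot> ((g - i \<cdot> p) \<cdot> (b \<cdot> f))" using True by (simp add: op_distribs op_assoc)
      finally show ?thesis .
    qed
    then show ?thesis
      using Cons.IH[OF Cons.prems(1) g ip(6) _ Cons.prems(5), of "f \<cdot> a" "b \<cdot> f"] Cons.prems fH X(1)
      by (auto simp: intw_mult)
  next
    case False
    \<comment> \<open>\<open>s b = p b f\<close> is nonzero, so \<open>s\<close> is a nonzero arrow
      to the simple \<open>y\<close>. A section \<open>j\<close> of it, pushed into the image of
      \<open>f\<close>, becomes the inclusion of a summand \<open>y\<close> with retraction
      \<open>p b f\<close>.\<close>
    define s where "s = p \<cdot> (b \<cdot> (f \<cdot> (a \<cdot> g)))"
    have aH: "a \<cdot> g \<in> intw Y X" using Cons.prems X(1) unfolding idem_def by (simp add: intw_mult)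
    have bf: "b \<cdot> f \<in> intw X Y" using Cons.prems(1,7) fH(1) X(1) by (simp add: intw_mult)
    have pbf: "p \<cdot> (b \<cdot> f) \<in> intw X y" using intw_mult[OF X(1) y(2) ip(2) bf] .
    have "s = (p \<cdot> (b \<cdot> f)) \<cdot> (a \<cdot> g)" unfolding s_def by (simp add: op_assoc)
    then have sH: "s \<in> intw Y y" using intw_mult[OF Cons.prems(1) y(2) pbf aH] by simp
    have sg: "s \<cdot> g = s" unfolding s_def using Cons.prems(2) unfolding idem_def by (simp add: op_assoc)
    have "s \<cdot> b = p \<cdot> (b \<cdot> (f \<cdot> f))" unfolding s_def Cons.prems(8)[symmetric] using Cons.prems(8) by (simp add: op_assoc)
    then have "s \<noteq> 0" using False fH by auto
    from dsum_detect_left[OF S(1) y(1) _ Cons.prems(1,2,3) sH sg this] Cons.prems(4) obtain j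
      where j: "j \<in> intw y Y" "s \<cdot> j = y \<I>" by blast
    define i' where "i' = f \<cdot> (a \<cdot> (g \<cdot> j))"
    define p' where "p' = p \<cdot> (b \<cdot> f)"
    have i': "i' \<in> intw y X" unfolding i'_def
      using intw_mult[OF y(2) X(1) fH(1) intw_mult[OF y(2) X(1) aH j(1)]] by (simp add: op_assoc)
    have p'i': "p' \<cdot> i' = y \<I>" using j(2) unfolding p'_def i'_def s_def by (simp add: op_assoc ff)
    have fi': "f \<cdot> i' = i'" "p' \<cdot> f = p'" unfolding i'_def p'_def by (simp_all add: ff fH op_assoc)
    have p': "p' \<in> intw X y" unfolding p'_def using pbf .
    have f': "idem X (f - i' \<cdot> p')" using idem_diff[OF X(1) y(2) Cons.prems(5) i' p' p'i' fi'] .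
    define f' where "f' = f - i' \<cdot> p'"
    have f'f': "f' \<in> intw X X" "f' \<cdot> f' = f'" using f' unfolding idem_def f'_def by auto
    have "p' \<cdot> f' = 0" unfolding f'_def
      using op_reassoc[OF p'i'] fi' intw_left[OF y(2) p'] by (simp add: op_distribs)
    then have pbf': "p \<cdot> (b \<cdot> (f \<cdot> f')) = 0" unfolding p'_def by (simp add: op_assoc)
    have ff': "f \<cdot> f' = f'" "f' \<cdot> f = f'" unfolding f'_def using op_reassoc[OF fi'(1)] fi' fH by (simp_all add: op_distribs op_assoc)
    have "f' = f' \<cdot> ((a \<cdot> (g \<cdot> b)) \<cdot> f')" using ff' f'f' Cons.prems(8) by simp
    also have "\<dots> = (f' \<cdot> a) \<cdot> ((g - i \<cdot> p) \<cdot> (b \<cdot> f'))" using pbf' ff' by (simp add: op_distribs op_assoc)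
    finally have "\<exists>xs. set xs \<subseteq> S \<and> dsum f' X xs"
      using Cons.IH[OF Cons.prems(1) g ip(6) _ _, of f' "f' \<cdot> a" "b \<cdot> f'"] Cons.prems f' f'f' X(1)
      by (auto simp: intw_mult f'_def)
    then obtain xs where "set xs \<subseteq> S" "dsum f' X xs" by blast
    then have "dsum f X (y # xs)" using dsum_ConsI[OF i' p' p'i' fi'] unfolding f'_def by blast
    then show ?thesis using \<open>set xs \<subseteq> S\<close> y(1) by (intro exI[of _ "y # xs"]) simp
  qed
qed

end

section \<open>Full subcategories of the category of endomorphisms\<close>

lemma lincat_sel_full_sub [simp]:
  "Obj (full_sub C S) = Obj C \<inter> S"
  "Src (full_sub C S) = Src C" "Tgt (full_sub C S) = Tgt C" "Ident (full_sub C S) = Ident C"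
  "Comp (full_sub C S) = Comp C" "Add (full_sub C S) = Add C" "Scal (full_sub C S) = Scal C" "Zero (full_sub C S) = Zero C"
  by (simp_all add: full_sub_def)

lemma moncat_sel_full_sub [simp]:
  "TensO (full_sub C S) = TensO C" "TensM (full_sub C S) = TensM C" "Unit (full_sub C S) = Unit C"
  "Assoc (full_sub C S) = Assoc C" "LUnit (full_sub C S) = LUnit C" "RUnit (full_sub C S) = RUnit C"
  by (simp_all add: full_sub_def)

lemma sel_End0 [simp]:
  "Obj (End0 M) = insert (\<lambda>x. 0) {\<phi>. endomorphism M \<phi> \<and> finite_index M \<phi>}"
  "Src (End0 M) (\<mu>, t, \<nu>) = \<mu>" "Tgt (End0 M) (\<mu>, t, \<nu>) = \<nu>" "Ident (End0 M) \<mu> = (\<mu>, \<mu> \<I>, \<mu>)"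
  "Comp (End0 M) (\<mu>', s, \<nu>) (\<mu>, t, \<nu>') = (\<mu>, s \<cdot> t, \<nu>)" "Add (End0 M) (\<mu>, t, \<nu>) (\<mu>', s, \<nu>') = (\<mu>, t + s, \<nu>)"
  "Scal (End0 M) c (\<mu>, t, \<nu>) = (\<mu>, op_scale c t, \<nu>)" "Zero (End0 M) \<mu> \<nu> = (\<mu>, 0, \<nu>)"
  "TensO (End0 M) \<mu> \<nu> = \<mu> \<circ> \<nu>" "TensM (End0 M) (\<mu>, t, \<mu>') (\<nu>, s, \<nu>') = (\<mu> \<circ> \<nu>, t \<cdot> \<mu> s, \<mu>' \<circ> \<nu>')"
  "Unit (End0 M) = id_on M" "Assoc (End0 M) \<mu> \<nu> \<xi> = (\<mu> \<circ> \<nu> \<circ> \<xi>, (\<mu> \<circ> \<nu> \<circ> \<xi>) \<I>, \<mu> \<circ> \<nu> \<circ> \<xi>)"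
  "LUnit (End0 M) \<mu> = (\<mu>, \<mu> \<I>, \<mu>)" "RUnit (End0 M) \<mu> = (\<mu>, \<mu> \<I>, \<mu>)"
  by (simp_all add: End0_def Let_def)

context vN_algebra begin

definition objs :: "'h endo set" where
  "objs = insert (\<lambda>x. 0) {\<phi>. endomorphism M \<phi> \<and> finite_index M \<phi>}"

lemma emap_endomorphism: "endomorphism M x \<Longrightarrow> emap x"
  unfolding endomorphism_def emap_def by auto

lemma emap_objs: "x \<in> objs \<Longrightarrow> emap x"
  unfolding objs_def using emap_endomorphism emap_zero by auto

lemma endomorphism_adj: "endomorphism M x \<Longrightarrow> z \<in> M \<Longrightarrow> x (op_adj z) = op_adj (x z)"
  unfolding endomorphism_def by auto

lemma endomorphism_one: "endomorphism M x \<Longrightarrow> x \<I> = \<I>"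
  unfolding endomorphism_def by auto

abbreviation cat :: "'h endo set \<Rightarrow> ('h endo, 'h intertwiner) moncat" where
  "cat S \<equiv> full_sub (End0 M) S"

lemma Obj_cat: "Obj (cat S) = objs \<inter> S"
  unfolding objs_def by simp

lemma Hom_cat: "Hom (cat S) x y = (if x \<in> objs \<inter> S \<and> y \<in> objs \<inter> S then (\<lambda>t. (x, t, y)) ` intw x y else {})"
  unfolding Hom_def full_sub_def End0_def intw_def objs_def Let_def by (auto simp: op_assoc image_iff)

lemma Hom_catD: "f \<in> Hom (cat S) x y \<Longrightarrow> x \<in> objs \<inter> S \<and> y \<in> objs \<inter> S \<and> (\<exists>t \<in> intw x y. f = (x, t, y))"
  unfolding Hom_cat by (auto split: if_splits)

lemma Hom_catE:
  assumes "f \<in> Hom (cat S) x y"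
  obtains t where "x \<in> objs \<inter> S" "y \<in> objs \<inter> S" "t \<in> intw x y" "f = (x, t, y)"
  using Hom_catD[OF assms] that by blast

lemma Hom_cat_iff [simp]:
  "(x', t, y') \<in> Hom (cat S) x y \<longleftrightarrow> x' = x \<and> y' = y \<and> x \<in> objs \<inter> S \<and> y \<in> objs \<inter> S \<and> t \<in> intw x y"
  unfolding Hom_cat by auto

lemma arrow_sum_cat:
  "arrow_sum (cat S) x y (map (\<lambda>k. (x, c k, y)) ks) = (x, sum_list (map c ks), y)"
  unfolding arrow_sum_def by (induction ks) simp_all

text \<open>Translates a family of inclusions and projections into the recursive form
  \<open>dsum\<close> by removing summands from the front: after \<open>m\<close> of them the
  remaining idempotent is the sum over \<open>k \<ge> m\<close>.\<close>

lemma dsum_drop: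
  assumes "emap X" "\<And>k. k < length xs \<Longrightarrow> a k \<in> intw (xs ! k) X \<and> b k \<in> intw X (xs ! k) \<and> emap (xs ! k)"
    and orth: "\<And>k l. k < length xs \<Longrightarrow> l < length xs \<Longrightarrow> b k \<cdot> a l = (if k = l then (xs ! k) \<I> else 0)"
    and "m \<le> length xs"
  shows "dsum (\<Sum>k=m..<length xs. a k \<cdot> b k) X (drop m xs)"
  using assms(4)
proof (induction rule: inc_induct)
  case base
  then show ?case by simp
next
  case (step n)
  let ?f = "\<lambda>n. \<Sum>k=n..<length xs. a k \<cdot> b k"
  have eq: "?f n = a n \<cdot> b n + ?f (Suc n)" using step(2) by (simp add: sum.atLeast_Suc_lessThan)
  have 1: "b k \<cdot> (a l \<cdot> s) = (if k = l then (xs ! k) \<I> \<cdot> s else 0)" if "k < length xs" "l < length xs" for k l s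
    using op_reassoc[OF orth[OF that]] by simp
  have "?f (Suc n) \<cdot> a n = 0" "b n \<cdot> ?f (Suc n) = 0"
    using step(2) by (simp_all add: blinfun_compose.sum_left blinfun_compose.sum_right op_assoc orth 1)
  moreover have "a n \<cdot> (xs ! n) \<I> = a n" "(xs ! n) \<I> \<cdot> b n = b n"
    using assms(2)[OF step(2)] intw_right intw_left by blast+
  ultimately have "dsum (?f n) X (xs ! n # drop (Suc n) xs)"
    using step assms(2)[OF step(2)] orth[of n n] unfolding eq
    by (intro dsum_ConsI[of "a n" _ _ "b n"]) (simp_all add: op_distribs op_assoc 1)
  then show ?case using step(2) by (simp add: Cons_nth_drop_Suc)
qed

lemma direct_sum_catD:
  assumes "direct_sum (cat S) X xs"
  shows "X \<in> objs \<inter> S" "set xs \<subseteq> objs \<inter> S" "dsum (X \<I>) X xs"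
    "\<exists>a b. (\<forall>k<length xs. a k \<in> intw (xs ! k) X \<and> b k \<in> intw X (xs ! k)) \<and>
        (\<forall>k<length xs. \<forall>l<length xs. b k \<cdot> a l = (if k = l then (xs ! k) \<I> else 0)) \<and>
        (\<Sum>k<length xs. a k \<cdot> b k) = X \<I>"
proof -
  show X: "X \<in> objs \<inter> S" "set xs \<subseteq> objs \<inter> S" using assms unfolding direct_sum_def Obj_cat by auto
  obtain i p where ip: "\<And>k. k < length xs \<Longrightarrow> i k \<in> Hom (cat S) (xs ! k) X \<and> p k \<in> Hom (cat S) X (xs ! k)"
    and orth: "\<And>k l. k < length xs \<Longrightarrow> l < length xs \<Longrightarrow>
           Comp (cat S) (p k) (i l) = (if k = l then Ident (cat S) (xs ! k) else Zero (cat S) (xs ! l) (xs ! k))"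
    and sm: "arrow_sum (cat S) X X (map (\<lambda>k. Comp (cat S) (i k) (p k)) [0..<length xs]) = Ident (cat S) X"
    using assms unfolding direct_sum_def by blast
  define a where "a k = fst (snd (i k))" for k
  define b where "b k = fst (snd (p k))" for k
  have i: "i k = (xs ! k, a k, X)" "a k \<in> intw (xs ! k) X" and p: "p k = (X, b k, xs ! k)" "b k \<in> intw X (xs ! k)"
    if "k < length xs" for k
    using ip[OF that] unfolding a_def b_def by (auto elim!: Hom_catE)
  have ba: "b k \<cdot> a l = (if k = l then (xs ! k) \<I> else 0)" if "k < length xs" "l < length xs" for k l
    using orth[OF that] i[OF that(2)] p[OF that(1)] by (auto split: if_splits)
  have "map (\<lambda>k. Comp (cat S) (i k) (p k)) [0..<length xs] = map (\<lambda>k. (X, a k \<cdot> b k, X)) [0..<length xs]"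
    by (rule map_cong) (auto simp: i p)
  with sm have "sum_list (map (\<lambda>k. a k \<cdot> b k) [0..<length xs]) = X \<I>" by (simp only: arrow_sum_cat) simp
  then have sm': "(\<Sum>k=0..<length xs. a k \<cdot> b k) = X \<I>" by (simp only: interv_sum_list_conv_sum_set_nat set_upt)
  have "emap (xs ! k)" if "k < length xs" for k using X(2) that nth_mem emap_objs by blast
  then show "dsum (X \<I>) X xs"
    using dsum_drop[of X xs a b 0] ba i p X emap_objs sm' by simp
  show "\<exists>a b. (\<forall>k<length xs. a k \<in> intw (xs ! k) X \<and> b k \<in> intw X (xs ! k)) \<and>
        (\<forall>k<length xs. \<forall>l<length xs. b k \<cdot> a l = (if k = l then (xs ! k) \<I> else 0)) \<and>
        (\<Sum>k<length xs. a k \<cdot> b k) = X \<I>"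
    using ba i p sm' by (intro exI[of _ a] exI[of _ b]) (simp add: atLeast0LessThan)
qed

lemma direct_sum_catI:
  assumes "X \<in> objs \<inter> S" "set xs \<subseteq> objs \<inter> S"
    "\<And>k. k < length xs \<Longrightarrow> a k \<in> intw (xs ! k) X \<and> b k \<in> intw X (xs ! k)"
    "\<And>k l. k < length xs \<Longrightarrow> l < length xs \<Longrightarrow> b k \<cdot> a l = (if k = l then (xs ! k) \<I> else 0)"
    "(\<Sum>k<length xs. a k \<cdot> b k) = X \<I>"
  shows "direct_sum (cat S) X xs"
proof -
  let ?i = "\<lambda>k. (xs ! k, a k, X)" and ?p = "\<lambda>k. (X, b k, xs ! k)"
  have "xs ! k \<in> objs \<inter> S" if "k < length xs" for k using assms(2) that by auto
  then have "\<forall>k<length xs. ?i k \<in> Hom (cat S) (xs ! k) X \<and> ?p k \<in> Hom (cat S) X (xs ! k)"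
    using assms by simp
  moreover have "\<forall>k<length xs. \<forall>l<length xs. Comp (cat S) (?p k) (?i l) =
      (if k = l then Ident (cat S) (xs ! k) else Zero (cat S) (xs ! l) (xs ! k))"
    using assms(4) by simp
  moreover have "arrow_sum (cat S) X X (map (\<lambda>k. Comp (cat S) (?i k) (?p k)) [0..<length xs]) = Ident (cat S) X"
    using arrow_sum_cat[of S X X "\<lambda>k. a k \<cdot> b k" "[0..<length xs]"] assms(5)
    by (simp add: interv_sum_list_conv_sum_set_nat atLeast0LessThan)
  ultimately have "\<exists>i p. (\<forall>k<length xs. i k \<in> Hom (cat S) (xs ! k) X \<and> p k \<in> Hom (cat S) X (xs ! k)) \<and>
      (\<forall>k<length xs. \<forall>l<length xs. Comp (cat S) (p k) (i l) =
        (if k = l then Ident (cat S) (xs ! k) else Zero (cat S) (xs ! l) (xs ! k))) \<and>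
      arrow_sum (cat S) X X (map (\<lambda>k. Comp (cat S) (i k) (p k)) [0..<length xs]) = Ident (cat S) X"
    by (intro exI[where x = ?p] exI[where x = ?i] conjI)
  then show ?thesis unfolding direct_sum_def Obj_cat using assms(1,2) by (intro conjI)
qed

lemma isomorphic_catI:
  assumes "x \<in> objs \<inter> S" "y \<in> objs \<inter> S" "t \<in> intw x y" "s \<in> intw y x" "s \<cdot> t = x \<I>" "t \<cdot> s = y \<I>"
  shows "isomorphic (cat S) x y"
proof -
  have t: "(x, t, y) \<in> Hom (cat S) x y" using assms by simp
  moreover from t have "(x, t, y) \<in> Arr (cat S)" unfolding Hom_def by simp
  then have "inverse_arrows (cat S) (x, t, y) (y, s, x)"
    unfolding inverse_arrows_def using assms by simp
  ultimately show ?thesis unfolding isomorphic_def iso_arrow_def by blast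
qed

lemma intw_adj:
  assumes "endomorphism M x" "endomorphism M y" "t \<in> intw x y"
  shows "op_adj t \<in> intw y x"
proof (rule intwI)
  have t: "t \<in> M" using assms intw_M by blast
  show "op_adj t \<in> M" using t by simp
  show "x \<I> \<cdot> op_adj t = op_adj t" "op_adj t \<cdot> y \<I> = op_adj t" using assms by (simp_all add: endomorphism_one)
  fix z assume z: "z \<in> M"
  have xM: "x w \<in> M" "y w \<in> M" if "w \<in> M" for w using assms that emap_M emap_endomorphism by blast+
  have "t \<cdot> x (op_adj z) = y (op_adj z) \<cdot> t" using assms z by (simp add: intw_nat)
  then have "op_adj (t \<cdot> x (op_adj z)) = op_adj (y (op_adj z) \<cdot> t)" by simp
  then have "op_adj (x (op_adj z)) \<cdot> op_adj t = op_adj t \<cdot> op_adj (y (op_adj z))"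
    using t xM z by (simp add: op_adj_mult M_bounded_ops)
  then show "op_adj t \<cdot> y z = x z \<cdot> op_adj t"
    using assms z by (simp add: endomorphism_adj[symmetric] op_adj_adj M_bounded_ops)
qed

text \<open>The adjoint of an intertwiner of unital endomorphisms is again one, so
  \<open>op_adj t \<cdot> t\<close> and \<open>t \<cdot> op_adj t\<close> are scalars. They agree
  and are nonzero, and the rescaled adjoint is the inverse.\<close>

lemma scalar_iso:
  assumes x: "endomorphism M x" "\<And>t. t \<in> intw x x \<Longrightarrow> \<exists>c. t = op_scale c \<I>"
    and y: "endomorphism M y" "\<And>t. t \<in> intw y y \<Longrightarrow> \<exists>c. t = op_scale c \<I>"
    and t: "t \<in> intw x y" "t \<noteq> 0"
  shows "\<exists>s \<in> intw y x. s \<cdot> t = \<I> \<and> t \<cdot> s = \<I>"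
proof -
  have t': "op_adj t \<in> intw y x" using intw_adj x(1) y(1) t(1) by blast
  have e: "emap x" "emap y" using x y emap_endomorphism by blast+
  have tM: "t \<in> M" "op_adj t \<in> M" using t t' intw_M by blast+
  obtain c where c: "op_adj t \<cdot> t = op_scale c \<I>" using x(2) intw_mult[OF e(1,1) t' t(1)] by blast
  obtain d where d: "t \<cdot> op_adj t = op_scale d \<I>" using y(2) intw_mult[OF e(2,2) t(1) t'] by blast
  have c0: "c \<noteq> 0" using op_adj_mult_eq_0[of t] c t(2) tM M_bounded_ops by auto
  have "op_scale c t = t \<cdot> (op_adj t \<cdot> t)" unfolding c by (simp add: op_scale_right M_bounded_ops tM)
  also have "\<dots> = op_scale d t" using op_reassoc[OF d] by (simp add: op_scale_left)
  finally have "c = d" using t(2) by (simp add: cvs.scale_cancel_right)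
  then show ?thesis using c d c0 t' e tM
    by (intro bexI[of _ "op_scale (inverse c) (op_adj t)"])
      (simp_all add: intw_scale op_scale_left op_scale_right M_bounded_ops)
qed

text \<open>Schur's lemma, from a definition of simplicity by monomorphisms: \<open>t\<close> has an
  eigenvalue, and subtracting it leaves an endomorphism that annihilates a nonzero arrow and
  therefore vanishes.\<close>

lemma simple_scalar:
  assumes fus: "fusion_category (cat S)" and x: "simple_obj (cat S) x" and t: "t \<in> intw x x"
  shows "\<exists>c. t = op_scale c (x \<I>)"
proof -
  interpret F: fusion_category "cat S" by (fact fus)
  have xO: "x \<in> objs \<inter> S" "x \<I> \<noteq> 0"
    using x unfolding simple_obj_def zero_obj_def Obj_cat by auto
  then have ex: "emap x" using emap_objs by blast
  obtain fs where fs: "set fs \<subseteq> Hom (cat S) x x"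
    "\<And>f. f \<in> Hom (cat S) x x \<Longrightarrow> \<exists>c. f = arrow_sum (cat S) x x (map (\<lambda>k. Scal (cat S) (c k) (fs ! k)) [0..<length fs])"
    using F.finite_dim_Hom[of x x] xO Obj_cat by blast
  define T where "T = (fst \<circ> snd) ` set fs"
  have span: "intw x x \<subseteq> cvs.span T"
  proof
    fix t assume "t \<in> intw x x"
    then obtain c where c: "(x, t, x) = arrow_sum (cat S) x x (map (\<lambda>k. Scal (cat S) (c k) (fs ! k)) [0..<length fs])"
      using fs(2)[of "(x, t, x)"] xO by auto
    have "map (\<lambda>k. Scal (cat S) (c k) (fs ! k)) [0..<length fs]
        = map (\<lambda>k. (x, op_scale (c k) (fst (snd (fs ! k))), x)) [0..<length fs]"
    proof (rule map_cong)
      fix k assume "k \<in> set [0..<length fs]"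
      then have "fs ! k \<in> Hom (cat S) x x" using fs(1) by auto
      then show "Scal (cat S) (c k) (fs ! k) = (x, op_scale (c k) (fst (snd (fs ! k))), x)" by (auto elim!: Hom_catE)
    qed simp
    with c have "t = sum_list (map (\<lambda>k. op_scale (c k) (fst (snd (fs ! k)))) [0..<length fs])"
      by (simp only: arrow_sum_cat) simp
    also have "\<dots> = (\<Sum>k = 0..<length fs. op_scale (c k) (fst (snd (fs ! k))))"
      by (simp only: interv_sum_list_conv_sum_set_nat set_upt)
    also have "\<dots> \<in> cvs.span T"
      by (intro cvs.span_sum cvs.span_scale cvs.span_base) (auto simp: T_def)
    finally show "t \<in> cvs.span T" .
  qed
  \<comment> \<open>The kernel of \<open>f\<close> is a monomorphism into the simple
    \<open>x\<close>. If it were invertible, \<open>f\<close> would be 0; so its source is zero and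
    \<open>f\<close> can be cancelled.\<close>
  have cancel: "q = 0" if f: "f \<in> intw x x" "f \<noteq> 0" and q: "q \<in> intw x x" "f \<cdot> q = 0" for f q
  proof -
    have "(x, f, x) \<in> Hom (cat S) x x" using f xO by simp
    then have "(x, f, x) \<in> Arr (cat S)" unfolding Hom_def by simp
    then obtain k where k: "kernel_of (cat S) (x, f, x) k" using F.kernel_ex by blast
    then have "k \<in> Hom (cat S) (Src (cat S) k) x" unfolding kernel_of_def Hom_def by simp
    then obtain w \<kappa> where kw: "w \<in> objs \<inter> S" "\<kappa> \<in> intw w x" "k = (w, \<kappa>, x)"
      by (auto elim!: Hom_catE)
    have uni: "\<exists>!u. u \<in> Hom (cat S) v w \<and> Comp (cat S) k u = h"
      if "h \<in> Hom (cat S) v x" "Comp (cat S) (x, f, x) h = Zero (cat S) v x" for v h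
      using k that unfolding kernel_of_def kw(3) by auto
    have fk: "f \<cdot> \<kappa> = 0" using k unfolding kernel_of_def kw(3) by simp
    have "mono_arrow (cat S) k" unfolding mono_arrow_def
    proof (intro conjI allI ballI impI)
      show "k \<in> Arr (cat S)" using k unfolding kernel_of_def by blast
      fix v g h assume g: "g \<in> Hom (cat S) v (Src (cat S) k)" and h: "h \<in> Hom (cat S) v (Src (cat S) k)"
        and gh: "Comp (cat S) k g = Comp (cat S) k h"
      have g': "g \<in> Hom (cat S) v w" and h': "h \<in> Hom (cat S) v w" using g h kw(3) by simp_all
      obtain g1 where g1: "g = (v, g1, w)" "v \<in> objs \<inter> S" "g1 \<in> intw v w" using g' by (auto elim: Hom_catE)
      have "Comp (cat S) k g \<in> Hom (cat S) v x"
        using g1 kw xO emap_objs intw_mult[of v x \<kappa> w g1] by auto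
      moreover have "Comp (cat S) (x, f, x) (Comp (cat S) k g) = Zero (cat S) v x"
        using op_reassoc[OF fk] g1 kw by simp
      ultimately show "g = h" using uni g' h' gh by metis
    qed
    then have "zero_obj (cat S) w \<or> iso_arrow (cat S) k"
      using x kw xO unfolding simple_obj_def by auto
    then show "q = 0"
    proof
      assume "zero_obj (cat S) w"
      then have w0: "w \<I> = 0" unfolding zero_obj_def by simp
      obtain u where u: "u \<in> Hom (cat S) x w" "Comp (cat S) k u = (x, q, x)"
        using uni[of "(x, q, x)" x] q xO by auto
      obtain u1 where u1: "u = (x, u1, w)" "u1 \<in> intw x w" using u(1) by (auto elim: Hom_catE)
      have "u1 = w \<I> \<cdot> u1" using intw_left u1(2) kw(1) emap_objs by auto
      then have "u1 = 0" using w0 by simp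
      then show ?thesis using u(2) u1 kw by simp
    next
      assume "iso_arrow (cat S) k"
      then obtain l where l: "l \<in> Hom (cat S) x w" "Comp (cat S) k l = Ident (cat S) x"
        unfolding iso_arrow_def inverse_arrows_def kw(3) by auto
      obtain l1 where "l = (x, l1, w)" using l(1) by (auto elim: Hom_catE)
      then have "\<kappa> \<cdot> l1 = x \<I>" using l(2) kw by simp
      then have "f \<cdot> x \<I> = 0" using op_reassoc[OF fk, of l1] by simp
      then show ?thesis using intw_right[OF ex f(1)] f(2) by simp
    qed
  qed
  have "\<exists>c. \<exists>q \<in> intw x x. q \<noteq> 0 \<and> t \<cdot> q = op_scale c q"
  proof (rule eigenvector_exists[OF subspace_intw[OF ex] _ _ _ span intw_id[OF ex] xO(2) t])
    show "intw x x \<subseteq> bounded_ops" using intw_M M_bounded_ops by blast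
    show "s \<cdot> t \<in> intw x x" if "s \<in> intw x x" "t \<in> intw x x" for s t using intw_mult[OF ex ex that] .
    show "finite T" unfolding T_def by simp
  qed
  then obtain c q where q: "q \<in> intw x x" "q \<noteq> 0" "t \<cdot> q = op_scale c q" by blast
  have "(t - op_scale c (x \<I>)) \<cdot> q = 0" using q intw_left[OF ex q(1)] by (simp add: op_distribs op_scale_left)
  moreover have "t - op_scale c (x \<I>) \<in> intw x x" using t ex by (simp add: intw_diff intw_scale intw_id)
  ultimately have "t - op_scale c (x \<I>) = 0" using cancel q(1,2) by blast
  then show ?thesis by auto
qed

end

section \<open>Endomorphisms and automorphisms\<close>

context vN_algebra begin

lemma op_le_refl: "op_le t t"
  by (simp add: op_le_def) (metis Reals_0 cinner_add_left add_cancel_right_right zero_complex.simps(1) order_refl)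

lemma normal_mapD:
  assumes "normal_map M N x" "D \<noteq> {}" "D \<subseteq> M" "\<forall>t\<in>D. op_adj t = t"
    "\<forall>t\<in>D. \<forall>t'\<in>D. \<exists>t''\<in>D. op_le t t'' \<and> op_le t' t''" "is_lub_in M D s"
  shows "is_lub_in N (x ` D) (x s)"
  using assms(1)[unfolded normal_map_def, rule_format, of D s] assms(2-6) by simp

text \<open>Normality applied to the two-element chain \<open>{t, t'}\<close>, whose least upper
  bound is \<open>t'\<close>.\<close>

lemma endomorphism_mono:
  assumes x: "endomorphism M x" and t: "t \<in> M" "t' \<in> M" "op_adj t = t" "op_adj t' = t'" "op_le t t'"
  shows "op_le (x t) (x t')"
proof -
  have lub: "is_lub_in M {t, t'} t'" unfolding is_lub_in_def using t op_le_refl by auto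
  have nx: "normal_map M M x" using x unfolding endomorphism_def by blast
  have "is_lub_in M (x ` {t, t'}) (x t')"
    by (rule normal_mapD[OF nx _ _ _ _ lub]) (use t op_le_refl in auto)
  then show ?thesis unfolding is_lub_in_def by auto
qed

text \<open>Monotonicity keeps images of directed sets directed, which is what normality of a
  composite requires.\<close>

lemma directed_image:
  assumes x: "endomorphism M x" and D: "D \<subseteq> M" "\<forall>t\<in>D. op_adj t = t"
    and dir: "\<forall>t\<in>D. \<forall>t'\<in>D. \<exists>t''\<in>D. op_le t t'' \<and> op_le t' t''"
  shows "x ` D \<subseteq> M" "\<forall>t\<in>x ` D. op_adj t = t" "\<forall>t\<in>x ` D. \<forall>t'\<in>x ` D. \<exists>t''\<in>x ` D. op_le t t'' \<and> op_le t' t''"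
proof -
  show "x ` D \<subseteq> M" using D x emap_endomorphism by (auto simp: subset_iff)
  show "\<forall>t\<in>x ` D. op_adj t = t" using D endomorphism_adj[OF x] by (auto simp: subset_iff) metis
  show "\<forall>t\<in>x ` D. \<forall>t'\<in>x ` D. \<exists>t''\<in>x ` D. op_le t t'' \<and> op_le t' t''"
  proof clarify
    fix t t' assume t: "t \<in> D" "t' \<in> D"
    then obtain t'' where "t'' \<in> D" "op_le t t''" "op_le t' t''" using dir by blast
    then show "\<exists>t''\<in>x ` D. op_le (x t) t'' \<and> op_le (x t') t''"
      using endomorphism_mono[OF x] t D by (intro bexI[of _ "x t''"]) (auto simp: subset_iff)
  qed
qed

lemma endomorphism_comp:
  assumes x: "endomorphism M x" and y: "endomorphism M y"
  shows "endomorphism M (x \<circ> y)"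
proof -
  have e: "emap x" "emap y" using x y emap_endomorphism by blast+
  have nx: "normal_map M M x" and ny: "normal_map M M y" using x y unfolding endomorphism_def by blast+
  have "normal_map M M (x \<circ> y)" unfolding normal_map_def
  proof (intro allI impI, elim conjE)
    fix D s
    assume D: "D \<noteq> {}" "D \<subseteq> M" "\<forall>t\<in>D. op_adj t = t" and dir: "\<forall>t\<in>D. \<forall>t'\<in>D. \<exists>t''\<in>D. op_le t t'' \<and> op_le t' t''"
      and s: "is_lub_in M D s"
    have lub: "is_lub_in M (y ` D) (y s)" by (rule normal_mapD[OF ny D dir s])
    have "y ` D \<noteq> {}" using D(1) by simp
    from normal_mapD[OF nx this directed_image[OF y D(2,3) dir] lub]
    have "is_lub_in M (x ` y ` D) (x (y s))" .
    then show "is_lub_in M ((x \<circ> y) ` D) ((x \<circ> y) s)" by (simp add: image_comp)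
  qed
  then show ?thesis
    using e emap_comp[OF e] x y endomorphism_one[OF x] endomorphism_one[OF y]
    unfolding endomorphism_def emap_def by auto
qed

lemma endomorphism_id_on: "endomorphism M (id_on M)"
proof -
  have "normal_map M M (id_on M)" unfolding normal_map_def
  proof (intro allI impI, elim conjE)
    fix D s assume D: "D \<subseteq> M" "is_lub_in M D s"
    have "id_on M ` D = D" using D(1) by (force simp: id_on_def)
    then show "is_lub_in M (id_on M ` D) (id_on M s)" using D(2) by (simp add: id_on_def is_lub_in_def)
  qed
  then show ?thesis unfolding endomorphism_def id_on_def by auto
qed

lemma automorphism_finite_index:
  assumes "automorphism M x"
  shows "finite_index M x"
proof -
  have "x ` M = M" using assms unfolding automorphism_def bij_betw_def by blast
  then have "conditional_expectation M (x ` M) (\<lambda>z. z)"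
    unfolding conditional_expectation_def normal_map_def by auto
  then show ?thesis unfolding finite_index_def
    by (intro exI[of _ "\<lambda>z. z"] exI[of _ 1]) (auto simp: op_le_refl)
qed

lemma comp_id_on: "emap x \<Longrightarrow> x \<circ> id_on M = x" "emap x \<Longrightarrow> id_on M \<circ> x = x"
proof -
  assume x: "emap x"
  show "x \<circ> id_on M = x" using x by (auto simp: id_on_def emap_outside fun_eq_iff)
  have "x z \<in> M" for z using x emap_outside[OF x, of z] by (cases "z \<in> M") auto
  then show "id_on M \<circ> x = x" by (auto simp: id_on_def fun_eq_iff)
qed

lemma intw_cancel_right:
  assumes "emap x" "emap y" "\<And>z. z \<in> M \<Longrightarrow> \<exists>w \<in> M. u w = z" "u \<I> = \<I>" "\<And>w. w \<in> M \<Longrightarrow> u w \<in> M"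
  shows "intw (x \<circ> u) (y \<circ> u) = intw x y"
  unfolding intw_def using assms(3,4,5) by (auto; metis)

end

section \<open>The crossed product\<close>

lemma cases_3: "(x::3) = 0 \<or> x = 1 \<or> x = 2"
  using exhaust_3[of x] by auto

lemma sum_UNIV_3: "(\<Sum>j\<in>UNIV. f (j :: 3)) = f 0 + f 1 + f 2"
proof -
  have U: "(UNIV :: 3 set) = {0, 1, 2}" using cases_3 by blast
  show ?thesis unfolding U by (simp add: add.assoc)
qed

lemma sum_shift: "(\<Sum>k\<in>UNIV. f (l + k)) = (\<Sum>k\<in>UNIV. f (k :: 'a :: {ab_group_add, finite}))"
  by (rule sum.reindex_bij_witness[of _ "\<lambda>k. k - l" "\<lambda>k. l + k"]) simp_all

lemma cases_2: "(x::2) = 0 \<or> x = 1"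
  using exhaust_2[of x] by auto

lemma cases_2x2: "(k :: 2 \<times> 2) = (0,0) \<or> k = (0,1) \<or> k = (1,0) \<or> k = (1,1)"
  using cases_2[of "fst k"] cases_2[of "snd k"] by (cases k) auto

lemma double_2x2 [simp]: "(k::2 \<times> 2) + k = 0"
  using cases_2[of "fst k"] cases_2[of "snd k"] by (cases k) (auto simp: zero_prod_def)

lemma uminus_2x2 [simp]: "- (k::2 \<times> 2) = k"
  using double_2x2 minus_unique by blast

lemma cases_generators:
  fixes k g h :: "2 \<times> 2"
  assumes "g \<noteq> 0" "h \<noteq> 0" "g \<noteq> h"
  shows "k = 0 \<or> k = g \<or> k = h \<or> k = g + h"
  using assms cases_2x2[of k] cases_2x2[of g] cases_2x2[of h]
  by (elim disjE) (simp_all add: zero_prod_def)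

lemma swap_2x2: "(k :: 2 \<times> 2) = l + g \<longleftrightarrow> k + g = l"
  by (auto simp: add.assoc)

lemma sum_zero_2x2 [simp]: "(k :: 2 \<times> 2) + l = 0 \<longleftrightarrow> k = l"
  using swap_2x2[of k 0 l] by simp

lemma sum_zero_2x2' [simp]: "0 = (k :: 2 \<times> 2) + l \<longleftrightarrow> k = l"
  using sum_zero_2x2[of k l] by metis

lemma double_left_2x2 [simp]: "(k :: 2 \<times> 2) + (k + l) = l"
  by (simp add: add.assoc[symmetric])

lemma UNIV_2x2: "(UNIV :: (2 \<times> 2) set) = {(0,0),(0,1),(1,0),(1,1)}"
  using cases_2 by auto

lemma least_of_nat_3: "(LEAST n. of_nat n = (0::3)) = 0" "(LEAST n. of_nat n = (1::3)) = 1" "(LEAST n. of_nat n = (2::3)) = 2"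
proof -
  show "(LEAST n. of_nat n = (0::3)) = 0" by (rule Least_equality) auto
  show "(LEAST n. of_nat n = (1::3)) = 1" by (rule Least_equality) (auto intro: ccontr simp: not_less_eq_eq)
  show "(LEAST n. of_nat n = (2::3)) = 2"
  proof (rule Least_equality)
    show "2 \<le> n" if "of_nat n = (2::3)" for n using that by (cases n; cases "n - 1") auto
  qed simp
qed

lemma range_list: "set xs \<subseteq> range f \<Longrightarrow> \<exists>js. xs = map f js"
  by (metis ex_map_conv subsetD rangeE)

locale crossed_product = vN_algebra M
  for M :: "('h::complex_hilbert_space \<Rightarrow>\<^sub>L 'h) set" +
  fixes \<alpha> :: "2 \<times> 2 \<Rightarrow> 'h endo" and \<rho> \<gamma> :: "'h endo" and \<theta> :: "2 \<times> 2 \<Rightarrow> 2 \<times> 2"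
  assumes one_nonzero: "(\<I> :: 'h \<Rightarrow>\<^sub>L 'h) \<noteq> 0"
    and \<alpha>_aut: "\<And>k. automorphism M (\<alpha> k)"
    and \<rho>_end: "endomorphism M \<rho>"
    and \<alpha>_mult: "\<And>k l. \<alpha> k \<circ> \<alpha> l = \<alpha> (k + l)"
    and \<alpha>_\<rho>: "\<And>k. \<alpha> k \<circ> \<rho> = \<rho> \<circ> \<alpha> (- k)"
    and fusion_C: "fusion_category (cat_C M \<alpha> \<rho>)"
    and simples: "\<And>x. simple_obj (cat_C M \<alpha> \<rho>) x \<longleftrightarrow>
          (\<exists>k. isomorphic (cat_C M \<alpha> \<rho>) x (\<alpha> k) \<or> isomorphic (cat_C M \<alpha> \<rho>) x (\<alpha> k \<circ> \<rho>))"
    and distinct_simples: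
      "\<And>k l. isomorphic (cat_C M \<alpha> \<rho>) (\<alpha> k) (\<alpha> l) \<Longrightarrow> k = l"
      "\<And>k l. isomorphic (cat_C M \<alpha> \<rho>) (\<alpha> k \<circ> \<rho>) (\<alpha> l \<circ> \<rho>) \<Longrightarrow> k = l"
      "\<And>k l. \<not> isomorphic (cat_C M \<alpha> \<rho>) (\<alpha> k) (\<alpha> l \<circ> \<rho>)"
    and fusion_rule: "direct_sum (cat_C M \<alpha> \<rho>) (\<rho> \<circ> \<rho>)
          [id_on M, \<alpha> (0, 0) \<circ> \<rho>, \<alpha> (0, 1) \<circ> \<rho>, \<alpha> (1, 0) \<circ> \<rho>, \<alpha> (1, 1) \<circ> \<rho>]"
    and \<gamma>_aut: "automorphism M \<gamma>"
    and \<gamma>_order: "\<gamma> \<circ> \<gamma> \<circ> \<gamma> = id_on M"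
    and \<gamma>_\<rho>: "\<gamma> \<circ> \<rho> = \<rho> \<circ> \<gamma>"
    and \<gamma>_\<alpha>: "\<And>k. \<gamma> \<circ> \<alpha> k = \<alpha> (\<theta> k) \<circ> \<gamma>"
    and \<theta>: "\<theta> 0 = 0" "\<And>k. k \<noteq> 0 \<Longrightarrow> {k, \<theta> k, \<theta> (\<theta> k)} = UNIV - {0}"
begin

definition SC :: "'h endo set" where
  "SC = {x. \<exists>xs. set xs \<subseteq> range \<alpha> \<union> range (\<lambda>g. \<alpha> g \<circ> \<rho>) \<and> direct_sum (End0 M) x xs}"

definition S2 :: "'h endo set" where
  "S2 = generated (End0 M) (insert \<gamma> (Obj (cat_C M \<alpha> \<rho>)))"

lemma cat_C_eq: "cat_C M \<alpha> \<rho> = cat SC"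
  unfolding cat_C_def SC_def ..

lemma cat_C2_eq: "cat_C2 M \<alpha> \<rho> \<gamma> = cat S2"
  unfolding cat_C2_def S2_def ..

lemma full_sub_UNIV: "full_sub (End0 M) UNIV = End0 M"
  unfolding full_sub_def by simp

lemma endo_\<alpha>: "endomorphism M (\<alpha> k)" and endo_\<gamma>: "endomorphism M \<gamma>"
  using \<alpha>_aut \<gamma>_aut unfolding automorphism_def by blast+

lemma emap_\<alpha> [simp]: "emap (\<alpha> k)" and emap_\<rho> [simp]: "emap \<rho>" and emap_\<gamma> [simp]: "emap \<gamma>"
  using endo_\<alpha> endo_\<gamma> \<rho>_end emap_endomorphism by blast+

text \<open>\<open>\<alpha> 0\<close> is idempotent under composition and injective on
  \<open>M\<close>.\<close>

lemma \<alpha>_0: "\<alpha> 0 = id_on M"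
proof
  fix z
  show "\<alpha> 0 z = id_on M z"
  proof (cases "z \<in> M")
    case True
    have "\<alpha> 0 (\<alpha> 0 z) = \<alpha> 0 z" using fun_cong[OF \<alpha>_mult[of 0 0], of z] by simp
    moreover have "inj_on (\<alpha> 0) M" using \<alpha>_aut[of 0] unfolding automorphism_def bij_betw_def by blast
    ultimately have "\<alpha> 0 z = z" using True emap_M[OF emap_\<alpha>] by (meson inj_onD)
    then show ?thesis using True by (simp add: id_on_def)
  next
    case False
    then show ?thesis using emap_outside[OF emap_\<alpha>] by (simp add: id_on_def)
  qed
qed

section \<open>Words in \<open>\<alpha>\<close>, \<open>\<rho>\<close>, \<open>\<gamma>\<close> and
  their normal form\<close>

definition gp :: "3 \<Rightarrow> 'h endo" where "gp c = pow3 M \<gamma> c"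

text \<open>The power \<open>\<theta>\<^sup>c\<close>, written out because the exponent is a residue
  mod 3.\<close>

definition th :: "3 \<Rightarrow> 2 \<times> 2 \<Rightarrow> 2 \<times> 2" where
  "th c = (if c = 0 then id else if c = 1 then \<theta> else \<theta> \<circ> \<theta>)"

text \<open>The factor \<open>id_on M\<close> only changes the power 0: \<open>\<rho> ^^ 0\<close>
  would be the identity on all operators instead of the unit object.\<close>

definition rpow :: "nat \<Rightarrow> 'h endo" where "rpow n = (\<rho> ^^ n) \<circ> id_on M"

lemma gp_simps: "gp 0 = id_on M" "gp 1 = \<gamma>" "gp 2 = \<gamma> \<circ> \<gamma>"
  unfolding gp_def pow3_def least_of_nat_3 by (simp_all add: numeral_2_eq_2 comp_id_on comp_assoc)

lemma gp_add: "gp c \<circ> gp d = gp (c + d)"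
proof -
  have 3: "\<gamma> \<circ> (\<gamma> \<circ> \<gamma>) = id_on M" using \<gamma>_order by (simp only: comp_assoc)
  then have 4: "\<gamma> \<circ> (\<gamma> \<circ> (\<gamma> \<circ> \<gamma>)) = \<gamma>" by (simp only: comp_id_on emap_\<gamma>)
  have n: "1 + 1 = (2::3)" "1 + 2 = (0::3)" "2 + 1 = (0::3)" "2 + 2 = (1::3)" by simp_all
  have e: "emap (\<gamma> \<circ> \<gamma>)" by (intro emap_comp emap_\<gamma>)
  show ?thesis
    using cases_3[of c] cases_3[of d]
    by (elim disjE) (simp_all only: gp_simps n comp_assoc 3 4 comp_id_on emap_\<gamma> emap_id_on e add_0_left add_0_right)
qed

lemma emap_gp [simp]: "emap (gp c)"
  using cases_3[of c] by (elim disjE) (simp_all add: gp_simps emap_comp emap_id_on)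

lemma endo_gp: "endomorphism M (gp c)"
  using cases_3[of c] by (elim disjE) (simp_all add: gp_simps endomorphism_comp endomorphism_id_on endo_\<gamma>)

lemma gp_\<alpha>: "gp c \<circ> \<alpha> k = \<alpha> (th c k) \<circ> gp c"
proof -
  have "\<gamma> \<circ> (\<gamma> \<circ> \<alpha> k) = \<alpha> (\<theta> (\<theta> k)) \<circ> (\<gamma> \<circ> \<gamma>)" by (simp add: \<gamma>_\<alpha> comp_assoc[symmetric])
  then show ?thesis
    using cases_3[of c] by (elim disjE) (simp_all add: gp_simps th_def comp_id_on \<gamma>_\<alpha> comp_assoc)
qed

lemma gp_\<rho>: "gp c \<circ> \<rho> = \<rho> \<circ> gp c"
proof -
  have "\<gamma> \<circ> (\<gamma> \<circ> \<rho>) = \<rho> \<circ> (\<gamma> \<circ> \<gamma>)" by (metis \<gamma>_\<rho> comp_assoc)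
  then show ?thesis
    using cases_3[of c] by (elim disjE) (simp_all add: gp_simps comp_id_on \<gamma>_\<rho> comp_assoc)
qed

lemma emap_rpow [simp]: "emap (rpow n)"
proof -
  have "emap (rpow (Suc n))" if "emap (rpow n)" for n
    using emap_comp[OF emap_\<rho> that] by (simp add: rpow_def comp_assoc)
  moreover have "emap (rpow 0)" by (simp add: rpow_def emap_id_on)
  ultimately show ?thesis by (induction n) auto
qed

lemma rpow_Suc: "rpow (Suc n) = \<rho> \<circ> rpow n" "rpow 0 = id_on M"
  by (simp_all add: rpow_def comp_assoc)

lemma endo_rpow: "endomorphism M (rpow n)"
  by (induction n) (simp_all only: rpow_Suc endomorphism_id_on endomorphism_comp \<rho>_end)

lemma rpow_add: "rpow m \<circ> rpow n = rpow (m + n)"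
  by (induction m) (simp_all only: rpow_Suc comp_id_on comp_assoc add_0_left add_Suc emap_rpow)

lemma rpow_\<alpha>: "rpow n \<circ> \<alpha> k = \<alpha> k \<circ> rpow n"
proof (induction n)
  case (Suc n)
  have "rpow (Suc n) \<circ> \<alpha> k = \<rho> \<circ> (rpow n \<circ> \<alpha> k)" by (simp add: rpow_Suc comp_assoc)
  also have "\<dots> = (\<rho> \<circ> \<alpha> k) \<circ> rpow n" unfolding Suc by (simp add: comp_assoc)
  also have "\<rho> \<circ> \<alpha> k = \<alpha> k \<circ> \<rho>" using \<alpha>_\<rho>[of k] by simp
  finally show ?case by (simp add: rpow_Suc comp_assoc)
qed (simp add: rpow_Suc comp_id_on)

lemma gp_rpow: "gp c \<circ> rpow n = rpow n \<circ> gp c"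
proof (induction n)
  case (Suc n)
  have "gp c \<circ> rpow (Suc n) = (gp c \<circ> \<rho>) \<circ> rpow n" by (simp add: rpow_Suc comp_assoc)
  also have "\<dots> = \<rho> \<circ> (gp c \<circ> rpow n)" unfolding gp_\<rho> by (simp add: comp_assoc)
  finally show ?case unfolding Suc by (simp only: rpow_Suc comp_assoc)
qed (simp add: rpow_Suc comp_id_on)

definition wd :: "2 \<times> 2 \<Rightarrow> nat \<Rightarrow> 3 \<Rightarrow> 'h endo" where
  "wd k n c = \<alpha> k \<circ> rpow n \<circ> gp c"

lemma emap_wd [simp]: "emap (wd k n c)"
  unfolding wd_def by (simp add: emap_comp)

lemma endo_wd: "endomorphism M (wd k n c)"
  unfolding wd_def by (simp add: endomorphism_comp endo_\<alpha> endo_rpow endo_gp)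

text \<open>The relations hold as equalities of maps, so a product of words is again a word. Moving
  \<open>\<gamma>\<^sup>c\<close> past \<open>\<alpha>\<^sub>l\<close> applies \<open>th c\<close>;
  \<open>\<rho>\<close> commutes with every \<open>\<alpha>\<^sub>l\<close> since the group has
  exponent 2.\<close>

lemma wd_mult: "wd k m c \<circ> wd l n d = wd (k + th c l) (m + n) (c + d)"
proof -
  have "wd k m c \<circ> wd l n d = \<alpha> k \<circ> rpow m \<circ> (gp c \<circ> \<alpha> l) \<circ> rpow n \<circ> gp d"
    unfolding wd_def by (simp add: comp_assoc)
  also have "\<dots> = \<alpha> k \<circ> (rpow m \<circ> \<alpha> (th c l)) \<circ> (gp c \<circ> rpow n) \<circ> gp d"
    unfolding gp_\<alpha> by (simp add: comp_assoc)
  also have "\<dots> = (\<alpha> k \<circ> \<alpha> (th c l)) \<circ> (rpow m \<circ> rpow n) \<circ> (gp c \<circ> gp d)"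
    unfolding rpow_\<alpha> gp_rpow by (simp add: comp_assoc)
  finally show ?thesis unfolding \<alpha>_mult rpow_add gp_add by (simp add: wd_def)
qed

lemma wd_simps: "wd k 0 0 = \<alpha> k" "wd 0 1 0 = \<rho>" "wd k 1 0 = \<alpha> k \<circ> \<rho>" "wd 0 0 0 = id_on M" "wd 0 0 c = gp c"
  unfolding wd_def One_nat_def
  by (simp_all only: rpow_Suc gp_simps comp_id_on emap_comp \<alpha>_0 emap_\<alpha> emap_\<rho> emap_gp emap_id_on)

lemma th_0 [simp]: "th c 0 = 0" "th 0 k = k"
  using \<theta>(1) by (auto simp: th_def)

text \<open>The orbit of a nonzero \<open>l\<close> under \<open>\<theta>\<close> has three
  elements. This freeness separates the degrees of the grading by powers of
  \<open>\<gamma>\<close>.\<close>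

lemma th_inj:
  assumes "l \<noteq> 0" "th c l = th d l"
  shows "c = d"
proof -
  have "card (UNIV - {0 :: 2 \<times> 2}) = 3" by (simp add: UNIV_2x2 zero_prod_def)
  then have "card {l, \<theta> l, \<theta> (\<theta> l)} = 3" using \<theta>(2)[OF assms(1)] by simp
  then have "l \<noteq> \<theta> l" "l \<noteq> \<theta> (\<theta> l)" "\<theta> l \<noteq> \<theta> (\<theta> l)" by (auto simp: card_insert_if split: if_splits)
  then show ?thesis using assms(2) cases_3[of c] cases_3[of d] by (auto simp: th_def)
qed

lemma th_nonzero: "l \<noteq> 0 \<Longrightarrow> th c l \<noteq> 0"
  using \<theta>(2)[of l] unfolding th_def by auto

section \<open>Words with at most one \<open>\<rho>\<close>: scalar endomorphisms, no arrows between
  different ones\<close>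

type_synonym idx = "(2 \<times> 2) \<times> bool \<times> 3"

lemma wd_one [simp]: "wd k n c \<I> = \<I>"
  by (rule endomorphism_one[OF endo_wd])

lemma one_intw: "endomorphism M x \<Longrightarrow> \<I> \<in> intw x x"
  using intw_id[OF emap_endomorphism] by (simp add: endomorphism_one)

lemma wd_0_objs: "n \<le> 1 \<Longrightarrow> wd k n 0 \<in> objs \<inter> SC"
proof -
  \<comment> \<open>That \<open>\<alpha> k \<circ> \<rho>\<close> is an object of the category, in
    particular of finite index, is read off from the fusion rule, whose summands are
    objects.\<close>
  have "\<alpha> k \<circ> \<rho> \<in> set [id_on M, \<alpha> (0, 0) \<circ> \<rho>, \<alpha> (0, 1) \<circ> \<rho>, \<alpha> (1, 0) \<circ> \<rho>, \<alpha> (1, 1) \<circ> \<rho>]"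
    using cases_2x2[of k] by (elim disjE) simp_all
  then have 1: "wd k 1 0 \<in> objs \<inter> SC"
    unfolding wd_simps using direct_sum_catD(2)[OF fusion_rule[unfolded cat_C_eq]] by blast
  have "\<alpha> k \<in> objs"
    unfolding objs_def using endo_\<alpha> automorphism_finite_index[OF \<alpha>_aut] by auto
  moreover from this have "direct_sum (cat UNIV) (\<alpha> k) [\<alpha> k]"
    by (intro direct_sum_catI[of _ _ _ "\<lambda>_. \<I>" "\<lambda>_. \<I>"])
      (auto simp: one_intw endo_\<alpha> endomorphism_one[OF endo_\<alpha>])
  then have "direct_sum (End0 M) (\<alpha> k) [\<alpha> k]" unfolding full_sub_UNIV .
  then have "\<alpha> k \<in> SC" unfolding SC_def by (intro CollectI exI[of _ "[\<alpha> k]"]) auto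
  ultimately have 0: "wd k 0 0 \<in> objs \<inter> SC" unfolding wd_simps by blast
  assume "n \<le> 1"
  then have "n = 0 \<or> n = 1" by linarith
  then show ?thesis using 0 1 by blast
qed

lemma isomorphic_refl: "x \<in> objs \<inter> S \<Longrightarrow> isomorphic (cat S) x x"
  using emap_objs by (intro isomorphic_catI[of x S x "x \<I>" "x \<I>"]) (auto simp: intw_id emap_one_mult)

lemma wd_0_simple: "n \<le> 1 \<Longrightarrow> simple_obj (cat SC) (wd k n 0)"
proof -
  assume n: "n \<le> 1"
  then have "n = 0 \<or> n = 1" by linarith
  moreover have "isomorphic (cat SC) (wd k n 0) (wd k n 0)" using isomorphic_refl wd_0_objs n by blast
  ultimately show ?thesis unfolding simples[unfolded cat_C_eq] by (auto simp only: wd_simps)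
qed

lemma wd_0_scalar: "n \<le> 1 \<Longrightarrow> t \<in> intw (wd k n 0) (wd k n 0) \<Longrightarrow> \<exists>c. t = op_scale c \<I>"
  using simple_scalar[OF fusion_C[unfolded cat_C_eq] wd_0_simple] by simp

text \<open>By \<open>scalar_iso\<close> a nonzero intertwiner is invertible, hence an isomorphism
  in C.\<close>

lemma wd_0_distinct:
  assumes "m \<le> 1" "n \<le> 1" "t \<in> intw (wd k m 0) (wd l n 0)" "t \<noteq> 0"
  shows "k = l \<and> m = n"
proof -
  have "\<exists>s \<in> intw (wd l n 0) (wd k m 0). s \<cdot> t = \<I> \<and> t \<cdot> s = \<I>"
    by (rule scalar_iso[OF endo_wd _ endo_wd _ assms(3,4)])
      (erule wd_0_scalar[OF assms(1)], erule wd_0_scalar[OF assms(2)])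
  then obtain s where s: "s \<in> intw (wd l n 0) (wd k m 0)" "s \<cdot> t = \<I>" "t \<cdot> s = \<I>" by blast
  have "isomorphic (cat SC) (wd k m 0) (wd l n 0)" "isomorphic (cat SC) (wd l n 0) (wd k m 0)"
    using isomorphic_catI wd_0_objs assms s by auto
  then show ?thesis
    using distinct_simples[unfolded cat_C_eq, folded wd_simps(1,3)] assms(1,2)
    by (cases m; cases n) auto
qed

lemma gp_inverse: "z \<in> M \<Longrightarrow> gp c (gp (- c) z) = z" "z \<in> M \<Longrightarrow> gp (- c) (gp c z) = z"
  using fun_cong[OF gp_add[of c "- c"], of z] fun_cong[OF gp_add[of "- c" c], of z]
  by (simp_all add: gp_simps id_on_def)

lemma gp_one [simp]: "gp c \<I> = \<I>"
  by (rule endomorphism_one[OF endo_gp])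

lemma intw_gp: "emap x \<Longrightarrow> emap y \<Longrightarrow> intw (x \<circ> gp c) (y \<circ> gp c) = intw x y"
proof (rule intw_cancel_right)
  show "\<exists>w \<in> M. gp c w = z" if "z \<in> M" for z
    using that gp_inverse(1)[OF that] by (intro bexI[of _ "gp (- c) z"]) simp_all
qed simp_all

lemma wd_gp: "wd k n 0 \<circ> gp c = wd k n c"
  using wd_mult[of k n 0 0 0 c] unfolding wd_simps by simp

text \<open>Composition with an automorphism on the right does not affect intertwiners, so words of
  equal degree reduce to degree 0.\<close>

lemma intw_wd_same: "intw (wd k m c) (wd l n c) = intw (wd k m 0) (wd l n 0)"
  using intw_gp[of "wd k m 0" "wd l n 0" c] unfolding wd_gp by simp

lemma wd_scalar: "n \<le> 1 \<Longrightarrow> t \<in> intw (wd k n c) (wd k n c) \<Longrightarrow> \<exists>c. t = op_scale c \<I>"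
  unfolding intw_wd_same[of k n c] by (rule wd_0_scalar)

text \<open>An isomorphism between words of different degrees \<open>c \<noteq> d\<close> would transport \<open>x \<circ> \<alpha> l = \<alpha> (th c l) \<circ> x\<close> and so
  identify \<open>\<alpha> (th c l)\<close> with \<open>\<alpha> (th d l)\<close>.\<close>

lemma wd_distinct:
  assumes mn: "m \<le> 1" "n \<le> 1" and t: "t \<in> intw (wd k m c) (wd l n d)" "t \<noteq> 0"
  shows "k = l \<and> m = n \<and> c = d"
proof -
  have "\<exists>s \<in> intw (wd l n d) (wd k m c). s \<cdot> t = \<I> \<and> t \<cdot> s = \<I>"
    by (rule scalar_iso[OF endo_wd _ endo_wd _ t]) (erule wd_scalar[OF mn(1)], erule wd_scalar[OF mn(2)])
  then obtain s where s: "s \<in> intw (wd l n d) (wd k m c)" "s \<cdot> t = \<I>" "t \<cdot> s = \<I>" by blast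
  have tM: "t \<in> M" "s \<in> M" using intw_M[OF t(1)] intw_M[OF s(1)] .
  obtain j :: "2 \<times> 2" where j: "j \<noteq> 0" using that[of "(1, 1)"] by (simp add: zero_prod_def)
  let ?X = "wd k m c" and ?Y = "wd l n d" and ?a = "\<alpha> (th c j)" and ?b = "\<alpha> (th d j)"
  have X: "?X (\<alpha> j z) = ?a (?X z)" for z
    using fun_cong[OF wd_mult[of k m c j 0 0], of z] fun_cong[OF wd_mult[of "th c j" 0 0 k m c], of z]
    by (simp add: wd_simps add.commute)
  have Y: "?Y (\<alpha> j z) = ?b (?Y z)" for z
    using fun_cong[OF wd_mult[of l n d j 0 0], of z] fun_cong[OF wd_mult[of "th d j" 0 0 l n d], of z]
    by (simp add: wd_simps add.commute)
  have one: "?b \<I> = \<I>" by (rule endomorphism_one[OF endo_\<alpha>])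
  have bb: "?b s \<cdot> ?b t = \<I>" "?b t \<cdot> ?b s = \<I>"
    using s tM by (simp_all add: emap_mult[symmetric] one)
  \<comment> \<open>\<open>t\<close> carries \<open>\<alpha> (th c j) \<circ> X\<close>, which is
    \<open>X \<circ> \<alpha> j\<close>, to \<open>Y \<circ> \<alpha> j\<close>, which is
    \<open>\<alpha> (th d j) \<circ> Y\<close>. The inverse of \<open>t\<close>, under
    \<open>\<alpha> (th d j)\<close>, returns from \<open>Y\<close> to \<open>X\<close>.\<close>
  define u where "u = ?b s \<cdot> t"
  have "u \<in> intw (wd (th c j) 0 0 \<circ> ?X) (wd (th d j) 0 0 \<circ> ?X)"
  proof (rule intwI)
    show "u \<in> M" unfolding u_def using tM by simp
    fix z assume z: "z \<in> M"
    have XYM: "?X z \<in> M" "?Y z \<in> M" using z by simp_all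
    have 1: "t \<cdot> ?a (?X z) = ?b (?Y z) \<cdot> t"
      using intw_nat[OF t(1), of "\<alpha> j z"] z by (simp add: X Y)
    have 2: "?b s \<cdot> ?b (?Y z) = ?b (?X z) \<cdot> ?b s"
      using intw_nat[OF s(1) z] tM XYM by (simp add: emap_mult[symmetric])
    have "u \<cdot> ?a (?X z) = ?b (?X z) \<cdot> u"
      unfolding u_def using 1 op_reassoc[OF 2, of t] by (simp add: op_assoc)
    then show "u \<cdot> (wd (th c j) 0 0 \<circ> ?X) z = (wd (th d j) 0 0 \<circ> ?X) z \<cdot> u"
      by (simp add: wd_simps)
  qed (simp_all add: u_def)
  then have "u \<in> intw (wd (th c j + k) m c) (wd (th d j + k) m c)" by (simp only: wd_mult) simp
  then have "u \<in> intw (wd (th c j + k) m 0) (wd (th d j + k) m 0)" unfolding intw_wd_same[of _ m c] .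
  moreover have "u \<noteq> 0"
  proof
    assume "u = 0"
    then have "?b t \<cdot> (u \<cdot> s) = 0" by simp
    then show False using one_nonzero s(3) bb(2) unfolding u_def by (simp add: op_assoc)
  qed
  ultimately have "th c j + k = th d j + k" using wd_0_distinct[OF mn(1,1), of u] by blast
  then have cd: "c = d" using th_inj[OF j] by simp
  have "t \<in> intw (wd k m 0) (wd l n 0)" using t(1) unfolding cd intw_wd_same[of k m d] .
  then show ?thesis using wd_0_distinct[OF mn _ t(2)] cd by simp
qed

text \<open>The 24 words that serve as simple objects of C2, indexed by group element, presence of
  \<open>\<rho>\<close> and degree.\<close>

definition W :: "idx \<Rightarrow> 'h endo" where
  "W = (\<lambda>(k, e, c). wd k (of_bool e) c)"

lemma W_cases: obtains k e c where "i = (k, e, c)" "W i = wd k (of_bool e) c"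
  unfolding W_def by (cases i) auto

lemma W_one [simp]: "W i \<I> = \<I>" and emap_W [simp]: "emap (W i)"
  by (rule W_cases[of i], simp)+

lemma W_link:
  assumes "t \<in> intw (W i) (W j)" "t \<noteq> 0"
  shows "i = j"
proof -
  obtain k e c where i: "i = (k, e, c)" "W i = wd k (of_bool e) c" by (rule W_cases)
  obtain l f d where j: "j = (l, f, d)" "W j = wd l (of_bool f) d" by (rule W_cases)
  have "k = l \<and> of_bool e = (of_bool f :: nat) \<and> c = d"
    by (rule wd_distinct[OF _ _ assms[unfolded i(2) j(2)]]) simp_all
  then show ?thesis unfolding i j by (cases e; cases f) simp_all
qed

lemma W_scalar: "t \<in> intw (W i) (W i) \<Longrightarrow> \<exists>c. t = op_scale c \<I>"
proof -
  assume t: "t \<in> intw (W i) (W i)"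
  obtain k e c where i: "W i = wd k (of_bool e) c" by (rule W_cases)
  show ?thesis by (rule wd_scalar[OF _ t[unfolded i]]) simp
qed

lemma W_id: "\<I> \<in> intw (W i) (W i)"
  using intw_id[OF emap_W, of i] unfolding W_one .

lemma inj_W: "inj W"
proof (rule injI)
  fix i j assume "W i = W j"
  then have "\<I> \<in> intw (W i) (W j)" using W_id[of i] by simp
  then show "i = j" using W_link one_nonzero by blast
qed

lemma orth_bricks_W: "orth_bricks (range W)"
  unfolding orth_bricks_def
proof (intro ballI conjI impI)
  fix x y assume x: "x \<in> range W" and y: "y \<in> range W"
  then obtain i j where ij: "x = W i" "y = W j" by blast
  show "emap x" unfolding ij by (rule emap_W)
  show "x \<I> \<noteq> 0" unfolding ij W_one by (rule one_nonzero)
  show "\<exists>c. t = op_scale c (x \<I>)" if "t \<in> intw x x" for t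
    using W_scalar[of t i] that unfolding ij W_one by blast
  show "intw x y = {0}" if "x \<noteq> y"
  proof
    show "intw x y \<subseteq> {0}" using W_link[of _ i j] that unfolding ij by blast
    show "{0} \<subseteq> intw x y" using intw_0 by blast
  qed
qed

section \<open>Fusion rules of words, as lists of indices with multiplicity\<close>

fun wl :: "nat \<Rightarrow> 2 \<times> 2 \<Rightarrow> 3 \<Rightarrow> idx list" where
  "wl 0 k c = [(k, False, c)]"
| "wl (Suc 0) k c = [(k, True, c)]"
| "wl (Suc (Suc n)) k c = wl n k c @ concat (map (\<lambda>l. wl (Suc n) (k + l) c) [(0,0),(0,1),(1,0),(1,1)])"

definition decomp :: "'h endo \<Rightarrow> idx list \<Rightarrow> bool" where
  "decomp X ix \<longleftrightarrow> emap X \<and> dsum (X \<I>) X (map W ix)"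

lemma decompD: "decomp X ix \<Longrightarrow> emap X" "decomp X ix \<Longrightarrow> dsum (X \<I>) X (map W ix)"
  unfolding decomp_def by simp_all

lemma dsum_self: "emap x \<Longrightarrow> dsum (x \<I>) x [x]"
  by (rule dsum_ConsI[of "x \<I>" x x "x \<I>"]) (simp_all add: intw_id emap_one_mult)

lemma decomp_W: "decomp (W i) [i]"
  unfolding decomp_def using dsum_self[OF emap_W] by simp

lemma decomp_refine:
  assumes "emap X" "dsum (X \<I>) X (map F js)" "\<And>j. j \<in> set js \<Longrightarrow> decomp (F j) (zs j)"
  shows "decomp X (concat (map zs js))"
proof -
  have "dsum (X \<I>) X (concat (map (\<lambda>j. map W (zs j)) js))"
    by (rule dsum_refine[OF assms(1) idem_one[OF assms(1)] assms(2)])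
      (use assms(3) in \<open>auto simp: decomp_def\<close>)
  then show ?thesis unfolding decomp_def using assms(1) by (simp add: map_concat comp_def)
qed

lemma dsum_whisker_one:
  assumes "emap X" "emap Y"
  shows "dsum (X \<I>) X (map F js) \<Longrightarrow> (\<And>j. j \<in> set js \<Longrightarrow> emap (F j)) \<Longrightarrow>
      dsum ((X \<circ> Y) \<I>) (X \<circ> Y) (map (\<lambda>j. F j \<circ> Y) js)"
    and "dsum (Y \<I>) Y (map F js) \<Longrightarrow> (\<And>j. j \<in> set js \<Longrightarrow> emap (F j)) \<Longrightarrow>
      dsum ((X \<circ> Y) \<I>) (X \<circ> Y) (map (\<lambda>j. X \<circ> F j) js)"
proof -
  show "dsum ((X \<circ> Y) \<I>) (X \<circ> Y) (map (\<lambda>j. F j \<circ> Y) js)"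
    if "dsum (X \<I>) X (map F js)" "\<And>j. j \<in> set js \<Longrightarrow> emap (F j)"
  proof -
    have "dsum (X \<I> \<cdot> X (Y \<I>)) (X \<circ> Y) (map (\<lambda>x. x \<circ> Y) (map F js))"
      by (rule dsum_whisker_right[OF assms _ intw_id[OF assms(1)] that(1)]) (use that(2) in auto)
    then show ?thesis using assms by (simp add: emap_one_mult comp_def[of "\<lambda>x. x \<circ> Y"])
  qed
  show "dsum ((X \<circ> Y) \<I>) (X \<circ> Y) (map (\<lambda>j. X \<circ> F j) js)"
    if "dsum (Y \<I>) Y (map F js)" "\<And>j. j \<in> set js \<Longrightarrow> emap (F j)"
  proof -
    have "dsum (X (Y \<I>)) (X \<circ> Y) (map (\<lambda>y. X \<circ> y) (map F js))"
      by (rule dsum_whisker_left[OF assms _ _ that(1)]) (use that(2) assms in auto)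
    then show ?thesis by (simp add: comp_def[of "\<lambda>y. X \<circ> y"])
  qed
qed

lemma dsum_\<rho>\<rho>:
  "dsum ((\<rho> \<circ> \<rho>) \<I>) (\<rho> \<circ> \<rho>) (map (\<lambda>(k, n). wd k n 0) ((0, 0) # map (\<lambda>l. (l, 1)) [(0,0),(0,1),(1,0),(1,1)]))"
  using direct_sum_catD(3)[OF fusion_rule[unfolded cat_C_eq]]
  by (simp add: wd_simps(3)[unfolded One_nat_def] wd_simps(4))

text \<open>Whiskers the rule for \<open>\<rho> \<circ> \<rho>\<close> by \<open>\<alpha> k\<close>
  on the left and \<open>\<rho>\<^sup>n\<gamma>\<^sup>c\<close> on the right. The resulting words
  have fewer factors \<open>\<rho>\<close>, which is the recursion of \<open>wl\<close>.\<close>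

lemma decomp_wd: "decomp (wd k n c) (wl n k c)"
proof (induction n k c rule: wl.induct)
  case (1 k c)
  then show ?case using decomp_W[of "(k, False, c)"] by (simp add: W_def)
next
  case (2 k c)
  then show ?case using decomp_W[of "(k, True, c)"] by (simp add: W_def)
next
  case (3 n k c)
  let ?G = "[(0,0),(0,1),(1,0),(1,1)] :: (2 \<times> 2) list"
  let ?js = "(0, 0) # map (\<lambda>l. (l, 1)) ?G"
  have e: "emap (\<rho> \<circ> \<rho>)" by (simp add: emap_comp)
  have "dsum ((wd k 0 0 \<circ> (\<rho> \<circ> \<rho>)) \<I>) (wd k 0 0 \<circ> (\<rho> \<circ> \<rho>)) (map (\<lambda>j. wd k 0 0 \<circ> (case j of (l, m) \<Rightarrow> wd l m 0)) ?js)"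
    by (rule dsum_whisker_one(2)[OF emap_wd e dsum_\<rho>\<rho>]) (auto split: prod.splits)
  then have d: "dsum ((wd k 0 0 \<circ> (\<rho> \<circ> \<rho>) \<circ> wd 0 n c) \<I>) (wd k 0 0 \<circ> (\<rho> \<circ> \<rho>) \<circ> wd 0 n c)
      (map (\<lambda>j. wd k 0 0 \<circ> (case j of (l, m) \<Rightarrow> wd l m 0) \<circ> wd 0 n c) ?js)"
    by (rule dsum_whisker_one(1)[OF emap_comp[OF emap_wd e] emap_wd]) (auto intro!: emap_comp emap_wd split: prod.splits)
  have "wd 0 1 0 \<circ> wd 0 1 0 = wd 0 2 0" by (simp only: wd_mult th_0 add_0_left one_add_one)
  then have rr: "\<rho> \<circ> \<rho> = wd 0 2 0" by (simp only: wd_simps(2))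
  have w: "wd k 0 0 \<circ> wd l m 0 \<circ> wd 0 n c = wd (k + l) (m + n) c" for l m
    by (simp only: wd_mult) simp
  have X: "wd k 0 0 \<circ> (\<rho> \<circ> \<rho>) \<circ> wd 0 n c = wd k (Suc (Suc n)) c"
    unfolding rr w by simp
  have js: "map (\<lambda>j. wd k 0 0 \<circ> (case j of (l, m) \<Rightarrow> wd l m 0) \<circ> wd 0 n c) ?js
      = map (\<lambda>(l, m). wd l m c) ((k, n) # map (\<lambda>l. (k + l, Suc n)) ?G)"
    by (simp add: w)
  have "decomp (wd k (Suc (Suc n)) c) (concat (map (\<lambda>(l, m). wl m l c) ((k, n) # map (\<lambda>l. (k + l, Suc n)) ?G)))"
  proof (rule decomp_refine[OF emap_wd d[unfolded X js]])
    fix j assume "j \<in> set ((k, n) # map (\<lambda>l. (k + l, Suc n)) ?G)"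
    then show "decomp (case j of (l, m) \<Rightarrow> wd l m c) (case j of (l, m) \<Rightarrow> wl m l c)"
      using 3 by auto
  qed
  then show ?case by simp
qed

definition wprod :: "idx \<Rightarrow> idx \<Rightarrow> idx list" where
  "wprod = (\<lambda>(k, e, c) (l, f, d). wl (of_bool e + of_bool f) (k + th c l) (c + d))"

lemma decomp_wprod: "decomp (W i \<circ> W j) (wprod i j)"
proof -
  obtain k e c where i: "i = (k, e, c)" "W i = wd k (of_bool e) c" by (rule W_cases)
  obtain l f d where j: "j = (l, f, d)" "W j = wd l (of_bool f) d" by (rule W_cases)
  show ?thesis unfolding i(2) j(2) wd_mult unfolding i(1) j(1) wprod_def prod.case by (rule decomp_wd)
qed

lemma decomp_comp:
  assumes X: "decomp X ix" and Y: "decomp Y js"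
  shows "decomp (X \<circ> Y) (concat (map (\<lambda>i. concat (map (wprod i) js)) ix))"
proof (rule decomp_refine[of _ "\<lambda>i. W i \<circ> Y"])
  show "emap (X \<circ> Y)" using decompD(1)[OF X] decompD(1)[OF Y] by (rule emap_comp)
  show "dsum ((X \<circ> Y) \<I>) (X \<circ> Y) (map (\<lambda>i. W i \<circ> Y) ix)"
    by (rule dsum_whisker_one(1)[OF decompD(1)[OF X] decompD(1)[OF Y] decompD(2)[OF X]]) simp
  show "decomp (W i \<circ> Y) (concat (map (wprod i) js))" for i
  proof (rule decomp_refine[of _ "\<lambda>j. W i \<circ> W j"])
    show "emap (W i \<circ> Y)" using emap_W decompD(1)[OF Y] by (rule emap_comp)
    show "dsum ((W i \<circ> Y) \<I>) (W i \<circ> Y) (map (\<lambda>j. W i \<circ> W j) js)"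
      by (rule dsum_whisker_one(2)[OF emap_W decompD(1)[OF Y] decompD(2)[OF Y]]) simp
  qed (rule decomp_wprod)
qed

text \<open>The degree is recorded because the words induced to C1 are those of degree 0.\<close>

lemma decomp_SC_degree:
  assumes "x \<in> SC"
  shows "\<exists>ix. decomp x ix \<and> (\<forall>j \<in> set ix. snd (snd j) = 0)"
proof -
  obtain xs where xs: "set xs \<subseteq> range \<alpha> \<union> range (\<lambda>g. \<alpha> g \<circ> \<rho>)" "direct_sum (cat UNIV) x xs"
    using assms unfolding SC_def full_sub_UNIV by blast
  let ?F = "\<lambda>(k, b). W (k, b, 0)"
  have "\<alpha> k \<in> range ?F" "\<alpha> k \<circ> \<rho> \<in> range ?F" for k
    using rangeI[of ?F "(k, False)"] rangeI[of ?F "(k, True)"] by (simp_all add: W_def wd_simps[unfolded One_nat_def])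
  then have "set xs \<subseteq> range ?F" using xs(1) by blast
  then obtain js where js: "xs = map ?F js" using range_list by blast
  let ?ix = "map (\<lambda>(k, b). (k, b, 0)) js"
  have "xs = map W ?ix" unfolding js by auto
  then have "decomp x ?ix" unfolding decomp_def
    using direct_sum_catD(1,3)[OF xs(2)] emap_objs by auto
  then show ?thesis by (intro exI[of _ ?ix]) auto
qed

text \<open>C2 is given by closure operations, so the claim is an induction over them. Closure under
  direct summands is the case that needs \<open>dsum_retract\<close>.\<close>

lemma decomp_S2:
  assumes "x \<in> S2"
  shows "\<exists>ix. decomp x ix"
  using assms unfolding S2_def cat_C_eq
proof (induction rule: generated.induct)
  case (base x)
  then consider "x = \<gamma>" | "x \<in> SC" by (auto simp: Obj_cat)
  then show ?case
  proof cases
    case 1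
    then have "x = W (0, False, 1)" by (simp add: W_def wd_simps gp_simps)
    then show ?thesis using decomp_W by blast
  qed (use decomp_SC_degree in blast)
next
  case unit
  have "id_on M = W (0, False, 0)" by (simp add: W_def wd_simps gp_simps \<alpha>_0)
  then have "\<one>\<^bsub>End0 M\<^esub> = W (0, False, 0)" by simp
  then show ?case using decomp_W by metis
next
  case (tensor x y)
  then obtain ix js where "decomp x ix" "decomp y js" by blast
  from decomp_comp[OF this] show ?case by (simp only: sel_End0) blast
next
  case (sum x y z)
  then obtain ix js where d: "decomp x ix" "decomp y js" by blast
  have z: "direct_sum (cat UNIV) z [x, y]" unfolding full_sub_UNIV by (rule sum(3))
  have "dsum (z \<I>) z (map (\<lambda>b. if b then x else y) [True, False])" using direct_sum_catD(3)[OF z] by simp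
  moreover have "emap z" using direct_sum_catD(1)[OF z] emap_objs by blast
  ultimately have "decomp z (concat (map (\<lambda>b. if b then ix else js) [True, False]))"
    using d by (intro decomp_refine[of z "\<lambda>b. if b then x else y" "[True, False]"]) simp_all
  then show ?case by blast
next
  case (summand y i x p)
  then obtain js where js: "decomp y js" by blast
  have "i \<in> Hom (cat UNIV) x y" "p \<in> Hom (cat UNIV) y x" using summand unfolding full_sub_UNIV by blast+
  then obtain a b where ab: "i = (x, a, y)" "a \<in> intw x y" "p = (y, b, x)" "b \<in> intw y x" "x \<in> objs"
    by (auto elim!: Hom_catE)
  have e: "emap x" "emap y" using ab(5) emap_objs decompD(1)[OF js] by blast+
  have "x \<I> = b \<cdot> (y \<I> \<cdot> a)" using summand(4) ab intw_left[OF e(2) ab(2)] by simp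
  from dsum_retract[OF orth_bricks_W _ e(2) idem_one[OF e(2)] decompD(2)[OF js] e(1) idem_one[OF e(1)] ab(4,2) this]
  obtain xs where "set xs \<subseteq> range W" "dsum (x \<I>) x xs" by auto
  then show ?case unfolding decomp_def using range_list[of _ W] e(1) by blast
qed

lemma count_list_map_W: "count_list (map W ix) (W i) = count_list ix i"
  by (induction "ix") (auto dest: injD[OF inj_W])

lemma cdim_decomp:
  assumes "decomp X ix"
  shows "cdim (intw (W i) X) (count_list ix i)"
proof -
  have X: "emap X" "dsum (X \<I>) X (map W ix)" using decompD[OF assms] by blast+
  have "{t \<in> intw (W i) X. X \<I> \<cdot> t = t} = intw (W i) X" using intw_left[OF X(1)] by auto
  then show ?thesis
    using cdim_hom_dsum[OF orth_bricks_W _ _ X(1) idem_one[OF X(1)] X(2), of "W i"]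
    by (simp add: count_list_map_W image_subset_iff)
qed

text \<open>An arrow that vanishes on all words vanishes on each summand of \<open>X\<close>, hence
  on \<open>X\<close>. This makes the words generators.\<close>

lemma decomp_detect:
  assumes "decomp X ix" "emap Y" "f \<in> intw X Y" "f \<noteq> 0"
  shows "\<exists>i. \<exists>t \<in> intw (W i) X. f \<cdot> t \<noteq> 0"
proof (rule ccontr)
  assume no: "\<not> ?thesis"
  have X: "emap X" using decompD(1)[OF assms(1)] .
  have "f \<cdot> g = 0" if "idem X g" "dsum g X (map W js)" for g js
    using that
  proof (induction js arbitrary: g)
    case (Cons j js)
    obtain i p where ip: "i \<in> intw (W j) X" "p \<in> intw X (W j)" "p \<cdot> i = W j \<I>" "g \<cdot> i = i" "p \<cdot> g = p"
      "dsum (g - i \<cdot> p) X (map W js)"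
      by (rule dsum_ConsE[of g X "W j" "map W js"]) (use Cons.prems in auto)
    have "idem X (g - i \<cdot> p)" by (rule idem_diff[OF X emap_W Cons.prems(1) ip(1-5)])
    then have "f \<cdot> (g - i \<cdot> p) = 0" using Cons.IH ip(6) by blast
    moreover have "f \<cdot> i = 0" using no ip(1) by blast
    ultimately show ?case by (simp add: op_distribs op_reassoc[of f i 0])
  qed simp
  from this[OF idem_one[OF X] decompD(2)[OF assms(1)]] show False
    using intw_right[OF X assms(3)] assms(4) by simp
qed

lemma decomp_regular:
  assumes "decomp X ix" "decomp Y js" "t \<in> intw X Y"
  shows "\<exists>g \<in> intw Y X. t \<cdot> (g \<cdot> t) = t"
  using dsum_regular[OF orth_bricks_W _ _ decompD(1)[OF assms(1)] idem_one[OF decompD(1)[OF assms(1)]]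
      decompD(2)[OF assms(1)] decompD(1)[OF assms(2)] decompD(2)[OF assms(2)] assms(3)
      intw_right[OF decompD(1)[OF assms(1)] assms(3)]]
  by (simp add: image_subset_iff)

end

section \<open>Conjugation by the automorphism\<close>

text \<open>Polarization.\<close>

lemma op_le_0_self_adjoint:
  assumes "op_le 0 t" and t: "t \<in> bounded_ops"
  shows "op_adj t = (t :: 'h::complex_hilbert_space \<Rightarrow>\<^sub>L 'h)"
proof (rule op_adj_unique)
  fix v w :: 'h
  have q: "Im (cinner (blinfun_apply t u) u) = 0" for u
    using assms(1) unfolding op_le_def by (auto simp: complex_is_Real_iff)
  have tc: "blinfun_apply t (scaleC c u) = scaleC c (blinfun_apply t u)" for c u
    using t unfolding bounded_ops_def by blast
  let ?a = "cinner (blinfun_apply t v) w" and ?b = "cinner (blinfun_apply t w) v"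
  have 1: "Im (cnj c * ?a + c * ?b) = 0" for c
  proof -
    have "cinner (blinfun_apply t (v + scaleC c w)) (v + scaleC c w) =
        cinner (blinfun_apply t v) v + cnj c * ?a + c * ?b + c * cnj c * cinner (blinfun_apply t w) w"
      by (simp add: blinfun.add_right tc cinner_add_left cinner_add_right cinner_scaleC_left cinner_scaleC_right
          algebra_simps)
    moreover have "Im (c * cnj c * cinner (blinfun_apply t w) w) = 0"
      using q[of w] by (simp add: complex_mult_cnj)
    ultimately show ?thesis using q[of "v + scaleC c w"] q[of v] by (simp only: plus_complex.sel)
  qed
  have "?a = cnj ?b" using 1[of 1] 1[of "\<i>"] by (simp add: complex_eq_iff)
  then show "?a = cinner v (blinfun_apply t w)" by (simp add: cinner_commute[symmetric])
qed

lemma op_le_diff: "op_le s t \<longleftrightarrow> op_le 0 (t - s)"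
  by (simp add: op_le_def)

lemma op_scale_of_real: "op_scale (complex_of_real c) t = c *\<^sub>R t"
  by (rule blinfun_eqI) (simp add: scaleC_of_real blinfun.scaleR_left)

context vN_algebra begin

text \<open>The difference of the two operators is positive, hence self-adjoint, so
  \<open>endomorphism_mono\<close> applies to 0 and the difference.\<close>

lemma endomorphism_op_le:
  assumes x: "endomorphism M x" and t: "s \<in> M" "t \<in> M" "op_le s t"
  shows "op_le (x s) (x t)"
proof -
  have e: "emap x" using emap_endomorphism[OF x] .
  have "op_le 0 (t - s)" using t(3) op_le_diff by blast
  moreover from this have "op_adj (t - s) = t - s"
    using t by (intro op_le_0_self_adjoint) (simp_all add: M_bounded_ops)
  moreover have "op_adj (0 :: 'h \<Rightarrow>\<^sub>L 'h) = 0"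
    by (rule op_le_0_self_adjoint) (simp_all add: op_le_refl)
  ultimately have "op_le (x 0) (x (t - s))" using t by (intro endomorphism_mono[OF x]) simp_all
  then show ?thesis using op_le_diff[of "x s" "x t"] e t by (simp add: emap_diff)
qed

lemma finite_index_image: "\<phi> ` M = \<psi> ` M \<Longrightarrow> finite_index M \<phi> \<longleftrightarrow> finite_index M \<psi>"
  unfolding finite_index_def by simp

text \<open>If \<open>E\<close> is an expectation for \<open>x\<close>, the conjugated map
  \<open>u \<circ> E \<circ> v\<close> is one for the new image and satisfies the Pimsner-Popa
  inequality with the same constant.\<close>

lemma finite_index_conj:
  assumes x: "emap x" "finite_index M x"
    and u: "endomorphism M u" and v: "endomorphism M v"
    and uv: "\<And>z. z \<in> M \<Longrightarrow> u (v z) = z" "\<And>z. z \<in> M \<Longrightarrow> v (u z) = z"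
  shows "finite_index M (u \<circ> x \<circ> v)"
proof -
  obtain E c where c: "0 < c" and E: "conditional_expectation M (x ` M) E"
    and pp: "\<forall>z\<in>M. op_le 0 z \<longrightarrow> op_le (c *\<^sub>R z) (E z)"
    using x(2) unfolding finite_index_def by blast
  note E = E[unfolded conditional_expectation_def]
  have EN: "E z \<in> x ` M" if "z \<in> M" for z using imageI[OF that, of E] E[THEN conjunct1] by (rule subsetD[rotated])
  note E = E[THEN conjunct2]
  have Eid: "E z = z" if "z \<in> x ` M" for z using E[THEN conjunct1, rule_format, OF that] .
  note E = E[THEN conjunct2]
  have Eadd: "E (y + z) = E y + E z" if "y \<in> M" "z \<in> M" for y z
    using E[THEN conjunct1, rule_format, OF that] .
  note E = E[THEN conjunct2]
  have Escale: "E (op_scale k z) = op_scale k (E z)" if "z \<in> M" for k z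
    using E[THEN conjunct1, rule_format, OF that] .
  note E = E[THEN conjunct2]
  have Emod: "E (a \<cdot> z \<cdot> b) = a \<cdot> E z \<cdot> b" if "z \<in> M" "a \<in> x ` M" "b \<in> x ` M" for z a b
    using E[THEN conjunct1, rule_format, OF that] .
  note E = E[THEN conjunct2]
  have Epos: "op_le 0 (E z)" if "z \<in> M" "op_le 0 z" for z
    using E[THEN conjunct1, rule_format, OF that] .
  have En: "normal_map M (x ` M) E" using E[THEN conjunct2] .
  have e: "emap u" "emap v" using u v emap_endomorphism by blast+
  have xM: "z \<in> M" if "z \<in> x ` M" for z using that x(1) by auto
  have EM: "E z \<in> M" if "z \<in> M" for z using EN[OF that] xM by blast
  have N': "(u \<circ> x \<circ> v) ` M = u ` x ` M"
  proof -
    have "z \<in> v ` M" if "z \<in> M" for z using image_eqI[of z v "u z"] uv(2) e that by simp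
    then have "v ` M = M" using e by auto
    then show ?thesis by (simp only: image_comp[symmetric])
  qed
  have vN: "v a \<in> x ` M" "a \<in> M" "u (v a) = a" if "a \<in> u ` x ` M" for a
    using that uv(2) xM e by auto
  let ?E = "\<lambda>z. u (E (v z))"
  have "conditional_expectation M (u ` x ` M) ?E" unfolding conditional_expectation_def
  proof (intro conjI ballI allI impI)
    show "?E ` M \<subseteq> u ` x ` M" using EN e by auto
    show "?E y = y" if "y \<in> u ` x ` M" for y using vN[OF that] Eid by simp
    show "?E (y + z) = ?E y + ?E z" if "y \<in> M" "z \<in> M" for y z
      using that e EM by (simp add: emap_add Eadd)
    show "?E (op_scale k z) = op_scale k (?E z)" if "z \<in> M" for z k
      using that e EM by (simp add: emap_scale Escale)
    show "?E (a \<cdot> z \<cdot> b) = a \<cdot> ?E z \<cdot> b" if "z \<in> M" "a \<in> u ` x ` M" "b \<in> u ` x ` M" for z a b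
    proof -
      note a = vN[OF that(2)] and b = vN[OF that(3)]
      have vz: "v z \<in> M" and m: "a \<cdot> z \<in> M" "v a \<in> M" "v b \<in> M" "E (v z) \<in> M" "v a \<cdot> E (v z) \<in> M"
        using that(1) a(2) b(2) e EM by simp_all
      have "v (a \<cdot> z \<cdot> b) = v a \<cdot> v z \<cdot> v b"
        by (simp only: emap_mult[OF e(2) m(1) b(2)] emap_mult[OF e(2) a(2) that(1)])
      then have "?E (a \<cdot> z \<cdot> b) = u (v a \<cdot> E (v z) \<cdot> v b)"
        by (simp only: Emod[OF vz a(1) b(1)])
      also have "\<dots> = a \<cdot> ?E z \<cdot> b"
        by (simp only: emap_mult[OF e(1) m(5) m(3)] emap_mult[OF e(1) m(2) m(4)] a(3) b(3))
      finally show ?thesis .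
    qed
    show "op_le 0 (?E z)" if z: "z \<in> M" "op_le 0 z" for z
    proof -
      have "op_le 0 (v z)" using endomorphism_op_le[OF v _ z(1,2)] e by simp
      then have "op_le 0 (E (v z))" using Epos z e by simp
      then show ?thesis using endomorphism_op_le[OF u, of 0 "E (v z)"] EM z e by simp
    qed
    show "normal_map M (u ` x ` M) ?E" unfolding normal_map_def
    proof (intro allI impI, elim conjE)
      fix D s
      assume D: "D \<noteq> {}" "D \<subseteq> M" "\<forall>t\<in>D. op_adj t = t"
        and dir: "\<forall>t\<in>D. \<forall>t'\<in>D. \<exists>t''\<in>D. op_le t t'' \<and> op_le t' t''" and s: "is_lub_in M D s"
      have nv: "normal_map M M v" using v unfolding endomorphism_def by blast
      have vD: "v ` D \<noteq> {}" using D(1) by simp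
      have l: "is_lub_in (x ` M) (E ` v ` D) (E (v s))"
        by (rule normal_mapD[OF En vD directed_image[OF v D(2,3) dir] normal_mapD[OF nv D dir s]])
      note l = l[unfolded is_lub_in_def]
      have lub: "E (v s) \<in> x ` M" "\<And>t. t \<in> D \<Longrightarrow> op_le (E (v t)) (E (v s))"
        "\<And>y. y \<in> x ` M \<Longrightarrow> (\<And>t. t \<in> D \<Longrightarrow> op_le (E (v t)) y) \<Longrightarrow> op_le (E (v s)) y"
        using l[THEN conjunct1] l[THEN conjunct2, THEN conjunct1] l[THEN conjunct2, THEN conjunct2, THEN bspec]
        by simp_all
      have vM: "v t \<in> M" if "t \<in> D" for t using that D(2) e by auto
      show "is_lub_in (u ` x ` M) (?E ` D) (?E s)" unfolding is_lub_in_def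
      proof (intro conjI ballI impI)
        show "?E s \<in> u ` x ` M" using lub(1) by (rule imageI)
        show "op_le t (?E s)" if "t \<in> ?E ` D" for t
          using that lub(2) endomorphism_op_le[OF u] EM vM xM[OF lub(1)] by blast
        fix y assume y: "y \<in> u ` x ` M" "\<forall>t\<in>?E ` D. op_le t y"
        have "op_le (E (v t)) (v y)" if "t \<in> D" for t
          using endomorphism_op_le[OF v, of "?E t" y] y(2) that vN(2)[OF y(1)] EM[OF vM[OF that]] e uv(2) by simp
        then have "op_le (E (v s)) (v y)" using lub(3) vN(1)[OF y(1)] by blast
        from endomorphism_op_le[OF u xM[OF lub(1)] xM[OF vN(1)[OF y(1)]] this]
        show "op_le (?E s) y" using vN(3)[OF y(1)] by simp
      qed
    qed
  qed
  moreover have "op_le (c *\<^sub>R z) (?E z)" if z: "z \<in> M" "op_le 0 z" for z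
  proof -
    have vz: "v z \<in> M" using z e by simp
    have "op_le 0 (v z)" using endomorphism_op_le[OF v _ z(1,2)] e by simp
    then have "op_le (op_scale (complex_of_real c) (v z)) (E (v z))" using pp vz by (simp add: op_scale_of_real)
    then have "op_le (u (op_scale (complex_of_real c) (v z))) (?E z)"
      using endomorphism_op_le[OF u] EM vz by simp
    then show ?thesis by (simp only: emap_scale[OF e(1) vz] uv(1)[OF z(1)]) (simp only: op_scale_of_real)
  qed
  ultimately show ?thesis unfolding finite_index_def N' using c by blast
qed

end

context crossed_product begin

lemma gp_image: "gp c ` M = M"
proof -
  have "z \<in> gp c ` M" if "z \<in> M" for z using image_eqI[of z "gp c" "gp (- c) z"] gp_inverse that by simp
  then show ?thesis by auto
qed

definition cj :: "3 \<Rightarrow> 'h endo \<Rightarrow> 'h endo" where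
  "cj c x = gp c \<circ> x \<circ> gp (- c)"

lemma cj_apply: "cj c x z = gp c (x (gp (- c) z))"
  by (simp add: cj_def)

lemma emap_cj: "emap x \<Longrightarrow> emap (cj c x)"
  unfolding cj_def by (simp add: emap_comp)

lemma cj_gp: "emap x \<Longrightarrow> cj c x \<circ> gp c = gp c \<circ> x"
  using gp_add[of "- c" c] by (simp add: cj_def comp_assoc gp_simps comp_id_on)

lemma cj_wd: "cj c (wd k n 0) = wd (th c k) n 0"
  using wd_mult[of 0 0 c k n 0] wd_mult[of "th c k" n c 0 0 "- c"] by (simp add: cj_def wd_simps)

lemma intw_cj: "emap x \<Longrightarrow> emap y \<Longrightarrow> t \<in> intw x y \<Longrightarrow> gp c t \<in> intw (cj c x) (cj c y)"
proof (rule intwI)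
  assume a: "emap x" "emap y" "t \<in> intw x y"
  have t: "t \<in> M" using intw_M[OF a(3)] .
  have g1: "gp (- c) \<I> = \<I>" by simp
  show "gp c t \<in> M" using t by simp
  show "cj c y \<I> \<cdot> gp c t = gp c t" "gp c t \<cdot> cj c x \<I> = gp c t"
    unfolding cj_apply g1 using a t by (simp_all add: emap_mult[symmetric] intw_left intw_right)
  show "gp c t \<cdot> cj c x z = cj c y z \<cdot> gp c t" if "z \<in> M" for z
    unfolding cj_apply using a t that by (simp add: emap_mult[symmetric] intw_nat)
qed

lemma endo_or_zero: "x \<in> objs \<Longrightarrow> (endomorphism M x \<and> finite_index M x) \<or> x = (\<lambda>_. 0)"
  unfolding objs_def by auto

lemma cj_objs:
  assumes "x \<in> objs"
  shows "cj c x \<in> objs"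
  using endo_or_zero[OF assms]
proof
  assume x: "endomorphism M x \<and> finite_index M x"
  have "finite_index M (cj c x)" unfolding cj_def
    by (rule finite_index_conj[OF emap_objs[OF assms] _ endo_gp endo_gp gp_inverse]) (use x in auto)
  moreover have "endomorphism M (cj c x)" unfolding cj_def
    using x endo_gp endomorphism_comp by blast
  ultimately show ?thesis unfolding objs_def by blast
next
  assume "x = (\<lambda>_. 0)"
  then have "cj c x = (\<lambda>_. 0)" by (simp add: cj_def fun_eq_iff)
  then show ?thesis unfolding objs_def by blast
qed

text \<open>Apply \<open>gp c\<close> to all inclusions and projections of a decomposition;
  conjugation permutes the words \<open>\<alpha> k\<close> and the words
  \<open>\<alpha> k \<circ> \<rho>\<close>.\<close>

lemma cj_C:
  assumes "x \<in> objs \<inter> SC"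
  shows "cj c x \<in> objs \<inter> SC"
proof -
  obtain xs where xs: "set xs \<subseteq> range \<alpha> \<union> range (\<lambda>g. \<alpha> g \<circ> \<rho>)" "direct_sum (cat UNIV) x xs"
    using assms unfolding SC_def full_sub_UNIV by blast
  obtain a b where ab: "\<And>k. k < length xs \<Longrightarrow> a k \<in> intw (xs ! k) x \<and> b k \<in> intw x (xs ! k)"
    "\<And>k l. k < length xs \<Longrightarrow> l < length xs \<Longrightarrow> b k \<cdot> a l = (if k = l then (xs ! k) \<I> else 0)"
    "(\<Sum>k<length xs. a k \<cdot> b k) = x \<I>"
    using direct_sum_catD(4)[OF xs(2)] by blast
  have e: "emap x" using assms emap_objs by blast
  have xk: "xs ! k \<in> objs" "emap (xs ! k)" if "k < length xs" for k
    using direct_sum_catD(2)[OF xs(2)] nth_mem[OF that] emap_objs by blast+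
  have abM: "a k \<in> M" "b k \<in> M" if "k < length xs" for k using ab(1)[OF that] intw_M by blast+
  have "direct_sum (cat UNIV) (cj c x) (map (cj c) xs)"
  proof (rule direct_sum_catI[of _ _ _ "\<lambda>k. gp c (a k)" "\<lambda>k. gp c (b k)"])
    show "cj c x \<in> objs \<inter> UNIV" using cj_objs assms by blast
    show "set (map (cj c) xs) \<subseteq> objs \<inter> UNIV" using cj_objs direct_sum_catD(2)[OF xs(2)] by auto
    show "gp c (a k) \<in> intw (map (cj c) xs ! k) (cj c x) \<and> gp c (b k) \<in> intw (cj c x) (map (cj c) xs ! k)"
      if "k < length (map (cj c) xs)" for k
      using that ab(1)[of k] xk[of k] e intw_cj by simp
    show "gp c (b k) \<cdot> gp c (a l) = (if k = l then (map (cj c) xs ! k) \<I> else 0)"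
      if "k < length (map (cj c) xs)" "l < length (map (cj c) xs)" for k l
      using that abM[of k] abM[of l] ab(2)[of k l] by (simp add: emap_mult[symmetric] cj_apply)
    have "(\<Sum>k<length xs. gp c (a k) \<cdot> gp c (b k)) = (\<Sum>k<length xs. gp c (a k \<cdot> b k))"
      by (rule sum.cong) (simp_all add: emap_mult abM)
    also have "\<dots> = gp c (\<Sum>k<length xs. a k \<cdot> b k)"
      by (rule emap_sum[THEN conjunct1, symmetric]) (simp_all add: abM)
    finally show "(\<Sum>k<length (map (cj c) xs). gp c (a k) \<cdot> gp c (b k)) = cj c x \<I>"
      by (simp add: ab(3) cj_apply)
  qed
  moreover have "set (map (cj c) xs) \<subseteq> range \<alpha> \<union> range (\<lambda>g. \<alpha> g \<circ> \<rho>)"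
  proof
    fix y assume "y \<in> set (map (cj c) xs)"
    then obtain z where z: "z \<in> set xs" "y = cj c z" by auto
    then obtain k where "z = wd k 0 0 \<or> z = wd k 1 0" using xs(1) unfolding wd_simps by blast
    then have "y = wd (th c k) 0 0 \<or> y = wd (th c k) 1 0" unfolding z(2) using cj_wd by blast
    then show "y \<in> range \<alpha> \<union> range (\<lambda>g. \<alpha> g \<circ> \<rho>)" unfolding wd_simps by blast
  qed
  ultimately show ?thesis using cj_objs assms unfolding SC_def full_sub_UNIV by blast
qed

lemma comp_C: "x \<in> objs \<inter> SC \<Longrightarrow> y \<in> objs \<inter> SC \<Longrightarrow> x \<circ> y \<in> objs \<inter> SC"
proof -
  interpret F: fusion_category "cat SC" using fusion_C unfolding cat_C_eq .
  show "x \<circ> y \<in> objs \<inter> SC" if "x \<in> objs \<inter> SC" "y \<in> objs \<inter> SC"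
    using F.TensO_Obj[of x y] that unfolding Obj_cat by simp
qed

lemma gp_objs: "gp c \<in> objs \<inter> S2"
proof
  have bij: "gp c ` M = M" by (rule gp_image)
  have "finite_index M \<gamma>" using \<gamma>_aut by (rule automorphism_finite_index)
  moreover have "\<gamma> ` M = M" using \<gamma>_aut unfolding automorphism_def bij_betw_def by blast
  ultimately have "finite_index M (gp c)" using finite_index_image[of "gp c" \<gamma>] bij by simp
  then show "gp c \<in> objs" unfolding objs_def using endo_gp by blast
  have g: "\<gamma> \<in> S2" unfolding S2_def
    using \<open>finite_index M \<gamma>\<close> endo_\<gamma> by (intro generated.base) auto
  have one: "id_on M \<in> S2" unfolding S2_def using generated.unit[of "End0 M"] by simp
  have "\<gamma> \<circ> \<gamma> \<in> S2" using g generated.tensor[of \<gamma> "End0 M" _ \<gamma>] unfolding S2_def by simp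
  then show "gp c \<in> S2" using cases_3[of c] g one by (elim disjE) (simp_all add: gp_simps)
qed

text \<open>Finite index depends on the image alone, and \<open>gp c\<close> maps \<open>M\<close>
  onto itself.\<close>

lemma comp_gp_objs:
  assumes "x \<in> objs \<inter> SC"
  shows "x \<circ> gp c \<in> objs \<inter> S2"
proof
  have x: "x \<in> objs" and e: "emap x" using assms emap_objs by blast+
  have gM: "gp c ` M = M" by (rule gp_image)
  show "x \<circ> gp c \<in> objs"
    using endo_or_zero[OF x]
  proof
    assume h: "endomorphism M x \<and> finite_index M x"
    have "(x \<circ> gp c) ` M = x ` M" using gM by (simp only: image_comp[symmetric])
    then have "finite_index M (x \<circ> gp c)" using h finite_index_image by blast
    then show ?thesis unfolding objs_def using h endo_gp endomorphism_comp by blast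
  next
    assume "x = (\<lambda>_. 0)"
    then have "x \<circ> gp c = (\<lambda>_. 0)" by (simp add: fun_eq_iff)
    then show ?thesis unfolding objs_def by blast
  qed
  have "x \<in> S2" unfolding S2_def cat_C_eq
    using assms by (intro generated.base) (auto simp: Obj_cat objs_def)
  then show "x \<circ> gp c \<in> S2"
    using gp_objs[of c] generated.tensor[of x "End0 M" _ "gp c"] unfolding S2_def by simp
qed

text \<open>Moving \<open>\<gamma>\<^sup>c\<close> to the right end, at the price of conjugating
  \<open>y\<close>, leaves a composite of objects of C. These are closed under composition because C
  is monoidal, which settles the finite index of the composite.\<close>

lemma sandwich_objs:
  assumes "x \<in> objs \<inter> SC" "y \<in> objs \<inter> SC"
  shows "x \<circ> W i \<circ> y \<in> objs \<inter> S2"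
proof -
  obtain k e c where i: "i = (k, e, c)" "W i = wd k (of_bool e) c" by (rule W_cases)
  have e: "emap y" using assms emap_objs by blast
  have "x \<circ> W i \<circ> y = x \<circ> wd k (of_bool e) 0 \<circ> (gp c \<circ> y)"
    unfolding i(2) wd_gp[of k _ c, symmetric] by (simp only: comp_assoc)
  also have "\<dots> = (x \<circ> wd k (of_bool e) 0 \<circ> cj c y) \<circ> gp c"
    unfolding cj_gp[OF e, symmetric] by (simp only: comp_assoc)
  finally show ?thesis
    using comp_gp_objs[OF comp_C[OF comp_C[OF assms(1) wd_0_objs] cj_C[OF assms(2)]]] by simp
qed

lemma id_on_C: "id_on M \<in> objs \<inter> SC"
  using wd_0_objs[of 0 0] wd_simps(4) by simp

lemma W_objs: "W i \<in> objs \<inter> S2"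
  using sandwich_objs[OF id_on_C id_on_C, of i] by (simp add: comp_id_on emap_comp emap_id_on)

end

section \<open>Equivalences and Gram matrices\<close>

text \<open>Links a category given as a record with an operator category: \<open>tag\<close> adds
  source and target to an operator, \<open>opr\<close> forgets them.\<close>

locale represented = opcat ob H I
  for ob :: "'p set" and H :: "'p \<Rightarrow> 'p \<Rightarrow> ('h::complex_hilbert_space \<Rightarrow>\<^sub>L 'h) set" and I +
  fixes C :: "('p, 'm, 'z) lincat_scheme" and tag :: "'p \<Rightarrow> 'p \<Rightarrow> ('h \<Rightarrow>\<^sub>L 'h) \<Rightarrow> 'm" and opr :: "'m \<Rightarrow> 'h \<Rightarrow>\<^sub>L 'h"
  assumes Obj_rep: "Obj C = ob"
    and Hom_rep: "p \<in> ob \<Longrightarrow> q \<in> ob \<Longrightarrow> Hom C p q = tag p q ` H p q"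
    and opr_tag: "opr (tag p q t) = t"
    and Ident_rep: "p \<in> ob \<Longrightarrow> Ident C p = tag p p (I p)"
    and Comp_rep: "Comp C (tag q r s) (tag p q t) = tag p r (s \<cdot> t)"
    and Add_rep: "Add C (tag p q s) (tag p q t) = tag p q (s + t)"
    and Scal_rep: "Scal C c (tag p q t) = tag p q (op_scale c t)"

text \<open>The effect of an equivalence on operators. Of essential surjectivity only a split
  epimorphism \<open>w\<close> from \<open>F p\<close> is kept, which is enough to transport
  generators.\<close>

lemma equivalence_opcat:
  assumes D: "represented obD HD ID D tagD opD" and E: "represented obE HE IE E tagE opE"
    and eq: "category_equivalence D E F \<Phi>"
  obtains \<psi> where "\<And>p q. p \<in> obD \<Longrightarrow> q \<in> obD \<Longrightarrow> bij_betw (\<psi> p q) (HD p q) (HE (F p) (F q))"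
    "\<And>p q s t. p \<in> obD \<Longrightarrow> q \<in> obD \<Longrightarrow> s \<in> HD p q \<Longrightarrow> t \<in> HD p q \<Longrightarrow> \<psi> p q (s + t) = \<psi> p q s + \<psi> p q t"
    "\<And>p q t c. p \<in> obD \<Longrightarrow> q \<in> obD \<Longrightarrow> t \<in> HD p q \<Longrightarrow> \<psi> p q (op_scale c t) = op_scale c (\<psi> p q t)"
    "\<And>p q r s t. p \<in> obD \<Longrightarrow> q \<in> obD \<Longrightarrow> r \<in> obD \<Longrightarrow> t \<in> HD p q \<Longrightarrow> s \<in> HD q r \<Longrightarrow>
        \<psi> p r (s \<cdot> t) = \<psi> q r s \<cdot> \<psi> p q t"
    "\<And>p. p \<in> obD \<Longrightarrow> F p \<in> obE"
    "\<And>z. z \<in> obE \<Longrightarrow> \<exists>p\<in>obD. \<exists>w \<in> HE (F p) z. \<exists>w' \<in> HE z (F p). w \<cdot> w' = IE z"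
proof -
  interpret D: represented obD HD ID D tagD opD by (fact D)
  interpret E: represented obE HE IE E tagE opE by (fact E)
  have lf: "linear_functor D E F \<Phi>"
    and bij: "\<And>x y. x \<in> obD \<Longrightarrow> y \<in> obD \<Longrightarrow> bij_betw \<Phi> (Hom D x y) (Hom E (F x) (F y))"
    and ess: "\<And>z. z \<in> obE \<Longrightarrow> \<exists>x\<in>obD. isomorphic E (F x) z"
    using eq unfolding category_equivalence_def D.Obj_rep E.Obj_rep by blast+
  note lf = lf[unfolded linear_functor_def D.Obj_rep E.Obj_rep]
  have F: "F p \<in> obE" if "p \<in> obD" for p using lf[THEN conjunct1] that by blast
  note lf = lf[THEN conjunct2]
  have sc: "\<Phi> (Scal D c f) = Scal E c (\<Phi> f)" if "f \<in> Hom D x y" for c f x y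
    using lf[THEN conjunct1] that by blast
  note lf = lf[THEN conjunct2]
  have add: "\<Phi> (Add D f g) = Add E (\<Phi> f) (\<Phi> g)" if "f \<in> Hom D x y" "g \<in> Hom D x y" for f g x y
    using lf[THEN conjunct1] that by blast
  have comp: "\<Phi> (Comp D g f) = Comp E (\<Phi> g) (\<Phi> f)" if "f \<in> Hom D x y" "g \<in> Hom D y z" for f g x y z
    using lf[THEN conjunct2] that by blast
  have tag_inj: "u = v" if "tagE p q u = tagE p q v" for p q u v
    using arg_cong[OF that, of opE] unfolding E.opr_tag .
  define \<psi> where "\<psi> p q t = opE (\<Phi> (tagD p q t))" for p q t
  have \<psi>: "\<Phi> (tagD p q t) = tagE (F p) (F q) (\<psi> p q t)" "\<psi> p q t \<in> HE (F p) (F q)"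
    if "p \<in> obD" "q \<in> obD" "t \<in> HD p q" for p q t
  proof -
    have "\<Phi> (tagD p q t) \<in> Hom E (F p) (F q)"
      using bij[OF that(1,2)] that unfolding D.Hom_rep[OF that(1,2)] by (auto simp: bij_betw_def)
    then show "\<Phi> (tagD p q t) = tagE (F p) (F q) (\<psi> p q t)" "\<psi> p q t \<in> HE (F p) (F q)"
      unfolding E.Hom_rep[OF F[OF that(1)] F[OF that(2)]] \<psi>_def by (auto simp: E.opr_tag)
  qed
  have tH: "tagD p q t \<in> Hom D p q" if "p \<in> obD" "q \<in> obD" "t \<in> HD p q" for p q t
    using that D.Hom_rep by blast
  have "bij_betw (\<psi> p q) (HD p q) (HE (F p) (F q))" if pq: "p \<in> obD" "q \<in> obD" for p q
  proof (rule bij_betwI')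
    fix s t assume st: "s \<in> HD p q" "t \<in> HD p q"
    show "(\<psi> p q s = \<psi> p q t) = (s = t)"
    proof
      assume "\<psi> p q s = \<psi> p q t"
      then have "\<Phi> (tagD p q s) = \<Phi> (tagD p q t)" using \<psi>(1)[OF pq] st by simp
      then have "tagD p q s = tagD p q t"
        using bij[OF pq] tH[OF pq] st unfolding bij_betw_def inj_on_def by blast
      then have "opD (tagD p q s) = opD (tagD p q t)" by simp
      then show "s = t" unfolding D.opr_tag .
    qed simp
  next
    show "\<psi> p q t \<in> HE (F p) (F q)" if "t \<in> HD p q" for t using \<psi>(2)[OF pq that] .
  next
    fix u assume "u \<in> HE (F p) (F q)"
    then have "tagE (F p) (F q) u \<in> \<Phi> ` Hom D p q"
      using bij[OF pq] E.Hom_rep[OF F[OF pq(1)] F[OF pq(2)]] by (simp add: bij_betw_def)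
    then obtain t where t: "t \<in> HD p q" "tagE (F p) (F q) u = \<Phi> (tagD p q t)"
      unfolding D.Hom_rep[OF pq] by auto
    then have "opE (tagE (F p) (F q) u) = opE (tagE (F p) (F q) (\<psi> p q t))" using \<psi>(1)[OF pq t(1)] by simp
    then have "u = \<psi> p q t" unfolding E.opr_tag .
    then show "\<exists>t\<in>HD p q. u = \<psi> p q t" using t(1) by blast
  qed
  moreover have "\<psi> p q (s + t) = \<psi> p q s + \<psi> p q t"
    if "p \<in> obD" "q \<in> obD" "s \<in> HD p q" "t \<in> HD p q" for p q s t
    using add[OF tH[OF that(1,2,3)] tH[OF that(1,2,4)]]
    unfolding D.Add_rep \<psi>(1)[OF that(1,2,3)] \<psi>(1)[OF that(1,2,4)] \<psi>(1)[OF that(1,2) D.H_add[OF that]]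
      E.Add_rep by (rule tag_inj)
  moreover have "\<psi> p q (op_scale c t) = op_scale c (\<psi> p q t)"
    if "p \<in> obD" "q \<in> obD" "t \<in> HD p q" for p q t c
    using sc[OF tH[OF that], of c]
    unfolding D.Scal_rep \<psi>(1)[OF that] \<psi>(1)[OF that(1,2) D.H_scale[OF that]] E.Scal_rep by (rule tag_inj)
  moreover have "\<psi> p r (s \<cdot> t) = \<psi> q r s \<cdot> \<psi> p q t"
    if "p \<in> obD" "q \<in> obD" "r \<in> obD" "t \<in> HD p q" "s \<in> HD q r" for p q r s t
    using comp[OF tH[OF that(1,2,4)] tH[OF that(2,3,5)]]
    unfolding D.Comp_rep \<psi>(1)[OF that(1,2,4)] \<psi>(1)[OF that(2,3,5)]
      \<psi>(1)[OF that(1,3) D.H_mult[OF that(1,2,3,5,4)]] E.Comp_rep by (rule tag_inj)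
  moreover have "\<exists>p\<in>obD. \<exists>w \<in> HE (F p) z. \<exists>w' \<in> HE z (F p). w \<cdot> w' = IE z" if z: "z \<in> obE" for z
  proof -
    obtain p where p: "p \<in> obD" "isomorphic E (F p) z" using ess[OF z] by blast
    then obtain f g where f: "f \<in> Hom E (F p) z" and fg: "inverse_arrows E f g"
      unfolding isomorphic_def iso_arrow_def by blast
    have "Src E f = F p" "Tgt E f = z" using f unfolding Hom_def by simp_all
    then have g: "g \<in> Hom E z (F p)" "Comp E f g = Ident E z" using fg unfolding inverse_arrows_def by auto
    obtain w w' where w: "w \<in> HE (F p) z" "f = tagE (F p) z w" "w' \<in> HE z (F p)" "g = tagE z (F p) w'"
      using f g(1) unfolding E.Hom_rep[OF F[OF p(1)] z] E.Hom_rep[OF z F[OF p(1)]] by blast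
    have "tagE z z (w \<cdot> w') = tagE z z (IE z)"
      using g(2) unfolding w(2,4) by (simp add: E.Comp_rep E.Ident_rep[OF z])
    then have "opE (tagE z z (w \<cdot> w')) = opE (tagE z z (IE z))" by simp
    then have "w \<cdot> w' = IE z" unfolding E.opr_tag .
    then show ?thesis using p(1) w by blast
  qed
  ultimately show thesis using F by (intro that[of \<psi>])
qed

text \<open>What remains of a category for counting: \<open>m\<close> holds the Hom dimensions of a
  generating family, \<open>n i s\<close> the multiplicity of the simple class \<open>s\<close> in
  the member \<open>i\<close>, and every class occurs somewhere.\<close>

definition gram :: "'s set \<Rightarrow> ('i \<Rightarrow> 's \<Rightarrow> nat) \<Rightarrow> ('i \<Rightarrow> 'i \<Rightarrow> nat) \<Rightarrow> bool" where
  "gram S n m \<longleftrightarrow> finite S \<and> (\<forall>i j. (\<Sum>s\<in>S. n i s * n j s) = m i j) \<and> (\<forall>s\<in>S. \<exists>i. 0 < n i s)"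

definition (in opcat) gram_family :: "('i \<Rightarrow> 'p) \<Rightarrow> ('i \<Rightarrow> 'i \<Rightarrow> nat) \<Rightarrow> bool" where
  "gram_family P m \<longleftrightarrow> (\<forall>i. P i \<in> ob) \<and> (\<forall>i j. cdim (H (P i) (P j)) (m i j)) \<and> generating P UNIV"

theorem equivalence_gram:
  fixes PD :: "'i::finite \<Rightarrow> 'p" and PE :: "'j::finite \<Rightarrow> 'q"
    and HD :: "'p \<Rightarrow> 'p \<Rightarrow> ('h::complex_hilbert_space \<Rightarrow>\<^sub>L 'h) set"
    and HE :: "'q \<Rightarrow> 'q \<Rightarrow> ('h \<Rightarrow>\<^sub>L 'h) set"
  assumes D: "represented obD HD ID D tagD opD" and E: "represented obE HE IE E tagE opE"
    and reg: "regular_opcat obE HE IE" and eq: "category_equivalence D E F \<Phi>"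
    and PD: "opcat.gram_family obD HD PD mD" and PE: "opcat.gram_family obE HE PE mE"
  shows "\<exists>(S :: (('j + 'i) \<times> nat) set set) nD nE. gram S nD mD \<and> gram S nE mE"
proof -
  interpret D: represented obD HD ID D tagD opD by (fact D)
  interpret E: represented obE HE IE E tagE opE by (fact E)
  interpret R: regular_opcat obE HE IE by (fact reg)
  obtain \<psi> where bij: "\<And>p q. p \<in> obD \<Longrightarrow> q \<in> obD \<Longrightarrow> bij_betw (\<psi> p q) (HD p q) (HE (F p) (F q))"
    and add: "\<And>p q s t. p \<in> obD \<Longrightarrow> q \<in> obD \<Longrightarrow> s \<in> HD p q \<Longrightarrow> t \<in> HD p q \<Longrightarrow> \<psi> p q (s + t) = \<psi> p q s + \<psi> p q t"
    and sc: "\<And>p q t c. p \<in> obD \<Longrightarrow> q \<in> obD \<Longrightarrow> t \<in> HD p q \<Longrightarrow> \<psi> p q (op_scale c t) = op_scale c (\<psi> p q t)"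
    and mult: "\<And>p q r s t. p \<in> obD \<Longrightarrow> q \<in> obD \<Longrightarrow> r \<in> obD \<Longrightarrow> t \<in> HD p q \<Longrightarrow> s \<in> HD q r \<Longrightarrow>
        \<psi> p r (s \<cdot> t) = \<psi> q r s \<cdot> \<psi> p q t"
    and F: "\<And>p. p \<in> obD \<Longrightarrow> F p \<in> obE"
    and ess: "\<And>z. z \<in> obE \<Longrightarrow> \<exists>p\<in>obD. \<exists>w \<in> HE (F p) z. \<exists>w' \<in> HE z (F p). w \<cdot> w' = IE z"
    by (rule equivalence_opcat[OF D E eq]) (rule that; assumption)
  have PDo: "PD i \<in> obD" "cdim (HD (PD i) (PD j)) (mD i j)" and Dgen: "D.generating PD UNIV" for i j
    using PD unfolding D.gram_family_def by simp_all
  have PEo: "PE i \<in> obE" "cdim (HE (PE i) (PE j)) (mE i j)" and Egen: "E.generating PE UNIV" for i j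
    using PE unfolding E.gram_family_def by simp_all
  \<comment> \<open>Both families are resolved together inside the regular category, that of
    \<open>D\<close> after transport by \<open>F\<close>; the classes of their bricks form the one
    set \<open>S\<close>.\<close>
  define Q where "Q = case_sum PE (F \<circ> PD)"
  have QI: "Q (Inl j) = PE j" and QJ: "Q (Inr i) = F (PD i)" for i j unfolding Q_def by simp_all
  have Qo: "Q x \<in> obE" for x by (cases x) (simp_all add: QI QJ PEo F PDo)
  have dJ: "cdim (HE (Q (Inr i)) (Q (Inr j))) (mD i j)" for i j
    unfolding QJ by (rule cdim_bij[OF PDo(2) bij[OF PDo(1) PDo(1), of i j]]) (simp_all add: add sc PDo(1))
  have dI: "cdim (HE (Q (Inl i)) (Q (Inl j))) (mE i j)" for i j
    unfolding QI by (rule PEo(2))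
  have "\<exists>d. cdim (HE (Q x) (Q x)) d" for x by (cases x) (use dI dJ in blast)+
  then obtain S :: "(('j + 'i) \<times> nat) set set" and n where S: "finite S"
    and dim: "\<And>x y. cdim (HE (Q x) (Q y)) (\<Sum>s\<in>S. n x s * n y s)"
    and cover: "\<And>J s. E.generating Q J \<Longrightarrow> s \<in> S \<Longrightarrow> \<exists>j\<in>J. 0 < n j s"
  proof -
    obtain S :: "(('j + 'i) \<times> nat) set set" and n where S: "finite S"
        "\<forall>i\<in>UNIV. \<forall>j\<in>UNIV. cdim (HE (Q i) (Q j)) (\<Sum>s\<in>S. n i s * n j s)"
        "\<forall>J. J \<subseteq> UNIV \<and> E.generating Q J \<longrightarrow> (\<forall>s\<in>S. \<exists>j\<in>J. 0 < n j s)"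
      using R.gram_decomposition[of UNIV Q] Qo \<open>\<And>x. \<exists>d. cdim (HE (Q x) (Q x)) d\<close> by auto
    show thesis by (rule that[of S n]) (use S in simp_all)
  qed
  have genE: "E.generating Q (range Inl)"
    using Egen unfolding E.generating_def by (simp add: QI)
  \<comment> \<open>A nonzero \<open>f\<close> stays nonzero between a split epimorphism
    \<open>w\<close> and a split monomorphism \<open>v'\<close>. It is thus seen between objects
    \<open>F p\<close> and \<open>F q\<close>, where fullness turns it into an arrow of
    \<open>D\<close>.\<close>
  have genD: "E.generating Q (range Inr)"
    unfolding E.generating_def
  proof (intro ballI impI)
    fix y z f assume y: "y \<in> obE" and z: "z \<in> obE" and f: "f \<in> HE y z" "f \<noteq> 0"
    obtain p w w' where p: "p \<in> obD" "w \<in> HE (F p) y" "w' \<in> HE y (F p)" "w \<cdot> w' = IE y" using ess[OF y] by blast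
    obtain q v v' where q: "q \<in> obD" "v \<in> HE (F q) z" "v' \<in> HE z (F q)" "v \<cdot> v' = IE z" using ess[OF z] by blast
    have g: "v' \<cdot> (f \<cdot> w) \<in> HE (F p) (F q)"
      using E.H_mult[OF F[OF p(1)] z F[OF q(1)] q(3) E.H_mult[OF F[OF p(1)] y z f(1) p(2)]] .
    then obtain g' where g': "g' \<in> HD p q" "\<psi> p q g' = v' \<cdot> (f \<cdot> w)"
      using bij[OF p(1) q(1)] unfolding bij_betw_def by (metis imageE)
    have "g' \<noteq> 0"
    proof
      assume "g' = 0"
      then have "v' \<cdot> (f \<cdot> w) = 0" using sc[OF p(1) q(1) g'(1), of 0] g'(2) by simp
      then have "v \<cdot> ((v' \<cdot> (f \<cdot> w)) \<cdot> w') = 0" by simp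
      then have "IE z \<cdot> (f \<cdot> IE y) = 0" using op_reassoc[OF q(4)] p(4) by (simp add: op_assoc)
      then show False using f E.I_left[OF y z f(1)] E.I_right[OF y z f(1)] by simp
    qed
    then obtain i t where t: "t \<in> HD (PD i) p" "g' \<cdot> t \<noteq> 0"
      using Dgen p(1) q(1) g'(1) unfolding D.generating_def by blast
    let ?u = "\<psi> (PD i) p t"
    have u: "?u \<in> HE (F (PD i)) (F p)" using bij[OF PDo(1) p(1)] t(1) unfolding bij_betw_def by blast
    have gt: "g' \<cdot> t \<in> HD (PD i) q" using D.H_mult[OF PDo(1) p(1) q(1) g'(1) t(1)] .
    have "\<psi> (PD i) q (g' \<cdot> t) \<noteq> 0"
    proof
      assume z: "\<psi> (PD i) q (g' \<cdot> t) = 0"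
      have "\<psi> (PD i) q 0 = 0" using sc[OF PDo(1) q(1) gt, of 0] by simp
      then have "g' \<cdot> t = 0"
        using z bij[OF PDo(1) q(1)] gt D.H_0[OF PDo(1) q(1)] unfolding bij_betw_def inj_on_def by metis
      then show False using t(2) by simp
    qed
    then have "(v' \<cdot> (f \<cdot> w)) \<cdot> ?u \<noteq> 0" using mult[OF PDo(1) p(1) q(1) t(1) g'(1)] g'(2) by simp
    then have "f \<cdot> (w \<cdot> ?u) \<noteq> 0" by (auto simp: op_assoc)
    moreover have "w \<cdot> ?u \<in> HE (Q (Inr i)) y" unfolding QJ
      using E.H_mult[OF F[OF PDo(1)] F[OF p(1)] y p(2) u] .
    ultimately show "\<exists>j\<in>range Inr. \<exists>t\<in>HE (Q j) y. f \<cdot> t \<noteq> 0" by blast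
  qed
  have "gram S (n \<circ> Inr) mD"
    unfolding gram_def using S cdim_unique[OF dim dJ] cover[OF genD] by auto
  moreover have "gram S (n \<circ> Inl) mE"
    unfolding gram_def using S cdim_unique[OF dim dI] cover[OF genE] by auto
  ultimately show ?thesis by blast
qed

section \<open>Bimodules over an algebra of endomorphisms\<close>

lemma lincat_sel_extend [simp]:
  "Obj (lincat.extend C f) = Obj C" "Arr (lincat.extend C f) = Arr C"
  "Src (lincat.extend C f) = Src C" "Tgt (lincat.extend C f) = Tgt C" "Ident (lincat.extend C f) = Ident C"
  "Comp (lincat.extend C f) = Comp C" "Add (lincat.extend C f) = Add C" "Scal (lincat.extend C f) = Scal C"
  "Zero (lincat.extend C f) = Zero C"
  by (simp_all add: lincat.extend_def)

lemma Hom_extend [simp]: "Hom (lincat.extend C f) = Hom C"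
  unfolding Hom_def by (simp add: fun_eq_iff)

lemma sel_structured [simp]:
  "Obj (structured C Obs U P) = Obs" "Ident (structured C Obs U P) p = (p, Ident C (U p), p)"
  "Comp (structured C Obs U P) (q, g, r) (p, f, q') = (p, Comp C g f, r)"
  "Add (structured C Obs U P) (p, f, q) (p', g, q') = (p, Add C f g, q)"
  "Scal (structured C Obs U P) c (p, f, q) = (p, Scal C c f, q)"
  "Zero (structured C Obs U P) p q = (p, Zero C (U p) (U q), q)"
  by (simp_all add: structured_def)

lemma Hom_structured:
  "Hom (structured C Obs U P) p q =
    (if p \<in> Obs \<and> q \<in> Obs then (\<lambda>f. (p, f, q)) ` {f \<in> Hom C (U p) (U q). P p q f} else {})"
  unfolding Hom_def structured_def by auto

text \<open>The algebra axioms as operator equations. Between unital maps, tensoring with an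
  identity on the right leaves an operator unchanged, and tensoring with the identity of
  \<open>a\<close> on the left applies \<open>a\<close>; associators and unit constraints have
  operator \<open>\<I>\<close>.\<close>

locale op_algebra = vN_algebra M
  for M :: "('h::complex_hilbert_space \<Rightarrow>\<^sub>L 'h) set" +
  fixes S :: "'h endo set" and a :: "'h endo" and m e :: "'h \<Rightarrow>\<^sub>L 'h"
  assumes id_obj: "id_on M \<in> objs \<inter> S" and a_obj: "a \<in> objs \<inter> S" and aa_obj: "a \<circ> a \<in> objs \<inter> S"
    and a_one [simp]: "a \<I> = \<I>"
    and m: "m \<in> intw (a \<circ> a) a" and e: "e \<in> intw (id_on M) a"
    and mm: "m \<cdot> m = m \<cdot> a m" and me: "m \<cdot> e = \<I>" and mae: "m \<cdot> a e = \<I>"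

lemma (in vN_algebra) op_algebraI:
  assumes alg: "algebra_in (cat S) (a, m0, e0)" and one: "a \<I> = \<I>"
  obtains m e where "m0 = (a \<circ> a, m, a)" "e0 = (id_on M, e, a)" "op_algebra M S a m e"
proof -
  have a: "a \<in> objs \<inter> S" using alg by (simp add: Obj_cat del: lincat_sel_full_sub(1))
  then have ea: "emap a" using emap_objs by blast
  have m0: "m0 \<in> Hom (cat S) (a \<circ> a) a" and e0: "e0 \<in> Hom (cat S) (id_on M) a" using alg by simp_all
  obtain m where m: "a \<circ> a \<in> objs \<inter> S" "m \<in> intw (a \<circ> a) a" "m0 = (a \<circ> a, m, a)" using m0 by (rule Hom_catE)
  obtain e where e: "id_on M \<in> objs \<inter> S" "e \<in> intw (id_on M) a" "e0 = (id_on M, e, a)" using e0 by (rule Hom_catE)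
  have id1: "id_on M \<I> = \<I>" by (simp add: id_on_def)
  have "m \<cdot> m = m \<cdot> a m" "m \<cdot> e = \<I>" "m \<cdot> a e = \<I>"
    using alg unfolding m(3) e(3) by (simp_all add: one id1)
  then have "op_algebra M S a m e"
    using a m e one vN_algebra_axioms unfolding op_algebra_def op_algebra_axioms_def by blast
  then show thesis using m(3) e(3) by (intro that)
qed

context op_algebra begin

lemma emap_a [simp]: "emap a" and m_M [simp]: "m \<in> M" and e_M [simp]: "e \<in> M"
  using a_obj emap_objs intw_M[OF m] intw_M[OF e] by blast+

lemma m_nat: "z \<in> M \<Longrightarrow> m \<cdot> a (a z) = a z \<cdot> m"
  using intw_nat[OF m] by simp

lemma e_nat: "z \<in> M \<Longrightarrow> e \<cdot> z = a z \<cdot> e"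
  using intw_nat[OF e] by (simp add: id_on_def)

abbreviation alg :: "'h endo \<times> 'h intertwiner \<times> 'h intertwiner" where
  "alg \<equiv> (a, (a \<circ> a, m, a), (id_on M, e, a))"

text \<open>The unit axiom has \<open>X \<I>\<close> in place of \<open>\<I>\<close> because the
  underlying object of a module may be zero.\<close>

definition lmod :: "'h endo \<Rightarrow> ('h \<Rightarrow>\<^sub>L 'h) \<Rightarrow> bool" where
  "lmod X l \<longleftrightarrow> l \<in> intw (a \<circ> X) X \<and> l \<cdot> m = l \<cdot> a l \<and> l \<cdot> e = X \<I>"

definition rmod :: "'h endo \<Rightarrow> ('h \<Rightarrow>\<^sub>L 'h) \<Rightarrow> bool" where
  "rmod X r \<longleftrightarrow> r \<in> intw (X \<circ> a) X \<and> r \<cdot> r = r \<cdot> X m \<and> r \<cdot> X e = X \<I>"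

lemma left_module_iff:
  "left_module (cat S) alg (X, L) \<longleftrightarrow> X \<in> objs \<inter> S \<and> a \<circ> X \<in> objs \<inter> S \<and> (\<exists>l. L = (a \<circ> X, l, X) \<and> lmod X l)"
proof -
  have "left_module (cat S) alg (X, (a \<circ> X, l, X)) \<longleftrightarrow> lmod X l"
    if X: "X \<in> objs \<inter> S" and aX: "a \<circ> X \<in> objs \<inter> S" and l: "l \<in> intw (a \<circ> X) X" for l
  proof -
    have eX: "emap X" using X emap_objs by blast
    have eaX: "emap (a \<circ> X)" using eX by (simp add: emap_comp)
    have lM: "l \<in> M" and XM: "X \<I> \<in> M" using intw_M[OF l] eX by simp_all
    have la: "l \<cdot> a (X \<I>) = l" "l \<cdot> (a (X \<I>) \<cdot> s) = l \<cdot> s" for s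
      using intw_right[OF eaX l] intw_right2[OF eaX l] by simp_all
    have 1: "l \<cdot> (m \<cdot> a (a (X \<I>))) = l \<cdot> m" using m_nat[OF XM] la by simp
    have "a l \<cdot> a (a (X \<I>)) = a l" using la(1) lM XM by (simp add: emap_mult[symmetric])
    then have 2: "l \<cdot> (a l \<cdot> a (a (X \<I>))) = l \<cdot> a l" by simp
    have 3: "l \<cdot> (e \<cdot> X \<I>) = l \<cdot> e" using e_nat[OF XM] la by simp
    have XX: "id_on M (X \<I>) = X \<I>" "id_on M \<circ> X = X" using XM comp_id_on[OF eX] by (simp_all add: id_on_def)
    show ?thesis unfolding lmod_def using X aX l
      by (simp add: Obj_cat XX comp_assoc 1 2 3 del: lincat_sel_full_sub(1))
  qed
  moreover have "X \<in> objs \<inter> S \<and> a \<circ> X \<in> objs \<inter> S \<and> (\<exists>l \<in> intw (a \<circ> X) X. L = (a \<circ> X, l, X))"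
    if "left_module (cat S) alg (X, L)"
  proof -
    have "L \<in> Hom (cat S) (a \<circ> X) X" using that by simp
    then show ?thesis using Hom_catD by blast
  qed
  ultimately show ?thesis unfolding lmod_def by blast
qed

lemma right_module_iff:
  "right_module (cat S) alg (X, R) \<longleftrightarrow> X \<in> objs \<inter> S \<and> X \<circ> a \<in> objs \<inter> S \<and> (\<exists>r. R = (X \<circ> a, r, X) \<and> rmod X r)"
proof -
  have "right_module (cat S) alg (X, (X \<circ> a, r, X)) \<longleftrightarrow> rmod X r"
    if X: "X \<in> objs \<inter> S" and Xa: "X \<circ> a \<in> objs \<inter> S" and r: "r \<in> intw (X \<circ> a) X" for r
  proof -
    have eX: "emap X" using X emap_objs by blast
    have rM: "r \<in> M" using intw_M[OF r] by simp
    have rX: "r \<cdot> X \<I> = r" "r \<cdot> (X \<I> \<cdot> s) = r \<cdot> s" for s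
      using intw_right[OF _ r] intw_right2[OF _ r] eX by (simp_all add: emap_comp)
    have 1: "X \<I> \<cdot> X m = X m" "X m \<cdot> X \<I> = X m" "X \<I> \<cdot> X e = X e" using eX by (simp_all add: emap_one_mult)
    have XX: "X \<circ> id_on M = X" using comp_id_on[OF eX] by simp
    show ?thesis unfolding rmod_def using X Xa r
      by (simp add: Obj_cat XX comp_assoc 1 rX del: lincat_sel_full_sub(1))
  qed
  moreover have "X \<in> objs \<inter> S \<and> X \<circ> a \<in> objs \<inter> S \<and> (\<exists>r \<in> intw (X \<circ> a) X. R = (X \<circ> a, r, X))"
    if "right_module (cat S) alg (X, R)"
  proof -
    have "R \<in> Hom (cat S) (X \<circ> a) X" using that by simp
    then show ?thesis using Hom_catD by blast
  qed
  ultimately show ?thesis unfolding rmod_def by blast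
qed

definition bim :: "'h endo \<Rightarrow> ('h \<Rightarrow>\<^sub>L 'h) \<Rightarrow> ('h \<Rightarrow>\<^sub>L 'h) \<Rightarrow> bool" where
  "bim X l r \<longleftrightarrow> lmod X l \<and> rmod X r \<and> r \<cdot> l = l \<cdot> a r"

definition mk :: "'h endo \<Rightarrow> ('h \<Rightarrow>\<^sub>L 'h) \<Rightarrow> ('h \<Rightarrow>\<^sub>L 'h) \<Rightarrow> 'h endo \<times> 'h intertwiner \<times> 'h intertwiner" where
  "mk X l r = (X, (a \<circ> X, l, X), (X \<circ> a, r, X))"

lemma bimodule_iff:
  "bimodule (cat S) alg p \<longleftrightarrow> (\<exists>X l r. p = mk X l r \<and> X \<in> objs \<inter> S \<and> a \<circ> X \<in> objs \<inter> S \<and> X \<circ> a \<in> objs \<inter> S \<and> bim X l r)"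
proof -
  obtain X L R where p: "p = (X, L, R)" by (cases p)
  have "Comp (cat S) (X \<circ> a, r, X) (TensM (cat S) (a \<circ> X, l, X) (Ident (cat S) a)) =
      Comp (cat S) (a \<circ> X, l, X) (Comp (cat S) (TensM (cat S) (Ident (cat S) a) (X \<circ> a, r, X)) (Assoc (cat S) a X a))
      \<longleftrightarrow> r \<cdot> l = l \<cdot> a r"
    if X: "X \<in> objs \<inter> S" and l: "l \<in> intw (a \<circ> X) X" and r: "r \<in> intw (X \<circ> a) X" for l r
  proof -
    have eX: "emap X" using X emap_objs by blast
    have M: "l \<in> M" "r \<in> M" "X \<I> \<in> M" using intw_M[OF l] intw_M[OF r] eX by simp_all
    have 1: "r \<cdot> X \<I> = r" "l \<cdot> a (X \<I>) = l" using intw_right[OF _ r] intw_right[OF _ l] eX by (simp_all add: emap_comp)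
    then have 2: "a r \<cdot> a (X \<I>) = a r" using M by (simp add: emap_mult[symmetric])
    show ?thesis by (simp add: comp_assoc 1 2)
  qed
  then show ?thesis unfolding p mk_def bimodule.simps left_module_iff right_module_iff bim_def lmod_def rmod_def
    by auto
qed

definition bobj where "bobj p = fst p"
definition lact where "lact p = fst (snd (fst (snd p)))"
definition ract where "ract p = fst (snd (snd (snd p)))"

lemma mk_sel [simp]: "bobj (mk X l r) = X" "lact (mk X l r) = l" "ract (mk X l r) = r" "fst (mk X l r) = X"
  by (simp_all add: mk_def bobj_def lact_def ract_def)

definition bims :: "('h endo \<times> 'h intertwiner \<times> 'h intertwiner) set" where
  "bims = {p. bimodule (cat S) alg p}"

lemma bimsD:
  assumes "p \<in> bims"
  shows "bobj p \<in> objs \<inter> S" "emap (bobj p)" "bim (bobj p) (lact p) (ract p)" "p = mk (bobj p) (lact p) (ract p)" "fst p = bobj p"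
proof -
  obtain X l r where "p = mk X l r" "X \<in> objs \<inter> S" "bim X l r"
    using assms unfolding bims_def mem_Collect_eq bimodule_iff by blast
  then show "bobj p \<in> objs \<inter> S" "emap (bobj p)" "bim (bobj p) (lact p) (ract p)" "p = mk (bobj p) (lact p) (ract p)" "fst p = bobj p"
    using emap_objs by auto
qed

definition bhom :: "_ \<Rightarrow> _ \<Rightarrow> ('h \<Rightarrow>\<^sub>L 'h) set" where
  "bhom p q = {t \<in> intw (bobj p) (bobj q). t \<cdot> lact p = lact q \<cdot> a t \<and> t \<cdot> ract p = ract q \<cdot> t}"

lemma opcat_bims: "opcat bims bhom (\<lambda>p. bobj p \<I>)"
proof (rule opcat.intro)
  fix p q assume p: "p \<in> bims" and q: "q \<in> bims"
  note p' = bimsD[OF p] and q' = bimsD[OF q]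
  have lq: "lact q \<in> bounded_ops" "ract q \<in> bounded_ops"
    using q'(3) intw_M M_bounded_ops unfolding bim_def lmod_def rmod_def by blast+
  show "cvs.subspace (bhom p q)" unfolding cvs.subspace_def bhom_def
    using intw_M by (auto simp: intw_0 intw_add[OF q'(2)] intw_scale[OF q'(2)] op_distribs emap_add emap_scale
        op_scale_left op_scale_right[OF lq(1)] op_scale_right[OF lq(2)])
  fix t assume t: "t \<in> bhom p q"
  then have t': "t \<in> intw (bobj p) (bobj q)" unfolding bhom_def by blast
  show "t \<in> bounded_ops" using M_bounded_ops[OF intw_M[OF t']] .
  show "bobj q \<I> \<cdot> t = t" "t \<cdot> bobj p \<I> = t" using intw_left[OF q'(2) t'] intw_right[OF p'(2) t'] .
next
  fix p assume p: "p \<in> bims"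
  note p' = bimsD[OF p]
  have l: "lact p \<in> intw (a \<circ> bobj p) (bobj p)" and r: "ract p \<in> intw (bobj p \<circ> a) (bobj p)"
    using p'(3) unfolding bim_def lmod_def rmod_def by blast+
  show "bobj p \<I> \<in> bhom p p" unfolding bhom_def
    using intw_left[OF p'(2) l] intw_left[OF p'(2) r] intw_right[OF _ l] intw_right[OF _ r] p'(2)
    by (simp add: intw_id emap_comp)
next
  fix p q r s t assume p: "p \<in> bims" and q: "q \<in> bims" and r: "r \<in> bims" and s: "s \<in> bhom q r" and t: "t \<in> bhom p q"
  have M: "s \<in> M" "t \<in> M" using s t intw_M unfolding bhom_def by blast+
  have "s \<cdot> t \<in> intw (bobj p) (bobj r)"
    using s t intw_mult[OF bimsD(2)[OF p] bimsD(2)[OF r]] unfolding bhom_def by blast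
  moreover have "s \<cdot> (t \<cdot> lact p) = lact r \<cdot> a (s \<cdot> t)" "s \<cdot> (t \<cdot> ract p) = ract r \<cdot> (s \<cdot> t)"
  proof -
    have 1: "t \<cdot> lact p = lact q \<cdot> a t" "t \<cdot> ract p = ract q \<cdot> t" "s \<cdot> lact q = lact r \<cdot> a s" "s \<cdot> ract q = ract r \<cdot> s"
      using s t unfolding bhom_def by simp_all
    show "s \<cdot> (t \<cdot> lact p) = lact r \<cdot> a (s \<cdot> t)" "s \<cdot> (t \<cdot> ract p) = ract r \<cdot> (s \<cdot> t)"
      unfolding 1(1,2) op_reassoc[OF 1(3)] op_reassoc[OF 1(4)] using M by (simp_all add: op_assoc emap_mult)
  qed
  ultimately show "s \<cdot> t \<in> bhom p r" unfolding bhom_def by (simp add: op_assoc)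
qed

lemma represented_bims:
  "represented bims bhom (\<lambda>p. bobj p \<I>) (dual_category (cat S) alg)
     (\<lambda>p q t. (p, (bobj p, t, bobj q), q)) (\<lambda>f. fst (snd (fst (snd f))))"
proof (intro represented.intro opcat_bims represented_axioms.intro)
  let ?D = "dual_category (cat S) alg"
  show "Obj ?D = bims" unfolding dual_category_def bims_def by simp
  show "Ident ?D p = (p, (bobj p, bobj p \<I>, bobj p), p)" for p unfolding dual_category_def bobj_def by simp
  show "Hom ?D p q = (\<lambda>t. (p, (bobj p, t, bobj q), q)) ` bhom p q" if p: "p \<in> bims" and q: "q \<in> bims" for p q
  proof -
    note p' = bimsD[OF p] and q' = bimsD[OF q]
    have "bimodule_map (cat S) alg p q (bobj p, t, bobj q) \<longleftrightarrow> t \<cdot> lact p = lact q \<cdot> a t \<and> t \<cdot> ract p = ract q \<cdot> t"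
      if t: "t \<in> intw (bobj p) (bobj q)" for t
    proof -
      have r: "ract q \<cdot> bobj q \<I> = ract q"
        using q'(2,3) intw_right[of "bobj q \<circ> a" "ract q" "bobj q"] unfolding bim_def rmod_def by (simp add: emap_comp)
      have 1: "t \<cdot> bobj p \<I> = t" using intw_right[OF p'(2) t] .
      have "bimodule_map (cat S) alg (mk (bobj p) (lact p) (ract p)) (mk (bobj q) (lact q) (ract q)) (bobj p, t, bobj q) \<longleftrightarrow>
          t \<cdot> lact p = lact q \<cdot> a t \<and> t \<cdot> ract p = ract q \<cdot> t"
        unfolding mk_def by (simp add: 1)
      then show ?thesis using p'(4) q'(4) by simp
    qed
    then have "{f \<in> Hom (cat S) (fst p) (fst q). bimodule_map (cat S) alg p q f} = (\<lambda>t. (bobj p, t, bobj q)) ` bhom p q"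
      unfolding bhom_def p'(5) q'(5) Hom_cat using p'(1) q'(1) by auto
    moreover have "Hom ?D p q = (\<lambda>f. (p, f, q)) ` {f \<in> Hom (cat S) (fst p) (fst q). bimodule_map (cat S) alg p q f}"
      unfolding dual_category_def Hom_extend Hom_structured using p q unfolding bims_def by simp
    ultimately show ?thesis by (simp add: image_image)
  qed
qed (simp_all add: dual_category_def)

definition free_bim :: "'h endo \<Rightarrow> 'h endo \<times> 'h intertwiner \<times> 'h intertwiner" where
  "free_bim y = mk (a \<circ> y \<circ> a) m (a (y m))"

lemma free_bim:
  assumes y: "emap y" "y \<I> = \<I>" and obj: "a \<circ> y \<circ> a \<in> objs \<inter> S" "a \<circ> (a \<circ> y \<circ> a) \<in> objs \<inter> S" "a \<circ> y \<circ> a \<circ> a \<in> objs \<inter> S"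
  shows "free_bim y \<in> bims"
proof -
  have mz: "m \<cdot> (a (a z)) = a z \<cdot> m" if "z \<in> M" for z using m_nat[OF that] .
  have "bim (a \<circ> y \<circ> a) m (a (y m))" unfolding bim_def lmod_def rmod_def
  proof (intro conjI)
    show "m \<in> intw (a \<circ> (a \<circ> y \<circ> a)) (a \<circ> y \<circ> a)"
      by (rule intwI) (simp_all add: y mz)
    show "a (y m) \<in> intw (a \<circ> y \<circ> a \<circ> a) (a \<circ> y \<circ> a)"
      by (rule intwI) (simp_all add: y emap_mult[symmetric] mz)
    show "a (y m) \<cdot> a (y m) = a (y m) \<cdot> (a \<circ> y \<circ> a) m" by (simp add: y emap_mult[symmetric] mm)
    show "a (y m) \<cdot> (a \<circ> y \<circ> a) e = (a \<circ> y \<circ> a) \<I>" by (simp add: y emap_mult[symmetric] mae)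
    show "a (y m) \<cdot> m = m \<cdot> a (a (y m))" using mz y by simp
  qed (simp_all add: mm me y)
  then show ?thesis unfolding bims_def free_bim_def mem_Collect_eq bimodule_iff using obj by blast
qed

text \<open>Frobenius reciprocity: \<open>\<eta>\<close> is the arrow from \<open>y\<close> to
  \<open>a \<circ> y \<circ> a\<close> made from the unit of the algebra, and composition with it is
  inverse to \<open>\<phi>\<close>. The second claim ensures that what \<open>f\<close> detects is
  still detected by \<open>\<phi> f\<close>.\<close>

lemma free_bim_universal:
  assumes y: "emap y" "y \<I> = \<I>" and q: "q \<in> bims"
  defines "\<phi> \<equiv> \<lambda>f. ract q \<cdot> (lact q \<cdot> a f)" and "\<eta> \<equiv> e \<cdot> y e"
  shows "bij_betw \<phi> (intw y (bobj q)) (bhom (free_bim y) q)"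
    and "f \<in> intw y (bobj q) \<Longrightarrow> \<phi> f \<cdot> \<eta> = f"
proof -
  let ?X = "bobj q" and ?l = "lact q" and ?r = "ract q"
  have X: "emap ?X" using bimsD(2)[OF q] .
  have l: "?l \<in> intw (a \<circ> ?X) ?X" "?l \<cdot> m = ?l \<cdot> a ?l" "?l \<cdot> e = ?X \<I>"
    and r: "?r \<in> intw (?X \<circ> a) ?X" "?r \<cdot> ?r = ?r \<cdot> ?X m" "?r \<cdot> ?X e = ?X \<I>" and rl: "?r \<cdot> ?l = ?l \<cdot> a ?r"
    using bimsD(3)[OF q] unfolding bim_def lmod_def rmod_def by simp_all
  have M: "?l \<in> M" "?r \<in> M" using intw_M[OF l(1)] intw_M[OF r(1)] .
  have ln: "?l \<cdot> (a (?X z) \<cdot> s) = ?X z \<cdot> (?l \<cdot> s)" if "z \<in> M" for z s using intw_nat2[OF l(1) that] by simp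
  have rn: "?r \<cdot> (?X (a z) \<cdot> s) = ?X z \<cdot> (?r \<cdot> s)" if "z \<in> M" for z s using intw_nat2[OF r(1) that] by simp
  have ret: "\<phi> f \<cdot> \<eta> = f" if f: "f \<in> intw y ?X" for f
  proof -
    have fM: "f \<in> M" using intw_M[OF f] .
    have "\<phi> f \<cdot> \<eta> = ?r \<cdot> (?l \<cdot> ((a f \<cdot> e) \<cdot> y e))" unfolding \<phi>_def \<eta>_def by (simp add: op_assoc)
    also have "\<dots> = ?r \<cdot> (?l \<cdot> (e \<cdot> (f \<cdot> y e)))" unfolding e_nat[OF fM, symmetric] by (simp add: op_assoc)
    also have "\<dots> = ?r \<cdot> (f \<cdot> y e)" using op_reassoc[OF l(3)] intw_left2[OF X f] by simp
    also have "\<dots> = f" using intw_nat[OF f e_M] op_reassoc[OF r(3)] intw_left[OF X f] by simp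
    finally show ?thesis .
  qed
  then show "f \<in> intw y ?X \<Longrightarrow> \<phi> f \<cdot> \<eta> = f" .
  have into: "\<phi> f \<in> bhom (free_bim y) q" if f: "f \<in> intw y ?X" for f
  proof -
    have fM: "f \<in> M" using intw_M[OF f] .
    have fy: "f \<cdot> y z = ?X z \<cdot> f" if "z \<in> M" for z using intw_nat[OF f that] .
    have "\<phi> f \<in> intw (a \<circ> y \<circ> a) ?X"
    proof (rule intwI)
      show "\<phi> f \<in> M" unfolding \<phi>_def using M fM by simp
      show "?X \<I> \<cdot> \<phi> f = \<phi> f" unfolding \<phi>_def using intw_left2[OF X r(1)] by simp
      show "\<phi> f \<cdot> (a \<circ> y \<circ> a) \<I> = \<phi> f" by (simp add: y)
      show "\<phi> f \<cdot> (a \<circ> y \<circ> a) z = ?X z \<cdot> \<phi> f" if z: "z \<in> M" for z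
      proof -
        have "\<phi> f \<cdot> (a \<circ> y \<circ> a) z = ?r \<cdot> (?l \<cdot> a (f \<cdot> y (a z)))"
          unfolding \<phi>_def using z fM y by (simp add: op_assoc emap_mult)
        also have "\<dots> = ?X z \<cdot> \<phi> f"
          unfolding \<phi>_def using z fM X by (simp add: fy emap_mult ln rn)
        finally show ?thesis .
      qed
    qed
    moreover have "\<phi> f \<cdot> m = ?l \<cdot> a (\<phi> f)"
    proof -
      have "\<phi> f \<cdot> m = ?r \<cdot> (?l \<cdot> (m \<cdot> a (a f)))" unfolding \<phi>_def m_nat[OF fM] by (simp add: op_assoc)
      also have "\<dots> = ?r \<cdot> (?l \<cdot> (a ?l \<cdot> a (a f)))" using op_reassoc[OF l(2)] by (simp add: op_assoc)
      also have "\<dots> = ?l \<cdot> (a ?r \<cdot> (a ?l \<cdot> a (a f)))" unfolding op_reassoc[OF rl] op_assoc ..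
      also have "\<dots> = ?l \<cdot> a (\<phi> f)" unfolding \<phi>_def using M fM by (simp add: emap_mult)
      finally show ?thesis .
    qed
    moreover have "\<phi> f \<cdot> a (y m) = ?r \<cdot> \<phi> f"
    proof -
      have "\<phi> f \<cdot> a (y m) = ?r \<cdot> (?l \<cdot> a (f \<cdot> y m))" unfolding \<phi>_def using fM y by (simp add: op_assoc emap_mult)
      also have "\<dots> = ?r \<cdot> (?X m \<cdot> (?l \<cdot> a f))" using fM X by (simp add: fy emap_mult ln)
      also have "\<dots> = ?r \<cdot> \<phi> f" unfolding \<phi>_def using op_reassoc[OF r(2)] by (simp add: op_assoc)
      finally show ?thesis .
    qed
    ultimately show ?thesis unfolding bhom_def free_bim_def by simp
  qed
  have yM: "y e \<in> M" using y by simp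
  have inv: "t \<cdot> \<eta> \<in> intw y ?X" "\<phi> (t \<cdot> \<eta>) = t" if t: "t \<in> bhom (free_bim y) q" for t
  proof -
    have ti: "t \<in> intw (a \<circ> y \<circ> a) ?X" and tm: "t \<cdot> m = ?l \<cdot> a t" and tr: "t \<cdot> a (y m) = ?r \<cdot> t"
      using t unfolding bhom_def free_bim_def by simp_all
    have tM: "t \<in> M" using intw_M[OF ti] .
    show "t \<cdot> \<eta> \<in> intw y ?X"
    proof (rule intwI)
      show "t \<cdot> \<eta> \<in> M" unfolding \<eta>_def using tM yM by simp
      show "?X \<I> \<cdot> (t \<cdot> \<eta>) = t \<cdot> \<eta>" using intw_left2[OF X ti] .
      show "t \<cdot> \<eta> \<cdot> y \<I> = t \<cdot> \<eta>" by (simp add: y)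
      show "t \<cdot> \<eta> \<cdot> y z = ?X z \<cdot> (t \<cdot> \<eta>)" if z: "z \<in> M" for z
      proof -
        have "\<eta> \<cdot> y z = e \<cdot> (y (e \<cdot> z))" unfolding \<eta>_def using z y by (simp add: op_assoc emap_mult)
        also have "\<dots> = (e \<cdot> y (a z)) \<cdot> y e" unfolding e_nat[OF z] using z y by (simp add: op_assoc emap_mult)
        also have "\<dots> = a (y (a z)) \<cdot> \<eta>" using e_nat[of "y (a z)"] z y unfolding \<eta>_def by (simp add: op_assoc)
        finally show ?thesis using intw_nat2[OF ti z] by (simp add: op_assoc)
      qed
    qed
    have "\<phi> (t \<cdot> \<eta>) = ?r \<cdot> ((?l \<cdot> a t) \<cdot> (a e \<cdot> a (y e)))"
      unfolding \<phi>_def \<eta>_def using tM yM by (simp add: op_assoc emap_mult)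
    also have "\<dots> = ?r \<cdot> (t \<cdot> a (y e))" unfolding tm[symmetric] using op_reassoc[OF mae] by (simp add: op_assoc)
    also have "\<dots> = (t \<cdot> a (y m)) \<cdot> a (y e)" unfolding tr by (simp add: op_assoc)
    also have "\<dots> = t" using y by (simp add: op_assoc emap_mult[symmetric] me)
    finally show "\<phi> (t \<cdot> \<eta>) = t" .
  qed
  show "bij_betw \<phi> (intw y ?X) (bhom (free_bim y) q)"
    by (rule bij_betwI[where g = "\<lambda>t. t \<cdot> \<eta>"]) (use into inv ret in auto)
qed

lemma cdim_free_bim:
  assumes "emap y" "y \<I> = \<I>" "q \<in> bims" "cdim (intw y (bobj q)) d"
  shows "cdim (bhom (free_bim y) q) d"
proof -
  have lr: "lact q \<in> bounded_ops" "ract q \<in> bounded_ops"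
    using bimsD(3)[OF assms(3)] intw_M M_bounded_ops unfolding bim_def lmod_def rmod_def by blast+
  show ?thesis
    by (rule cdim_bij[OF assms(4) free_bim_universal(1)[OF assms(1-3)]])
      (simp_all add: emap_add emap_scale intw_M op_distribs op_scale_right[OF lr(1)] op_scale_right[OF lr(2)])
qed

end

section \<open>Maschke averaging\<close>

context vN_algebra begin

text \<open>In the intended case \<open>a = 1 + s\<close> with \<open>s\<close> of order two,
  \<open>u\<close> and \<open>v\<close> are the actions of \<open>s\<close> from the left and from
  the right, each with square \<open>c\<close>. A quasi-inverse \<open>h\<close> on underlying
  objects is averaged over both involutions. If \<open>t\<close> commutes with the actions, each of
  the four translates of \<open>h\<close> is a quasi-inverse of \<open>t\<close>, hence so is their
  mean.\<close>

lemma maschke_average: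
  assumes X: "emap X" and Y: "emap Y" and s: "emap s" "\<And>z. z \<in> M \<Longrightarrow> s (s z) = z" and c: "c \<noteq> 0"
    and uX: "u \<in> intw (s \<circ> X) X" "u \<cdot> s u = op_scale c (X \<I>)"
    and uY: "u' \<in> intw (s \<circ> Y) Y" "u' \<cdot> s u' = op_scale c (Y \<I>)"
    and vX: "v \<in> intw (X \<circ> s) X" "v \<cdot> v = op_scale c (X \<I>)" "v \<cdot> u = u \<cdot> s v"
    and vY: "v' \<in> intw (Y \<circ> s) Y" "v' \<cdot> v' = op_scale c (Y \<I>)" "v' \<cdot> u' = u' \<cdot> s v'"
    and h: "h \<in> intw Y X"
  shows "\<exists>g \<in> intw Y X. g \<cdot> u' = u \<cdot> s g \<and> g \<cdot> v' = v \<cdot> g \<and>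
    (\<forall>t \<in> intw X Y. t \<cdot> u = u' \<cdot> s t \<and> t \<cdot> v = v' \<cdot> t \<and> t \<cdot> (h \<cdot> t) = t \<longrightarrow> t \<cdot> (g \<cdot> t) = t)"
proof -
  have M: "u \<in> M" "u' \<in> M" "v \<in> M" "v' \<in> M" "h \<in> M"
    using intw_M[OF uX(1)] intw_M[OF uY(1)] intw_M[OF vX(1)] intw_M[OF vY(1)] intw_M[OF h] .
  have sM: "s u \<in> M" "s u' \<in> M" "s v \<in> M" "s v' \<in> M" "s h \<in> M" using M s by simp_all
  note sc = op_scale_left op_scale_right[OF M_bounded_ops]
  let ?d = "inverse c"
  \<comment> \<open>\<open>k\<close> is \<open>c\<close> times the translate of \<open>h\<close> by
    the left action. \<open>g\<close> then averages over the right action as well, and 1/4 is one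
    over the number of translates.\<close>
  define k where "k = u \<cdot> (s h \<cdot> s u')"
  define h1 where "h1 = h + op_scale ?d k"
  define g where "g = op_scale (1/4) (h1 + op_scale ?d (v \<cdot> (h1 \<cdot> v')))"
  have su': "s u' \<in> intw Y (s \<circ> Y)"
  proof (rule intwI)
    show "s u' \<in> M" by (rule sM)
    show "(s \<circ> Y) \<I> \<cdot> s u' = s u'" using intw_left[OF Y uY(1)] s Y M by (simp add: emap_mult[symmetric])
    show "s u' \<cdot> Y z = (s \<circ> Y) z \<cdot> s u'" if z: "z \<in> M" for z
    proof -
      have "s (u' \<cdot> s (Y z)) = s (Y z \<cdot> u')" using intw_nat[OF uY(1) z] by simp
      then show ?thesis using s Y M z by (simp add: emap_mult)
    qed
    then show "s u' \<cdot> Y \<I> = s u'" using \<open>(s \<circ> Y) \<I> \<cdot> s u' = s u'\<close> by simp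
  qed
  have kH: "k \<in> intw Y X" unfolding k_def
    by (intro intw_mult[OF Y X uX(1)] intw_mult[OF Y emap_comp[OF s(1) X] intw_whisker_left[OF s(1) Y X h] su'])
  have h1H: "h1 \<in> intw Y X" unfolding h1_def using h kH by (simp add: intw_add[OF X] intw_scale[OF X])
  have h1M: "h1 \<in> M" "k \<in> M" using intw_M[OF h1H] intw_M[OF kH] .
  have XI: "X \<I> \<cdot> (h \<cdot> x) = h \<cdot> x" "X \<I> \<cdot> (h1 \<cdot> x) = h1 \<cdot> x" for x using intw_left2[OF X h] intw_left2[OF X h1H] .
  have wH: "v \<cdot> (h1 \<cdot> v') \<in> intw Y X"
  proof (rule intwI)
    show "v \<cdot> (h1 \<cdot> v') \<in> M" using M h1M by simp
    show "X \<I> \<cdot> (v \<cdot> (h1 \<cdot> v')) = v \<cdot> (h1 \<cdot> v')" using intw_left2[OF X vX(1)] .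
    show nat: "v \<cdot> (h1 \<cdot> v') \<cdot> Y z = X z \<cdot> (v \<cdot> (h1 \<cdot> v'))" if z: "z \<in> M" for z
    proof -
      have "v' \<cdot> Y z = Y (s z) \<cdot> v'" using intw_nat[OF vY(1), of "s z"] s z by simp
      then have "v \<cdot> (h1 \<cdot> v') \<cdot> Y z = v \<cdot> (h1 \<cdot> (Y (s z) \<cdot> v'))" by (simp add: op_assoc)
      also have "\<dots> = v \<cdot> (X (s z) \<cdot> (h1 \<cdot> v'))" using intw_nat2[OF h1H] s z by simp
      also have "\<dots> = X z \<cdot> (v \<cdot> (h1 \<cdot> v'))" using intw_nat2[OF vX(1) z] by simp
      finally show ?thesis .
    qed
    show "v \<cdot> (h1 \<cdot> v') \<cdot> Y \<I> = v \<cdot> (h1 \<cdot> v')"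
      using nat[of \<I>] intw_left2[OF X vX(1)] by simp
  qed
  have gH: "g \<in> intw Y X" unfolding g_def using h1H wH by (simp add: intw_add[OF X] intw_scale[OF X])
  have ssh: "s (s h) = h" "s (s u') = u'" "s (s u) = u" "s (s v) = v" using s(2) M by simp_all
  have su'u': "s u' \<cdot> u' = op_scale c (s (Y \<I>))"
    using arg_cong[OF uY(2), of s] M sM s(1) Y by (simp add: emap_mult emap_scale ssh)
  have shY: "s h \<cdot> s (Y \<I>) = s h" using intw_right[OF Y h] s(1) M Y by (simp add: emap_mult[symmetric])
  have h1u: "h1 \<cdot> u' = u \<cdot> s h1"
  proof -
    have "k \<cdot> u' = op_scale c (u \<cdot> s h)"
      unfolding k_def using M sM by (simp add: op_assoc su'u' sc shY)
    moreover have "u \<cdot> s k = op_scale c (h \<cdot> u')"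
    proof -
      have "s k = s u \<cdot> (h \<cdot> u')" unfolding k_def using M sM s(1) by (simp add: emap_mult ssh)
      then show ?thesis using op_reassoc[OF uX(2), of "h \<cdot> u'"] by (simp add: sc XI)
    qed
    ultimately show ?thesis unfolding h1_def using M s(1) h1M c
      by (simp add: op_distribs emap_add emap_scale sc)
  qed
  have "(v \<cdot> (h1 \<cdot> v')) \<cdot> u' = u \<cdot> s (v \<cdot> (h1 \<cdot> v'))"
  proof -
    have "(v \<cdot> (h1 \<cdot> v')) \<cdot> u' = v \<cdot> (h1 \<cdot> (u' \<cdot> s v'))" using vY(3) by (simp add: op_assoc)
    also have "\<dots> = v \<cdot> (u \<cdot> (s h1 \<cdot> s v'))" using op_reassoc[OF h1u] by (simp add: op_assoc)
    also have "\<dots> = u \<cdot> (s v \<cdot> (s h1 \<cdot> s v'))" using op_reassoc[OF vX(3)] by (simp add: op_assoc)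
    finally show ?thesis using M h1M s(1) by (simp add: emap_mult)
  qed
  then have gu: "g \<cdot> u' = u \<cdot> s g" unfolding g_def using h1u M h1M s(1)
    by (simp add: op_distribs emap_add emap_scale sc)
  have h1Y: "h1 \<cdot> Y \<I> = h1" using intw_right[OF Y h1H] .
  have gv: "g \<cdot> v' = v \<cdot> g"
  proof -
    have 1: "(v \<cdot> (h1 \<cdot> v')) \<cdot> v' = op_scale c (v \<cdot> h1)" using M h1M by (simp add: op_assoc vY(2) sc h1Y)
    have 2: "v \<cdot> (v \<cdot> (h1 \<cdot> v')) = op_scale c (h1 \<cdot> v')" using op_reassoc[OF vX(2)] by (simp add: sc XI)
    show ?thesis unfolding g_def using M h1M c by (simp add: op_distribs sc 1 2 add.commute)
  qed
  have "t \<cdot> (g \<cdot> t) = t"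
    if t: "t \<in> intw X Y" and tu: "t \<cdot> u = u' \<cdot> s t" and tv: "t \<cdot> v = v' \<cdot> t" and tht: "t \<cdot> (h \<cdot> t) = t" for t
  proof -
    have tM: "t \<in> M" "s t \<in> M" using intw_M[OF t] s(1) by simp_all
    have YI: "Y \<I> \<cdot> t = t" using intw_left[OF Y t] .
    have su't: "s u' \<cdot> t = s t \<cdot> s u" using arg_cong[OF tu, of s] M tM s by (simp add: emap_mult)
    have "t \<cdot> (k \<cdot> t) = u' \<cdot> (s t \<cdot> (s h \<cdot> (s t \<cdot> s u)))"
      unfolding k_def using op_reassoc[OF tu] su't by (simp add: op_assoc)
    also have "s t \<cdot> (s h \<cdot> (s t \<cdot> s u)) = s (t \<cdot> (h \<cdot> t)) \<cdot> s u" using M tM sM s(1) by (simp add: emap_mult op_assoc)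
    also have "u' \<cdot> (s (t \<cdot> (h \<cdot> t)) \<cdot> s u) = (u' \<cdot> s u') \<cdot> t" unfolding tht by (simp add: op_assoc su't)
    finally have tkt: "t \<cdot> (k \<cdot> t) = op_scale c t" unfolding uY(2) by (simp add: sc YI)
    have th1t: "t \<cdot> (h1 \<cdot> t) = op_scale 2 t"
      unfolding h1_def using tM M h1M c cvs.scale_left_distrib[of 1 1 t] by (simp add: op_distribs sc tht tkt)
    have "t \<cdot> ((v \<cdot> (h1 \<cdot> v')) \<cdot> t) = v' \<cdot> (t \<cdot> (h1 \<cdot> (t \<cdot> v)))"
      using op_reassoc[OF tv] tv by (simp add: op_assoc)
    also have "\<dots> = v' \<cdot> ((t \<cdot> (h1 \<cdot> t)) \<cdot> v)" by (simp add: op_assoc)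
    also have "\<dots> = op_scale 2 (v' \<cdot> (v' \<cdot> t))" unfolding th1t using M by (simp add: sc tv)
    also have "v' \<cdot> (v' \<cdot> t) = op_scale c t" using op_reassoc[OF vY(2)] by (simp add: sc YI)
    finally have "t \<cdot> ((v \<cdot> (h1 \<cdot> v')) \<cdot> t) = op_scale 2 (op_scale c t)" .
    then have "t \<cdot> (g \<cdot> t) = op_scale (1/4) (op_scale 2 t + op_scale 2 t)"
      unfolding g_def using tM M h1M c by (simp add: op_distribs sc th1t)
    then show ?thesis by (simp add: cvs.scale_left_distrib[symmetric])
  qed
  then show ?thesis using gH gu gv by blast
qed

end

context op_algebra begin

text \<open>\<open>c\<close> compares the product of \<open>s\<close> with itself to the unit
  \<open>e\<close>. The averaged quasi-inverse commutes with the actions of \<open>s\<close>, and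
  with that of the unit anyway; since \<open>a\<close> is the sum of the two, it is a bimodule
  map.\<close>

lemma regular_bims:
  assumes s: "emap s" "\<And>z. z \<in> M \<Longrightarrow> s (s z) = z"
    and i: "i \<in> intw s a" and c: "m \<cdot> (i \<cdot> s i) = op_scale c e" "c \<noteq> 0"
    and p: "p0 \<in> M" "p1 \<in> M" "e \<cdot> p0 + i \<cdot> p1 = \<I>"
    and reg: "\<And>p q t. p \<in> bims \<Longrightarrow> q \<in> bims \<Longrightarrow> t \<in> intw (bobj p) (bobj q) \<Longrightarrow>
        \<exists>h \<in> intw (bobj q) (bobj p). t \<cdot> (h \<cdot> t) = t"
  shows "regular_opcat bims bhom (\<lambda>p. bobj p \<I>)"
proof (intro regular_opcat.intro opcat_bims regular_opcat_axioms.intro)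
  \<comment> \<open>The actions of the algebra, restricted along the inclusion \<open>i\<close> of
    \<open>s\<close>, in the form that \<open>maschke_average\<close> takes.\<close>
  define u :: "'h endo \<times> 'h intertwiner \<times> 'h intertwiner \<Rightarrow> 'h \<Rightarrow>\<^sub>L 'h" where "u p = lact p \<cdot> i" for p
  define v :: "'h endo \<times> 'h intertwiner \<times> 'h intertwiner \<Rightarrow> 'h \<Rightarrow>\<^sub>L 'h" where "v p = ract p \<cdot> bobj p i" for p
  have iM: "i \<in> M" using intw_M[OF i] .
  have inat: "i \<cdot> s z = a z \<cdot> i" "i \<cdot> (s z \<cdot> x) = a z \<cdot> (i \<cdot> x)" if "z \<in> M" for z x
    using intw_nat[OF i that] intw_nat2[OF i that] .
  note sc = op_scale_left op_scale_right[OF M_bounded_ops]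
  have uv: "u p \<in> intw (s \<circ> bobj p) (bobj p)" "u p \<cdot> s (u p) = op_scale c (bobj p \<I>)"
    "v p \<in> intw (bobj p \<circ> s) (bobj p)" "v p \<cdot> v p = op_scale c (bobj p \<I>)" "v p \<cdot> u p = u p \<cdot> s (v p)"
    if p: "p \<in> bims" for p
  proof -
    let ?X = "bobj p" and ?l = "lact p" and ?r = "ract p"
    have X: "emap ?X" using bimsD(2)[OF p] .
    have l: "?l \<in> intw (a \<circ> ?X) ?X" "?l \<cdot> m = ?l \<cdot> a ?l" "?l \<cdot> e = ?X \<I>"
      and r: "?r \<in> intw (?X \<circ> a) ?X" "?r \<cdot> ?r = ?r \<cdot> ?X m" "?r \<cdot> ?X e = ?X \<I>" and rl: "?r \<cdot> ?l = ?l \<cdot> a ?r"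
      using bimsD(3)[OF p] unfolding bim_def lmod_def rmod_def by simp_all
    have M: "?l \<in> M" "?r \<in> M" using intw_M[OF l(1)] intw_M[OF r(1)] .
    have ln: "?l \<cdot> (a (?X z) \<cdot> x) = ?X z \<cdot> (?l \<cdot> x)" if "z \<in> M" for z x using intw_nat2[OF l(1) that] by simp
    have rn: "?r \<cdot> (?X (a z) \<cdot> x) = ?X z \<cdot> (?r \<cdot> x)" if "z \<in> M" for z x using intw_nat2[OF r(1) that] by simp
    show "u p \<in> intw (s \<circ> ?X) ?X"
    proof (rule intwI)
      show "u p \<in> M" unfolding u_def using M iM by simp
      show "?X \<I> \<cdot> u p = u p" unfolding u_def using intw_left2[OF X l(1)] .
      show nat: "u p \<cdot> (s \<circ> ?X) z = ?X z \<cdot> u p" if "z \<in> M" for z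
        unfolding u_def using that X by (simp add: op_assoc inat ln)
      show "u p \<cdot> (s \<circ> ?X) \<I> = u p"
        unfolding nat[OF M_closed(2)] using \<open>?X \<I> \<cdot> u p = u p\<close> .
    qed
    show "v p \<in> intw (?X \<circ> s) ?X"
    proof (rule intwI)
      show "v p \<in> M" unfolding v_def using M iM X by simp
      show "?X \<I> \<cdot> v p = v p" unfolding v_def using intw_left2[OF X r(1)] .
      show nat: "v p \<cdot> (?X \<circ> s) z = ?X z \<cdot> v p" if z: "z \<in> M" for z
      proof -
        have "v p \<cdot> (?X \<circ> s) z = ?r \<cdot> ?X (i \<cdot> s z)" unfolding v_def using X iM s(1) z by (simp add: op_assoc emap_mult)
        also have "\<dots> = ?X z \<cdot> v p" unfolding v_def inat(1)[OF z] using X iM z by (simp add: emap_mult rn)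
        finally show ?thesis .
      qed
      show "v p \<cdot> (?X \<circ> s) \<I> = v p"
        unfolding nat[OF M_closed(2)] using \<open>?X \<I> \<cdot> v p = v p\<close> .
    qed
    show "u p \<cdot> s (u p) = op_scale c (?X \<I>)"
    proof -
      have "u p \<cdot> s (u p) = ?l \<cdot> (a ?l \<cdot> (i \<cdot> s i))" unfolding u_def using M iM s(1) by (simp add: op_assoc emap_mult inat)
      also have "\<dots> = ?l \<cdot> (m \<cdot> (i \<cdot> s i))" using op_reassoc[OF l(2)] by (simp add: op_assoc)
      finally show ?thesis unfolding c(1) using M by (simp add: sc l(3))
    qed
    show "v p \<cdot> v p = op_scale c (?X \<I>)"
    proof -
      have "v p \<cdot> v p = ?r \<cdot> ((?X i \<cdot> ?r) \<cdot> ?X i)" unfolding v_def by (simp add: op_assoc)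
      also have "?X i \<cdot> ?r = ?r \<cdot> ?X (a i)" using intw_nat[OF r(1) iM] by simp
      also have "?r \<cdot> ((?r \<cdot> ?X (a i)) \<cdot> ?X i) = ?r \<cdot> (?X m \<cdot> ?X (a i \<cdot> i))"
        using op_reassoc[OF r(2)] X iM by (simp add: op_assoc emap_mult)
      also have "\<dots> = ?r \<cdot> ?X (op_scale c e)" unfolding c(1)[symmetric] inat(1)[OF iM] using X iM by (simp add: emap_mult)
      also have "\<dots> = op_scale c (?X \<I>)" using X M by (simp add: emap_scale sc r(3))
      finally show ?thesis .
    qed
    show "v p \<cdot> u p = u p \<cdot> s (v p)"
    proof -
      have "v p \<cdot> u p = ?r \<cdot> ((?X i \<cdot> ?l) \<cdot> i)" unfolding v_def u_def by (simp add: op_assoc)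
      also have "?X i \<cdot> ?l = ?l \<cdot> a (?X i)" using intw_nat[OF l(1) iM] by simp
      also have "?r \<cdot> ((?l \<cdot> a (?X i)) \<cdot> i) = ?l \<cdot> (a ?r \<cdot> (a (?X i) \<cdot> i))"
        using op_reassoc[OF rl] by (simp add: op_assoc)
      also have "\<dots> = u p \<cdot> s (v p)" unfolding u_def v_def using M iM X s(1)
        by (simp add: op_assoc emap_mult inat)
      finally show ?thesis .
    qed
  qed
  fix p q t assume pq: "p \<in> bims" "q \<in> bims" and t: "t \<in> bhom p q"
  let ?X = "bobj p" and ?Y = "bobj q"
  have X: "emap ?X" "emap ?Y" using bimsD(2) pq by blast+
  have t': "t \<in> intw ?X ?Y" "t \<cdot> lact p = lact q \<cdot> a t" "t \<cdot> ract p = ract q \<cdot> t" using t unfolding bhom_def by simp_all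
  have tM: "t \<in> M" using intw_M[OF t'(1)] .
  obtain h where h: "h \<in> intw ?Y ?X" "t \<cdot> (h \<cdot> t) = t" using reg[OF pq t'(1)] by blast
  obtain g where g: "g \<in> intw ?Y ?X" "g \<cdot> u q = u p \<cdot> s g" "g \<cdot> v q = v p \<cdot> g"
    "\<And>t. t \<in> intw ?X ?Y \<Longrightarrow> t \<cdot> u p = u q \<cdot> s t \<Longrightarrow> t \<cdot> v p = v q \<cdot> t \<Longrightarrow> t \<cdot> (h \<cdot> t) = t \<Longrightarrow> t \<cdot> (g \<cdot> t) = t"
    using maschke_average[OF X s c(2) uv(1,2)[OF pq(1)] uv(1,2)[OF pq(2)] uv(3-5)[OF pq(1)] uv(3-5)[OF pq(2)] h(1)]
    by blast
  have tu: "t \<cdot> u p = u q \<cdot> s t" unfolding u_def using op_reassoc[OF t'(2)] tM by (simp add: op_assoc inat)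
  have tv: "t \<cdot> v p = v q \<cdot> t" unfolding v_def using op_reassoc[OF t'(3)] intw_nat[OF t'(1) iM] by (simp add: op_assoc)
  have gM: "g \<in> M" using intw_M[OF g(1)] .
  have l: "lact x \<cdot> e = bobj x \<I>" "lact x \<in> M" "ract x \<cdot> bobj x e = bobj x \<I>" "ract x \<in> M"
    "ract x \<cdot> bobj x \<I> = ract x" if x: "x \<in> bims" for x
    using bimsD(2,3)[OF x] intw_M intw_right[of "bobj x \<circ> a" "ract x" "bobj x"]
    unfolding bim_def lmod_def rmod_def by (simp_all add: emap_comp) blast+
  \<comment> \<open>Inserting \<open>e p0 + i p1 = \<I>\<close> splits the action into its unit part
    and its \<open>s\<close> part.\<close>
  have "g \<cdot> lact q = lact p \<cdot> a g"
  proof -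
    have "g \<cdot> lact q = g \<cdot> (lact q \<cdot> (e \<cdot> p0 + i \<cdot> p1))" unfolding p(3) by simp
    also have "\<dots> = (g \<cdot> ?Y \<I>) \<cdot> p0 + (g \<cdot> u q) \<cdot> p1"
      unfolding u_def using op_reassoc[OF l(1)[OF pq(2)]] by (simp add: op_distribs op_assoc)
    also have "\<dots> = g \<cdot> p0 + (u p \<cdot> s g) \<cdot> p1" unfolding g(2) using intw_right[OF X(2) g(1)] by simp
    also have "\<dots> = (lact p \<cdot> e) \<cdot> (g \<cdot> p0) + (lact p \<cdot> i) \<cdot> (s g \<cdot> p1)"
      unfolding l(1)[OF pq(1)] u_def using intw_left2[OF X(1) g(1)] by (simp add: op_assoc)
    also have "\<dots> = lact p \<cdot> (a g \<cdot> (e \<cdot> p0 + i \<cdot> p1))"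
      using op_reassoc[OF e_nat[OF gM]] inat(2)[OF gM] by (simp add: op_distribs op_assoc)
    finally show ?thesis unfolding p(3) by simp
  qed
  moreover have "g \<cdot> ract q = ract p \<cdot> g"
  proof -
    have YI: "?Y \<I> = ?Y e \<cdot> ?Y p0 + ?Y i \<cdot> ?Y p1"
      unfolding p(3)[symmetric] using X(2) p(1,2) iM by (simp add: emap_add emap_mult)
    have gX: "g \<cdot> ?Y z = ?X z \<cdot> g" "g \<cdot> (?Y z \<cdot> x) = ?X z \<cdot> (g \<cdot> x)" if "z \<in> M" for z x
      using intw_nat[OF g(1) that] intw_nat2[OF g(1) that] .
    have "g \<cdot> ract q = g \<cdot> (ract q \<cdot> ?Y \<I>)" using l(5)[OF pq(2)] by simp
    also have "\<dots> = (g \<cdot> ?Y \<I>) \<cdot> ?Y p0 + (g \<cdot> v q) \<cdot> ?Y p1"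
      unfolding YI v_def using op_reassoc[OF l(3)[OF pq(2)]] YI by (simp add: op_distribs op_assoc)
    also have "\<dots> = g \<cdot> ?Y p0 + (v p \<cdot> g) \<cdot> ?Y p1" unfolding g(3) using intw_right[OF X(2) g(1)] by simp
    also have "\<dots> = (ract p \<cdot> ?X e) \<cdot> (g \<cdot> ?Y p0) + (ract p \<cdot> ?X i) \<cdot> (g \<cdot> ?Y p1)"
      unfolding l(3)[OF pq(1)] v_def using intw_left2[OF X(1) g(1)] by (simp add: op_assoc)
    also have "\<dots> = ract p \<cdot> (g \<cdot> ?Y \<I>)"
      unfolding YI by (simp add: op_distribs op_assoc gX(2) iM)
    finally show ?thesis using intw_right[OF X(2) g(1)] by simp
  qed
  ultimately have "g \<in> bhom q p" unfolding bhom_def using g(1) by simp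
  then show "\<exists>g\<in>bhom q p. t \<cdot> (g \<cdot> t) = t" using g(4)[OF t'(1) tu tv h(2)] by blast
qed

text \<open>If the product of \<open>s\<close> with itself in \<open>a = 1 + s\<close> vanished, \<open>s\<close> would be a proper left ideal.\<close>

lemma square_nonzero:
  assumes s: "s \<in> objs \<inter> S" "s \<I> \<noteq> 0" and as: "a \<circ> s \<in> objs \<inter> S"
    and i: "i \<in> intw s a" "p1 \<in> intw a s" "p1 \<cdot> i = s \<I>" "p0 \<in> intw a (id_on M)" "p0 \<cdot> e = \<I>"
      "e \<cdot> p0 + i \<cdot> p1 = \<I>"
    and no: "intw (id_on M) s = {0}"
    and simple: "simple_obj (left_module_category (cat S) alg) (a, (a \<circ> a, m, a))"
  shows "m \<cdot> (i \<cdot> s i) \<noteq> 0"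
proof
  assume z: "m \<cdot> (i \<cdot> s i) = 0"
  let ?L = "left_module_category (cat S) alg"
  have es: "emap s" using s emap_objs by blast
  have M: "i \<in> M" "p1 \<in> M" "p0 \<in> M" using intw_M[OF i(1)] intw_M[OF i(2)] intw_M[OF i(4)] .
  have one: "\<I> \<noteq> (0 :: 'h \<Rightarrow>\<^sub>L 'h)" using s(2) emap_mult[OF es M_closed(2,2)] emap_0[OF es] by auto
  have p0n: "p0 \<cdot> a z = z \<cdot> p0" if "z \<in> M" for z using intw_nat[OF i(4) that] that by (simp add: id_on_def)
  have in': "i \<cdot> s z = a z \<cdot> i" if "z \<in> M" for z using intw_nat[OF i(1) that] .
  \<comment> \<open>If the product of \<open>s\<close> with itself is 0, the left action of
    \<open>a\<close> on \<open>s\<close> factors through the projection \<open>p0\<close> to the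
    unit object.\<close>
  have mi: "m \<cdot> a i = i \<cdot> p0"
  proof -
    have "m \<cdot> a i = m \<cdot> (a i \<cdot> (e \<cdot> p0 + i \<cdot> p1))" unfolding i(6) by simp
    also have "\<dots> = m \<cdot> (e \<cdot> (i \<cdot> p0)) + (m \<cdot> (i \<cdot> s i)) \<cdot> p1"
      using op_reassoc[OF e_nat[OF M(1)]] op_reassoc[OF in'[OF M(1)]] by (simp add: op_distribs op_assoc)
    finally show ?thesis unfolding z using op_reassoc[OF me] by simp
  qed
  have p1i: "p1 \<cdot> (i \<cdot> x) = s \<I> \<cdot> x" for x using op_reassoc[OF i(3)] .
  have sI: "s \<I> = \<I>"
  proof -
    have "endomorphism M s" using s unfolding objs_def by auto
    then show ?thesis by (rule endomorphism_one)
  qed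
  have p0M: "p0 \<in> intw (a \<circ> s) s"
  proof (rule intwI)
    show nat: "p0 \<cdot> (a \<circ> s) w = s w \<cdot> p0" if w: "w \<in> M" for w using p0n[of "s w"] es w by simp
    show "p0 \<in> M" by (rule M)
    show "s \<I> \<cdot> p0 = p0" unfolding sI by simp
    show "p0 \<cdot> (a \<circ> s) \<I> = p0" unfolding nat[OF M_closed(2)] using \<open>s \<I> \<cdot> p0 = p0\<close> .
  qed
  have "lmod s p0" unfolding lmod_def
  proof (intro conjI p0M)
    have "i \<cdot> (p0 \<cdot> m) = (m \<cdot> a i) \<cdot> m" unfolding mi by (simp add: op_assoc)
    also have "\<dots> = m \<cdot> (m \<cdot> a (a i))" using m_nat[OF M(1)] by (simp add: op_assoc)
    also have "\<dots> = m \<cdot> (a m \<cdot> a (a i))" using op_reassoc[OF mm] by (simp add: op_assoc)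
    also have "\<dots> = m \<cdot> (a i \<cdot> a p0)" using arg_cong[OF mi, of a] M by (simp add: emap_mult)
    also have "\<dots> = i \<cdot> (p0 \<cdot> a p0)" using op_reassoc[OF mi] by (simp add: op_assoc)
    finally have "p1 \<cdot> (i \<cdot> (p0 \<cdot> m)) = p1 \<cdot> (i \<cdot> (p0 \<cdot> a p0))" by simp
    then show "p0 \<cdot> m = p0 \<cdot> a p0" unfolding p1i sI by simp
    show "p0 \<cdot> e = s \<I>" using i(5) sI by simp
  qed
  then have sobj: "left_module (cat S) alg (s, (a \<circ> s, p0, s))" unfolding left_module_iff using s as by blast
  have "lmod a m" unfolding lmod_def using m mm me by simp
  then have aobj: "left_module (cat S) alg (a, (a \<circ> a, m, a))" unfolding left_module_iff using a_obj aa_obj by blast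
  let ?s = "(s, (a \<circ> s, p0, s))" and ?a = "(a, (a \<circ> a, m, a))"
  let ?f = "(?s, (s, i, a), ?a)"
  have f: "?f \<in> Hom ?L ?s ?a"
    unfolding left_module_category_def Hom_structured using sobj aobj s a_obj i(1) mi by simp
  have hom: "\<exists>w t. g = (x, (w, t, s), ?s) \<and> t \<in> intw w s \<and> fst x = w" if "g \<in> Hom ?L x ?s" for g x
    using that unfolding left_module_category_def Hom_structured
    by (auto split: if_splits elim!: Hom_catE)
  have "mono_arrow ?L ?f" unfolding mono_arrow_def
  proof (intro conjI allI ballI impI)
    show "?f \<in> Arr ?L" using f unfolding Hom_def by simp
    fix x g h assume g: "g \<in> Hom ?L x (Src ?L ?f)" and h: "h \<in> Hom ?L x (Src ?L ?f)"
      and gh: "Comp ?L ?f g = Comp ?L ?f h"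
    have src: "Src ?L ?f = ?s" using f unfolding Hom_def by simp
    obtain w t where g': "g = (x, (w, t, s), ?s)" "t \<in> intw w s" "fst x = w" using hom g unfolding src by blast
    obtain w' t' where h': "h = (x, (w', t', s), ?s)" "t' \<in> intw w' s" "fst x = w'" using hom h unfolding src by blast
    have "i \<cdot> t = i \<cdot> t'" using gh unfolding g'(1) h'(1) left_module_category_def by simp
    then have "p1 \<cdot> (i \<cdot> t) = p1 \<cdot> (i \<cdot> t')" by simp
    then show "g = h" using g' h' unfolding p1i sI by simp
  qed
  then have "zero_obj ?L ?s \<or> iso_arrow ?L ?f" using simple f unfolding simple_obj_def by blast
  then show False
  proof
    assume "zero_obj ?L ?s"
    then show False using s(2) unfolding zero_obj_def left_module_category_def by simp
  next
    assume "iso_arrow ?L ?f"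
    then obtain g where "g \<in> Hom ?L (Tgt ?L ?f) (Src ?L ?f)" "Comp ?L ?f g = Ident ?L (Tgt ?L ?f)"
      unfolding iso_arrow_def inverse_arrows_def by blast
    moreover have "Src ?L ?f = ?s" "Tgt ?L ?f = ?a" using f unfolding Hom_def by simp_all
    ultimately have g: "g \<in> Hom ?L ?a ?s" "Comp ?L ?f g = Ident ?L ?a" by simp_all
    obtain t where g': "g = (?a, (a, t, s), ?s)" "t \<in> intw a s" using hom[OF g(1)] by auto
    \<comment> \<open>An inverse \<open>t\<close> of the inclusion would put the unit
      \<open>e\<close> inside \<open>s\<close>, which admits no nonzero arrow from the unit
      object.\<close>
    have "i \<cdot> t = \<I>" using g(2) unfolding g'(1) left_module_category_def by simp
    then have "i \<cdot> (t \<cdot> e) = e" by (simp add: op_reassoc)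
    moreover have "t \<cdot> e \<in> intw (id_on M) s" using intw_mult[OF emap_id_on es g'(2) e] .
    ultimately have "e = 0" using no by auto
    then show False using me one by simp
  qed
qed

end

section \<open>C2 and its dual categories as operator categories with Gram families\<close>

context vN_algebra begin

lemma opcat_cat: "opcat (objs \<inter> S) intw (\<lambda>x. x \<I>)"
proof (rule opcat.intro)
  fix x y assume "x \<in> objs \<inter> S" and y': "y \<in> objs \<inter> S"
  then have x: "emap x" and y: "emap y" using emap_objs by blast+
  show "cvs.subspace (intw x y)" unfolding cvs.subspace_def
    using intw_0 intw_add[OF y] intw_scale[OF y] by blast
  fix t assume t: "t \<in> intw x y"
  show "t \<in> bounded_ops" using M_bounded_ops[OF intw_M[OF t]] .
  show "y \<I> \<cdot> t = t" "t \<cdot> x \<I> = t" using intw_left[OF y t] intw_right[OF x t] .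
next
  show "x \<I> \<in> intw x x" if "x \<in> objs \<inter> S" for x using that emap_objs intw_id by blast
next
  fix x y z s t assume "x \<in> objs \<inter> S" "z \<in> objs \<inter> S" and st: "s \<in> intw y z" "t \<in> intw x y"
  then have "emap x" "emap z" using emap_objs by blast+
  from intw_mult[OF this st] show "s \<cdot> t \<in> intw x z" .
qed

lemma represented_cat:
  "represented (objs \<inter> S) intw (\<lambda>x. x \<I>) (cat S) (\<lambda>x y t. (x, t, y)) (\<lambda>f. fst (snd f))"
  by (intro represented.intro opcat_cat represented_axioms.intro)
    (simp_all add: Obj_cat Hom_cat del: lincat_sel_full_sub(1))

end

context crossed_product begin

definition lcomp :: "idx list \<Rightarrow> idx list \<Rightarrow> idx list" where
  "lcomp ix js = concat (map (\<lambda>i. concat (map (wprod i) js)) ix)"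

lemma decomp_lcomp: "decomp X ix \<Longrightarrow> decomp Y js \<Longrightarrow> decomp (X \<circ> Y) (lcomp ix js)"
  unfolding lcomp_def by (rule decomp_comp)

lemma regular_S2: "regular_opcat (objs \<inter> S2) intw (\<lambda>x. x \<I>)"
proof (intro regular_opcat.intro opcat_cat regular_opcat_axioms.intro)
  fix x y t assume "x \<in> objs \<inter> S2" "y \<in> objs \<inter> S2" and t: "t \<in> intw x y"
  then obtain ix js where "decomp x ix" "decomp y js" using decomp_S2 by blast
  from decomp_regular[OF this t] show "\<exists>g\<in>intw y x. t \<cdot> (g \<cdot> t) = t" .
qed

lemma gram_family_W: "opcat.gram_family (objs \<inter> S2) intw W (\<lambda>i j. of_bool (i = j))"
proof -
  interpret opcat "objs \<inter> S2" intw "\<lambda>x. x \<I>" by (rule opcat_cat)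
  have "cdim (intw (W i) (W j)) (of_bool (i = j))" for i j
    using cdim_decomp[OF decomp_W, of i j] by (cases "i = j") simp_all
  moreover have "generating W UNIV" unfolding generating_def
  proof (intro ballI impI)
    fix y z f assume y: "y \<in> objs \<inter> S2" and z: "z \<in> objs \<inter> S2" and f: "f \<in> intw y z" "f \<noteq> 0"
    obtain ix where "decomp y ix" using decomp_S2 y by blast
    from decomp_detect[OF this _ f] show "\<exists>j\<in>UNIV. \<exists>t\<in>intw (W j) y. f \<cdot> t \<noteq> 0"
      using emap_objs z by simp
  qed
  ultimately show ?thesis unfolding gram_family_def using W_objs by blast
qed

lemma W_unit: "W (0, False, 0) = id_on M"
  by (simp add: W_def wd_simps \<alpha>_0)

lemma two_summands:
  assumes sum: "direct_sum (cat S2) a [id_on M, W (k, b, 0)]"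
  shows "a \<in> objs \<inter> SC" "a \<I> = \<I>" "decomp a [(0, False, 0), (k, b, 0)]"
    and "\<exists>i0 \<in> intw (id_on M) a. \<exists>p0 \<in> intw a (id_on M). \<exists>i \<in> intw (W (k, b, 0)) a. \<exists>p1 \<in> intw a (W (k, b, 0)).
      p0 \<cdot> i0 = \<I> \<and> p0 \<cdot> i = 0 \<and> p1 \<cdot> i0 = 0 \<and> p1 \<cdot> i = \<I> \<and> i0 \<cdot> p0 + i \<cdot> p1 = \<I>"
proof -
  let ?s = "W (k, b, 0)"
  let ?xs = "[id_on M, ?s]"
  have a: "a \<in> objs" using direct_sum_catD(1)[OF sum] by blast
  then have ea: "emap a" by (rule emap_objs)
  obtain u v where uv: "\<And>j. j < length ?xs \<Longrightarrow> u j \<in> intw (?xs ! j) a \<and> v j \<in> intw a (?xs ! j)"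
    "\<And>j l. j < length ?xs \<Longrightarrow> l < length ?xs \<Longrightarrow> v j \<cdot> u l = (if j = l then (?xs ! j) \<I> else 0)"
    "(\<Sum>j<length ?xs. u j \<cdot> v j) = a \<I>"
    using direct_sum_catD(4)[OF sum] by blast
  have "direct_sum (cat UNIV) a ?xs"
    by (rule direct_sum_catI[of _ _ _ u v]) (use a direct_sum_catD(2)[OF sum] uv in auto)
  moreover have "id_on M \<in> range \<alpha>" using rangeI[of \<alpha> 0] unfolding \<alpha>_0 .
  moreover have "?s \<in> range \<alpha> \<union> range (\<lambda>g. \<alpha> g \<circ> \<rho>)"
    by (cases b) (simp_all add: W_def wd_simps[unfolded One_nat_def])
  ultimately have "a \<in> SC" unfolding SC_def full_sub_UNIV by (intro CollectI exI[of _ ?xs]) simp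
  then show "a \<in> objs \<inter> SC" using a by simp
  have id1: "id_on M \<I> = \<I>" by (simp add: id_on_def)
  have u0: "u 0 \<in> intw (id_on M) a" and v0: "v 0 \<in> intw a (id_on M)" and vu: "v 0 \<cdot> u 0 = \<I>"
    and u1: "u 1 \<in> intw ?s a" and v1: "v 1 \<in> intw a ?s" and vu1: "v 1 \<cdot> u 1 = \<I>"
    and z: "v 0 \<cdot> u 1 = 0" "v 1 \<cdot> u 0 = 0" and sm: "u 0 \<cdot> v 0 + u 1 \<cdot> v 1 = a \<I>"
    using uv(1)[of 0] uv(1)[of 1] uv(2)[of 0 0] uv(2)[of 1 1] uv(2)[of 0 1] uv(2)[of 1 0] uv(3) id1
    by simp_all
  show one: "a \<I> = \<I>"
    using endo_or_zero[OF a]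
  proof
    assume "a = (\<lambda>_. 0)"
    then have "u 0 = 0" using intw_left[OF ea u0] by simp
    then show ?thesis using vu one_nonzero by simp
  qed (simp add: endomorphism_one)
  show "decomp a [(0, False, 0), (k, b, 0)]" unfolding decomp_def
    using ea direct_sum_catD(3)[OF sum] by (simp add: W_unit)
  show "\<exists>i0 \<in> intw (id_on M) a. \<exists>p0 \<in> intw a (id_on M). \<exists>i \<in> intw ?s a. \<exists>p1 \<in> intw a ?s.
      p0 \<cdot> i0 = \<I> \<and> p0 \<cdot> i = 0 \<and> p1 \<cdot> i0 = 0 \<and> p1 \<cdot> i = \<I> \<and> i0 \<cdot> p0 + i \<cdot> p1 = \<I>"
    by (intro bexI[of _ "u 0"] bexI[of _ "v 0"] bexI[of _ "u 1"] bexI[of _ "v 1"] conjI)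
      (use u0 v0 u1 v1 vu vu1 z sm one in simp_all)
qed

end

locale dual_of_C2 = crossed_product M \<alpha> \<rho> \<gamma> \<theta> + op_algebra M "crossed_product.S2 M \<alpha> \<rho> \<gamma>" a m e
  for M :: "('h::complex_hilbert_space \<Rightarrow>\<^sub>L 'h) set" and \<alpha> \<rho> \<gamma> \<theta> a m e +
  fixes ix :: "((2 \<times> 2) \<times> bool \<times> 3) list"
  assumes a_C: "a \<in> objs \<inter> SC" and a_decomp: "decomp a ix"
begin

text \<open>By reciprocity, an arrow from the free bimodule on \<open>W i\<close> to that on
  \<open>W j\<close> is an arrow from \<open>W i\<close> to \<open>a \<circ> W j \<circ> a\<close>.
  The dimension is thus a multiplicity that depends only on the decomposition of \<open>a\<close>
  into words.\<close>

lemma gram_family_free_bim: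
  "opcat.gram_family bims bhom (\<lambda>j. free_bim (W j)) (\<lambda>i j. count_list (lcomp (lcomp ix [j]) ix) i)"
proof -
  interpret opcat bims bhom "\<lambda>p. bobj p \<I>" by (rule opcat_bims)
  have free: "free_bim (W j) \<in> bims" for j
  proof (rule free_bim)
    show "a \<circ> W j \<circ> a \<in> objs \<inter> S2" by (rule sandwich_objs[OF a_C a_C])
    have "a \<circ> (a \<circ> W j \<circ> a) = (a \<circ> a) \<circ> W j \<circ> a" "a \<circ> W j \<circ> a \<circ> a = a \<circ> W j \<circ> (a \<circ> a)"
      by (simp_all only: comp_assoc)
    then show "a \<circ> (a \<circ> W j \<circ> a) \<in> objs \<inter> S2" "a \<circ> W j \<circ> a \<circ> a \<in> objs \<inter> S2"
      using sandwich_objs[OF comp_C[OF a_C a_C] a_C, of j] sandwich_objs[OF a_C comp_C[OF a_C a_C], of j] by simp_all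
  qed simp_all
  moreover have "cdim (bhom (free_bim (W i)) (free_bim (W j))) (count_list (lcomp (lcomp ix [j]) ix) i)" for i j
  proof (rule cdim_free_bim[OF emap_W W_one free])
    have "bobj (free_bim (W j)) = a \<circ> W j \<circ> a" unfolding free_bim_def by simp
    then show "cdim (intw (W i) (bobj (free_bim (W j)))) (count_list (lcomp (lcomp ix [j]) ix) i)"
      using cdim_decomp[OF decomp_lcomp[OF decomp_lcomp[OF a_decomp decomp_W] a_decomp]] by simp
  qed
  moreover have "generating (\<lambda>j. free_bim (W j)) UNIV" unfolding generating_def
  proof (intro ballI impI)
    fix p q f assume p: "p \<in> bims" and q: "q \<in> bims" and f: "f \<in> bhom p q" "f \<noteq> 0"
    have f': "f \<in> intw (bobj p) (bobj q)" using f(1) unfolding bhom_def by blast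
    obtain ix where "decomp (bobj p) ix" using decomp_S2 bimsD(1)[OF p] by blast
    then obtain i t where t: "t \<in> intw (W i) (bobj p)" "f \<cdot> t \<noteq> 0"
      using decomp_detect[OF _ bimsD(2)[OF q] f' f(2)] by blast
    let ?t = "ract p \<cdot> (lact p \<cdot> a t)"
    have "?t \<in> bhom (free_bim (W i)) p"
      using free_bim_universal(1)[OF emap_W W_one p, of i] t(1) by (rule bij_betwE[THEN bspec])
    moreover have "f \<cdot> ?t \<noteq> 0"
    proof
      assume "f \<cdot> ?t = 0"
      then have "f \<cdot> (?t \<cdot> (e \<cdot> W i e)) = 0" by (simp only: op_assoc[symmetric]) simp
      then show False using t(2) unfolding free_bim_universal(2)[OF emap_W W_one p t(1)] by simp
    qed
    ultimately show "\<exists>j\<in>UNIV. \<exists>t\<in>bhom (free_bim (W j)) p. f \<cdot> t \<noteq> 0" by blast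
  qed
  ultimately show ?thesis unfolding gram_family_def by blast
qed

text \<open>The Hom space from the unit object to \<open>a\<close> is one-dimensional. Both the unit
  \<open>e\<close> and the product of \<open>s\<close> with itself lie in it, the latter because
  \<open>s\<close> squares to the unit object, so both are multiples of the inclusion
  \<open>i0\<close>. Simplicity of \<open>a\<close> as a module makes the second multiple nonzero,
  and averaging applies.\<close>

lemma regular_bims_two_summands:
  assumes ix: "ix = [(0, False, 0), (g, False, 0)]" and g: "g \<noteq> 0"
    and sum: "direct_sum (cat S2) a [id_on M, W (g, False, 0)]"
    and simple: "simple_obj (left_module_category (cat S2) alg) (a, (a \<circ> a, m, a))"
  shows "regular_opcat bims bhom (\<lambda>p. bobj p \<I>)"
proof -
  let ?s = "W (g, False, 0)"
  obtain i0 q0 i p1 where i0: "i0 \<in> intw (id_on M) a" and q0: "q0 \<in> intw a (id_on M)"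
    and i: "i \<in> intw ?s a" and p1: "p1 \<in> intw a ?s"
    and r: "q0 \<cdot> i0 = \<I>" "q0 \<cdot> i = 0" "p1 \<cdot> i0 = 0" "p1 \<cdot> i = \<I>" "i0 \<cdot> q0 + i \<cdot> p1 = \<I>"
    using two_summands(4)[OF sum] by blast
  have iM: "i \<in> M" "p1 \<in> M" "q0 \<in> M" using intw_M[OF i] intw_M[OF p1] intw_M[OF q0] .
  have split: "x = i0 \<cdot> (q0 \<cdot> x) + i \<cdot> (p1 \<cdot> x)" for x
    using arg_cong[OF r(5), of "\<lambda>z. z \<cdot> x"] by (simp add: op_distribs op_assoc)
  have no: "x = 0" if "x \<in> intw (id_on M) ?s" for x
    using W_link[of x "(0, False, 0)" "(g, False, 0)"] that g unfolding W_unit by auto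
  have unit: "\<exists>c. x = op_scale c i0" if x: "x \<in> intw (id_on M) a" for x
  proof -
    have "p1 \<cdot> x = 0" by (rule no[OF intw_mult[OF emap_id_on emap_W p1 x]])
    moreover have "q0 \<cdot> x \<in> intw (W (0, False, 0)) (W (0, False, 0))"
      unfolding W_unit by (rule intw_mult[OF emap_id_on emap_id_on q0 x])
    then obtain c where "q0 \<cdot> x = op_scale c \<I>" using W_scalar by blast
    ultimately have "x = op_scale c i0"
      using split[of x] by (simp add: op_scale_right[OF M_bounded_ops[OF intw_M[OF i0]]])
    then show ?thesis by blast
  qed
  obtain l where l: "e = op_scale l i0" using unit[OF e] by blast
  have l0: "l \<noteq> 0"
  proof
    assume "l = 0"
    then have "e = 0" using l by simp
    then show False using me one_nonzero by simp
  qed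
  \<comment> \<open>\<open>e\<close> is \<open>l\<close> times the given inclusion, so the
    projection is rescaled to keep the splitting of \<open>a\<close>.\<close>
  let ?p0 = "op_scale (1 / l) q0"
  have p0: "?p0 \<in> intw a (id_on M)" by (rule intw_scale[OF emap_id_on q0])
  have sc: "op_scale x i0 \<cdot> y = op_scale x (i0 \<cdot> y)" "q0 \<cdot> op_scale x y = op_scale x (q0 \<cdot> y)"
    "i0 \<cdot> op_scale x y = op_scale x (i0 \<cdot> y)" for x y
    using op_scale_left op_scale_right[OF M_bounded_ops[OF intw_M[OF q0]]]
      op_scale_right[OF M_bounded_ops[OF intw_M[OF i0]]] by simp_all
  have pe: "?p0 \<cdot> e = \<I>" unfolding l op_scale_left sc r using l0 by simp
  have ep: "e \<cdot> ?p0 + i \<cdot> p1 = \<I>" unfolding l sc using l0 r(5) by simp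
  have s2: "?s \<circ> ?s = id_on M"
  proof -
    have "g + g = 0" by (rule double_2x2)
    then show ?thesis unfolding W_def using \<alpha>_mult[of g g] by (simp only: wd_simps prod.case of_bool_eq \<alpha>_0)
  qed
  have mi: "m \<cdot> (i \<cdot> ?s i) \<noteq> 0"
  proof (rule square_nonzero[of ?s i p1 ?p0])
    show "?s \<in> objs \<inter> S2" by (rule W_objs)
    show "a \<circ> ?s \<in> objs \<inter> S2" using sandwich_objs[OF a_C id_on_C, of "(g, False, 0)"] by (simp add: comp_id_on emap_comp)
    show "intw (id_on M) ?s = {0}" using no intw_0 by blast
  qed (use one_nonzero i p1 r p0 pe ep simple in simp_all)
  have "m \<cdot> (i \<cdot> ?s i) \<in> intw (id_on M) a"
  proof (rule intwI)
    show "m \<cdot> (i \<cdot> ?s i) \<in> M" using iM by simp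
    show "m \<cdot> (i \<cdot> ?s i) \<cdot> id_on M z = a z \<cdot> (m \<cdot> (i \<cdot> ?s i))" if z: "z \<in> M" for z
    proof -
      have "z = ?s (?s z)" using fun_cong[OF s2, of z] z by (simp add: id_on_def)
      then have "?s i \<cdot> z = ?s (i \<cdot> ?s z)" using z iM by (simp add: emap_mult)
      also have "\<dots> = ?s (a z) \<cdot> ?s i" unfolding intw_nat[OF i z] using z iM by (simp add: emap_mult)
      finally have "i \<cdot> (?s i \<cdot> z) = a (a z) \<cdot> (i \<cdot> ?s i)" using intw_nat2[OF i, of "a z"] z by simp
      then have "m \<cdot> (i \<cdot> (?s i \<cdot> z)) = a z \<cdot> (m \<cdot> (i \<cdot> ?s i))"
        using op_reassoc[OF m_nat[OF z]] by (simp add: op_assoc)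
      then show ?thesis using z by (simp add: op_assoc id_on_def)
    qed
  qed (simp_all add: id_on_def)
  then obtain c where c: "m \<cdot> (i \<cdot> ?s i) = op_scale c i0" using unit by blast
  show ?thesis
  proof (rule regular_bims[of ?s i "c / l" ?p0 p1])
    show "?s (?s z) = z" if "z \<in> M" for z using fun_cong[OF s2, of z] that by (simp add: id_on_def)
    show "m \<cdot> (i \<cdot> ?s i) = op_scale (c / l) e" unfolding c l using l0 by simp
    show "c / l \<noteq> 0"
    proof
      assume "c / l = 0"
      then have "c = 0" using l0 by simp
      then show False using mi c by simp
    qed
    show "\<exists>h\<in>intw (bobj q) (bobj p). t \<cdot> (h \<cdot> t) = t"
      if "p \<in> bims" "q \<in> bims" "t \<in> intw (bobj p) (bobj q)" for p q t
      by (rule regular_opcat.regular[OF regular_S2, OF bimsD(1)[OF that(1)] bimsD(1)[OF that(2)] that(3)])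
  qed (use i iM ep intw_M[OF p0] in simp_all)
qed

end

context crossed_product begin

lemma dual_of_C2I:
  assumes alg: "algebra_in (cat S2) A" and sum: "direct_sum (cat S2) (fst A) [id_on M, W (k, b, 0)]"
  obtains a m e where "A = (a, (a \<circ> a, m, a), (id_on M, e, a))"
    "dual_of_C2 M \<alpha> \<rho> \<gamma> \<theta> a m e [(0, False, 0), (k, b, 0)]" "direct_sum (cat S2) a [id_on M, W (k, b, 0)]"
proof -
  obtain a m0 e0 where A: "A = (a, m0, e0)" by (cases A)
  have s: "direct_sum (cat S2) a [id_on M, W (k, b, 0)]" using sum unfolding A by simp
  obtain m e where me: "m0 = (a \<circ> a, m, a)" "e0 = (id_on M, e, a)" "op_algebra M S2 a m e"
    by (rule op_algebraI[OF alg[unfolded A] two_summands(2)[OF s]])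
  have "dual_of_C2 M \<alpha> \<rho> \<gamma> \<theta> a m e [(0, False, 0), (k, b, 0)]"
    using me(3) two_summands(1,3)[OF s] crossed_product_axioms
    by (intro dual_of_C2.intro dual_of_C2_axioms.intro)
  then show thesis by (intro that[of a m e] s) (simp_all only: A me)
qed

end

section \<open>Equivariant objects\<close>

context vN_algebra begin

lemma intw_sum: "emap x \<Longrightarrow> emap y \<Longrightarrow> (\<And>j. j \<in> J \<Longrightarrow> t j \<in> intw x y) \<Longrightarrow> (\<Sum>j\<in>J. t j) \<in> intw x y"
  by (induction J rule: infinite_finite_induct) (simp_all add: intw_0 intw_add)

end

context crossed_product begin

lemma cj_conj: "conj_obj M \<gamma> k = cj k"
  by (simp add: fun_eq_iff conj_obj_def cj_def gp_def)

lemma cj_cj: "cj k (cj l x) = cj (k + l) x"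
proof -
  have "cj k (cj l x) = (gp k \<circ> gp l) \<circ> x \<circ> (gp (- l) \<circ> gp (- k))" by (simp only: cj_def comp_assoc)
  then show ?thesis unfolding gp_add by (simp add: cj_def add.commute)
qed

lemma cj_0: "emap x \<Longrightarrow> cj 0 x = x"
  by (simp add: cj_def gp_simps comp_id_on emap_comp emap_id_on)

lemma gp_gp: "gp k (gp l z) = gp (k + l) z"
  using fun_cong[OF gp_add[of k l], of z] by simp

lemma gp_0: "z \<in> M \<Longrightarrow> gp 0 z = z"
  by (simp add: gp_simps id_on_def)

definition eqobs :: "('h endo \<times> (3 \<Rightarrow> 'h intertwiner)) set" where
  "eqobs = {p. equivariant_object (cat SC) (conj_obj M \<gamma>) (conj_arr M \<gamma>) p}"

definition eqact :: "'h endo \<times> (3 \<Rightarrow> 'h intertwiner) \<Rightarrow> 3 \<Rightarrow> 'h \<Rightarrow>\<^sub>L 'h" where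
  "eqact p k = fst (snd (snd p k))"

definition eqhom :: "'h endo \<times> (3 \<Rightarrow> 'h intertwiner) \<Rightarrow> 'h endo \<times> (3 \<Rightarrow> 'h intertwiner) \<Rightarrow> ('h \<Rightarrow>\<^sub>L 'h) set" where
  "eqhom p q = {t \<in> intw (fst p) (fst q). \<forall>k. t \<cdot> eqact p k = eqact q k \<cdot> gp k t}"

lemma eqobs_iff:
  "(X, u) \<in> eqobs \<longleftrightarrow> X \<in> objs \<inter> SC \<and> (\<exists>a. u = (\<lambda>k. (cj k X, a k, X)) \<and> (\<forall>k. a k \<in> intw (cj k X) X \<and>
      (\<exists>w \<in> intw X (cj k X). w \<cdot> a k = cj k X \<I> \<and> a k \<cdot> w = X \<I>)) \<and> (\<forall>k l. a (k + l) = a k \<cdot> gp k (a l)))"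
  (is "?L \<longleftrightarrow> ?R")
proof
  assume L: ?L
  note L = L[unfolded eqobs_def mem_Collect_eq equivariant_object_def prod.case cj_conj Obj_cat]
  have X: "X \<in> objs \<inter> SC" using L by blast
  define a where "a k = fst (snd (u k))" for k
  have uH: "u k \<in> Hom (cat SC) (cj k X) X" and iso: "iso_arrow (cat SC) (u k)" for k using L by blast+
  have u: "u k = (cj k X, a k, X)" and aH: "a k \<in> intw (cj k X) X" for k
    using Hom_catD[OF uH[of k]] unfolding a_def by auto
  have "\<exists>w \<in> intw X (cj k X). w \<cdot> a k = cj k X \<I> \<and> a k \<cdot> w = X \<I>" for k
    using iso[of k] unfolding u iso_arrow_def inverse_arrows_def
    by (auto elim!: Hom_catE)
  moreover have "a (k + l) = a k \<cdot> gp k (a l)" for k l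
  proof -
    have "u (k + l) = Comp (cat SC) (u k) (conj_arr M \<gamma> k (u l))" using L by blast
    then show ?thesis unfolding u conj_arr_def gp_def by simp
  qed
  ultimately show ?R using X aH u by (intro conjI exI[of _ a] ext allI) simp_all
next
  assume ?R
  then obtain a where X: "X \<in> objs \<inter> SC" and u: "u = (\<lambda>k. (cj k X, a k, X))"
    and a: "\<And>k. a k \<in> intw (cj k X) X" "\<And>k l. a (k + l) = a k \<cdot> gp k (a l)"
    and w: "\<And>k. \<exists>w \<in> intw X (cj k X). w \<cdot> a k = cj k X \<I> \<and> a k \<cdot> w = X \<I>" by blast
  have cX: "cj k X \<in> objs \<inter> SC" for k by (rule cj_C[OF X])
  have uH: "u k \<in> Hom (cat SC) (cj k X) X" for k unfolding u using X cX a(1) by simp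
  have "iso_arrow (cat SC) (u k)" for k
  proof -
    obtain v where v: "v \<in> intw X (cj k X)" "v \<cdot> a k = cj k X \<I>" "a k \<cdot> v = X \<I>" using w by blast
    have "u k \<in> Arr (cat SC)" using uH[of k] unfolding Hom_def by blast
    then have "inverse_arrows (cat SC) (u k) (X, v, cj k X)"
      unfolding inverse_arrows_def u using X cX v by simp
    then show ?thesis unfolding iso_arrow_def by blast
  qed
  moreover have "u (k + l) = Comp (cat SC) (u k) (conj_arr M \<gamma> k (u l))" for k l
    unfolding u conj_arr_def cj_conj gp_def[symmetric] by (simp add: a(2) cj_cj)
  ultimately show ?L
    unfolding eqobs_def mem_Collect_eq equivariant_object_def prod.case cj_conj Obj_cat using X uH by blast
qed

lemma eqobsD:
  assumes p: "p \<in> eqobs"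
  shows "fst p \<in> objs \<inter> SC" "emap (fst p)" "eqact p k \<in> intw (cj k (fst p)) (fst p)" "eqact p k \<in> M"
    "snd p k = (cj k (fst p), eqact p k, fst p)"
    "eqact p (k + l) = eqact p k \<cdot> gp k (eqact p l)" "eqact p 0 = fst p \<I>"
    "eqact p k \<cdot> gp k (eqact p (- k)) = fst p \<I>" "gp k (eqact p (- k)) \<cdot> eqact p k = cj k (fst p) \<I>"
proof -
  obtain X u where p': "p = (X, u)" by (cases p)
  obtain a where X: "X \<in> objs \<inter> SC" and u: "u = (\<lambda>k. (cj k X, a k, X))"
    and a: "\<And>k. a k \<in> intw (cj k X) X" "\<And>k l. a (k + l) = a k \<cdot> gp k (a l)"
    and w: "\<And>k. \<exists>w \<in> intw X (cj k X). w \<cdot> a k = cj k X \<I> \<and> a k \<cdot> w = X \<I>"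
    using p unfolding p' eqobs_iff by blast
  have act: "eqact p = a" unfolding p' eqact_def u by (simp add: fun_eq_iff)
  have eX: "emap X" using X emap_objs by blast
  have aM: "a k \<in> M" for k by (rule intw_M[OF a(1)])
  have XM: "X \<I> \<in> M" using eX by simp
  \<comment> \<open>The cocycle condition makes \<open>a 0\<close> idempotent, and it is
    invertible.\<close>
  have a0: "a 0 = X \<I>"
  proof -
    obtain v where v: "v \<in> intw X (cj 0 X)" "v \<cdot> a 0 = cj 0 X \<I>" using w by blast
    have "a 0 = a 0 \<cdot> a 0" using a(2)[of 0 0] gp_0[OF aM[of 0]] by simp
    then have "v \<cdot> a 0 = v \<cdot> (a 0 \<cdot> a 0)" by simp
    then have "X \<I> = X \<I> \<cdot> a 0" using v(2) op_reassoc[OF v(2)] cj_0[OF eX] by simp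
    then show ?thesis using intw_left[OF eX a(1)[of 0]] by simp
  qed
  have b: "a k \<cdot> gp k (a (- k)) = X \<I>" for k using a(2)[of k "- k"] a0 by simp
  have c: "gp k (a (- k)) \<cdot> a k = cj k X \<I>" for k
  proof -
    have "gp k (a (- k)) \<cdot> a k = gp k (a (- k) \<cdot> gp (- k) (a k))"
      using aM by (simp add: emap_mult gp_inverse)
    then show ?thesis using b[of "- k"] by (simp add: cj_apply)
  qed
  show "fst p \<in> objs \<inter> SC" "emap (fst p)" "eqact p k \<in> intw (cj k (fst p)) (fst p)" "eqact p k \<in> M"
    "snd p k = (cj k (fst p), eqact p k, fst p)"
    "eqact p (k + l) = eqact p k \<cdot> gp k (eqact p l)" "eqact p 0 = fst p \<I>"
    "eqact p k \<cdot> gp k (eqact p (- k)) = fst p \<I>" "gp k (eqact p (- k)) \<cdot> eqact p k = cj k (fst p) \<I>"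
    unfolding act unfolding p' fst_conv snd_conv u using X eX a(1) aM a(2)[of k l] a0 b c by simp_all
qed

lemma opcat_eqobs: "opcat eqobs eqhom (\<lambda>p. fst p \<I>)"
proof (rule opcat.intro)
  fix p q assume p: "p \<in> eqobs" and q: "q \<in> eqobs"
  note p' = eqobsD[OF p] and q' = eqobsD[OF q]
  have b: "eqact q k \<in> bounded_ops" for k using M_bounded_ops[OF q'(4)] .
  show "cvs.subspace (eqhom p q)" unfolding cvs.subspace_def eqhom_def
    using intw_M by (auto simp: intw_0 intw_add[OF q'(2)] intw_scale[OF q'(2)] op_distribs emap_add emap_scale
        op_scale_left op_scale_right[OF b])
  fix t assume t: "t \<in> eqhom p q"
  then have t': "t \<in> intw (fst p) (fst q)" unfolding eqhom_def by blast
  show "t \<in> bounded_ops" using M_bounded_ops[OF intw_M[OF t']] .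
  show "fst q \<I> \<cdot> t = t" "t \<cdot> fst p \<I> = t" using intw_left[OF q'(2) t'] intw_right[OF p'(2) t'] .
next
  fix p assume p: "p \<in> eqobs"
  note p' = eqobsD[OF p]
  have "fst p \<I> \<cdot> eqact p k = eqact p k \<cdot> gp k (fst p \<I>)" for k
  proof -
    have 1: "gp k (fst p \<I>) = cj k (fst p) \<I>" by (simp add: cj_apply)
    show ?thesis unfolding 1 using intw_left[OF p'(2) p'(3)] intw_right[OF emap_cj[OF p'(2)] p'(3)] by simp
  qed
  then show "fst p \<I> \<in> eqhom p p" unfolding eqhom_def using intw_id[OF p'(2)] by simp
next
  fix p q r s t assume p: "p \<in> eqobs" and q: "q \<in> eqobs" and r: "r \<in> eqobs" and s: "s \<in> eqhom q r" and t: "t \<in> eqhom p q"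
  have s': "s \<in> intw (fst q) (fst r)" "s \<cdot> eqact q k = eqact r k \<cdot> gp k s" for k using s unfolding eqhom_def by simp_all
  have t': "t \<in> intw (fst p) (fst q)" "t \<cdot> eqact p k = eqact q k \<cdot> gp k t" for k using t unfolding eqhom_def by simp_all
  have M: "s \<in> M" "t \<in> M" using intw_M[OF s'(1)] intw_M[OF t'(1)] .
  have "(s \<cdot> t) \<cdot> eqact p k = eqact r k \<cdot> gp k (s \<cdot> t)" for k
    using M op_reassoc[OF s'(2)[of k]] by (simp add: op_assoc t'(2) emap_mult)
  then show "s \<cdot> t \<in> eqhom p r"
    unfolding eqhom_def using intw_mult[OF eqobsD(2)[OF p] eqobsD(2)[OF r] s'(1) t'(1)] by simp
qed

lemma cat_C1_eq: "cat_C1 M \<alpha> \<rho> \<gamma> = equivariantization (cat SC) (conj_obj M \<gamma>) (conj_arr M \<gamma>)"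
  unfolding cat_C1_def cat_C_eq ..

lemma represented_C1:
  "represented eqobs eqhom (\<lambda>p. fst p \<I>) (cat_C1 M \<alpha> \<rho> \<gamma>)
     (\<lambda>p q t. (p, (fst p, t, fst q), q)) (\<lambda>f. fst (snd (fst (snd f))))"
proof (intro represented.intro opcat_eqobs represented_axioms.intro)
  let ?D = "cat_C1 M \<alpha> \<rho> \<gamma>"
  show "Obj ?D = eqobs" unfolding cat_C1_eq equivariantization_def Let_def eqobs_def by simp
  show "Ident ?D p = (p, (fst p, fst p \<I>, fst p), p)" for p
    unfolding cat_C1_eq equivariantization_def Let_def by simp
  show "Hom ?D p q = (\<lambda>t. (p, (fst p, t, fst q), q)) ` eqhom p q" if p: "p \<in> eqobs" and q: "q \<in> eqobs" for p q
  proof -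
    obtain X u Y v where pq: "p = (X, u)" "q = (Y, v)" by (cases p; cases q)
    have uv: "u k = (cj k X, eqact p k, X)" "v k = (cj k Y, eqact q k, Y)" for k
      using eqobsD(5)[OF p, of k] eqobsD(5)[OF q, of k] unfolding pq by simp_all
    have 1: "(\<forall>k. Comp (cat SC) (X, t, Y) (u k) = Comp (cat SC) (v k) (conj_arr M \<gamma> k (X, t, Y))) \<longleftrightarrow>
        (\<forall>k. t \<cdot> eqact p k = eqact q k \<cdot> gp k t)" for t
      unfolding uv conj_arr_def cj_conj gp_def[symmetric] by simp
    have "{f \<in> Hom (cat SC) X Y. \<forall>k. Comp (cat SC) f (u k) = Comp (cat SC) (v k) (conj_arr M \<gamma> k f)} =
        (\<lambda>t. (X, t, Y)) ` {t \<in> intw X Y. \<forall>k. t \<cdot> eqact p k = eqact q k \<cdot> gp k t}"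
      using eqobsD(1)[OF p] eqobsD(1)[OF q] unfolding pq fst_conv Hom_cat
      by (simp only: if_True conj_absorb simp_thms) (use 1[unfolded pq] in auto)
    moreover have "Hom ?D p q = (\<lambda>f. (p, f, q)) ` {f \<in> Hom (cat SC) X Y. \<forall>k. Comp (cat SC) f (u k) = Comp (cat SC) (v k) (conj_arr M \<gamma> k f)}"
      unfolding cat_C1_eq equivariantization_def Let_def Hom_extend Hom_structured
      using p q unfolding eqobs_def pq by simp
    ultimately show ?thesis unfolding eqhom_def by (simp add: image_image pq)
  qed
qed (simp_all add: cat_C1_eq equivariantization_def Let_def)

text \<open>Maschke averaging over the group of order three: \<open>g k\<close> is the translate of
  a quasi-inverse \<open>h\<close> of underlying objects by the equivariant structures, with
  \<open>v k\<close> the inverse of \<open>eqact q k\<close>. Since \<open>t\<close> is equivariant,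
  each translate is again a quasi-inverse.\<close>

lemma regular_eqobs: "regular_opcat eqobs eqhom (\<lambda>p. fst p \<I>)"
proof (intro regular_opcat.intro opcat_eqobs regular_opcat_axioms.intro)
  fix p q t assume p: "p \<in> eqobs" and q: "q \<in> eqobs" and t: "t \<in> eqhom p q"
  let ?X = "fst p" and ?Y = "fst q"
  note p' = eqobsD[OF p] and q' = eqobsD[OF q]
  have t': "t \<in> intw ?X ?Y" "t \<cdot> eqact p k = eqact q k \<cdot> gp k t" for k using t unfolding eqhom_def by simp_all
  have tM: "t \<in> M" using intw_M[OF t'(1)] .
  obtain ix js where "decomp ?X ix" "decomp ?Y js" using decomp_SC_degree p'(1) q'(1) by blast
  from decomp_regular[OF this t'(1)] obtain h where h: "h \<in> intw ?Y ?X" "t \<cdot> (h \<cdot> t) = t" by blast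
  have hM: "h \<in> M" using intw_M[OF h(1)] .
  define v where "v k = gp k (eqact q (- k))" for k
  have vM: "v k \<in> M" for k unfolding v_def using q'(4) by simp
  have v: "v k \<in> intw ?Y (cj k ?Y)" for k
  proof -
    have "v k \<in> intw (cj k (cj (- k) ?Y)) (cj k ?Y)"
      unfolding v_def by (rule intw_cj[OF emap_cj[OF q'(2)] q'(2) q'(3)])
    then show ?thesis unfolding cj_cj using cj_0[OF q'(2)] by simp
  qed
  \<comment> \<open>The cocycle identity, rewritten for the inverses \<open>v\<close>. It makes the
    action of \<open>l\<close> permute the \<open>g k\<close>, which is
    \<open>shift\<close>.\<close>
  have v1: "v (l + k) \<cdot> eqact q l = gp l (v k)" for k l
  proof -
    have "eqact q (- k) = eqact q (- (l + k)) \<cdot> gp (- (l + k)) (eqact q l)"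
      using q'(6)[of "- (l + k)" l] by simp
    then have "v k = gp k (eqact q (- (l + k))) \<cdot> gp (- l) (eqact q l)"
      unfolding v_def using q'(4) by (simp add: emap_mult gp_gp)
    then have "gp l (v k) = gp l (gp k (eqact q (- (l + k)))) \<cdot> gp l (gp (- l) (eqact q l))"
      using q'(4) by (simp add: emap_mult)
    then show ?thesis unfolding v_def gp_gp using q'(4)[of l] by (simp add: gp_0)
  qed
  define g where "g k = eqact p k \<cdot> (gp k h \<cdot> v k)" for k
  have gH: "g k \<in> intw ?Y ?X" for k
    unfolding g_def by (rule intw_mult[OF q'(2) p'(2) p'(3) intw_mult[OF q'(2) emap_cj[OF p'(2)] intw_cj[OF q'(2) p'(2) h(1)] v]])
  have gM: "g k \<in> M" for k using intw_M[OF gH] .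
  have shift: "eqact p l \<cdot> gp l (g k) = g (l + k) \<cdot> eqact q l" for k l
  proof -
    have "eqact p l \<cdot> gp l (g k) = (eqact p l \<cdot> gp l (eqact p k)) \<cdot> (gp (l + k) h \<cdot> gp l (v k))"
      unfolding g_def using p'(4) hM vM by (simp add: emap_mult gp_gp op_assoc)
    then show ?thesis unfolding g_def p'(6)[symmetric] v1[symmetric] by (simp add: op_assoc)
  qed
  have tgt: "t \<cdot> (g k \<cdot> t) = t" for k
  proof -
    have "t \<cdot> eqact p (- k) = eqact q (- k) \<cdot> gp (- k) t" by (rule t'(2))
    then have "gp k (t \<cdot> eqact p (- k)) = gp k (eqact q (- k) \<cdot> gp (- k) t)" by simp
    then have vt: "v k \<cdot> t = gp k t \<cdot> gp k (eqact p (- k))"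
      unfolding v_def using p'(4) q'(4) tM by (simp add: emap_mult gp_inverse)
    have "t \<cdot> (g k \<cdot> t) = (t \<cdot> eqact p k) \<cdot> (gp k h \<cdot> (v k \<cdot> t))" unfolding g_def by (simp add: op_assoc)
    also have "\<dots> = eqact q k \<cdot> (gp k (t \<cdot> (h \<cdot> t)) \<cdot> gp k (eqact p (- k)))"
      unfolding t'(2) vt using tM hM by (simp add: op_assoc emap_mult)
    also have "\<dots> = (t \<cdot> eqact p k) \<cdot> gp k (eqact p (- k))" unfolding h(2) t'(2) by (simp add: op_assoc)
    also have "\<dots> = t" using p'(8) intw_right[OF p'(2) t'(1)] by (simp add: op_assoc)
    finally show ?thesis .
  qed
  let ?g = "op_scale (1 / 3) (\<Sum>k\<in>UNIV. g k)"
  have gs: "(\<Sum>k\<in>UNIV. g k) \<in> intw ?Y ?X" by (rule intw_sum[OF q'(2) p'(2) gH])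
  have gsM: "(\<Sum>k\<in>UNIV. g k) \<in> M" using intw_M[OF gs] .
  have "eqact p l \<cdot> gp l (\<Sum>k\<in>UNIV. g k) = (\<Sum>k\<in>UNIV. g k) \<cdot> eqact q l" for l
  proof -
    have "gp l (\<Sum>k\<in>UNIV. g k) = (\<Sum>k\<in>UNIV. gp l (g k))" using emap_sum[OF emap_gp, of UNIV g] gM by simp
    then have "eqact p l \<cdot> gp l (\<Sum>k\<in>UNIV. g k) = (\<Sum>k\<in>UNIV. g (l + k) \<cdot> eqact q l)"
      by (simp only: blinfun_compose.sum_right shift)
    also have "\<dots> = (\<Sum>k\<in>UNIV. g k \<cdot> eqact q l)" by (rule sum_shift)
    finally show ?thesis by (simp only: blinfun_compose.sum_left)
  qed
  then have "?g \<in> eqhom q p" unfolding eqhom_def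
    using gsM intw_scale[OF p'(2) gs]
    by (simp add: emap_scale op_scale_left op_scale_right[OF M_bounded_ops[OF p'(4)]])
  moreover have "t \<cdot> (?g \<cdot> t) = t"
  proof -
    have "t \<cdot> ((\<Sum>k\<in>UNIV. g k) \<cdot> t) = (\<Sum>k\<in>(UNIV :: 3 set). t)"
      by (simp only: blinfun_compose.sum_left blinfun_compose.sum_right tgt)
    also have "\<dots> = op_scale 3 t"
      using op_scale_of_real[of 3 t] by (simp add: sum_constant_scaleR)
    finally have "t \<cdot> (?g \<cdot> t) = op_scale (1 / 3) (op_scale 3 t)"
      by (simp add: op_scale_left op_scale_right[OF M_bounded_ops[OF tM]])
    then show ?thesis by simp
  qed
  ultimately show "\<exists>g\<in>eqhom q p. t \<cdot> (g \<cdot> t) = t" by blast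
qed

text \<open>C provides binary direct sums; inclusions and projections of two of them are
  composed.\<close>

lemma direct_sum_3:
  assumes "x \<in> objs \<inter> SC" "y \<in> objs \<inter> SC" "z \<in> objs \<inter> SC"
  shows "\<exists>q. direct_sum (cat SC) q [x, y, z]"
proof -
  interpret F: fusion_category "cat SC" using fusion_C unfolding cat_C_eq .
  obtain r where r: "direct_sum (cat SC) r [x, y]" using F.direct_sum_ex[unfolded Obj_cat] assms by blast
  obtain q where q: "direct_sum (cat SC) q [r, z]"
    using F.direct_sum_ex[unfolded Obj_cat] assms(3) direct_sum_catD(1)[OF r] by blast
  obtain c d where cd: "\<And>k. k < length [x, y] \<Longrightarrow> c k \<in> intw ([x, y] ! k) r \<and> d k \<in> intw r ([x, y] ! k)"
    "\<And>k l. k < length [x, y] \<Longrightarrow> l < length [x, y] \<Longrightarrow> d k \<cdot> c l = (if k = l then ([x, y] ! k) \<I> else 0)"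
    "(\<Sum>k<length [x, y]. c k \<cdot> d k) = r \<I>"
    using direct_sum_catD(4)[OF r] by blast
  obtain a b where ab: "\<And>k. k < length [r, z] \<Longrightarrow> a k \<in> intw ([r, z] ! k) q \<and> b k \<in> intw q ([r, z] ! k)"
    "\<And>k l. k < length [r, z] \<Longrightarrow> l < length [r, z] \<Longrightarrow> b k \<cdot> a l = (if k = l then ([r, z] ! k) \<I> else 0)"
    "(\<Sum>k<length [r, z]. a k \<cdot> b k) = q \<I>"
    using direct_sum_catD(4)[OF q] by blast
  have er: "emap r" and eq: "emap q" and e: "emap x" "emap y" "emap z"
    using direct_sum_catD(1)[OF r] direct_sum_catD(1)[OF q] assms emap_objs by blast+
  have c: "c 0 \<in> intw x r" "c 1 \<in> intw y r" "d 0 \<in> intw r x" "d 1 \<in> intw r y"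
    "d 0 \<cdot> c 0 = x \<I>" "d 0 \<cdot> c 1 = 0" "d 1 \<cdot> c 0 = 0" "d 1 \<cdot> c 1 = y \<I>" "c 0 \<cdot> d 0 + c 1 \<cdot> d 1 = r \<I>"
    using cd(1)[of 0] cd(1)[of 1] cd(2)[of 0 0] cd(2)[of 0 1] cd(2)[of 1 0] cd(2)[of 1 1] cd(3) by simp_all
  have a: "a 0 \<in> intw r q" "a 1 \<in> intw z q" "b 0 \<in> intw q r" "b 1 \<in> intw q z"
    "b 0 \<cdot> a 0 = r \<I>" "b 0 \<cdot> a 1 = 0" "b 1 \<cdot> a 0 = 0" "b 1 \<cdot> a 1 = z \<I>" "a 0 \<cdot> b 0 + a 1 \<cdot> b 1 = q \<I>"
    using ab(1)[of 0] ab(1)[of 1] ab(2)[of 0 0] ab(2)[of 0 1] ab(2)[of 1 0] ab(2)[of 1 1] ab(3) by simp_all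
  have s: "a 0 \<cdot> (c 0 \<cdot> (d 0 \<cdot> w)) + a 0 \<cdot> (c 1 \<cdot> (d 1 \<cdot> w)) = a 0 \<cdot> w" for w
  proof -
    have "a 0 \<cdot> (c 0 \<cdot> (d 0 \<cdot> w)) + a 0 \<cdot> (c 1 \<cdot> (d 1 \<cdot> w)) = a 0 \<cdot> ((c 0 \<cdot> d 0 + c 1 \<cdot> d 1) \<cdot> w)"
      by (simp add: op_distribs op_assoc)
    then show ?thesis unfolding c(9) using intw_right2[OF er a(1)] by simp
  qed
  have rc: "r \<I> \<cdot> c 0 = c 0" "r \<I> \<cdot> c 1 = c 1" using intw_left[OF er] c by blast+
  let ?u = "[a 0 \<cdot> c 0, a 0 \<cdot> c 1, a 1]" and ?v = "[d 0 \<cdot> b 0, d 1 \<cdot> b 0, b 1]" and ?xs = "[x, y, z]"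
  have lt: "k = 0 \<or> k = 1 \<or> k = 2" if "k < length ?xs" for k :: nat using that by auto
  have "direct_sum (cat SC) q ?xs"
  proof (rule direct_sum_catI[of _ _ _ "\<lambda>k. ?u ! k" "\<lambda>k. ?v ! k"])
    show "q \<in> objs \<inter> SC" by (rule direct_sum_catD(1)[OF q])
    show "set ?xs \<subseteq> objs \<inter> SC" using assms by simp
    show "?u ! k \<in> intw (?xs ! k) q \<and> ?v ! k \<in> intw q (?xs ! k)" if "k < length ?xs" for k
      using lt[OF that] intw_mult[OF e(1) eq a(1) c(1)] intw_mult[OF e(2) eq a(1) c(2)]
        intw_mult[OF eq e(1) c(3) a(3)] intw_mult[OF eq e(2) c(4) a(3)] a(2,4)
      by (elim disjE) simp_all
    show "?v ! k \<cdot> ?u ! l = (if k = l then (?xs ! k) \<I> else 0)" if "k < length ?xs" "l < length ?xs" for k l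
      using lt[OF that(1)] lt[OF that(2)] op_reassoc[OF a(5)] op_reassoc[OF a(6)] op_reassoc[OF a(7)] op_reassoc[OF a(8)]
      by (elim disjE) (simp_all add: op_assoc rc[unfolded One_nat_def] c[unfolded One_nat_def] a[unfolded One_nat_def])
    show "(\<Sum>k<length ?xs. ?u ! k \<cdot> ?v ! k) = q \<I>"
      using s[of "b 0"] a(9) by (simp add: op_assoc numeral_3_eq_3 numeral_2_eq_2)
  qed
  then show ?thesis by blast
qed

lemma orbit_sum_ex:
  assumes n: "n \<le> 1"
  obtains Q i p where "Q \<in> objs \<inter> SC" "dsum (Q \<I>) Q [wd (th 0 k) n 0, wd (th 1 k) n 0, wd (th 2 k) n 0]"
    "\<And>j :: 3. i j \<in> intw (wd (th j k) n 0) Q" "\<And>j :: 3. p j \<in> intw Q (wd (th j k) n 0)"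
    "\<And>j l. p j \<cdot> i l = (if j = l then \<I> else 0)" "(\<Sum>j\<in>UNIV. i j \<cdot> p j) = Q \<I>"
proof -
  let ?xs = "[wd (th 0 k) n 0, wd (th 1 k) n 0, wd (th 2 k) n 0]"
  obtain Q where Q: "direct_sum (cat SC) Q ?xs" using direct_sum_3 wd_0_objs[OF n] by blast
  obtain a b where ab: "\<And>k. k < length ?xs \<Longrightarrow> a k \<in> intw (?xs ! k) Q \<and> b k \<in> intw Q (?xs ! k)"
    "\<And>k l. k < length ?xs \<Longrightarrow> l < length ?xs \<Longrightarrow> b k \<cdot> a l = (if k = l then (?xs ! k) \<I> else 0)"
    "(\<Sum>k<length ?xs. a k \<cdot> b k) = Q \<I>"
    using direct_sum_catD(4)[OF Q] by blast
  \<comment> \<open>Positions in the list of summands, so that these can be indexed by the cyclic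
    group.\<close>
  define \<nu> :: "3 \<Rightarrow> nat" where "\<nu> j = (if j = 0 then 0 else if j = 1 then 1 else 2)" for j
  have \<nu>: "\<nu> j < length ?xs" "?xs ! \<nu> j = wd (th j k) n 0" for j
    using cases_3[of j] by (elim disjE; simp add: \<nu>_def)+
  have inj: "\<nu> j = \<nu> l \<longleftrightarrow> j = l" for j l
    using cases_3[of j] cases_3[of l] by (elim disjE; simp add: \<nu>_def)
  have "(\<Sum>j\<in>UNIV. a (\<nu> j) \<cdot> b (\<nu> j)) = Q \<I>"
    unfolding sum_UNIV_3 using ab(3) by (simp add: \<nu>_def numeral_3_eq_3 numeral_2_eq_2)
  moreover have "b (\<nu> j) \<cdot> a (\<nu> l) = (if j = l then \<I> else 0)" for j l
    using ab(2)[OF \<nu>(1)[of j] \<nu>(1)[of l]] unfolding inj \<nu>(2) by simp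
  moreover have "a (\<nu> j) \<in> intw (wd (th j k) n 0) Q \<and> b (\<nu> j) \<in> intw Q (wd (th j k) n 0)" for j
    using ab(1)[OF \<nu>(1)[of j]] unfolding \<nu>(2) .
  ultimately show thesis
    by (intro that[of Q "\<lambda>j. a (\<nu> j)" "\<lambda>j. b (\<nu> j)"] direct_sum_catD(1,3)[OF Q]) simp_all
qed

text \<open>Induction from \<open>C\<close> to its equivariantization, left adjoint to the forgetful functor.\<close>

lemma induced_object:
  fixes k
  assumes n: "n \<le> 1"
  defines "x \<equiv> wd k n 0"
  shows "\<exists>P \<in> eqobs. dsum (fst P \<I>) (fst P) [wd (th 0 k) n 0, wd (th 1 k) n 0, wd (th 2 k) n 0] \<and>
    (\<forall>q \<in> eqobs. \<exists>\<phi> \<eta>. bij_betw \<phi> (intw x (fst q)) (eqhom P q) \<and>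
      (\<forall>f \<in> intw x (fst q). \<phi> f \<cdot> \<eta> = f \<and> (\<forall>c. \<phi> (op_scale c f) = op_scale c (\<phi> f)) \<and>
        (\<forall>g \<in> intw x (fst q). \<phi> (f + g) = \<phi> f + \<phi> g)))"
proof -
  obtain Q i p where Q: "Q \<in> objs \<inter> SC" "dsum (Q \<I>) Q [wd (th 0 k) n 0, wd (th 1 k) n 0, wd (th 2 k) n 0]"
    and i: "\<And>j. i j \<in> intw (wd (th j k) n 0) Q" and p: "\<And>j. p j \<in> intw Q (wd (th j k) n 0)"
    and orth: "\<And>j l. p j \<cdot> i l = (if j = l then \<I> else 0)" and one: "(\<Sum>j\<in>UNIV. i j \<cdot> p j) = Q \<I>"
    by (rule orbit_sum_ex[OF n, of k]) (rule that; assumption)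
  have eQ: "emap Q" and ecQ: "emap (cj l Q)" for l using Q(1) emap_objs emap_cj by blast+
  have iM: "i j \<in> M" and pM: "p j \<in> M" for j using intw_M[OF i] intw_M[OF p] .
  have orth2: "p j \<cdot> (i l \<cdot> s) = (if j = l then s else 0)" for j l s
    using op_reassoc[OF orth[of j l], of s] by (simp split: if_splits)
  have x: "emap x" "x \<I> = \<I>" unfolding x_def by simp_all
  have cx: "wd (th j k) n 0 = cj j x" for j unfolding x_def cj_wd ..
  have gi: "gp l (i j) \<in> intw (wd (th (l + j) k) n 0) (cj l Q)" for l j
    using intw_cj[OF emap_wd eQ i[of j], of l] unfolding cx cj_cj .
  have gpp: "gp l (p j) \<in> intw (cj l Q) (wd (th (l + j) k) n 0)" for l j
    using intw_cj[OF eQ emap_wd p[of j], of l] unfolding cx cj_cj .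
  have gorth: "gp l (p j) \<cdot> gp l (i j') = (if j = j' then \<I> else 0)" for l j j'
    using iM pM orth by (simp add: emap_mult[symmetric])
  \<comment> \<open>\<open>a l\<close> sends the conjugate by \<open>\<gamma>\<^sup>l\<close> of the
    summand \<open>j\<close> to the summand \<open>l + j\<close>: the equivariant structure on an
    orbit sum permutes the summands. \<open>b l\<close> is its inverse.\<close>
  define a where "a l = (\<Sum>j\<in>UNIV. i (l + j) \<cdot> gp l (p j))" for l
  define b where "b l = (\<Sum>j\<in>UNIV. gp l (i j) \<cdot> p (l + j))" for l
  have aI: "a l \<in> intw (cj l Q) Q" for l
    unfolding a_def by (intro intw_sum[OF ecQ eQ] intw_mult[OF ecQ eQ i gpp])
  have aM: "a l \<in> M" for l using intw_M[OF aI] .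
  have bI: "b l \<in> intw Q (cj l Q)" for l
    unfolding b_def by (intro intw_sum[OF eQ ecQ] intw_mult[OF eQ ecQ gi p])
  have ai: "a l \<cdot> gp l (i j) = i (l + j)" for l j
  proof -
    have "a l \<cdot> gp l (i j) = (\<Sum>j'\<in>UNIV. if j' = j then i (l + j') else 0)"
      unfolding a_def blinfun_compose.sum_left
      by (rule sum.cong) (simp_all add: op_assoc gorth)
    then show ?thesis by simp
  qed
  have pa: "p (l + j) \<cdot> a l = gp l (p j)" for l j
  proof -
    have "p (l + j) \<cdot> a l = (\<Sum>j'\<in>UNIV. if j = j' then gp l (p j') else 0)"
      unfolding a_def blinfun_compose.sum_right
      by (rule sum.cong) (simp_all add: orth2)
    then show ?thesis by simp
  qed
  have ab: "a l \<cdot> b l = Q \<I>" for l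
  proof -
    have "a l \<cdot> b l = (\<Sum>j\<in>UNIV. i (l + j) \<cdot> p (l + j))"
      unfolding b_def blinfun_compose.sum_right op_reassoc[OF ai] ..
    then show ?thesis using sum_shift[of "\<lambda>j. i j \<cdot> p j" l] one by simp
  qed
  have gone: "(\<Sum>j\<in>UNIV. gp l (i j) \<cdot> gp l (p j)) = cj l Q \<I>" for l
  proof -
    have "gp l (\<Sum>j\<in>UNIV. i j \<cdot> p j) = (\<Sum>j\<in>UNIV. gp l (i j \<cdot> p j))"
      using emap_sum[OF emap_gp, of UNIV "\<lambda>j. i j \<cdot> p j"] iM pM by simp
    then show ?thesis unfolding one using iM pM by (simp add: emap_mult cj_apply)
  qed
  have ba: "b l \<cdot> a l = cj l Q \<I>" for l
  proof -
    have "b l \<cdot> a l = (\<Sum>j\<in>UNIV. gp l (i j) \<cdot> gp l (p j))"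
      unfolding b_def blinfun_compose.sum_left op_assoc pa ..
    then show ?thesis using gone by simp
  qed
  have mult: "a (l + l') = a l \<cdot> gp l (a l')" for l l'
  proof -
    have "gp l (a l') = (\<Sum>j\<in>UNIV. gp l (i (l' + j) \<cdot> gp l' (p j)))"
      unfolding a_def using emap_sum[OF emap_gp, of UNIV "\<lambda>j. i (l' + j) \<cdot> gp l' (p j)"] iM pM by simp
    then have "gp l (a l') = (\<Sum>j\<in>UNIV. gp l (i (l' + j)) \<cdot> gp (l + l') (p j))"
      using iM pM by (simp add: emap_mult gp_gp)
    then have "a l \<cdot> gp l (a l') = (\<Sum>j\<in>UNIV. i (l + (l' + j)) \<cdot> gp (l + l') (p j))"
      by (simp only: blinfun_compose.sum_right op_reassoc[OF ai])
    then show ?thesis unfolding a_def[of "l + l'"] by (simp add: add.assoc)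
  qed
  let ?P = "(Q, \<lambda>l. (cj l Q, a l, Q))"
  have P: "?P \<in> eqobs" unfolding eqobs_iff
  proof (intro conjI Q(1) exI[of _ a] refl allI bexI)
    fix l l'
    show "a l \<in> intw (cj l Q) Q" "b l \<in> intw Q (cj l Q)" "b l \<cdot> a l = cj l Q \<I>" "a l \<cdot> b l = Q \<I>"
      by (rule aI bI ba ab)+
    show "a (l + l') = a l \<cdot> gp l (a l')" by (rule mult)
  qed
  have act: "eqact ?P l = a l" for l by (simp add: eqact_def)
  have "\<exists>\<phi> \<eta>. bij_betw \<phi> (intw x (fst q)) (eqhom ?P q) \<and>
      (\<forall>f \<in> intw x (fst q). \<phi> f \<cdot> \<eta> = f \<and> (\<forall>c. \<phi> (op_scale c f) = op_scale c (\<phi> f)) \<and>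
        (\<forall>g \<in> intw x (fst q). \<phi> (f + g) = \<phi> f + \<phi> g))" if q: "q \<in> eqobs" for q
  proof -
    let ?Y = "fst q"
    note q' = eqobsD[OF q]
    \<comment> \<open>On the summand \<open>l\<close>, equivariance forces the extension of
      \<open>f\<close> to be the translate of \<open>f\<close> by \<open>l\<close>. Restriction
      along the inclusion \<open>i 0\<close> of \<open>x\<close> is the inverse bijection.\<close>
    define \<phi> where "\<phi> f = (\<Sum>l\<in>UNIV. eqact q l \<cdot> (gp l f \<cdot> p l))" for f
    have i0: "i 0 \<in> intw x Q" using i[of 0] unfolding cx cj_0[OF x(1)] .
    have ret: "\<phi> f \<cdot> i 0 = f" if f: "f \<in> intw x ?Y" for f
    proof -
      have "\<phi> f \<cdot> i 0 = (\<Sum>l\<in>UNIV. if l = 0 then eqact q l \<cdot> gp l f else 0)"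
        unfolding \<phi>_def blinfun_compose.sum_left by (rule sum.cong) (simp_all add: op_assoc orth)
      then have "\<phi> f \<cdot> i 0 = eqact q 0 \<cdot> gp 0 f" by simp
      then show ?thesis unfolding q'(7) using intw_left[OF q'(2) f] gp_0[OF intw_M[OF f]] by simp
    qed
    have into: "\<phi> f \<in> eqhom ?P q" if f: "f \<in> intw x ?Y" for f
    proof -
      have fM: "f \<in> M" using intw_M[OF f] .
      have "\<phi> f \<in> intw Q ?Y" unfolding \<phi>_def
      proof (intro intw_sum[OF eQ q'(2)])
        fix l
        have "gp l f \<in> intw (wd (th l k) n 0) (cj l ?Y)" unfolding cx by (rule intw_cj[OF x(1) q'(2) f])
        from intw_mult[OF eQ q'(2) q'(3) intw_mult[OF eQ emap_cj[OF q'(2)] this p]]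
        show "eqact q l \<cdot> (gp l f \<cdot> p l) \<in> intw Q ?Y" .
      qed
      moreover have "\<phi> f \<cdot> a l = eqact q l \<cdot> gp l (\<phi> f)" for l
      proof -
        have "gp l (\<phi> f) = (\<Sum>j\<in>UNIV. gp l (eqact q j \<cdot> (gp j f \<cdot> p j)))"
          unfolding \<phi>_def using emap_sum[OF emap_gp, of UNIV "\<lambda>j. eqact q j \<cdot> (gp j f \<cdot> p j)"] fM pM q'(4) by simp
        also have "\<dots> = (\<Sum>j\<in>UNIV. gp l (eqact q j) \<cdot> (gp (l + j) f \<cdot> gp l (p j)))"
          using fM pM q'(4) by (simp add: emap_mult gp_gp)
        finally have "eqact q l \<cdot> gp l (\<phi> f) = (\<Sum>j\<in>UNIV. eqact q (l + j) \<cdot> (gp (l + j) f \<cdot> gp l (p j)))"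
          by (simp only: blinfun_compose.sum_right op_reassoc[OF q'(6)[symmetric]])
        also have "\<dots> = (\<Sum>j\<in>UNIV. eqact q (l + j) \<cdot> (gp (l + j) f \<cdot> p (l + j))) \<cdot> a l"
          by (simp only: blinfun_compose.sum_left op_assoc pa)
        finally show ?thesis unfolding \<phi>_def sum_shift[of "\<lambda>j. eqact q j \<cdot> (gp j f \<cdot> p j)" l] by simp
      qed
      ultimately show ?thesis unfolding eqhom_def act by simp
    qed
    have inv: "t \<cdot> i 0 \<in> intw x ?Y" "\<phi> (t \<cdot> i 0) = t" if t: "t \<in> eqhom ?P q" for t
    proof -
      have t': "t \<in> intw Q ?Y" "t \<cdot> a l = eqact q l \<cdot> gp l t" for l using t unfolding eqhom_def act by simp_all
      have tM: "t \<in> M" using intw_M[OF t'(1)] .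
      show "t \<cdot> i 0 \<in> intw x ?Y" by (rule intw_mult[OF x(1) q'(2) t'(1) i0])
      have "eqact q l \<cdot> (gp l (t \<cdot> i 0) \<cdot> p l) = t \<cdot> (i l \<cdot> p l)" for l
      proof -
        have "eqact q l \<cdot> (gp l (t \<cdot> i 0) \<cdot> p l) = (eqact q l \<cdot> gp l t) \<cdot> (gp l (i 0) \<cdot> p l)"
          using tM iM by (simp add: emap_mult op_assoc)
        also have "\<dots> = t \<cdot> ((a l \<cdot> gp l (i 0)) \<cdot> p l)" unfolding t'(2)[symmetric] by (simp only: op_assoc)
        finally show ?thesis unfolding ai by simp
      qed
      then have "\<phi> (t \<cdot> i 0) = t \<cdot> (\<Sum>l\<in>UNIV. i l \<cdot> p l)"
        unfolding \<phi>_def by (simp only: blinfun_compose.sum_right)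
      then show "\<phi> (t \<cdot> i 0) = t" unfolding one using intw_right[OF eQ t'(1)] by simp
    qed
    have "bij_betw \<phi> (intw x ?Y) (eqhom ?P q)"
      by (rule bij_betwI[where g = "\<lambda>t. t \<cdot> i 0"]) (use into inv ret in auto)
    moreover have "\<phi> (op_scale c f) = op_scale c (\<phi> f)" if f: "f \<in> intw x ?Y" for f c
      unfolding \<phi>_def cvs.scale_sum_right using intw_M[OF f]
      by (simp add: emap_scale op_scale_left op_scale_right[OF M_bounded_ops[OF q'(4)]])
    moreover have "\<phi> (f + g) = \<phi> f + \<phi> g" if "f \<in> intw x ?Y" "g \<in> intw x ?Y" for f g
      unfolding \<phi>_def sum.distrib[symmetric] using intw_M[OF that(1)] intw_M[OF that(2)]
      by (simp add: emap_add op_distribs)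
    ultimately show ?thesis using ret by blast
  qed
  then show ?thesis using P Q(2) by (intro bexI[of _ ?P]) simp_all
qed

section \<open>The Gram family of C1\<close>

definition orbit :: "(2 \<times> 2) \<times> bool \<Rightarrow> idx list" where
  "orbit = (\<lambda>(k, b). [(th 0 k, b, 0), (th 1 k, b, 0), (th 2 k, b, 0)])"

text \<open>The universal property of an induced object, with bijection and unit bound
  existentially, so that a family of such objects can be chosen.\<close>

definition represents :: "idx \<Rightarrow> 'h endo \<times> (3 \<Rightarrow> 'h intertwiner) \<Rightarrow> bool" where
  "represents i P \<longleftrightarrow> (\<forall>q \<in> eqobs. \<exists>\<phi> \<eta>. bij_betw \<phi> (intw (W i) (fst q)) (eqhom P q) \<and>
      (\<forall>f \<in> intw (W i) (fst q). \<phi> f \<cdot> \<eta> = f \<and> (\<forall>c. \<phi> (op_scale c f) = op_scale c (\<phi> f)) \<and>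
        (\<forall>g \<in> intw (W i) (fst q). \<phi> (f + g) = \<phi> f + \<phi> g)))"

lemma induced_object_W: "\<exists>P \<in> eqobs. dsum (fst P \<I>) (fst P) (map W (orbit (k, b))) \<and> represents (k, b, 0) P"
  unfolding orbit_def represents_def W_def prod.case list.map by (rule induced_object) simp

text \<open>By adjunction, arrows between induced objects are arrows from a word to the orbit sum
  underlying the other object.\<close>

lemma gram_family_C1:
  "\<exists>P. opcat.gram_family eqobs eqhom P (\<lambda>i j. count_list (orbit j) (fst i, snd i, 0))"
proof -
  interpret opcat eqobs eqhom "\<lambda>p. fst p \<I>" by (rule opcat_eqobs)
  have "\<exists>P. P \<in> eqobs \<and> dsum (fst P \<I>) (fst P) (map W (orbit i)) \<and> represents (fst i, snd i, 0) P" for i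
    using induced_object_W[of "fst i" "snd i"] unfolding prod.collapse Bex_def .
  from choice[OF allI[OF this]] obtain P where
    "\<forall>i. P i \<in> eqobs \<and> dsum (fst (P i) \<I>) (fst (P i)) (map W (orbit i)) \<and> represents (fst i, snd i, 0) (P i)"
    by (rule exE)
  then have Po: "\<And>i. P i \<in> eqobs" and Ps: "\<And>i. dsum (fst (P i) \<I>) (fst (P i)) (map W (orbit i))"
    and Pr: "\<And>i. represents (fst i, snd i, 0) (P i)"
    by (simp_all del: split_paired_All)
  have "decomp (fst (P i)) (orbit i)" for i
    unfolding decomp_def using Ps[of i] eqobsD(2)[OF Po] by blast
  note dim = cdim_decomp[OF this]
  have \<phi>: "\<exists>\<phi> \<eta>. bij_betw \<phi> (intw (W (fst i, snd i, 0)) (fst q)) (eqhom (P i) q) \<and>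
      (\<forall>f \<in> intw (W (fst i, snd i, 0)) (fst q). \<phi> f \<cdot> \<eta> = f \<and> (\<forall>c. \<phi> (op_scale c f) = op_scale c (\<phi> f)) \<and>
        (\<forall>g \<in> intw (W (fst i, snd i, 0)) (fst q). \<phi> (f + g) = \<phi> f + \<phi> g))" if "q \<in> eqobs" for i q
    using bspec[OF Pr[of i, unfolded represents_def] that] .
  have "cdim (eqhom (P i) (P j)) (count_list (orbit j) (fst i, snd i, 0))" for i j
  proof -
    obtain \<phi> \<eta> where b: "bij_betw \<phi> (intw (W (fst i, snd i, 0)) (fst (P j))) (eqhom (P i) (P j))"
      and l: "\<forall>f \<in> intw (W (fst i, snd i, 0)) (fst (P j)). \<phi> f \<cdot> \<eta> = f \<and> (\<forall>c. \<phi> (op_scale c f) = op_scale c (\<phi> f)) \<and>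
        (\<forall>g \<in> intw (W (fst i, snd i, 0)) (fst (P j)). \<phi> (f + g) = \<phi> f + \<phi> g)"
      using \<phi>[OF Po, of i j] by (elim exE conjE)
    show ?thesis by (rule cdim_bij[OF dim b]) (simp_all add: l)
  qed
  moreover have "generating P UNIV" unfolding generating_def
  proof (intro ballI impI)
    fix q r f assume q: "q \<in> eqobs" and r: "r \<in> eqobs" and f: "f \<in> eqhom q r" "f \<noteq> 0"
    have f': "f \<in> intw (fst q) (fst r)" using f(1) unfolding eqhom_def by blast
    obtain ix where ix: "decomp (fst q) ix" "\<forall>j \<in> set ix. snd (snd j) = 0"
      using decomp_SC_degree eqobsD(1)[OF q] by blast
    obtain j t where t: "t \<in> intw (W j) (fst q)" "f \<cdot> t \<noteq> 0"
      using decomp_detect[OF ix(1) eqobsD(2)[OF r] f' f(2)] by blast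
    \<comment> \<open>The word that detects \<open>f\<close> occurs in \<open>fst q\<close>; it
      therefore has degree 0 and can be induced.\<close>
    have "count_list ix j \<noteq> 0"
    proof
      assume "count_list ix j = 0"
      then have "intw (W j) (fst q) = {0}" using cdim_decomp[OF ix(1), of j] cdim_0D by simp
      then show False using t by simp
    qed
    then have "j \<in> set ix" by (simp add: count_list_0_iff)
    then have j: "j = (fst (fst j, fst (snd j)), snd (fst j, fst (snd j)), 0)" using bspec[OF ix(2)] by (simp add: prod_eq_iff)
    define i where "i = (fst j, fst (snd j))"
    note j = j[folded i_def]
    obtain \<phi> \<eta> where b: "bij_betw \<phi> (intw (W (fst i, snd i, 0)) (fst q)) (eqhom (P i) q)"
      and l: "\<forall>f \<in> intw (W (fst i, snd i, 0)) (fst q). \<phi> f \<cdot> \<eta> = f \<and> (\<forall>c. \<phi> (op_scale c f) = op_scale c (\<phi> f)) \<and>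
        (\<forall>g \<in> intw (W (fst i, snd i, 0)) (fst q). \<phi> (f + g) = \<phi> f + \<phi> g)"
      using \<phi>[OF q, of i] by (elim exE conjE)
    have t': "t \<in> intw (W (fst i, snd i, 0)) (fst q)" using t(1) j by simp
    have "\<phi> t \<in> eqhom (P i) q" using b t' by (rule bij_betwE[THEN bspec])
    moreover have "f \<cdot> \<phi> t \<noteq> 0"
    proof
      assume "f \<cdot> \<phi> t = 0"
      then have "f \<cdot> (\<phi> t \<cdot> \<eta>) = 0" by (simp only: op_assoc[symmetric]) simp
      then show False using t(2) bspec[OF l t'] by simp
    qed
    ultimately show "\<exists>j\<in>UNIV. \<exists>t\<in>eqhom (P j) q. f \<cdot> t \<noteq> 0" by blast
  qed
  ultimately show ?thesis unfolding gram_family_def using Po by blast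
qed

end

section \<open>Ranks from Gram matrices\<close>

definition gsupp :: "'s set \<Rightarrow> ('i \<Rightarrow> 's \<Rightarrow> nat) \<Rightarrow> 'i \<Rightarrow> 's set" where
  "gsupp S n i = {s \<in> S. 0 < n i s}"

lemma gramD:
  assumes "gram S n m"
  shows "finite S" "(\<Sum>s\<in>S. n i s * n j s) = m i j" "(\<Union>i. gsupp S n i) = S" "finite (gsupp S n i)" "gsupp S n i \<subseteq> S"
  using assms unfolding gram_def gsupp_def by auto

text \<open>The rows of \<open>n\<close> at \<open>i\<close> and \<open>j\<close> differ by a vector
  of squared norm \<open>m i i + m j j - 2 m i j = 0\<close>.\<close>

lemma gram_equal:
  assumes g: "gram S n m" and eq: "m i i = m i j" "m j j = m i j"
  shows "gsupp S n i = gsupp S n j"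
proof -
  let ?d = "\<lambda>s. int (n i s) - int (n j s)"
  have "(\<Sum>s\<in>S. ?d s * ?d s) = int (\<Sum>s\<in>S. n i s * n i s) + int (\<Sum>s\<in>S. n j s * n j s) - 2 * int (\<Sum>s\<in>S. n i s * n j s)"
    by (simp add: algebra_simps sum.distrib sum_subtractf sum_distrib_left)
  also have "\<dots> = 0" unfolding gramD(2)[OF g] using eq by simp
  finally have "\<forall>s\<in>S. ?d s * ?d s = 0" using gramD(1)[OF g] by (simp add: sum_nonneg_eq_0_iff)
  then show ?thesis unfolding gsupp_def by auto
qed

lemma gram_disjoint:
  assumes g: "gram S n m" and "m i j = 0"
  shows "gsupp S n i \<inter> gsupp S n j = {}"
  using assms(2) gramD(1)[OF g] unfolding gramD(2)[OF g, symmetric] gsupp_def by auto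

lemma gram_sum_gsupp:
  assumes g: "gram S n m"
  shows "(\<Sum>s\<in>gsupp S n i. n i s * n j s) = m i j"
  unfolding gramD(2)[OF g, symmetric] using gramD(1)[OF g]
  by (intro sum.mono_neutral_left) (auto simp: gsupp_def)

lemma gram_card_gsupp:
  assumes g: "gram S n m"
  shows "card (gsupp S n i) \<le> m i i"
proof -
  have "card (gsupp S n i) = (\<Sum>s\<in>gsupp S n i. 1)" by simp
  also have "\<dots> \<le> (\<Sum>s\<in>gsupp S n i. n i s * n i s)" by (rule sum_mono) (auto simp: gsupp_def)
  finally show ?thesis unfolding gram_sum_gsupp[OF g] .
qed

text \<open>\<open>T\<close> represents the rows of \<open>n\<close> up to equality, and a row of
  squared norm \<open>m j j\<close> has at most that many constituents.\<close>

lemma gram_card_le: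
  assumes g: "gram S n m" and T: "finite T" "\<And>i. \<exists>j\<in>T. m i i = m i j \<and> m j j = m i j"
  shows "card S \<le> (\<Sum>j\<in>T. m j j)"
proof -
  have "S \<subseteq> (\<Union>j\<in>T. gsupp S n j)"
  proof
    fix s assume "s \<in> S"
    then obtain i where "s \<in> gsupp S n i" using gramD(3)[OF g] by blast
    moreover obtain j where "j \<in> T" "m i i = m i j" "m j j = m i j" using T(2) by blast
    ultimately show "s \<in> (\<Union>j\<in>T. gsupp S n j)" using gram_equal[OF g] by blast
  qed
  then have "card S \<le> card (\<Union>j\<in>T. gsupp S n j)"
    using T(1) gramD(4)[OF g] by (intro card_mono) auto
  also have "\<dots> \<le> (\<Sum>j\<in>T. card (gsupp S n j))" using T(1) by (rule card_UN_le)
  also have "\<dots> \<le> (\<Sum>j\<in>T. m j j)" by (rule sum_mono) (rule gram_card_gsupp[OF g])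
  finally show ?thesis .
qed

text \<open>With the identity as Gram matrix, the members have nonempty and pairwise disjoint sets
  of constituents.\<close>

lemma gram_card_ge:
  fixes m :: "'i::finite \<Rightarrow> 'i \<Rightarrow> nat"
  assumes g: "gram S n m" and m: "\<And>i j. m i j = of_bool (i = j)"
  shows "CARD('i) \<le> card S"
proof -
  have "gsupp S n i \<noteq> {}" for i using gram_sum_gsupp[OF g, of i i] m[of i i] by auto
  then have "\<exists>f. \<forall>i. f i \<in> gsupp S n i" by (intro choice) blast
  then obtain f where f: "\<And>i. f i \<in> gsupp S n i" by blast
  have "inj f"
  proof (rule injI)
    fix i j assume "f i = f j"
    then have "f i \<in> gsupp S n i \<inter> gsupp S n j" using f[of i] f[of j] by simp
    then show "i = j" using gram_disjoint[OF g, of i j] m[of i j] by (cases "i = j") auto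
  qed
  moreover have "range f \<subseteq> S" using f gramD(5)[OF g] by blast
  ultimately show ?thesis using card_inj_on_le[of f UNIV S] gramD(1)[OF g] by simp
qed

lemma gram_norm_1:
  assumes g: "gram S n m" and "m i i = 1"
  obtains e where "gsupp S n i = {e}" "\<And>j. n j e = m i j"
proof -
  have "(\<Sum>s\<in>S. n i s * n i s) = 1" unfolding gramD(2)[OF g] by fact
  then obtain e where e: "e \<in> S" "n i e * n i e = 1" "\<forall>b\<in>S. e \<noteq> b \<longrightarrow> n i b * n i b = 0"
    unfolding sum_eq_1_iff[OF gramD(1)[OF g]] by blast
  have s: "gsupp S n i = {e}" unfolding gsupp_def using e by auto
  moreover have "n j e = m i j" for j using gram_sum_gsupp[OF g, of i j] e(2) unfolding s by simp
  ultimately show thesis by (rule that)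
qed

text \<open>2 is a sum of positive squares only as 1 + 1. The object is a sum of two distinct simple
  classes, and the row \<open>m i\<close> records the sums of the multiplicities of these
  two.\<close>

lemma gram_norm_2:
  assumes g: "gram S n m" and "m i i = 2"
  obtains u v where "u \<noteq> v" "gsupp S n i = {u, v}" "\<And>j. n j u + n j v = m i j"
proof -
  have 2: "(\<Sum>s\<in>gsupp S n i. n i s * n i s) = 2" unfolding gram_sum_gsupp[OF g] by fact
  then have "gsupp S n i \<noteq> {}" by auto
  then obtain u where u: "u \<in> gsupp S n i" by blast
  have *: "n i u * n i u + (\<Sum>s\<in>gsupp S n i - {u}. n i s * n i s) = 2"
    using 2 sum.remove[OF gramD(4)[OF g] u, of "\<lambda>s. n i s * n i s"] by simp
  have "0 < n i u" using u unfolding gsupp_def by simp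
  moreover have "n i u < 2"
  proof (rule ccontr)
    assume "\<not> n i u < 2"
    then have "2 * 2 \<le> n i u * n i u" by (intro mult_le_mono) simp_all
    then show False using * by simp
  qed
  ultimately have nu: "n i u = 1" by simp
  then have "(\<Sum>s\<in>gsupp S n i - {u}. n i s * n i s) = 1" using * by simp
  then obtain v where v: "v \<in> gsupp S n i - {u}" "n i v * n i v = 1"
      "\<forall>b\<in>gsupp S n i - {u}. v \<noteq> b \<longrightarrow> n i b * n i b = 0"
    unfolding sum_eq_1_iff[OF finite_Diff[OF gramD(4)[OF g]]] by blast
  have uv: "u \<noteq> v" and s: "gsupp S n i = {u, v}" using u v by (auto simp: gsupp_def)
  moreover have "n j u + n j v = m i j" for j
    using gram_sum_gsupp[OF g, of i j] v(2) nu uv unfolding s by simp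
  ultimately show thesis by (rule that)
qed

section \<open>Multiplicities of words in products with \<open>1 + \<alpha>\<^sub>g\<close> and
  \<open>1 + \<alpha>\<^sub>h\<rho>\<close>\<close>

context crossed_product begin

text \<open>The sum of all \<open>\<alpha>\<^sub>l\<rho>\<close>, shifted by \<open>k\<close>. The
  shift permutes the list, so counts do not depend on \<open>k\<close>; it is kept to match
  \<open>wl\<close>.\<close>

definition all_\<rho> :: "2 \<times> 2 \<Rightarrow> 3 \<Rightarrow> idx list" where
  "all_\<rho> k c = map (\<lambda>l. (k + l, True, c)) [(0,0),(0,1),(1,0),(1,1)]"

lemma wl_2: "wl (Suc (Suc 0)) k c = (k, False, c) # all_\<rho> k c"
  by (simp add: all_\<rho>_def)

lemma count_all_\<rho>: "count_list (all_\<rho> k c) (l, b, d) = of_bool (b \<and> c = d)"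
  using cases_2x2[of k] cases_2x2[of l] unfolding all_\<rho>_def by (elim disjE) (simp_all add: zero_prod_def)

lemma sum_list_all: "sum_list (map (\<lambda>l :: 2 \<times> 2. of_bool (x = y + l)) [(0,0),(0,1),(1,0),(1,1)]) = (1 :: nat)"
  using cases_2x2[of x] cases_2x2[of y] by (elim disjE) (simp_all add: zero_prod_def)

lemma count_concat_map: "count_list (concat (map f xs)) x = sum_list (map (\<lambda>y. count_list (f y) x) xs)"
  by (induction xs) simp_all

lemma lcomp_simps: "lcomp [] js = []" "lcomp (i # ix) js = concat (map (wprod i) js) @ lcomp ix js"
  "lcomp (ix @ ix') js = lcomp ix js @ lcomp ix' js"
  by (simp_all add: lcomp_def)

text \<open>The left factor shifts by \<open>g\<close>, the right one by \<open>th d g\<close>,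
  because it has to pass \<open>\<gamma>\<^sup>d\<close>.\<close>

lemma count_one_plus_\<alpha>:
  "count_list (lcomp (lcomp [(0, False, 0), (g, False, 0)] [(l, f, d)]) [(0, False, 0), (g, False, 0)]) (k, b, c) =
    (if c = d \<and> b = f then of_bool (k = l) + of_bool (k = l + g) + of_bool (k = l + th d g) + of_bool (k = l + g + th d g) else 0)"
  by (cases f) (auto simp: lcomp_simps wprod_def add_ac)

text \<open>Each \<open>\<alpha>\<^sub>j\<rho>\<close> occurs once in the sum itself and four times
  in the four squares of \<open>\<rho>\<close>, each \<open>\<alpha>\<^sub>j\<close> once in the
  latter: hence 5 and 1.\<close>

lemma count_\<alpha>\<rho>_all_\<rho>:
  "count_list (lcomp (all_\<rho> l d) [(0, False, 0), (h, True, 0)]) (k, b, c) =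
    (if c = d then (if b then 5 else 1) else 0)"
proof -
  have "count_list (concat (map (wprod (l + j, True, d)) [(0, False, 0), (h, True, 0)])) (k, b, c) =
      (if c = d then (if b then of_bool (k = l + j) + 1 else of_bool (k = (l + th d h) + j)) else 0)" for j
    by (auto simp: wprod_def wl_2 count_all_\<rho> add_ac simp del: wl.simps(3))
  then show ?thesis
    unfolding lcomp_def all_\<rho>_def map_map count_concat_map comp_def
    using sum_list_all[of k l] sum_list_all[of k "l + th d h"] by (cases b) (simp_all split: if_splits)
qed

text \<open>For \<open>x = \<alpha>\<^sub>l\<rho>\<gamma>\<^sup>d\<close> the constant 6 is 1 + 1 +
  4: one copy of every \<open>\<alpha>\<^sub>k\<rho>\<close> from each of the two terms with a
  square of \<open>\<rho>\<close>, and four from the term with the cube. The two index conditions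
  come from \<open>x\<close> itself and from the single \<open>\<rho>\<close> in the cube.\<close>

lemma count_one_plus_\<alpha>\<rho>:
  "count_list (lcomp (lcomp [(0, False, 0), (h, True, 0)] [(l, f, d)]) [(0, False, 0), (h, True, 0)]) (k, b, c) =
    (if c \<noteq> d then 0 else if b = f then of_bool (k = l) + of_bool (k = l + h + th d h) + 6 * of_bool b
     else 1 + of_bool (k = l + h) + of_bool (k = l + th d h))"
proof (cases f)
  case False
  then show ?thesis
    by (auto simp: lcomp_simps wprod_def wl_2 count_all_\<rho> add_ac simp del: wl.simps(3))
next
  case True
  have 1: "lcomp [(0, False, 0), (h, True, 0)] [(l, True, d)] = (l, True, d) # (h + l, False, d) # all_\<rho> (h + l) d"
    by (simp add: lcomp_simps wprod_def wl_2 del: wl.simps(3))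
  have f: "f = True" using True by simp
  show ?thesis unfolding f 1 lcomp_simps(2)[of "(l, True, d)"] lcomp_simps(2)[of "(h + l, False, d)"]
      count_list_append count_\<alpha>\<rho>_all_\<rho>
    by (cases b; cases "c = d")
      (simp_all add: wprod_def wl_2 count_all_\<rho> add_ac of_bool_def eq_commute[of k] del: wl.simps(3))
qed

lemma count_orbit:
  "count_list (orbit (l, f)) (k, b, 0) = (if b = f then of_bool (k = l) + of_bool (k = th 1 l) + of_bool (k = th 2 l) else 0)"
  by (simp add: orbit_def)

section \<open>Upper bounds for the ranks of C3 and C1\<close>

lemma th_moves: "l \<noteq> 0 \<Longrightarrow> c \<noteq> 0 \<Longrightarrow> th c l \<noteq> l"
  using th_inj[of l c 0] by auto

lemma th_distinct: "l \<noteq> 0 \<Longrightarrow> l \<noteq> th 1 l" "l \<noteq> 0 \<Longrightarrow> l \<noteq> th 2 l" "l \<noteq> 0 \<Longrightarrow> th 1 l \<noteq> th 2 l"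
  using th_moves[of l 1] th_moves[of l 2] th_inj[of l 1 2] by auto

text \<open>In degree 0 the left and right shifts coincide: two cosets of \<open>g\<close>, with or
  without \<open>\<rho>\<close>, each of squared norm 2, give 8. In degree
  \<open>c \<noteq> 0\<close> the shifts \<open>g\<close> and \<open>th c g\<close> generate the
  group, so all \<open>k\<close> yield the same simple object; two degrees, with or without
  \<open>\<rho>\<close>, give 4.\<close>

lemma rank_one_plus_\<alpha>:
  assumes gr: "gram S n (\<lambda>i j. count_list (lcomp (lcomp [(0, False, 0), (g, False, 0)] [j]) [(0, False, 0), (g, False, 0)]) i)"
    and g: "g \<noteq> 0"
  shows "card S \<le> 12"
proof -
  define m where "m i j = count_list (lcomp (lcomp [(0, False, 0), (g, False, 0)] [j]) [(0, False, 0), (g, False, 0)]) i" for i j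
  have gr: "gram S n m" using gr unfolding m_def .
  have m: "m (k, b, c) (l, f, d) =
      (if c = d \<and> b = f then of_bool (k = l) + of_bool (k = l + g) + of_bool (k = l + th d g) + of_bool (k = l + g + th d g) else 0)"
    for k b c l f d unfolding m_def by (rule count_one_plus_\<alpha>)
  let ?r = "th 1 g"
  have r: "?r \<noteq> 0" "?r \<noteq> g" using th_nonzero[OF g] th_moves[OF g] by simp_all
  let ?T = "set [(0, False, 0), (?r, False, 0), (0, True, 0), (?r, True, 0),
    (0, False, 1), (0, True, 1), (0, False, 2), (0, True, 2)]"
  have one: "m (k, b, c) (l, b, c) = 1" if c: "c \<noteq> 0" for k b c l
  proof -
    have "k + l = 0 \<or> k + l = g \<or> k + l = th c g \<or> k + l = g + th c g"
      using cases_generators[OF g th_nonzero[OF g], of c "k + l"] th_moves[OF g c] by fastforce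
    moreover have "th c g \<noteq> g" "th c g \<noteq> 0" using th_moves[OF g c] th_nonzero[OF g] by simp_all
    moreover have "k = l + x \<longleftrightarrow> k + l = x" for x using swap_2x2[of k x l] by (simp add: add.commute)
    from this[of 0] this[of g] this[of "th c g"] this[of "g + th c g"]
    have "m (k, b, c) (l, b, c) = of_bool (k + l = 0) + of_bool (k + l = g) + of_bool (k + l = th c g) + of_bool (k + l = g + th c g)"
      unfolding m by (simp add: add.assoc)
    ultimately show ?thesis using g by auto
  qed
  have "card S \<le> (\<Sum>j\<in>?T. m j j)"
  proof (rule gram_card_le[OF gr])
    fix i :: idx
    obtain k b c where i: "i = (k, b, c)" by (cases i)
    show "\<exists>j\<in>?T. m i i = m i j \<and> m j j = m i j"
    proof (cases "c = 0")
      case True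
      have "k = 0 \<or> k = g \<or> k = ?r \<or> k = g + ?r" using cases_generators[OF g r(1)] r(2) by metis
      then have "(k = 0 \<or> k = g) \<or> (k = ?r \<or> k = ?r + g)" by (auto simp: add.commute)
      then show ?thesis
      proof
        assume "k = 0 \<or> k = g"
        then show ?thesis unfolding i True using g by (intro bexI[of _ "(0, b, 0)"]) (auto simp: m)
      next
        assume "k = ?r \<or> k = ?r + g"
        then show ?thesis unfolding i True using g by (intro bexI[of _ "(?r, b, 0)"]) (auto simp: m add.assoc)
      qed
    next
      case False
      then show ?thesis unfolding i using cases_3[of c]
        by (intro bexI[of _ "(0, b, c)"]) (auto simp: one)
    qed
  qed simp
  also have "(\<Sum>j\<in>?T. m j j) \<le> (\<Sum>j\<leftarrow>[(0, False, 0), (?r, False, 0), (0, True, 0), (?r, True, 0),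
    (0, False, 1), (0, True, 1), (0, False, 2), (0, True, 2)]. m j j)"
    using r by (subst sum.distinct_set_conv_list) auto
  also have "\<dots> = 12" using g th_distinct[OF g] th_nonzero[OF g] by (simp add: one m)
  finally show ?thesis .
qed

text \<open>An induced object has squared norm 3 on a fixed word and 1 on a free orbit. The proof
  yields 3 + 1 + 3 + 1 = 8; the stated 12 is the bound shared with C3.\<close>

lemma rank_C1:
  assumes "gram S n (\<lambda>i j. count_list (orbit j) (fst i, snd i, 0))"
  shows "card S \<le> 12"
proof -
  obtain g :: "2 \<times> 2" where g: "g \<noteq> 0" using that[of "(1, 1)"] by (simp add: zero_prod_def)
  let ?T = "set [(0, False), (g, False), (0, True), (g, True)]"
  define m where "m i j = count_list (orbit j) (fst i, snd i, 0)" for i j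
  have gr: "gram S n m" using assms unfolding m_def .
  have m: "m (k, b) (l, f) = (if b = f then of_bool (k = l) + of_bool (k = th 1 l) + of_bool (k = th 2 l) else 0)"
    for k b l f unfolding m_def by (simp add: count_orbit)
  have one: "m (k, b) (l, b) = 1" if "k \<noteq> 0" "l \<noteq> 0" for k b l
  proof -
    have "k = l \<or> k = th 1 l \<or> k = th 2 l" using \<theta>(2)[OF that(2)] that(1) unfolding th_def by auto
    moreover have "th 1 l \<noteq> l" "th 2 l \<noteq> l" "th 1 l \<noteq> th 2 l"
      using th_moves[OF that(2)] th_inj[OF that(2), of 1 2] by auto
    ultimately show ?thesis unfolding m by auto
  qed
  have "card S \<le> (\<Sum>j\<in>?T. m j j)"
  proof (rule gram_card_le[OF gr])
    fix i :: "(2 \<times> 2) \<times> bool"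
    obtain k b where i: "i = (k, b)" by (cases i)
    show "\<exists>j\<in>?T. m i i = m i j \<and> m j j = m i j"
    proof (cases "k = 0")
      case True
      then show ?thesis unfolding i by (intro bexI[of _ "(0, b)"]) auto
    next
      case False
      then show ?thesis unfolding i using g by (intro bexI[of _ "(g, b)"]) (auto simp: one)
    qed
  qed simp
  also have "(\<Sum>j\<in>?T. m j j) = 8" using g th_distinct[OF g] th_nonzero[OF g] by (simp add: one m)
  finally show ?thesis by simp
qed

section \<open>Bounds for the rank of C4\<close>

context
  fixes S :: "'s set" and n :: "idx \<Rightarrow> 's \<Rightarrow> nat" and m :: "idx \<Rightarrow> idx \<Rightarrow> nat" and h :: "2 \<times> 2"
  assumes gr: "gram S n m" and h: "h \<noteq> 0"
    and m: "\<And>k b c l f d. m (k, b, c) (l, f, d) =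
      (if c \<noteq> d then 0 else if b = f then of_bool (k = l) + of_bool (k = l + h + th d h) + 6 * of_bool b
       else 1 + of_bool (k = l + h) + of_bool (k = l + th d h))"
begin

text \<open>The four bimodules on \<open>\<alpha>\<^sub>k\<close> have squared norm 2 and are
  disjoint, which gives 8 classes. A bimodule on \<open>\<alpha>\<^sub>l\<rho>\<close> has squared
  norm 8, and its multiplicities on these classes already account for 1 + 1 + 1 + 5, so it contains
  nothing new.\<close>

lemma degree_0_supp: "card (\<Union>k b. gsupp S n (k, b, 0)) = 8"
proof -
  let ?N = "\<lambda>k. gsupp S n (k, False, 0)"
  have two: "card (?N k) = 2 \<and> (\<forall>l. 1 + 4 * of_bool (k = l + h) \<le> (\<Sum>s\<in>?N k. n (l, True, 0) s * n (l, True, 0) s))" for k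
  proof -
    have "m (k, False, 0) (k, False, 0) = 2" by (simp add: m add.assoc)
    then obtain u v where uv: "u \<noteq> v" "?N k = {u, v}" "\<And>j. n j u + n j v = m (k, False, 0) j"
      using gram_norm_2[OF gr, of "(k, False, 0)"] by blast
    have "1 + 4 * of_bool (k = l + h) \<le> (\<Sum>s\<in>?N k. n (l, True, 0) s * n (l, True, 0) s)" for l
    proof -
      let ?a = "n (l, True, 0) u" and ?b = "n (l, True, 0) v"
      have ab: "?a + ?b = 1 + 2 * of_bool (k = l + h)" using uv(3)[of "(l, True, 0)"] by (simp add: m)
      \<comment> \<open>Two multiplicities with sum 3 have squares adding up to at least 1 + 4, two
        with sum 1 to exactly 1.\<close>
      have "1 + 4 * of_bool (k = l + h) \<le> ?a * ?a + ?b * ?b"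
      proof (cases "k = l + h")
        case True
        then have "?b = 3 - ?a" "?a = 0 \<or> ?a = 1 \<or> ?a = 2 \<or> ?a = 3" using ab by auto
        then show ?thesis using True by auto
      next
        case False
        then have "?b = 1 - ?a" "?a = 0 \<or> ?a = 1" using ab by auto
        then show ?thesis using False by auto
      qed
      then show ?thesis unfolding uv(2) using uv(1) by simp
    qed
    then show ?thesis unfolding uv(2) using uv(1) by simp
  qed
  have fin: "finite (?N k)" for k by (rule gramD(4)[OF gr])
  have disj: "\<forall>i\<in>UNIV. \<forall>j\<in>UNIV. i \<noteq> j \<longrightarrow> ?N i \<inter> ?N j = {}"
    by (intro ballI impI gram_disjoint[OF gr]) (simp add: m add.assoc)
  let ?A = "\<Union>k. ?N k"
  have A: "?A \<subseteq> S" by (intro UN_least gramD(5)[OF gr])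
  have "card ?A = (\<Sum>k\<in>(UNIV :: (2 \<times> 2) set). card (?N k))"
    by (rule card_UN_disjoint) (use fin disj in simp_all)
  then have card: "card ?A = 8" using two by simp
  have sub: "gsupp S n (l, True, 0) \<subseteq> ?A" for l
  proof -
    let ?f = "\<lambda>s. n (l, True, 0) s * n (l, True, 0) s"
    have "8 = (\<Sum>k\<in>(UNIV :: (2 \<times> 2) set). 1 + 4 * of_bool (k = l + h) :: nat)"
      unfolding sum.distrib sum_distrib_left[symmetric] by (simp add: of_bool_def)
    also have "\<dots> \<le> (\<Sum>k\<in>UNIV. sum ?f (?N k))" by (rule sum_mono) (rule two[THEN conjunct2, THEN spec])
    also have "\<dots> = sum ?f ?A" by (rule sum.UNION_disjoint[symmetric]) (use fin disj in simp_all)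
    finally have "8 \<le> sum ?f ?A" .
    moreover have "sum ?f S = 8" using gramD(2)[OF gr, of "(l, True, 0)" "(l, True, 0)"] by (simp add: m add.assoc)
    moreover have "sum ?f S = sum ?f (S - ?A) + sum ?f ?A" by (rule sum.subset_diff[OF A gramD(1)[OF gr]])
    ultimately have "sum ?f (S - ?A) = 0" by linarith
    then have z: "\<forall>s\<in>S - ?A. ?f s = 0" using gramD(1)[OF gr] by simp
    show ?thesis
    proof
      fix s assume s: "s \<in> gsupp S n (l, True, 0)"
      then have s': "s \<in> S" "?f s \<noteq> 0" by (simp_all add: gsupp_def)
      show "s \<in> ?A"
      proof (rule ccontr)
        assume "s \<notin> ?A"
        then have "s \<in> S - ?A" using s'(1) by (rule DiffI[rotated])
        from bspec[OF z this] s'(2) show False by simp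
      qed
    qed
  qed
  have "(\<Union>k b. gsupp S n (k, b, 0)) = ?A"
  proof
    show "(\<Union>k b. gsupp S n (k, b, 0)) \<subseteq> ?A"
    proof (intro UN_least)
      fix k b show "gsupp S n (k, b, 0) \<subseteq> ?A" using sub[of k] by (cases b) auto
    qed
  qed blast
  then show ?thesis using card by simp
qed

text \<open>The bimodules on \<open>\<alpha>\<^sub>k\<close> have squared norm 1 and give two
  classes \<open>e1\<close>, \<open>e2\<close>. Those on \<open>\<alpha>\<^sub>l\<rho>\<close> have
  squared norm 7 and contain these two with multiplicities 1 and 2 in some order. This leaves
  squared norm 2, so at least one and at most two further classes. As \<open>k\<close> and
  \<open>k + h + th c h\<close> have equal rows, only \<open>l = 0\<close> and \<open>l = h\<close>
  count, whence 2 + 1 and 2 + 2 + 2.\<close>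

lemma degree_nonzero_supp:
  assumes c: "c \<noteq> 0"
  shows "3 \<le> card (\<Union>k b. gsupp S n (k, b, c))" "card (\<Union>k b. gsupp S n (k, b, c)) \<le> 6"
proof -
  let ?h = "th c h" and ?N = "\<lambda>k b. gsupp S n (k, b, c)"
  have h': "?h \<noteq> 0" "?h \<noteq> h" "h \<noteq> ?h" using th_nonzero[OF h] th_moves[OF h c] by auto
  have "m (0, False, c) (0, False, c) = 1" "m (h, False, c) (h, False, c) = 1" using h h' by (simp_all add: m add.assoc)
  then obtain e1 e2 where e1: "?N 0 False = {e1}" "\<And>j. n j e1 = m (0, False, c) j"
    and e2: "?N h False = {e2}" "\<And>j. n j e2 = m (h, False, c) j"
    using gram_norm_1[OF gr, of "(0, False, c)"] gram_norm_1[OF gr, of "(h, False, c)"] by metis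
  have "?N 0 False \<inter> ?N h False = {}" by (rule gram_disjoint[OF gr]) (use h h' in \<open>simp add: m add.assoc\<close>)
  then have ne: "e1 \<noteq> e2" unfolding e1(1) e2(1) by simp
  have rest: "{e1, e2} \<subseteq> ?N l True \<and> 1 \<le> card (?N l True - {e1, e2}) \<and> card (?N l True - {e1, e2}) \<le> 2"
    if l: "l = 0 \<or> l = h" for l
  proof -
    let ?x = "(l, True, c)"
    let ?f = "\<lambda>s. n ?x s * n ?x s"
    have v: "n ?x e1 = 1 \<and> n ?x e2 = 2 \<or> n ?x e1 = 2 \<and> n ?x e2 = 1"
      using l h h' unfolding e1(2) e2(2) by (auto simp: m add.assoc)
    then have sub: "{e1, e2} \<subseteq> ?N l True" using e1(1) e2(1) unfolding gsupp_def by auto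
    have "sum ?f (?N l True) = 7" unfolding gram_sum_gsupp[OF gr] using h h' by (simp add: m add.assoc)
    moreover have "sum ?f (?N l True) = sum ?f (?N l True - {e1, e2}) + sum ?f {e1, e2}"
      by (rule sum.subset_diff[OF sub gramD(4)[OF gr]])
    moreover have "sum ?f {e1, e2} = 5" using v ne by auto
    ultimately have 2: "sum ?f (?N l True - {e1, e2}) = 2" by simp
    have "?N l True - {e1, e2} \<noteq> {}"
    proof
      assume E: "?N l True - {e1, e2} = {}"
      show False using 2 unfolding E by simp
    qed
    then have "0 < card (?N l True - {e1, e2})" using gramD(4)[OF gr] by (simp only: card_gt_0_iff finite_Diff simp_thms)
    moreover have "card (?N l True - {e1, e2}) \<le> sum ?f (?N l True - {e1, e2})"
      unfolding card_eq_sum by (rule sum_mono) (auto simp: gsupp_def)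
    ultimately have "1 \<le> card (?N l True - {e1, e2})" "card (?N l True - {e1, e2}) \<le> 2" using 2 by linarith+
    then show ?thesis using sub by (intro conjI)
  qed
  let ?R0 = "?N 0 True - {e1, e2}" and ?R1 = "?N h True - {e1, e2}"
  have W: "(\<Union>k b. ?N k b) = {e1, e2} \<union> (?R0 \<union> ?R1)"
  proof
    show "(\<Union>k b. ?N k b) \<subseteq> {e1, e2} \<union> (?R0 \<union> ?R1)"
    proof (intro UN_least)
      fix k b
      have "k = 0 \<or> k = h \<or> k = ?h \<or> k = h + ?h" by (rule cases_generators[OF h h'(1,3)])
      then have "?N k b = ?N 0 b \<or> ?N k b = ?N h b"
      proof (elim disjE)
        assume k: "k = ?h"
        have "?N k b = ?N h b" by (rule gram_equal[OF gr]) (use h h' in \<open>simp_all add: m k add_ac\<close>)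
        then show ?thesis by simp
      next
        assume k: "k = h + ?h"
        have "?N k b = ?N 0 b" by (rule gram_equal[OF gr]) (use h h' in \<open>simp_all add: m k add_ac\<close>)
        then show ?thesis by simp
      qed simp_all
      then show "?N k b \<subseteq> {e1, e2} \<union> (?R0 \<union> ?R1)" using e1(1) e2(1) by (cases b) auto
    qed
    show "{e1, e2} \<union> (?R0 \<union> ?R1) \<subseteq> (\<Union>k b. ?N k b)" using e1(1) e2(1) by blast
  qed
  have fin: "finite ?R0" "finite ?R1" using gramD(4)[OF gr] by simp_all
  have "card (\<Union>k b. ?N k b) = 2 + card (?R0 \<union> ?R1)"
    unfolding W using ne fin by (subst card_Un_disjoint) auto
  moreover have "card (?R0 \<union> ?R1) \<le> card ?R0 + card ?R1" by (rule card_Un_le)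
  moreover have "card ?R0 \<le> card (?R0 \<union> ?R1)" using fin by (intro card_mono) auto
  moreover have "1 \<le> card ?R0" "card ?R0 \<le> 2" "card ?R1 \<le> 2" using rest by simp_all
  ultimately show "3 \<le> card (\<Union>k b. ?N k b)" "card (\<Union>k b. ?N k b) \<le> 6" by linarith+
qed

text \<open>Classes of different degrees are distinct because the Gram matrix vanishes between
  degrees; the bounds are 8 + 3 + 3 and 8 + 6 + 6.\<close>

lemma rank_bounds: "14 \<le> card S" "card S \<le> 20"
proof -
  let ?W = "\<lambda>c. \<Union>k b. gsupp S n (k, b, c)"
  have "(\<Union>i. gsupp S n i) = (\<Union>c. ?W c)"
  proof (intro equalityI UN_least)
    fix i :: idx
    obtain k b c where i: "i = (k, b, c)" by (cases i)
    show "gsupp S n i \<subseteq> (\<Union>c. ?W c)" unfolding i by blast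
  qed blast
  then have "S = (\<Union>c. ?W c)" using gramD(3)[OF gr] by simp
  moreover have "finite (?W c)" for c using gramD(4)[OF gr] by simp
  moreover have "?W c \<inter> ?W d = {}" if cd: "c \<noteq> d" for c d
  proof -
    have "gsupp S n (k, b, c) \<inter> gsupp S n (l, f, d) = {}" for k b l f
      by (rule gram_disjoint[OF gr]) (use cd in \<open>simp add: m\<close>)
    then show ?thesis by blast
  qed
  ultimately have "card S = (\<Sum>c\<in>UNIV. card (?W c))"
    using card_UN_disjoint[of "UNIV :: 3 set" ?W] by simp
  then have "card S = 8 + card (?W 1) + card (?W 2)" unfolding sum_UNIV_3 degree_0_supp .
  then show "14 \<le> card S" "card S \<le> 20"
    using degree_nonzero_supp[of 1] degree_nonzero_supp[of 2] by simp_all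
qed

end

lemma rank_one_plus_\<alpha>\<rho>:
  assumes "gram S n (\<lambda>i j. count_list (lcomp (lcomp [(0, False, 0), (h, True, 0)] [j]) [(0, False, 0), (h, True, 0)]) i)"
    and "h \<noteq> 0"
  shows "14 \<le> card S" "card S \<le> 20"
  by (rule rank_bounds[OF assms]; rule count_one_plus_\<alpha>\<rho>)+

end

section \<open>Comparison of the ranks\<close>

lemma tensor_equivalentD: "tensor_equivalent D E \<Longrightarrow> \<exists>F \<Phi>. category_equivalence D E F \<Phi>"
  unfolding tensor_equivalent_def by blast

lemma q_system_algebra: "q_system C dag A \<Longrightarrow> algebra_in C A"
  by (cases A) (simp only: q_system.simps)

theorem lemma3p30:
  fixes M :: "('h::complex_hilbert_space \<Rightarrow>\<^sub>L 'h) set"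
    and \<alpha> :: "2 \<times> 2 \<Rightarrow> 'h endo" and \<rho> \<gamma> :: "'h endo" and \<theta> :: "2 \<times> 2 \<Rightarrow> 2 \<times> 2"
    and A B :: "'h endo \<times> 'h intertwiner \<times> 'h intertwiner" and g h :: "2 \<times> 2"
  assumes M: "type_III_factor M"
    \<comment> \<open>the realization of the category C in \<open>End0 M\<close>\<close>
    and \<alpha>_aut: "\<forall>k. automorphism M (\<alpha> k)"
    and \<rho>_obj: "endomorphism M \<rho>" "finite_index M \<rho>"
    and \<alpha>_mult: "\<forall>k l. \<alpha> k \<circ> \<alpha> l = \<alpha> (k + l)"
    and \<alpha>_\<rho>: "\<forall>k. \<alpha> k \<circ> \<rho> = \<rho> \<circ> \<alpha> (- k)"
    and fusion_C: "fusion_category (cat_C M \<alpha> \<rho>)"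
    and simples: "\<forall>x. simple_obj (cat_C M \<alpha> \<rho>) x \<longleftrightarrow>
          (\<exists>k. isomorphic (cat_C M \<alpha> \<rho>) x (\<alpha> k) \<or> isomorphic (cat_C M \<alpha> \<rho>) x (\<alpha> k \<circ> \<rho>))"
    and distinct_simples:
      "\<forall>k l. isomorphic (cat_C M \<alpha> \<rho>) (\<alpha> k) (\<alpha> l) \<longrightarrow> k = l"
      "\<forall>k l. isomorphic (cat_C M \<alpha> \<rho>) (\<alpha> k \<circ> \<rho>) (\<alpha> l \<circ> \<rho>) \<longrightarrow> k = l"
      "\<forall>k l. \<not> isomorphic (cat_C M \<alpha> \<rho>) (\<alpha> k) (\<alpha> l \<circ> \<rho>)"
    and fusion_rule: "direct_sum (cat_C M \<alpha> \<rho>) (\<rho> \<circ> \<rho>)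
          [id_on M, \<alpha> (0, 0) \<circ> \<rho>, \<alpha> (0, 1) \<circ> \<rho>, \<alpha> (1, 0) \<circ> \<rho>, \<alpha> (1, 1) \<circ> \<rho>]"
    and Q_\<rho>: "\<exists>Q. q_system (cat_C M \<alpha> \<rho>) dagger Q \<and> direct_sum (cat_C M \<alpha> \<rho>) (fst Q) [id_on M, \<rho>]"
    \<comment> \<open>the automorphism of order three\<close>
    and \<gamma>_aut: "automorphism M \<gamma>"
    and \<gamma>_order: "\<gamma> \<circ> \<gamma> \<circ> \<gamma> = id_on M" "\<gamma> \<noteq> id_on M"
    and \<gamma>_\<rho>: "\<gamma> \<circ> \<rho> = \<rho> \<circ> \<gamma>"
    and \<gamma>_\<alpha>: "\<forall>k. \<gamma> \<circ> \<alpha> k = \<alpha> (\<theta> k) \<circ> \<gamma>"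
    and \<theta>: "\<theta> 0 = 0" "\<forall>k. k \<noteq> 0 \<longrightarrow> {k, \<theta> k, \<theta> (\<theta> k)} = UNIV - {0}"
    \<comment> \<open>the algebras \<open>1 + \<alpha>\<^sub>g\<close> and \<open>1 + \<alpha>\<^sub>h\<rho>\<close>\<close>
    and g: "g \<noteq> 0" and A: "division_algebra (cat_C2 M \<alpha> \<rho> \<gamma>) A"
      "direct_sum (cat_C2 M \<alpha> \<rho> \<gamma>) (fst A) [id_on M, \<alpha> g]"
    and h: "h \<noteq> 0" and B: "q_system (cat_C2 M \<alpha> \<rho> \<gamma>) dagger B"
      "direct_sum (cat_C2 M \<alpha> \<rho> \<gamma>) (fst B) [id_on M, \<alpha> h \<circ> \<rho>]"
  shows "\<not> tensor_equivalent (dual_category (cat_C2 M \<alpha> \<rho> \<gamma>) B) (cat_C1 M \<alpha> \<rho> \<gamma>) \<and>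
         \<not> tensor_equivalent (dual_category (cat_C2 M \<alpha> \<rho> \<gamma>) B) (cat_C2 M \<alpha> \<rho> \<gamma>) \<and>
         \<not> tensor_equivalent (dual_category (cat_C2 M \<alpha> \<rho> \<gamma>) B) (dual_category (cat_C2 M \<alpha> \<rho> \<gamma>) A)"
proof -
  interpret vN_algebra M using M unfolding type_III_factor_def factor_def by unfold_locales blast
  interpret crossed_product M \<alpha> \<rho> \<gamma> \<theta>
  proof (intro crossed_product.intro crossed_product_axioms.intro vN_algebra_axioms)
    show "(\<I> :: 'h \<Rightarrow>\<^sub>L 'h) \<noteq> 0" using M unfolding type_III_factor_def factor_def by blast
  qed (rule \<alpha>_aut[rule_format] \<rho>_obj(1) \<alpha>_mult[rule_format] \<alpha>_\<rho>[rule_format] fusion_C simples[rule_format]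
      distinct_simples[rule_format] fusion_rule \<gamma>_aut \<gamma>_order(1) \<gamma>_\<rho> \<gamma>_\<alpha>[rule_format] \<theta>(1) \<theta>(2)[rule_format]; assumption?)+
  have W: "W (k, False, 0) = \<alpha> k" "W (k, True, 0) = \<alpha> k \<circ> \<rho>" for k
    by (simp_all add: W_def wd_simps[unfolded One_nat_def])
  have Balg: "algebra_in (cat S2) B" using q_system_algebra[OF B(1)] unfolding cat_C2_eq .
  have Bsum: "direct_sum (cat S2) (fst B) [id_on M, W (h, True, 0)]" using B(2) unfolding cat_C2_eq W .
  obtain b mb eb where Beq: "B = (b, (b \<circ> b, mb, b), (id_on M, eb, b))"
    and Bloc: "dual_of_C2 M \<alpha> \<rho> \<gamma> \<theta> b mb eb [(0, False, 0), (h, True, 0)]"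
    by (rule dual_of_C2I[OF Balg Bsum]) (rule that; assumption)
  interpret B: dual_of_C2 M \<alpha> \<rho> \<gamma> \<theta> b mb eb "[(0, False, 0), (h, True, 0)]" by (fact Bloc)
  note D = B.represented_bims[folded Beq cat_C2_eq]
  have "\<not> tensor_equivalent (dual_category (cat_C2 M \<alpha> \<rho> \<gamma>) B) (cat_C1 M \<alpha> \<rho> \<gamma>)"
  proof
    assume "tensor_equivalent (dual_category (cat_C2 M \<alpha> \<rho> \<gamma>) B) (cat_C1 M \<alpha> \<rho> \<gamma>)"
    then obtain F \<Phi> where eq: "category_equivalence (dual_category (cat_C2 M \<alpha> \<rho> \<gamma>) B) (cat_C1 M \<alpha> \<rho> \<gamma>) F \<Phi>"
      using tensor_equivalentD by blast
    obtain P where P: "opcat.gram_family eqobs eqhom P (\<lambda>i j. count_list (orbit j) (fst i, snd i, 0))"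
      using gram_family_C1 by blast
    from equivalence_gram[OF D represented_C1 regular_eqobs eq B.gram_family_free_bim P]
    obtain S :: "(((2 \<times> 2) \<times> bool + idx) \<times> nat) set set" and nD nE where "gram S nD (\<lambda>i j. count_list (lcomp (lcomp [(0, False, 0), (h, True, 0)] [j]) [(0, False, 0), (h, True, 0)]) i)"
      "gram S nE (\<lambda>i j. count_list (orbit j) (fst i, snd i, 0))" by blast
    \<comment> \<open>At least 14 classes against at most 12.\<close>
    from rank_one_plus_\<alpha>\<rho>(1)[OF this(1) h] rank_C1[OF this(2)] show False by simp
  qed
  moreover have "\<not> tensor_equivalent (dual_category (cat_C2 M \<alpha> \<rho> \<gamma>) B) (cat_C2 M \<alpha> \<rho> \<gamma>)"
  proof
    assume "tensor_equivalent (dual_category (cat_C2 M \<alpha> \<rho> \<gamma>) B) (cat_C2 M \<alpha> \<rho> \<gamma>)"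
    then obtain F \<Phi> where eq: "category_equivalence (dual_category (cat_C2 M \<alpha> \<rho> \<gamma>) B) (cat S2) F \<Phi>"
      using tensor_equivalentD unfolding cat_C2_eq by blast
    from equivalence_gram[OF D represented_cat regular_S2 eq B.gram_family_free_bim gram_family_W]
    obtain S :: "((idx + idx) \<times> nat) set set" and nD nE where "gram S nD (\<lambda>i j. count_list (lcomp (lcomp [(0, False, 0), (h, True, 0)] [j]) [(0, False, 0), (h, True, 0)]) i)"
      "gram S nE (\<lambda>i j :: idx. of_bool (i = j))" by blast
    \<comment> \<open>At most 20 classes against the 24 words.\<close>
    from rank_one_plus_\<alpha>\<rho>(2)[OF this(1) h] gram_card_ge[OF this(2)] show False by simp
  qed
  moreover have "\<not> tensor_equivalent (dual_category (cat_C2 M \<alpha> \<rho> \<gamma>) B) (dual_category (cat_C2 M \<alpha> \<rho> \<gamma>) A)"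
  proof
    assume "tensor_equivalent (dual_category (cat_C2 M \<alpha> \<rho> \<gamma>) B) (dual_category (cat_C2 M \<alpha> \<rho> \<gamma>) A)"
    then obtain F \<Phi> where eq: "category_equivalence (dual_category (cat_C2 M \<alpha> \<rho> \<gamma>) B) (dual_category (cat_C2 M \<alpha> \<rho> \<gamma>) A) F \<Phi>"
      using tensor_equivalentD by blast
    have Aalg: "algebra_in (cat S2) A" and simple: "simple_obj (left_module_category (cat S2) A) (fst A, fst (snd A))"
      using A(1) unfolding cat_C2_eq division_algebra_def by blast+
    have Asum: "direct_sum (cat S2) (fst A) [id_on M, W (g, False, 0)]" using A(2) unfolding cat_C2_eq W .
    obtain a ma ea where Aeq: "A = (a, (a \<circ> a, ma, a), (id_on M, ea, a))"
      and Aloc: "dual_of_C2 M \<alpha> \<rho> \<gamma> \<theta> a ma ea [(0, False, 0), (g, False, 0)]"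
      and asum: "direct_sum (cat S2) a [id_on M, W (g, False, 0)]"
      by (rule dual_of_C2I[OF Aalg Asum]) (rule that; assumption)
    interpret A: dual_of_C2 M \<alpha> \<rho> \<gamma> \<theta> a ma ea "[(0, False, 0), (g, False, 0)]" by (fact Aloc)
    \<comment> \<open>The regular side is now the dual category with respect to \<open>A\<close>,
      where averaging over a group of order two is available.\<close>
    have reg: "regular_opcat A.bims A.bhom (\<lambda>p. A.bobj p \<I>)"
      by (rule A.regular_bims_two_summands[OF refl g asum simple[unfolded Aeq fst_conv snd_conv]])
    from equivalence_gram[OF D A.represented_bims[folded Aeq cat_C2_eq] reg eq B.gram_family_free_bim A.gram_family_free_bim]
    obtain S :: "((idx + idx) \<times> nat) set set" and nD nE where "gram S nD (\<lambda>i j. count_list (lcomp (lcomp [(0, False, 0), (h, True, 0)] [j]) [(0, False, 0), (h, True, 0)]) i)"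
      "gram S nE (\<lambda>i j. count_list (lcomp (lcomp [(0, False, 0), (g, False, 0)] [j]) [(0, False, 0), (g, False, 0)]) i)" by blast
    from rank_one_plus_\<alpha>\<rho>(1)[OF this(1) h] rank_one_plus_\<alpha>[OF this(2) g] show False by simp
  qed
  ultimately show ?thesis by blast
qed

end
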